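(* Assume the setting described in the context. Then $\Gamma$ is a global fundamental solution of $\mathcal{H}$: for every $z\in\mathbb{R}^{1+n}$, $\Gamma(z;\cdot)\in L^1_{\mathrm{loc}}(\mathbb{R}^{1+n})$ and $$\int_{\mathbb{R}^{1+n}}\Gamma(z;\zeta)\,\mathcal{H}^*\varphi(\zeta)\,d\zeta=-\varphi(z)\quad\text{for every }\varphi\in C_0^\infty(\mathbb{R}^{1+n}).$$ Moreover: (i) $\Gamma\ge 0$, and $\Gamma(t,x;s,y)=0$ if and only if $s\le t$. (ii) $\Gamma(t,x;s,y)=\Gamma(-s,x;-t,y)$ and $\Gamma(t,x;s,y)=\Gamma(0,x;s-t,y)=\Gamma(t-s,x;0,y)$; furthermore $\Gamma(t,x;s,y)=\Gamma(t,y;s,x)$. (iii) For every $\lambda>0$, $\Gamma(\lambda^2t,\delta_\lambda(x);\lambda^2s,\delta_\lambda(y))=\lambda^{-q}\Gamma(t,x;s,y)$, where $q=\sum_{j=1}^n\sigma_j$. (iv) $\Gamma$ is smooth out of the diagonal of $\mathbb{R}^{1+n}\times\mathbb{R}^{1+n}$. (v) For every compact $K\subseteq\mathbb{R}^{1+n}$, $\lim_{\|\zeta\|\to\infty}\sup_{z\in K}\Gamma(z;\zeta)=\lim_{\|\zeta\|\to\infty}\sup_{z\in K}\Gamma(\zeta;z)=0$. (vi) $\Gamma\in L^1_{\mathrm{loc}}(\mathbb{R}^{1+n}\times\mathbb{R}^{1+n})$, and for every fixed $z\in\mathbb{R}^{1+n}$, $\Gamma(z;\cdot),\Gamma(\cdot;z)\in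 L^1_{\mathrm{loc}}(\mathbb{R}^{1+n})$. (vii) For every fixed $(t,x)\in\mathbb{R}^{1+n}$, $\int_{\mathbb{R}^n}\Gamma(t,x;s,y)\,dy=1$ for every $s>t$. (viii) For every $\varphi\in C_0^\infty(\mathbb{R}^{1+n})$, the function $\Lambda_\varphi(\zeta):=\int_{\mathbb{R}^{1+n}}\Gamma(z;\zeta)\varphi(z)\,dz$ is smooth on $\mathbb{R}^{1+n}$, vanishes at infinity, and $\mathcal{H}(\Lambda_\varphi)=-\varphi$ on $\mathbb{R}^{1+n}$. (ix) If $\varphi\in C(\mathbb{R}^n)$ is bounded, then $u(t,x):=\int_{\mathbb{R}^n}\Gamma(0,y;t,x)\varphi(y)\,dy$, $(t,x)\in\Omega=(0,\infty)\times\mathbb{R}^n$, is the unique bounded classical solution of the Cauchy problem $\mathcal{H}u=0$ in $\Omega$, $u(0,x)=\varphi(x)$ for $x\in\mathbb{R}^n$. (x) For every $x,y\in\mathbb{R}^n$ and $s,t>0$: $\Gamma(0,y;t+s,x)=\int_{\mathbb{R}^n}\Gamma(0,w;t,x)\,\Gamma(0,y;s,w)\,dw$. Finally, the function $\Gamma^*(t,x;s,y):=\Gamma(s,y;t,x)$ is a global fundamental solution of $\mathcal{H}^*$, satisfying the dual statements of (i)–(x).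
   Context: Let $X_1,\dots,X_m$ be smooth vector fields on $\mathbb{R}^n$, linearly independent in the vector space of smooth vector fields on $\mathbb{R}^n$, satisfying: (H.1) there are reals $1=\sigma_1\le\dots\le\sigma_n$ such that, with $\delta_\lambda(x)=(\lambda^{\sigma_1}x_1,\dots,\lambda^{\sigma_n}x_n)$, every $X_j$ is $\delta_\lambda$-homogeneous of degree 1, i.e. $X_j(f\circ\delta_\lambda)=\lambda(X_jf)\circ\delta_\lambda$ for all $\lambda>0$, $f\in C^\infty(\mathbb{R}^n)$; (H.2) $\dim\{Y(0):Y\in\mathrm{Lie}\{X_1,\dots,X_m\}\}=n$, where $\mathrm{Lie}\{X_1,\dots,X_m\}$ is the smallest Lie subalgebra of smooth vector fields containing $X_1,\dots,X_m$. Let $N=\dim\mathrm{Lie}\{X_1,\dots,X_m\}$, assume $N>n$ and set $p=N-n$. Let $\mathcal{L}=\sum_{j=1}^mX_j^2$, $\mathcal{H}=\mathcal{L}-\partial_t$ on $\mathbb{R}^{1+n}=\mathbb{R}_t\times\mathbb{R}^n_x$ (points $z=(t,x)$), and $\mathcal{H}^*=\mathcal{L}+\partial_t$ its formal adjoint. Fix a homogeneous Carnot group $\mathbb{G}=(\mathbb{R}^N,\star)$ on $\mathbb{R}^N=\mathbb{R}^n_x\times\mathbb{R}^p_\xi$ with dilations (group automorphisms) $D_\lambda(x,\xi)=(\delta_\lambda(x),\delta^*_\lambda(\xi))$, $\delta^*_\lambda(\xi)=(\lambda^{\sigma^*_1}\xi_1,\dots,\lambda^{\sigma^*_p}\xi_p)$,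 and left-invariant, $D_\lambda$-homogeneous of degree 1 vector fields $Z_1,\dots,Z_m$ on $\mathbb{G}$ which Lie-generate the Lie algebra of $\mathbb{G}$ and such that each $Z_i$ lifts $X_i$, i.e. $Z_i(f\circ\pi)(x,\xi)=(X_if)(x)$ for all $f\in C^\infty(\mathbb{R}^n)$, where $\pi(x,\xi)=x$ (such $\mathbb{G}$ and $Z_i$ exist). Let $q=\sum_{j=1}^n\sigma_j$, $q^*=\sum_{k=1}^p\sigma_k^*$, $Q=q+q^*$. Let $\mathcal{H}_{\mathbb{G}}=\sum_{j=1}^mZ_j^2-\partial_t$ on $\mathbb{R}^{1+N}$ and let $\gamma_{\mathbb{G}}$ be the unique fundamental solution of $\mathcal{H}_{\mathbb{G}}$ with pole at the origin and vanishing at infinity (smooth away from the origin; $\Gamma_{\mathbb{G}}(t,x,\xi;s,y,\eta):=\gamma_{\mathbb{G}}(s-t,(x,\xi)^{-1}\star(y,\eta))$ is a global fundamental solution of $\mathcal{H}_{\mathbb{G}}$). Define, for $(t,x),(s,y)\in\mathbb{R}^{1+n}$, $\Gamma(t,x;s,y)=\int_{\mathbb{R}^p}\gamma_{\mathbb{G}}(s-t,(x,0)^{-1}\star(y,\eta))\,d\eta$. A classical solution of the Cauchy problem $\mathcal{H}u=0$ in $\Omega=(0,\infty)\times\mathbb{R}^n$, $u(0,\cdot)=\varphi$, is a function $u\in C^2(\Omega)$ with $\mathcal{H}u=0$ in $\Omega$, continuous up to $\overline{\Omega}$, with $u(0,x)=\varphi(x)$ for all $x$. *)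

theory Defs
  imports "HOL-Analysis.Analysis"
begin

fun C_k_on :: "nat \<Rightarrow> 'a::euclidean_space set \<Rightarrow> ('a \<Rightarrow> real) \<Rightarrow> bool" where
  "C_k_on 0 U f = continuous_on U f"
| "C_k_on (Suc k) U f =
     ((\<forall>x\<in>U. f differentiable (at x)) \<and>
      (\<forall>v. C_k_on k U (\<lambda>x. frechet_derivative f (at x) v)))"

definition smooth_on :: "'a::euclidean_space set \<Rightarrow> ('a \<Rightarrow> real) \<Rightarrow> bool" where
  "smooth_on U f \<longleftrightarrow> (\<forall>k. C_k_on k U f)"

text \<open>Smooth maps into a Euclidean space (componentwise); vector fields are maps 'a => 'a
  (their coefficient vectors).\<close>
definition smooth_map :: "('a::euclidean_space \<Rightarrow> 'b::euclidean_space) \<Rightarrow> bool" where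
  "smooth_map F \<longleftrightarrow> (\<forall>b\<in>Basis. smooth_on UNIV (\<lambda>x. F x \<bullet> b))"

definition test_fun :: "('a::euclidean_space \<Rightarrow> real) \<Rightarrow> bool" where
  "test_fun f \<longleftrightarrow> smooth_on UNIV f \<and> compact (closure {x. f x \<noteq> 0})"

definition loc_int :: "('a::euclidean_space \<Rightarrow> real) \<Rightarrow> bool" where
  "loc_int f \<longleftrightarrow> (\<forall>K. compact K \<longrightarrow> set_integrable lborel K f)"

definition vf :: "('a::euclidean_space \<Rightarrow> 'a) \<Rightarrow> ('a \<Rightarrow> real) \<Rightarrow> 'a \<Rightarrow> real" where
  "vf X f = (\<lambda>x. frechet_derivative f (at x) (X x))"

text \<open>Lie bracket [X,Y], so that [X,Y]f = X(Yf) - Y(Xf).\<close>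
definition lie_bracket :: "('a::euclidean_space \<Rightarrow> 'a) \<Rightarrow> ('a \<Rightarrow> 'a) \<Rightarrow> 'a \<Rightarrow> 'a" where
  "lie_bracket X Y = (\<lambda>x. frechet_derivative Y (at x) (X x) - frechet_derivative X (at x) (Y x))"

inductive_set lie_gen :: "('a::euclidean_space \<Rightarrow> 'a) set \<Rightarrow> ('a \<Rightarrow> 'a) set" for S where
  base: "X \<in> S \<Longrightarrow> X \<in> lie_gen S"
| zero: "(\<lambda>x. 0) \<in> lie_gen S"
| add: "X \<in> lie_gen S \<Longrightarrow> Y \<in> lie_gen S \<Longrightarrow> (\<lambda>x. X x + Y x) \<in> lie_gen S"
| scale: "X \<in> lie_gen S \<Longrightarrow> (\<lambda>x. c *\<^sub>R X x) \<in> lie_gen S"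
| bracket: "X \<in> lie_gen S \<Longrightarrow> Y \<in> lie_gen S \<Longrightarrow> lie_bracket X Y \<in> lie_gen S"

definition indep_fields :: "('a \<Rightarrow> 'b::real_vector) set \<Rightarrow> bool" where
  "indep_fields B \<longleftrightarrow> (\<forall>S c. finite S \<and> S \<subseteq> B \<and> (\<forall>x. (\<Sum>Y\<in>S. c Y *\<^sub>R Y x) = 0)
       \<longrightarrow> (\<forall>Y\<in>S. c Y = 0))"

definition fields_dim :: "('a \<Rightarrow> 'b::real_vector) set \<Rightarrow> nat \<Rightarrow> bool" where
  "fields_dim A N \<longleftrightarrow> (\<exists>B. finite B \<and> card B = N \<and> B \<subseteq> A \<and> indep_fields B \<and>
       (\<forall>Y\<in>A. \<exists>c. Y = (\<lambda>x. \<Sum>Z\<in>B. c Z *\<^sub>R Z x)))"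

definition dil :: "('n \<Rightarrow> real) \<Rightarrow> real \<Rightarrow> real^'n \<Rightarrow> real^'n" where
  "dil \<sigma> l x = (\<chi> j. l powr \<sigma> j * x $ j)"

definition hom_deg1 :: "(real \<Rightarrow> 'a \<Rightarrow> 'a) \<Rightarrow> ('a::euclidean_space \<Rightarrow> 'a) \<Rightarrow> bool" where
  "hom_deg1 D X \<longleftrightarrow> (\<forall>l>0. \<forall>f. smooth_on UNIV f \<longrightarrow>
       vf X (\<lambda>x. f (D l x)) = (\<lambda>x. l * vf X f (D l x)))"

definition tvf :: "('a \<Rightarrow> 'a) \<Rightarrow> real \<times> 'a \<Rightarrow> real \<times> 'a" where
  "tvf X = (\<lambda>z. (0, X (snd z)))"

text \<open>heat_op e: sum_j X_j^2 u - e * d_t u. e = 1 gives H = L - d_t, e = -1 gives H* = L + d_t.\<close>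
definition heat_op :: "real \<Rightarrow> nat \<Rightarrow> (nat \<Rightarrow> 'a \<Rightarrow> 'a) \<Rightarrow> (real \<times> 'a::euclidean_space \<Rightarrow> real)
     \<Rightarrow> real \<times> 'a \<Rightarrow> real" where
  "heat_op e m Xs u z =
     (\<Sum>j<m. vf (tvf (Xs j)) (vf (tvf (Xs j)) u) z) - e * frechet_derivative u (at z) (1, 0)"

definition left_inv :: "('g \<Rightarrow> 'g \<Rightarrow> 'g) \<Rightarrow> ('g::euclidean_space \<Rightarrow> 'g) \<Rightarrow> bool" where
  "left_inv gmul Z \<longleftrightarrow> (\<forall>a f. smooth_on UNIV f \<longrightarrow>
       vf Z (\<lambda>y. f (gmul a y)) = (\<lambda>y. vf Z f (gmul a y)))"

definition lifts :: "((real^'n) \<times> (real^'p) \<Rightarrow> (real^'n) \<times> (real^'p)) \<Rightarrow> (real^'n \<Rightarrow> real^'n) \<Rightarrow> bool" where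
  "lifts Z X \<longleftrightarrow> (\<forall>f. smooth_on UNIV f \<longrightarrow> vf Z (\<lambda>w. f (fst w)) = (\<lambda>w. vf X f (fst w)))"

definition Gam :: "((real^'n) \<times> (real^'p) \<Rightarrow> (real^'n) \<times> (real^'p) \<Rightarrow> (real^'n) \<times> (real^'p))
    \<Rightarrow> ((real^'n) \<times> (real^'p) \<Rightarrow> (real^'n) \<times> (real^'p)) \<Rightarrow> (real \<times> ((real^'n) \<times> (real^'p)) \<Rightarrow> real)
    \<Rightarrow> real \<times> (real^'n) \<Rightarrow> real \<times> (real^'n) \<Rightarrow> real" where
  "Gam gmul ginv \<gamma> z \<zeta> =
     (LINT \<eta>|lborel. \<gamma> (fst \<zeta> - fst z, gmul (ginv (snd z, 0)) (snd \<zeta>, \<eta>)))"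

definition Omega :: "real \<Rightarrow> (real \<times> (real^'n)) set" where
  "Omega e = {z. e * fst z > 0}"

definition classical_sol :: "real \<Rightarrow> nat \<Rightarrow> (nat \<Rightarrow> real^'n \<Rightarrow> real^'n) \<Rightarrow> (real^'n \<Rightarrow> real)
    \<Rightarrow> (real \<times> (real^'n) \<Rightarrow> real) \<Rightarrow> bool" where
  "classical_sol e m Xs \<phi> u \<longleftrightarrow>
     C_k_on 2 (Omega e) u \<and> (\<forall>z\<in>Omega e. heat_op e m Xs u z = 0) \<and>
     continuous_on (closure (Omega e)) u \<and> (\<forall>x. u (0, x) = \<phi> x)"

definition Lam :: "(real \<times> 'a \<Rightarrow> real \<times> 'a \<Rightarrow> real) \<Rightarrow> (real \<times> 'a::euclidean_space \<Rightarrow> real)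
    \<Rightarrow> real \<times> 'a \<Rightarrow> real" where
  "Lam G \<phi> = (\<lambda>\<zeta>. LINT z|lborel. G z \<zeta> * \<phi> z)"

definition FS_props :: "real \<Rightarrow> nat \<Rightarrow> (nat \<Rightarrow> real^'n \<Rightarrow> real^'n) \<Rightarrow> ('n \<Rightarrow> real)
    \<Rightarrow> (real \<times> (real^'n) \<Rightarrow> real \<times> (real^'n) \<Rightarrow> real) \<Rightarrow> bool" where
  "FS_props e m Xs \<sigma> G \<longleftrightarrow>
   \<comment> \<open>global fundamental solution of heat_op e\<close>
   (\<forall>z. loc_int (G z) \<and>
        (\<forall>\<phi>. test_fun \<phi> \<longrightarrow> (LINT \<zeta>|lborel. G z \<zeta> * heat_op (-e) m Xs \<phi> \<zeta>) = - \<phi> z)) \<and>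
   \<comment> \<open>(i)\<close>
   (\<forall>z \<zeta>. 0 \<le> G z \<zeta>) \<and>
   (\<forall>t x s y. G (t, x) (s, y) = 0 \<longleftrightarrow> e * (s - t) \<le> 0) \<and>
   \<comment> \<open>(ii)\<close>
   (\<forall>t x s y. G (t, x) (s, y) = G (-s, x) (-t, y) \<and> G (t, x) (s, y) = G (0, x) (s - t, y) \<and>
              G (t, x) (s, y) = G (t - s, x) (0, y) \<and> G (t, x) (s, y) = G (t, y) (s, x)) \<and>
   \<comment> \<open>(iii)\<close>
   (\<forall>l>0. \<forall>t x s y. G (l\<^sup>2 * t, dil \<sigma> l x) (l\<^sup>2 * s, dil \<sigma> l y)
                      = l powr (- (\<Sum>j\<in>UNIV. \<sigma> j)) * G (t, x) (s, y)) \<and>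
   \<comment> \<open>(iv)\<close>
   smooth_on {p. fst p \<noteq> snd p} (\<lambda>p. G (fst p) (snd p)) \<and>
   \<comment> \<open>(v)\<close>
   (\<forall>K. compact K \<and> K \<noteq> {} \<longrightarrow>
        ((\<lambda>\<zeta>. SUP z\<in>K. G z \<zeta>) \<longlongrightarrow> 0) at_infinity \<and>
        ((\<lambda>\<zeta>. SUP z\<in>K. G \<zeta> z) \<longlongrightarrow> 0) at_infinity) \<and>
   \<comment> \<open>(vi)\<close>
   loc_int (\<lambda>p. G (fst p) (snd p)) \<and> (\<forall>z. loc_int (G z) \<and> loc_int (\<lambda>\<zeta>. G \<zeta> z)) \<and>
   \<comment> \<open>(vii)\<close>
   (\<forall>t x s. e * (s - t) > 0 \<longrightarrow> (LINT y|lborel. G (t, x) (s, y)) = 1) \<and>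
   \<comment> \<open>(viii)\<close>
   (\<forall>\<phi>. test_fun \<phi> \<longrightarrow> smooth_on UNIV (Lam G \<phi>) \<and> (Lam G \<phi> \<longlongrightarrow> 0) at_infinity \<and>
        (\<forall>\<zeta>. heat_op e m Xs (Lam G \<phi>) \<zeta> = - \<phi> \<zeta>)) \<and>
   \<comment> \<open>(ix)\<close>
   (\<forall>\<phi>. continuous_on UNIV \<phi> \<and> bounded (range \<phi>) \<longrightarrow>
      (let u = (\<lambda>z. if e * fst z > 0 then (LINT y|lborel. G (0, y) z * \<phi> y) else \<phi> (snd z))
       in classical_sol e m Xs \<phi> u \<and> bounded (u ` Omega e) \<and>
          (\<forall>v. classical_sol e m Xs \<phi> v \<and> bounded (v ` Omega e) \<longrightarrow>
               (\<forall>z\<in>closure (Omega e). v z = u z)))) \<and>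
   \<comment> \<open>(x)\<close>
   (\<forall>x y s t. e * s > 0 \<and> e * t > 0 \<longrightarrow>
      G (0, y) (t + s, x) = (LINT w|lborel. G (0, w) (t, x) * G (0, y) (s, w)))"

end

theory Submission
  imports Defs
begin

text \<open>Everything about the group kernel \<open>\<gamma>\<close> is derived from the maximum principle for functions vanishing
at infinity, without hypoellipticity: a convolution of \<open>\<gamma>\<close> with a test function solves the heat equation
classically, so uniqueness of vanishing solutions gives the sign, the support in positive time, the
homogeneity and the symmetry under inversion of \<open>\<gamma>\<close>, and with a barrier also the bounded Cauchy problem and
the Chapman-Kolmogorov identity.  By Cauchy-Schwarz the latter bounds the even time derivatives of \<open>\<gamma>\<close> by
their values at the pole, which homogeneity makes explicit; the resulting analyticity in time gives strict
positivity.

Because the left-invariant fields project to fields on the base, the first component of \<open>a \<star> g\<close> depends on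
\<open>a\<close> only through its first component (induction on the degree of homogeneity).  Hence the fibres can be moved
by measure-preserving maps, the integral of \<open>\<gamma>\<close> over a fibre does not depend on the chosen base point in
the fibre, and the properties of \<open>\<gamma>\<close> descend to the base.\<close>

text \<open>The hypotheses give \<open>\<gamma>\<close> as a weak solution, so the operator is
  applied to it only off the pole. Of the two potentials, \<open>potA\<close> suits left invariance:
  translating a test function gives \<open>potA (heat (-1) \<psi>) = - \<psi>\<close> at once. The
  convolution \<open>potB\<close>, which solves the equation, is reached from it by duality. Strict
  positivity is where a Harnack inequality would be expected. Instead a zero of
  \<open>\<gamma>\<close> is carried backwards in time by the semigroup identity and forwards by
  Taylor's formula; even orders are taken because order \<open>2 * j\<close> splits equally between
  the two factors of Chapman-Kolmogorov, which then differ by a translation only. The passage to the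
  base rests on a fact about flows: the flow of a left-invariant field is a right translation, so if
  all these fields project, right translations descend to the base; the degree induction proves this
  without flows. The two operators are treated together through a sign \<open>e\<close> with
  \<open>e * e = 1\<close>, because time reversal exchanges them.\<close>

abbreviation ddir :: "'a::euclidean_space => ('a => real) => 'a => real" where
 "ddir v f \<equiv> \<lambda>x. frechet_derivative f (at x) v"

section \<open>Calculus of finitely often differentiable functions\<close>

declare C_k_on.simps(2) [simp del]

lemma C_k_on_SucE:
 assumes "C_k_on (Suc k) U f"
 shows "x \<in> U ==> f differentiable (at x)" "C_k_on k U (ddir v f)"
 using assms by (auto simp: C_k_on.simps(2))

lemma has_derivative_frechet:
 "f differentiable (at x) ==> (f has_derivative frechet_derivative f (at x)) (at x)"
 by (simp add: frechet_derivative_works)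

lemma frechet_derivative_eqI:
 "(f has_derivative f') (at x) ==> frechet_derivative f (at x) = f'"
 using frechet_derivative_at by metis

lemma frechet_derivative_cong_open:
 assumes "open U" "x \<in> U" "\<And>y. y \<in> U ==> f y = g y"
 shows "frechet_derivative f (at x) = frechet_derivative g (at x)"
proof -
 have "(f has_derivative F) (at x) \<longleftrightarrow> (g has_derivative F) (at x)" for F
  using has_derivative_transform_within_open[of f F x UNIV U g]
   has_derivative_transform_within_open[of g F x UNIV U f] assms by auto
 then show ?thesis by (simp add: frechet_derivative_def)
qed

lemma differentiable_cong_open:
 assumes "open U" "x \<in> U" "\<And>y. y \<in> U ==> f y = g y" "f differentiable (at x)"
 shows "g differentiable (at x)"
 using has_derivative_transform_within_open[of f _ x UNIV U g] assms
 unfolding differentiable_def by blast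

lemma frechet_derivative_basis:
 fixes f :: "'a::euclidean_space => real"
 assumes "f differentiable (at x)"
 shows "frechet_derivative f (at x) v = (\<Sum>b\<in>Basis. (v \<bullet> b) * frechet_derivative f (at x) b)"
proof -
 have l: "linear (frechet_derivative f (at x))"
  using assms by (rule linear_frechet_derivative)
 have "frechet_derivative f (at x) v = frechet_derivative f (at x) (\<Sum>b\<in>Basis. (v \<bullet> b) *\<^sub>R b)"
  by (simp add: euclidean_representation)
 also have "\<dots> = (\<Sum>b\<in>Basis. (v \<bullet> b) *\<^sub>R frechet_derivative f (at x) b)"
  using l by (simp add: linear_sum linear_scale)
 finally show ?thesis by simp
qed

lemma C_k_on_imp_continuous_on: "C_k_on k U f ==> continuous_on U f"
proof (cases k)
 case (Suc n)
 assume "C_k_on k U f"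
 then show ?thesis using Suc
  by (simp add: C_k_on.simps(2) continuous_on_eq_continuous_within)
   (blast intro: differentiable_imp_continuous_within differentiable_at_withinI)
qed simp

lemma C_k_on_SucD: "C_k_on (Suc k) U f ==> C_k_on k U f"
proof (induction k arbitrary: f)
 case 0 then show ?case using C_k_on_imp_continuous_on by (metis C_k_on.simps(1))
next
 case (Suc k)
 then show ?case by (metis C_k_on.simps(2))
qed

lemma C_k_on_cong:
 assumes "open U" "\<And>x. x \<in> U ==> f x = g x" "C_k_on k U f"
 shows "C_k_on k U g"
 using assms(2,3)
proof (induction k arbitrary: f g)
 case 0 then show ?case using continuous_on_cong[of U U f g] by simp
next
 case (Suc k)
 have "g differentiable (at x)" if "x \<in> U" for x
  by (rule differentiable_cong_open[OF assms(1) that Suc.prems(1) C_k_on_SucE(1)[OF Suc.prems(2) that]])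
 moreover have "C_k_on k U (ddir v g)" for v
 proof (rule Suc.IH[OF _ C_k_on_SucE(2)[OF Suc.prems(2)]])
  show "ddir v f x = ddir v g x" if "x \<in> U" for x
   by (simp only: frechet_derivative_cong_open[OF assms(1) that Suc.prems(1)])
 qed
 ultimately show ?case by (simp add: C_k_on.simps(2))
qed

lemma C_k_on_subset: "C_k_on k U f ==> V \<subseteq> U ==> C_k_on k V f"
 by (induction k arbitrary: f) (auto simp: C_k_on.simps(2) intro: continuous_on_subset)

lemma C_k_on_localI:
 assumes "\<And>x. x \<in> U ==> \<exists>V. open V \<and> x \<in> V \<and> C_k_on k V f"
 shows "C_k_on k U f"
 using assms
proof (induction k arbitrary: f)
 case 0
 then have "continuous (at x) f" if "x \<in> U" for x
  using that by (metis C_k_on.simps(1) continuous_on_eq_continuous_at)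
 then show ?case by (simp add: continuous_at_imp_continuous_on)
next
 case (Suc k)
 have "C_k_on k U (ddir v f)" for v

 proof (rule Suc.IH)
  fix x assume "x \<in> U"
  then obtain V where "open V" "x \<in> V" "C_k_on (Suc k) V f" using Suc.prems by blast
  then show "\<exists>V. open V \<and> x \<in> V \<and> C_k_on k V (ddir v f)"
   using C_k_on_SucE(2)[of k V f v] by blast
 qed
 moreover have "\<forall>x\<in>U. f differentiable (at x)" by (meson Suc.prems C_k_on_SucE(1))
 ultimately show ?case by (simp add: C_k_on.simps(2))
qed

lemma C_k_on_const [simp]: "C_k_on k U (\<lambda>x. c)"
 by (induction k arbitrary: c) (auto simp: C_k_on.simps(2))

lemma C_k_on_linear: "bounded_linear f ==> C_k_on k U f"
proof (cases k)
 case 0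
 then show "bounded_linear f ==> ?thesis"
  by (simp add: linear_continuous_on)
next
 case (Suc n)
 assume b: "bounded_linear f"
 then have "(f has_derivative f) (at x)" for x by (rule bounded_linear_imp_has_derivative)
 then have "frechet_derivative f (at x) = f" "f differentiable (at x)" for x
  using frechet_derivative_eqI by (auto simp: differentiable_def)
 then show ?thesis using Suc by (simp add: C_k_on.simps(2))
qed

lemma C_k_on_add:
 assumes "open U" "C_k_on k U f" "C_k_on k U g"
 shows "C_k_on k U (\<lambda>x. f x + g x)"
 using assms(2,3)
proof (induction k arbitrary: f g)
 case 0 then show ?case by (auto intro: continuous_intros)
next
 case (Suc k)
 have *: "frechet_derivative (\<lambda>x. f x + g x) (at x) v = ddir v f x + ddir v g x" if "x \<in> U" for x v
  using frechet_derivative_eqI[OF has_derivative_add[OF has_derivative_frechet has_derivative_frechet,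
   OF C_k_on_SucE(1)[OF Suc.prems(1) that] C_k_on_SucE(1)[OF Suc.prems(2) that]]] by simp
 have "C_k_on k U (ddir v (\<lambda>x. f x + g x))" for v
  by (rule C_k_on_cong[OF assms(1), of "\<lambda>x. ddir v f x + ddir v g x"]) (use * Suc.IH[OF C_k_on_SucE(2)[OF Suc.prems(1)] C_k_on_SucE(2)[OF Suc.prems(2)]] in auto)
 then show ?case using Suc.prems by (auto simp: C_k_on.simps(2) intro!: differentiable_add)
qed

lemma C_k_on_mult:
 assumes "open U" "C_k_on k U f" "C_k_on k U g"
 shows "C_k_on k U (\<lambda>x. f x * g x)"
 using assms(2,3)
proof (induction k arbitrary: f g)
 case 0 then show ?case by (auto intro: continuous_intros)
next
 case (Suc k)
 have *: "frechet_derivative (\<lambda>x. f x * g x) (at x) v = f x * ddir v g x + ddir v f x * g x" if "x \<in> U" for x v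
  using frechet_derivative_eqI[OF has_derivative_mult[OF has_derivative_frechet has_derivative_frechet,
   OF C_k_on_SucE(1)[OF Suc.prems(1) that] C_k_on_SucE(1)[OF Suc.prems(2) that]]] by simp
 have "C_k_on k U (\<lambda>x. f x * ddir v g x + ddir v f x * g x)" for v
  by (rule C_k_on_add[OF assms(1) Suc.IH[OF C_k_on_SucD[OF Suc.prems(1)] C_k_on_SucE(2)[OF Suc.prems(2)]]
     Suc.IH[OF C_k_on_SucE(2)[OF Suc.prems(1)] C_k_on_SucD[OF Suc.prems(2)]]])
 then have "C_k_on k U (ddir v (\<lambda>x. f x * g x))" for v
  by (rule C_k_on_cong[OF assms(1), rotated]) (simp add: *)
 then show ?case using Suc.prems by (auto simp: C_k_on.simps(2) intro!: differentiable_mult)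
qed

lemma C_k_on_sum:
 assumes "open U" "\<And>i. i \<in> I ==> C_k_on k U (f i)"
 shows "C_k_on k U (\<lambda>x. \<Sum>i\<in>I. f i x)"
 using assms(2)
 by (induction I rule: infinite_finite_induct) (auto intro: C_k_on_add[OF assms(1)])

lemma C_k_on_cmult: "open U ==> C_k_on k U f ==> C_k_on k U (\<lambda>x. c * f x)"
 by (intro C_k_on_mult) auto

lemma C_k_on_minus: "open U ==> C_k_on k U f ==> C_k_on k U (\<lambda>x. - f x)"
 using C_k_on_cmult[of U k f "-1"] by simp

lemma C_k_on_diff: "open U ==> C_k_on k U f ==> C_k_on k U g ==> C_k_on k U (\<lambda>x. f x - g x)"
 using C_k_on_add[of U k f "\<lambda>x. - g x"] C_k_on_minus[of U k g] by simp

lemma C_k_on_inverse: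
 assumes "open U" "C_k_on k U f" "\<And>x. x \<in> U ==> f x \<noteq> 0"
 shows "C_k_on k U (\<lambda>x. 1 / f x)"
 using assms(2)
proof (induction k)
 case 0 then show ?case using assms(3) by (auto intro!: continuous_intros)
next
 case (Suc k)
 have d: "((\<lambda>x. 1 / f x) has_derivative (\<lambda>v. - (ddir v f x) * ((1 / f x) * (1 / f x)))) (at x)" if "x \<in> U" for x
  using has_derivative_divide[OF has_derivative_const[of 1] has_derivative_frechet[of f x] assms(3)[OF that]] C_k_on_SucE(1)[OF Suc.prems that]
  by (simp add: field_simps power2_eq_square)
 have IH: "C_k_on k U (\<lambda>x. 1 / f x)" using Suc.IH C_k_on_SucD[OF Suc.prems] by blast
 have "C_k_on k U (\<lambda>x. - (ddir v f x) * ((1 / f x) * (1 / f x)))" for v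
  by (rule C_k_on_mult[OF assms(1) C_k_on_minus[OF assms(1) C_k_on_SucE(2)[OF Suc.prems]]
     C_k_on_mult[OF assms(1) IH IH]])
 then have "C_k_on k U (ddir v (\<lambda>x. 1 / f x))" for v
  by (rule C_k_on_cong[OF assms(1) _, of "\<lambda>x. - (ddir v f x) * ((1 / f x) * (1 / f x))", rotated])
   (simp add: frechet_derivative_eqI[OF d])
 then show ?case using d by (auto simp: differentiable_def C_k_on.simps(2))
qed

lemma differentiable_componentwise:
 fixes F :: "'a::euclidean_space => 'b::euclidean_space"
 assumes "\<And>b. b \<in> Basis ==> (\<lambda>x. F x \<bullet> b) differentiable (at x)"
 shows "F differentiable (at x)"
 using assms differentiable_componentwise_within[of F x UNIV] by simp

lemma frechet_derivative_component:
 fixes F :: "'a::euclidean_space => 'b::euclidean_space"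
 assumes "F differentiable (at x)"
 shows "frechet_derivative (\<lambda>x. F x \<bullet> b) (at x) v = frechet_derivative F (at x) v \<bullet> b"
proof -
 have "((\<lambda>x. F x \<bullet> b) has_derivative (\<lambda>v. frechet_derivative F (at x) v \<bullet> b)) (at x)"
  by (rule has_derivative_inner_left[OF has_derivative_frechet[OF assms]])
 then show ?thesis by (simp add: frechet_derivative_eqI)
qed

lemma frechet_derivative_compose_real:
 fixes F :: "'a::euclidean_space => 'b::euclidean_space" and f :: "'b => real"
 assumes "F differentiable (at x)" "f differentiable (at (F x))"
 shows "frechet_derivative (\<lambda>x. f (F x)) (at x) v
  = frechet_derivative f (at (F x)) (frechet_derivative F (at x) v)"
proof -
 have "((\<lambda>x. f (F x)) has_derivative (\<lambda>v. frechet_derivative f (at (F x)) (frechet_derivative F (at x) v))) (at x)"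
  by (rule has_derivative_compose[OF has_derivative_frechet[OF assms(1)] has_derivative_frechet[OF assms(2)]])
 then show ?thesis by (simp add: frechet_derivative_eqI)
qed

text \<open>By the chain rule a directional derivative of the composition is a finite sum of
  products of a derivative of a component of \<open>F\<close> with a partial derivative of
  \<open>f\<close> composed with \<open>F\<close>; the latter is one order lower, so the induction
  runs over \<open>f\<close> with \<open>F\<close> fixed.\<close>

lemma C_k_on_compose:
 fixes F :: "'a::euclidean_space => 'b::euclidean_space" and f :: "'b => real"
 assumes "open U" "\<And>b. b \<in> Basis ==> C_k_on k U (\<lambda>x. F x \<bullet> b)" "C_k_on k V f" "F ` U \<subseteq> V"
 shows "C_k_on k U (\<lambda>x. f (F x))"
 using assms(2,3)
proof (induction k arbitrary: f)
 case 0
 have "continuous_on U F"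
  unfolding continuous_on_componentwise[of U F] using 0(1) by simp
 then show ?case using continuous_on_compose2[of V f U F] 0(2) assms(4) by simp
next
 case (Suc k)
 have dF: "F differentiable (at x)" if "x \<in> U" for x
  by (rule differentiable_componentwise) (rule C_k_on_SucE(1)[OF Suc.prems(1) that])
 have df: "f differentiable (at (F x))" if "x \<in> U" for x
  using C_k_on_SucE(1)[OF Suc.prems(2)] that assms(4) by auto
 have eq: "(\<Sum>b\<in>Basis. ddir v (\<lambda>x. F x \<bullet> b) x * ddir b f (F x)) = ddir v (\<lambda>x. f (F x)) x" if "x \<in> U" for x v
  unfolding frechet_derivative_compose_real[OF dF[OF that] df[OF that]]
  by (subst frechet_derivative_basis[OF df[OF that]])
   (simp add: frechet_derivative_component[OF dF[OF that]])
 have "C_k_on k U (\<lambda>x. ddir b f (F x))" if "b \<in> Basis" for b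
  by (rule Suc.IH[OF C_k_on_SucD[OF Suc.prems(1)] C_k_on_SucE(2)[OF Suc.prems(2)]])
 then have "C_k_on k U (\<lambda>x. \<Sum>b\<in>Basis. ddir v (\<lambda>x. F x \<bullet> b) x * ddir b f (F x))" for v
  by (intro C_k_on_sum C_k_on_mult assms(1) C_k_on_SucE(2)[OF Suc.prems(1)])
 then have "C_k_on k U (ddir v (\<lambda>x. f (F x)))" for v
  by (rule C_k_on_cong[OF assms(1), rotated]) (use eq in auto)
 moreover have "(\<lambda>x. f (F x)) differentiable (at x)" if "x \<in> U" for x
  using differentiable_chain_at[OF dF df] that by (simp add: o_def)
 ultimately show ?case by (simp add: C_k_on.simps(2))
qed

lemma C_k_on_real_SucI:
 fixes f :: "real => real"
 assumes "open U" "\<And>x. x \<in> U ==> (f has_real_derivative g x) (at x)" "C_k_on k U g"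
 shows "C_k_on (Suc k) U f"
proof -
 have d: "(f has_derivative (\<lambda>v. g x * v)) (at x)" if "x \<in> U" for x
  using assms(2)[OF that] by (simp add: has_field_derivative_def)
 have "C_k_on k U (ddir v f)" for v
  by (rule C_k_on_cong[OF assms(1), of "\<lambda>x. v * g x"])
   (use frechet_derivative_eqI[OF d] assms C_k_on_cmult in auto)
 then show ?thesis using d by (auto simp: differentiable_def C_k_on.simps(2))
qed

section \<open>Smooth functions and smooth maps\<close>

lemma smooth_onD:
 assumes "smooth_on U f"
 shows "C_k_on k U f" "x \<in> U ==> f differentiable (at x)" "smooth_on U (ddir v f)" "continuous_on U f"
proof -
 have *: "C_k_on j U f" for j using assms by (simp add: smooth_on_def)
 show "C_k_on k U f" "x \<in> U ==> f differentiable (at x)" "smooth_on U (ddir v f)" "continuous_on U f"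
  using *[of k] C_k_on_SucE[OF *[of "Suc _"]] C_k_on_imp_continuous_on[OF *[of 0]]
  by (auto simp: smooth_on_def)
qed

lemma smooth_on_compose:
 fixes F :: "'a::euclidean_space => 'b::euclidean_space"
 assumes "open U" "\<And>b. b \<in> Basis ==> smooth_on U (\<lambda>x. F x \<bullet> b)" "smooth_on V f" "F ` U \<subseteq> V"
 shows "smooth_on U (\<lambda>x. f (F x))"
 unfolding smooth_on_def
 by (intro allI C_k_on_compose[OF assms(1) _ smooth_onD(1)[OF assms(3)] assms(4)] smooth_onD(1)[OF assms(2)])

lemma smooth_on_compose_map:
 fixes F :: "'a::euclidean_space => 'b::euclidean_space"
 assumes "open U" "smooth_map F" "smooth_on V f" "F ` U \<subseteq> V"
 shows "smooth_on U (\<lambda>x. f (F x))"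
 by (rule smooth_on_compose[OF assms(1) _ assms(3,4)])
  (use assms(2) in \<open>auto simp: smooth_map_def smooth_on_def intro: C_k_on_subset\<close>)

lemma smooth_on_subset: "smooth_on U f ==> V \<subseteq> U ==> smooth_on V f"
 by (auto simp: smooth_on_def intro: C_k_on_subset)

lemma smooth_on_cong: "open U ==> (\<And>x. x \<in> U ==> f x = g x) ==> smooth_on U f ==> smooth_on U g"
 unfolding smooth_on_def by (intro allI C_k_on_cong[of U f g]) auto

lemma smooth_on_localI:
 assumes "\<And>x. x \<in> U ==> \<exists>V. open V \<and> x \<in> V \<and> smooth_on V f"
 shows "smooth_on U f"
 unfolding smooth_on_def
proof (intro allI C_k_on_localI)
 show "\<exists>V. open V \<and> x \<in> V \<and> C_k_on k V f" if "x \<in> U" for k x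
  using assms[OF that] by (auto simp: smooth_on_def)
qed

lemma smooth_on_const [simp]: "smooth_on U (\<lambda>x. c)"
 by (simp add: smooth_on_def)

lemma smooth_on_linear: "bounded_linear f ==> smooth_on U f"
 by (simp add: smooth_on_def C_k_on_linear)

lemma smooth_on_intros:
 assumes "open U" "smooth_on U f" "smooth_on U g"
 shows smooth_on_add: "smooth_on U (\<lambda>x. f x + g x)"
  and smooth_on_diff: "smooth_on U (\<lambda>x. f x - g x)"
  and smooth_on_mult: "smooth_on U (\<lambda>x. f x * g x)"
 using assms(2,3) by (simp_all add: smooth_on_def C_k_on_add[OF assms(1)] C_k_on_mult[OF assms(1)] C_k_on_diff[OF assms(1)])

lemma smooth_on_divide:
 assumes "open U" "smooth_on U f" "smooth_on U g" "\<And>x. x \<in> U ==> g x \<noteq> 0"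
 shows "smooth_on U (\<lambda>x. f x / g x)"
proof -
 have "C_k_on k U (\<lambda>x. f x * (1 / g x))" for k
  by (rule C_k_on_mult[OF assms(1) smooth_onD(1)[OF assms(2)]
     C_k_on_inverse[OF assms(1) smooth_onD(1)[OF assms(3)] assms(4)]])
 then show ?thesis by (simp add: smooth_on_def)
qed

lemma smooth_on_sum:
 "open U ==> (\<And>i. i \<in> I ==> smooth_on U (f i)) ==> smooth_on U (\<lambda>x. \<Sum>i\<in>I. f i x)"
 by (simp add: smooth_on_def C_k_on_sum)

lemma smooth_mapD:
 assumes "smooth_map F"
 shows "F differentiable (at x)" "continuous_on U F" "F \<in> borel_measurable borel"
proof -
 show d: "F differentiable (at x)" for x
  by (rule differentiable_componentwise) (use assms in \<open>auto simp: smooth_map_def intro: smooth_onD(2)[OF _ UNIV_I]\<close>)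
 show c: "continuous_on U F" for U
  by (simp add: continuous_on_eq_continuous_within differentiable_imp_continuous_within differentiable_at_withinI d)
 show "F \<in> borel_measurable borel" using c by (rule borel_measurable_continuous_onI)
qed

lemma smooth_map_component: "smooth_map F ==> smooth_on UNIV (\<lambda>x. F x \<bullet> b)"
proof -
 assume s: "smooth_map F"
 have "F x \<bullet> b = (\<Sum>c\<in>Basis. (b \<bullet> c) * (F x \<bullet> c))" for x
  by (subst euclidean_inner) (simp add: mult.commute)
 then show ?thesis using s
  by (auto simp: smooth_map_def intro!: smooth_on_sum smooth_on_mult)
qed

lemma smooth_map_compose:
 assumes "smooth_map G" "smooth_map F"
 shows "smooth_map (\<lambda>x. G (F x))"
 using assms smooth_on_compose_map[OF open_UNIV assms(2), of UNIV] by (auto simp: smooth_map_def)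

lemma smooth_map_linear: "bounded_linear F ==> smooth_map F"
 unfolding smooth_map_def
 by (intro ballI smooth_on_linear) (auto intro: bounded_linear_compose[OF bounded_linear_inner_left])

lemma smooth_map_const: "smooth_map (\<lambda>x. c)"
 by (simp add: smooth_map_def)

lemma smooth_map_Pair:
 assumes "smooth_map F" "smooth_map G"
 shows "smooth_map (\<lambda>x. (F x, G x))"
 using assms by (auto simp: smooth_map_def Basis_prod_def)

lemma smooth_map_fst [simp]: "smooth_map fst" and smooth_map_snd [simp]: "smooth_map snd"
 and smooth_map_ident [simp]: "smooth_map (\<lambda>x. x)"
 by (intro smooth_map_linear bounded_linear_fst bounded_linear_snd bounded_linear_ident)+

lemma smooth_map_fst' : "smooth_map F ==> smooth_map (\<lambda>x. fst (F x))"
 and smooth_map_snd' : "smooth_map F ==> smooth_map (\<lambda>x. snd (F x))"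
 using smooth_map_compose[OF smooth_map_fst] smooth_map_compose[OF smooth_map_snd] by auto

lemma smooth_map_add: "smooth_map F ==> smooth_map G ==> smooth_map (\<lambda>x. F x + G x)"
 and smooth_map_diff: "smooth_map F ==> smooth_map G ==> smooth_map (\<lambda>x. F x - G x)"
 by (auto simp: smooth_map_def inner_add_left inner_diff_left intro!: smooth_on_add smooth_on_diff)

lemma smooth_map_real: "smooth_map (f :: 'a::euclidean_space => real) \<longleftrightarrow> smooth_on UNIV f"
 by (simp add: smooth_map_def)

lemma smooth_map_scaleR:
 "smooth_on UNIV f ==> smooth_map G ==> smooth_map (\<lambda>x. f x *\<^sub>R G x)"
 by (auto simp: smooth_map_def intro!: smooth_on_mult)

lemma smooth_map_sum:
 "(\<And>i. i \<in> I ==> smooth_map (F i)) ==> smooth_map (\<lambda>x. \<Sum>i\<in>I. F i x)"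
 by (auto simp: smooth_map_def inner_sum_left intro!: smooth_on_sum)

lemma smooth_map_frechet:
 assumes "smooth_map F"
 shows "smooth_map (\<lambda>x. frechet_derivative F (at x) v)"
proof -
 have "(\<lambda>x. frechet_derivative F (at x) v \<bullet> b) = ddir v (\<lambda>x. F x \<bullet> b)" for b
  using frechet_derivative_component[OF smooth_mapD(1)[OF assms]] by auto
 then show ?thesis using smooth_onD(3)[OF smooth_map_component[OF assms]]
  by (auto simp: smooth_map_def)
qed

section \<open>Bump functions\<close>

text \<open>The index \<open>n\<close> makes the family closed under differentiation: every
  derivative of the standard flat function is a linear combination of members, so one induction
  gives smoothness.\<close>

definition flat :: "nat => real => real" where
 "flat n x = (if x \<le> 0 then 0 else exp (- (1 / x)) / x ^ n)"

text \<open>A single term of the exponential series of \<open>1 / x\<close> lies below its sum. The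
  term of order \<open>n + 2\<close> leaves two spare powers of \<open>x\<close>, which is what
  differentiability at the origin requires.\<close>

lemma flat_bound: "\<bar>flat n x\<bar> \<le> fact (n + 2) * x\<^sup>2"
proof (cases "x \<le> 0")
 case False
 then have x: "x > 0" by simp
 have "(1 / x) ^ (n + 2) / fact (n + 2) = (\<Sum>k\<in>{n+2}. (1 / x) ^ k / fact k)" by simp
 also have "\<dots> \<le> (\<Sum>k<n+3. (1 / x) ^ k / fact k)"
  using x by (intro sum_mono2) auto
 also have "\<dots> \<le> (\<Sum>k. (1 / x) ^ k / fact k)"
  using x summable_exp[of "1/x"] by (intro sum_le_suminf) (auto simp: divide_inverse mult.commute)
 also have "\<dots> = exp (1 / x)"
  by (simp add: exp_def divide_inverse scaleR_conv_of_real mult.commute)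
 finally have *: "(1 / x) ^ (n + 2) / fact (n + 2) \<le> exp (1 / x)" .
 have "exp (- (1 / x)) \<le> c * x ^ m" if "(1 / x) ^ m / c \<le> exp (1 / x)" "c > 0" for c m
  using x that by (simp add: exp_minus field_simps)
 from this[OF * ] have "exp (- (1 / x)) \<le> fact (n + 2) * x ^ (n + 2)" by simp
 then have "exp (- (1 / x)) / x ^ n \<le> fact (n + 2) * x ^ 2"
  using x by (simp add: divide_le_eq power_add mult_ac power2_eq_square)
 then show ?thesis using x by (simp add: flat_def)
qed (simp add: flat_def)

lemma flat_deriv: "(flat n has_real_derivative (flat (n + 2) x - n * flat (n + 1) x)) (at x)"
proof -
 consider "x < 0" | "x > 0" | "x = 0" by linarith
 then show ?thesis
 proof cases
  case 1
  have "((\<lambda>_. 0) has_real_derivative 0) (at x)" by simp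
  then have "(flat n has_real_derivative 0) (at x)"
   by (rule has_field_derivative_transform_within_open[where S="{..<0}"]) (use 1 in \<open>auto simp: flat_def\<close>)
  then show ?thesis using 1 by (simp add: flat_def)
 next
  case 2
  have "((\<lambda>x. exp (- (1 / x)) / x ^ n) has_real_derivative (flat (n + 2) x - n * flat (n + 1) x)) (at x)"
  proof -
   have p: "((\<lambda>x. x ^ n) has_real_derivative n * x ^ n / x) (at x)"
    using 2 DERIV_pow[of n x UNIV] by (cases n) auto
   have e: "((\<lambda>x. exp (- (1 / x))) has_real_derivative exp (- (1 / x)) / x\<^sup>2) (at x)"
    using 2 by (auto intro!: derivative_eq_intros simp: power2_eq_square)
   show ?thesis
    by (rule DERIV_cong[OF DERIV_divide[OF e p]]) (use 2 in \<open>simp_all add: flat_def field_simps power2_eq_square\<close>)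
  qed
  then show ?thesis
   by (rule has_field_derivative_transform_within_open[where S="{0<..}"]) (use 2 in \<open>auto simp: flat_def\<close>)
 next
  case 3
  have "((\<lambda>h. flat n h / h) \<longlongrightarrow> 0) (at 0)"
  proof (rule Lim_null_comparison)
   show "\<forall>\<^sub>F h in at 0. norm (flat n h / h) \<le> fact (n + 2) * \<bar>h\<bar>"
    using flat_bound[of n] by (intro always_eventually allI)
     (auto simp: abs_mult power2_eq_square divide_le_eq mult.assoc)
   show "((\<lambda>h::real. fact (n + 2) * \<bar>h\<bar>) \<longlongrightarrow> 0) (at 0)"
    by (auto intro!: tendsto_eq_intros)
  qed
  then show ?thesis using 3 by (simp add: has_field_derivative_iff flat_def)
 qed
qed

lemma C_k_on_flat: "C_k_on k UNIV (flat n)"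
proof (induction k arbitrary: n)
 case 0
 show ?case using flat_deriv[of n]
  by (auto simp: continuous_on_eq_continuous_at intro: DERIV_isCont)
next
 case (Suc k)
 have "C_k_on k UNIV (\<lambda>x. flat (n + 2) x - n * flat (n + 1) x)"
  by (intro C_k_on_diff C_k_on_cmult Suc.IH open_UNIV)
 then show ?case by (intro C_k_on_real_SucI[OF open_UNIV flat_deriv])
qed

lemma smooth_on_flat: "smooth_on UNIV (flat n)"
 by (simp add: smooth_on_def C_k_on_flat)

lemma flat_pos: "flat 0 x > 0 \<longleftrightarrow> x > 0" and flat_nonneg: "flat 0 x \<ge> 0" and flat_zero: "flat 0 x = 0 \<longleftrightarrow> x \<le> 0"
 by (auto simp: flat_def)

lemma smooth_on_norm_sq: "smooth_on UNIV (\<lambda>x::'a::euclidean_space. (norm (x - a))\<^sup>2)"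
proof -
 have "smooth_on UNIV (\<lambda>x. \<Sum>b\<in>Basis. ((x - a) \<bullet> b) * ((x - a) \<bullet> b))"
  by (intro smooth_on_sum smooth_on_mult open_UNIV smooth_map_component smooth_map_diff smooth_map_const smooth_map_ident)
 then show ?thesis
  unfolding power2_norm_eq_inner by (subst euclidean_inner)
qed

text \<open>The squared norm is a polynomial in the coordinates, so the centre causes no loss of
  smoothness.\<close>

definition bump :: "'a::euclidean_space => real => 'a => real" where
 "bump a r x = flat 0 (r\<^sup>2 - (norm (x - a))\<^sup>2)"

lemma test_funI:
 assumes "smooth_on UNIV f" "compact K" "\<And>x. x \<notin> K ==> f x = 0"
 shows "test_fun f"
proof -
 have "closure {x. f x \<noteq> 0} \<subseteq> K"
  using assms(2,3) by (intro closure_minimal) (auto intro: compact_imp_closed)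
 then show ?thesis using assms(1,2) bounded_subset by (auto simp: test_fun_def compact_eq_bounded_closed)
qed

lemma test_funE:
 assumes "test_fun f"
 obtains K where "compact K" "\<And>x. x \<notin> K ==> f x = 0" "smooth_on UNIV f"
 using assms that[of "closure {x. f x \<noteq> 0}"] closure_subset[of "{x. f x \<noteq> 0}"] unfolding test_fun_def by blast

lemma bump_props:
 assumes "r > 0"
 shows smooth_on_bump: "smooth_on UNIV (bump a r)" and test_fun_bump: "test_fun (bump a r)"
  and bump_nonneg: "bump a r x \<ge> 0" and bump_pos: "bump a r x > 0 \<longleftrightarrow> x \<in> ball a r"
proof -
 show s: "smooth_on UNIV (bump a r)"
  unfolding bump_def by (rule smooth_on_compose_map[OF open_UNIV _ smooth_on_flat])
   (auto simp: smooth_map_real intro!: smooth_on_diff smooth_on_norm_sq)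
 show "bump a r x \<ge> 0" by (simp add: bump_def flat_nonneg)
 have *: "bump a r x > 0 \<longleftrightarrow> x \<in> ball a r" for x
  using assms by (auto simp: bump_def flat_pos dist_norm norm_minus_commute power_strict_mono
    dest: power2_less_imp_less)
 then show "bump a r x > 0 \<longleftrightarrow> x \<in> ball a r" .
 show "test_fun (bump a r)"
 proof (rule test_funI[OF s compact_cball])
  fix x assume "x \<notin> cball a r"
  then show "bump a r x = 0" using *[of x] by (auto simp: bump_def flat_nonneg less_le)
 qed
qed

text \<open>The usual quotient \<open>a / (a + b)\<close>: the two terms of the denominator never
  vanish together, and the quotient is 1 where the second vanishes and 0 where the first
  does.\<close>

definition cutoff :: "real => 'a::euclidean_space => real" where
 "cutoff r x = flat 0 ((r + 1)\<^sup>2 - (norm x)\<^sup>2) /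
   (flat 0 ((r + 1)\<^sup>2 - (norm x)\<^sup>2) + flat 0 ((norm x)\<^sup>2 - r\<^sup>2))"

lemma cutoff_props:
 fixes x :: "'a::euclidean_space"
 assumes "r > 0"
 shows smooth_on_cutoff: "smooth_on UNIV (cutoff r :: 'a => real)"
  and test_fun_cutoff: "test_fun (cutoff r :: 'a => real)"
  and cutoff_range: "0 \<le> cutoff r x" "cutoff r x \<le> 1"
  and cutoff_one: "x \<in> cball 0 r ==> cutoff r x = 1"
  and cutoff_zero: "x \<notin> cball 0 (r + 1) ==> cutoff r x = 0"
proof -
 have pos: "flat 0 ((r + 1)\<^sup>2 - (norm x)\<^sup>2) + flat 0 ((norm x)\<^sup>2 - r\<^sup>2) > 0" for x :: 'a
 proof (cases "norm x < r + 1")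
  case True
  then have "(norm x)\<^sup>2 < (r + 1)\<^sup>2" by (intro power_strict_mono) auto
  then show ?thesis by (intro add_pos_nonneg) (auto simp: flat_pos flat_nonneg)
 next
  case False
  then have "r\<^sup>2 < (norm x)\<^sup>2" using assms by (intro power_strict_mono) auto
  then show ?thesis by (intro add_nonneg_pos) (auto simp: flat_pos flat_nonneg)
 qed
 have n: "smooth_on UNIV (\<lambda>x::'a. (norm x)\<^sup>2)" using smooth_on_norm_sq[of "0::'a"] by simp
 have f: "smooth_on UNIV (\<lambda>x::'a. flat 0 (g x))" if "smooth_on UNIV g" for g
  by (rule smooth_on_compose_map[OF open_UNIV _ smooth_on_flat]) (auto simp: smooth_map_real that)
 show s: "smooth_on UNIV (cutoff r :: 'a => real)"
  unfolding cutoff_def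
  by (intro smooth_on_divide smooth_on_add f smooth_on_diff smooth_on_const n open_UNIV)
   (use pos less_irrefl in metis)
 have z: "cutoff r x = 0" if "x \<notin> cball 0 (r + 1)" for x :: 'a
 proof -
  have "(r + 1)\<^sup>2 \<le> (norm x)\<^sup>2" using that assms by (intro power_mono) auto
  then show ?thesis by (simp add: cutoff_def flat_def)
 qed
 show "x \<notin> cball 0 (r + 1) ==> cutoff r x = 0" by (rule z)
 show "test_fun (cutoff r :: 'a => real)"
  by (rule test_funI[OF s compact_cball z])
 show "0 \<le> cutoff r x" unfolding cutoff_def by (intro divide_nonneg_pos pos flat_nonneg)
 show "cutoff r x \<le> 1" unfolding cutoff_def using pos[of x] flat_nonneg[of "(norm x)\<^sup>2 - r\<^sup>2"] by (simp add: divide_le_eq)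
 show "cutoff r x = 1" if "x \<in> cball 0 r"
 proof -
  have "(norm x)\<^sup>2 \<le> r\<^sup>2" using that assms by (intro power_mono) auto
  then have "flat 0 ((norm x)\<^sup>2 - r\<^sup>2) = 0" by (simp add: flat_def)
  then show ?thesis using pos[of x] by (simp add: cutoff_def)
 qed
qed

section \<open>The operators \<open>heat_op\<close>\<close>

lemma frechet_derivative_linear:
 assumes "f differentiable (at x)"
 shows "frechet_derivative f (at x) (a *\<^sub>R v) = a *\<^sub>R frechet_derivative f (at x) v"
  and "frechet_derivative f (at x) (v + w) = frechet_derivative f (at x) v + frechet_derivative f (at x) w"
  and "frechet_derivative f (at x) 0 = 0"
  and "frechet_derivative f (at x) (sum g I) = (\<Sum>i\<in>I. frechet_derivative f (at x) (g i))"
proof -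
 interpret linear "frechet_derivative f (at x)"
  using assms by (rule linear_frechet_derivative)
 show "frechet_derivative f (at x) (a *\<^sub>R v) = a *\<^sub>R frechet_derivative f (at x) v"
  "frechet_derivative f (at x) (v + w) = frechet_derivative f (at x) v + frechet_derivative f (at x) w"
  "frechet_derivative f (at x) 0 = 0"
  "frechet_derivative f (at x) (sum g I) = (\<Sum>i\<in>I. frechet_derivative f (at x) (g i))"
  by (simp_all add: scale add sum zero)
qed

lemma vf_cong: "open U ==> x \<in> U ==> (\<And>y. y \<in> U ==> f y = g y) ==> vf X f x = vf X g x"
 using frechet_derivative_cong_open[of U x f g] by (simp add: vf_def)

lemma vf_related:
 fixes \<Phi> :: "'a::euclidean_space => 'b::euclidean_space"
 assumes "\<Phi> differentiable (at x)" "f differentiable (at (\<Phi> x))"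
  "frechet_derivative \<Phi> (at x) (X x) = c *\<^sub>R Y (\<Phi> x)"
 shows "vf X (\<lambda>x. f (\<Phi> x)) x = c * vf Y f (\<Phi> x)"
 using frechet_derivative_compose_real[OF assms(1,2)] frechet_derivative_linear(1)[OF assms(2)] assms(3)
 by (simp add: vf_def)

lemma ddir_snd_basis:
 fixes u :: "real \<times> 'a::euclidean_space => real"
 assumes "u differentiable (at z)"
 shows "ddir (0, v) u z = (\<Sum>b\<in>Basis. (v \<bullet> b) * ddir (0, b) u z)"
proof -
 have "(\<Sum>b\<in>Basis. (v \<bullet> b) *\<^sub>R ((0::real), b)) = (0, \<Sum>b\<in>Basis. (v \<bullet> b) *\<^sub>R b)"
  by (simp add: prod_eq_iff fst_sum snd_sum)
 then have "(0, v) = (\<Sum>b\<in>Basis. (v \<bullet> b) *\<^sub>R ((0::real), b))"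
  by (simp add: euclidean_representation)
 then have "ddir (0, v) u z = ddir (\<Sum>b\<in>Basis. (v \<bullet> b) *\<^sub>R ((0::real), b)) u z" by (rule arg_cong)
 also have "\<dots> = (\<Sum>b\<in>Basis. ddir ((v \<bullet> b) *\<^sub>R ((0::real), b)) u z)"
  by (rule frechet_derivative_linear(4)[OF assms])
 also have "\<dots> = (\<Sum>b\<in>Basis. (v \<bullet> b) *\<^sub>R ddir (0, b) u z)"
  by (rule sum.cong[OF refl frechet_derivative_linear(1)[OF assms]])
 finally show ?thesis by simp
qed

lemma C_k_on_vf_tvf:
 fixes u :: "real \<times> 'a::euclidean_space => real"
 assumes "open W" "C_k_on (Suc k) W u" "smooth_map Y"
 shows "C_k_on k W (vf (tvf Y) u)"
proof -
 have "C_k_on k W (\<lambda>z. \<Sum>b\<in>Basis. (Y (snd z) \<bullet> b) * ddir (0, b) u z)"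
  using smooth_onD(1)[OF smooth_map_component[OF smooth_map_compose[OF assms(3) smooth_map_snd]]]
  by (intro C_k_on_sum C_k_on_mult assms(1) C_k_on_SucE(2)[OF assms(2)]) (auto intro: C_k_on_subset)
 then show ?thesis
  by (rule C_k_on_cong[OF assms(1), rotated])
   (simp add: vf_def tvf_def ddir_snd_basis[OF C_k_on_SucE(1)[OF assms(2)], symmetric])
qed

lemma smooth_on_vf_tvf:
 assumes "open W" "smooth_on W u" "smooth_map Y"
 shows "smooth_on W (vf (tvf Y) u)"
 using C_k_on_vf_tvf[OF assms(1) smooth_onD(1)[OF assms(2)] assms(3)] by (simp add: smooth_on_def)

lemma smooth_on_heat_op:
 assumes "open W" "smooth_on W u" "\<forall>j<m. smooth_map (Xs j)"
 shows "smooth_on W (heat_op e m Xs u)"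
 unfolding heat_op_def
 by (intro smooth_on_diff smooth_on_sum smooth_on_mult smooth_on_vf_tvf smooth_on_const assms(1,2) smooth_onD(3))
  (use assms(3) in auto)

lemma heat_op_cong:
 assumes "open U" "z \<in> U" "\<And>y. y \<in> U ==> u y = v y"
 shows "heat_op e m Xs u z = heat_op e m Xs v z"
proof -
 have "vf (tvf (Xs j)) u y = vf (tvf (Xs j)) v y" if "y \<in> U" for j y
  by (rule vf_cong[OF assms(1) that assms(3)])
 then have "vf (tvf (Xs j)) (vf (tvf (Xs j)) u) z = vf (tvf (Xs j)) (vf (tvf (Xs j)) v) z" for j
  by (intro vf_cong[OF assms(1,2)]) auto
 then show ?thesis using frechet_derivative_cong_open[OF assms] by (simp add: heat_op_def)
qed

text \<open>One chain rule for every change of variables below: left translation, dilation, time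
  shift, time reversal, and the projection of the group to the base. The squares of the fields pick
  up the factor \<open>c\<close> twice and the time derivative picks up \<open>r\<close>; the last
  hypothesis balances the two.\<close>

lemma heat_op_related:
 fixes u :: "real \<times> 'b::euclidean_space => real" and \<Phi> :: "'a::euclidean_space => 'b" and r t0 :: real
 defines "\<Psi> \<equiv> \<lambda>z. (r * fst z + t0, \<Phi> (snd z))"
 assumes "open W" "\<Psi> z \<in> W" "C_k_on 2 W u" "smooth_map \<Phi>" "\<forall>j<m. smooth_map (Ys j)"
  and rel: "\<forall>j<m. \<forall>x. frechet_derivative \<Phi> (at x) (Xs j x) = c *\<^sub>R Ys j (\<Phi> x)"
  and "e * r = c\<^sup>2 * e'"
 shows "heat_op e m Xs (\<lambda>z. u (\<Psi> z)) z = c\<^sup>2 * heat_op e' m Ys u (\<Psi> z)"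
proof -
 have C: "C_k_on (Suc (Suc 0)) W u" using assms(4) by (simp add: numeral_2_eq_2)
 have d\<Psi>: "(\<Psi> has_derivative (\<lambda>v. (r * fst v, frechet_derivative \<Phi> (at (snd y)) (snd v)))) (at y)" for y
  unfolding \<Psi>_def
  by (rule has_derivative_Pair)
   (auto intro!: derivative_eq_intros has_derivative_compose[OF has_derivative_snd[OF has_derivative_ident]
     has_derivative_frechet[OF smooth_mapD(1)[OF assms(5)]]])
 have s\<Psi>: "smooth_map \<Psi>" unfolding \<Psi>_def
  by (intro smooth_map_Pair smooth_map_compose[OF assms(5)] smooth_map_snd)
   (auto simp: smooth_map_real intro!: smooth_on_add smooth_on_mult smooth_on_linear[OF bounded_linear_fst] smooth_on_const)
 define V where "V = \<Psi> -` W"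
 have V: "open V" unfolding V_def
  using smooth_mapD(2)[OF s\<Psi>, of UNIV] assms(2) by (simp add: open_vimage)
 have tX: "frechet_derivative \<Psi> (at y) (tvf (Xs j) y) = c *\<^sub>R tvf (Ys j) (\<Psi> y)" if "j < m" for j y
  using rel that unfolding frechet_derivative_eqI[OF d\<Psi>] by (simp add: tvf_def \<Psi>_def)
 have v1: "vf (tvf (Xs j)) (\<lambda>z. u (\<Psi> z)) y = c * vf (tvf (Ys j)) u (\<Psi> y)" if "j < m" "y \<in> V" for j y
  by (rule vf_related[where \<Phi>=\<Psi> and f=u and Y="tvf (Ys j)", OF smooth_mapD(1)[OF s\<Psi>] C_k_on_SucE(1)[OF C] tX[OF that(1)]])
   (use that(2) in \<open>simp add: V_def\<close>)
 have v2: "vf (tvf (Xs j)) (vf (tvf (Xs j)) (\<lambda>z. u (\<Psi> z))) z = c\<^sup>2 * vf (tvf (Ys j)) (vf (tvf (Ys j)) u) (\<Psi> z)"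
  if j: "j < m" for j
 proof -
  have df: "vf (tvf (Ys j)) u differentiable (at (\<Psi> z))"
   using C_k_on_SucE(1)[OF C_k_on_vf_tvf[OF assms(2) C assms(6)[rule_format, OF j]] assms(3)] .
  have "vf (tvf (Xs j)) (vf (tvf (Xs j)) (\<lambda>z. u (\<Psi> z))) z
   = vf (tvf (Xs j)) (\<lambda>y. (\<lambda>w. c * vf (tvf (Ys j)) u w) (\<Psi> y)) z"
   by (rule vf_cong[OF V]) (use assms(3) v1[OF j] in \<open>auto simp: V_def\<close>)
  also have "\<dots> = c * vf (tvf (Ys j)) (\<lambda>w. c * vf (tvf (Ys j)) u w) (\<Psi> z)"
   by (rule vf_related[where \<Phi>=\<Psi> and f="\<lambda>w. c * vf (tvf (Ys j)) u w" and Y="tvf (Ys j)", OF smooth_mapD(1)[OF s\<Psi>] _ tX[OF j]]) (intro differentiable_mult differentiable_const df)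
  also have "vf (tvf (Ys j)) (\<lambda>w. c * vf (tvf (Ys j)) u w) (\<Psi> z) = c * vf (tvf (Ys j)) (vf (tvf (Ys j)) u) (\<Psi> z)"
   using frechet_derivative_eqI[OF has_derivative_mult_right[OF has_derivative_frechet[OF df], of c]]
   unfolding vf_def[of _ "\<lambda>w. c * vf (tvf (Ys j)) u w"] vf_def[of _ "vf (tvf (Ys j)) u"] by simp
  finally show ?thesis by (simp add: power2_eq_square)
 qed
 have du: "u differentiable (at (\<Psi> z))" using C_k_on_SucE(1)[OF C assms(3)] .
 have "frechet_derivative (\<lambda>z. u (\<Psi> z)) (at z) (1, 0) = frechet_derivative u (at (\<Psi> z)) (r *\<^sub>R (1, 0))"
  unfolding frechet_derivative_compose_real[OF smooth_mapD(1)[OF s\<Psi>] du] frechet_derivative_eqI[OF d\<Psi>]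
  by (simp add: frechet_derivative_linear(3)[OF smooth_mapD(1)[OF assms(5)]])
 then have "e * frechet_derivative (\<lambda>z. u (\<Psi> z)) (at z) (1, 0) = (e * r) * frechet_derivative u (at (\<Psi> z)) (1, 0)"
  using frechet_derivative_linear(1)[OF du, of r "(1,0)"] by simp
 then show ?thesis using assms(8) v2
  by (simp add: heat_op_def right_diff_distrib sum_distrib_left)
qed

text \<open>The first-order coefficient that remains when the sum of squares is written in
  non-divergence form.\<close>

definition drift :: "nat => (nat => 'a => 'a) => 'a => 'a::euclidean_space" where
 "drift m Xs x = (\<Sum>j<m. frechet_derivative (Xs j) (at x) (Xs j x))"

text \<open>At a fixed point the operator has constant coefficients, which reduces statements on integrals and
 extrema to directional derivatives.\<close>

lemma heat_op_expand:
 fixes u :: "real \<times> 'a::euclidean_space => real"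
 assumes "open W" "z \<in> W" "C_k_on 2 W u" "\<forall>j<m. smooth_map (Xs j)"
 shows "heat_op e m Xs u z = (\<Sum>j<m. ddir (0, Xs j (snd z)) (ddir (0, Xs j (snd z)) u) z)
   + ddir (0, drift m Xs (snd z)) u z - e * ddir (1, 0) u z"
proof -
 have C: "C_k_on (Suc (Suc 0)) W u" using assms(3) by (simp add: numeral_2_eq_2)
 note du = C_k_on_SucE(1)[OF C]
 note dg = C_k_on_SucE(1)[OF C_k_on_SucE(2)[OF C] assms(2)]
 have "vf (tvf (Xs j)) (vf (tvf (Xs j)) u) z = ddir (0, Xs j (snd z)) (ddir (0, Xs j (snd z)) u) z
   + ddir (0, frechet_derivative (Xs j) (at (snd z)) (Xs j (snd z))) u z" if "j < m" for j
 proof -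
  define X where "X = Xs j"
  define v where "v = X (snd z)"
  have dX: "X differentiable (at (snd z))" using smooth_mapD(1)[OF assms(4)[rule_format, OF that]] by (simp add: X_def)
  have da: "((\<lambda>y. X (snd y) \<bullet> b) has_derivative (\<lambda>w. frechet_derivative X (at (snd z)) (snd w) \<bullet> b)) (at z)" for b
   by (intro has_derivative_inner_left has_derivative_compose[OF has_derivative_snd[OF has_derivative_ident]
     has_derivative_frechet[OF dX]])
  have "((\<lambda>y. \<Sum>b\<in>Basis. (X (snd y) \<bullet> b) * ddir (0, b) u y) has_derivative
    (\<lambda>w. \<Sum>b\<in>Basis. (v \<bullet> b) * ddir w (ddir (0, b) u) z +
      (frechet_derivative X (at (snd z)) (snd w) \<bullet> b) * ddir (0, b) u z)) (at z)"
   unfolding v_def by (intro has_derivative_sum has_derivative_mult da has_derivative_frechet dg)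
  then have 1: "((vf (tvf X) u) has_derivative
    (\<lambda>w. \<Sum>b\<in>Basis. (v \<bullet> b) * ddir w (ddir (0, b) u) z +
      (frechet_derivative X (at (snd z)) (snd w) \<bullet> b) * ddir (0, b) u z)) (at z)"
   by (rule has_derivative_transform_within_open[OF _ assms(1,2)])
    (simp add: vf_def tvf_def ddir_snd_basis[OF du, symmetric])
  have "((\<lambda>y. \<Sum>b\<in>Basis. (v \<bullet> b) * ddir (0, b) u y) has_derivative
    (\<lambda>w. \<Sum>b\<in>Basis. (v \<bullet> b) * ddir w (ddir (0, b) u) z)) (at z)"
   by (intro has_derivative_sum has_derivative_mult_right has_derivative_frechet dg)
  then have 2: "((ddir (0, v) u) has_derivative
    (\<lambda>w. \<Sum>b\<in>Basis. (v \<bullet> b) * ddir w (ddir (0, b) u) z)) (at z)"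
   by (rule has_derivative_transform_within_open[OF _ assms(1,2)])
    (simp add: ddir_snd_basis[OF du, symmetric])
  have "vf (tvf X) (vf (tvf X) u) z = frechet_derivative (vf (tvf X) u) (at z) (0, v)"
   by (subst vf_def) (simp add: tvf_def v_def)
  also have "\<dots> = ddir (0, v) (ddir (0, v) u) z
   + ddir (0, frechet_derivative X (at (snd z)) v) u z"
   unfolding frechet_derivative_eqI[OF 1] frechet_derivative_eqI[OF 2]
    ddir_snd_basis[OF du[OF assms(2)], of "frechet_derivative X (at (snd z)) v"]
   by (simp add: sum.distrib)
  finally show ?thesis by (simp add: X_def v_def)
 qed
 moreover have "ddir (0, drift m Xs (snd z)) u z
   = (\<Sum>j<m. ddir (0, frechet_derivative (Xs j) (at (snd z)) (Xs j (snd z))) u z)"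
 proof -
  have "(0, drift m Xs (snd z)) = (\<Sum>j<m. ((0::real), frechet_derivative (Xs j) (at (snd z)) (Xs j (snd z))))"
   by (simp add: drift_def prod_eq_iff fst_sum snd_sum)
  then show ?thesis using frechet_derivative_linear(4)[OF du[OF assms(2)]] by simp
 qed
 ultimately show ?thesis by (simp add: heat_op_def sum.distrib)
qed

lemma heat_op_cmult_add:
 fixes u v :: "real \<times> 'a::euclidean_space => real"
 assumes "open W" "z \<in> W" "C_k_on 2 W u" "C_k_on 2 W v" "\<forall>j<m. smooth_map (Xs j)"
 shows "heat_op e m Xs (\<lambda>z. a * u z + b * v z) z = a * heat_op e m Xs u z + b * heat_op e m Xs v z"
proof -
 have C: "C_k_on (Suc (Suc 0)) W u" "C_k_on (Suc (Suc 0)) W v" using assms by (simp_all add: numeral_2_eq_2)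
 have C': "C_k_on 2 W (\<lambda>z. a * u z + b * v z)"
  by (intro C_k_on_add C_k_on_cmult assms)
 have 1: "ddir p (\<lambda>z. a * f z + b * g z) y = a * ddir p f y + b * ddir p g y"
  if "f differentiable (at y)" "g differentiable (at y)" for p y and f g :: "real \<times> 'a => real"
  using frechet_derivative_eqI[OF has_derivative_add[OF has_derivative_mult_right[OF has_derivative_frechet[OF that(1)], of a]
   has_derivative_mult_right[OF has_derivative_frechet[OF that(2)], of b]]] by simp
 have 2: "ddir p (\<lambda>z. a * u z + b * v z) y = a * ddir p u y + b * ddir p v y" if "y \<in> W" for p y
  by (rule 1[OF C_k_on_SucE(1)[OF C(1) that] C_k_on_SucE(1)[OF C(2) that]])
 have 3: "ddir p (ddir p (\<lambda>z. a * u z + b * v z)) z = a * ddir p (ddir p u) z + b * ddir p (ddir p v) z" for p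
 proof -
  have "ddir p (ddir p (\<lambda>z. a * u z + b * v z)) z = ddir p (\<lambda>y. a * ddir p u y + b * ddir p v y) z"
   by (subst frechet_derivative_cong_open[OF assms(1,2)]) (use 2 in auto)
  also have "\<dots> = a * ddir p (ddir p u) z + b * ddir p (ddir p v) z"
   by (rule 1[OF C_k_on_SucE(1)[OF C_k_on_SucE(2)[OF C(1)] assms(2)] C_k_on_SucE(1)[OF C_k_on_SucE(2)[OF C(2)] assms(2)]])
  finally show ?thesis .
 qed
 show ?thesis
  unfolding heat_op_expand[OF assms(1,2) C' assms(5)] heat_op_expand[OF assms(1,2,3,5)] heat_op_expand[OF assms(1,2,4,5)] 3
   2[OF assms(2)]
  by (simp add: sum.distrib sum_distrib_left algebra_simps)
qed

section \<open>Dilations and homogeneous functions\<close>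

text \<open>Weights sit on basis vectors, so that time, base, fibre, group and products of these are
  all covered by one notion.\<close>

definition dilation :: "('a::euclidean_space => real) => (real => 'a => 'a) => bool" where
 "dilation w \<delta> \<longleftrightarrow> (\<forall>b\<in>Basis. w b \<ge> 1) \<and> (\<forall>l>0. \<forall>x. \<forall>b\<in>Basis. \<delta> l x \<bullet> b = l powr w b * (x \<bullet> b))"

definition hdim :: "('a::euclidean_space => real) => real" where
 "hdim w = (\<Sum>b\<in>Basis. w b)"

text \<open>A continuous gauge that is homogeneous of degree exactly one. It replaces the norm in
  all decay and integrability estimates.\<close>

definition hn :: "('a::euclidean_space => real) => 'a => real" where
 "hn w x = (\<Sum>b\<in>Basis. \<bar>x \<bullet> b\<bar> powr (1 / w b))"

definition homog :: "(real => 'a => 'a) => real => 'a set => ('a => real) => bool" where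
 "homog \<delta> d W f \<longleftrightarrow> (\<forall>l>0. \<forall>x\<in>W. \<delta> l x \<in> W \<and> f (\<delta> l x) = l powr d * f x)"

text \<open>A basis vector of a product has exactly one nonzero component, and that component
  carries the weight.\<close>

definition wprod :: "('a::euclidean_space => real) => ('b::euclidean_space => real) => 'a \<times> 'b => real" where
 "wprod v w b = (if snd b = 0 then v (fst b) else w (snd b))"

definition dprod :: "(real => 'a => 'a) => (real => 'b => 'b) => real => 'a \<times> 'b => 'a \<times> 'b" where
 "dprod \<delta> \<epsilon> l z = (\<delta> l (fst z), \<epsilon> l (snd z))"

definition wvec :: "('n::finite => real) => real^'n => real" where
 "wvec \<sigma> b = (\<Sum>j\<in>UNIV. \<sigma> j * b $ j)"

lemma dilationD:
 assumes "dilation w \<delta>"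
 shows "b \<in> Basis ==> w b \<ge> 1" "l > 0 ==> b \<in> Basis ==> \<delta> l x \<bullet> b = l powr w b * (x \<bullet> b)"
 using assms unfolding dilation_def by blast+

lemma dilation_eqI:
 assumes "dilation w \<delta>" "l > 0" "\<And>b. b \<in> Basis ==> l powr w b * (x \<bullet> b) = y \<bullet> b"
 shows "\<delta> l x = y"
 by (rule euclidean_eqI) (simp add: dilationD[OF assms(1)] assms)

lemma dilation_bounded_linear:
 assumes "dilation w \<delta>" "l > 0"
 shows "bounded_linear (\<delta> l)"
proof -
 have "\<delta> l (x + y) = \<delta> l x + \<delta> l y" for x y
  by (rule dilation_eqI[OF assms]) (simp add: dilationD[OF assms(1)] assms(2) algebra_simps)
 moreover have "\<delta> l (c *\<^sub>R x) = c *\<^sub>R \<delta> l x" for c x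
  by (rule dilation_eqI[OF assms]) (simp add: dilationD[OF assms(1)] assms(2) algebra_simps)
 ultimately show ?thesis by (simp add: linear_conv_bounded_linear[symmetric] linear_iff)
qed

lemma dilation_mult: "dilation w \<delta> ==> l > 0 ==> k > 0 ==> \<delta> l (\<delta> k x) = \<delta> (l * k) x"
 by (rule dilation_eqI) (auto simp: dilationD powr_mult)

lemma dilation_1: "dilation w \<delta> ==> \<delta> 1 x = x"
 by (rule dilation_eqI) (auto simp: dilationD)

lemma dilation_0: "dilation w \<delta> ==> l > 0 ==> \<delta> l 0 = 0"
 by (rule dilation_eqI) (auto simp: dilationD)

lemma dilation_inverse:
 assumes "dilation w \<delta>" "l > 0"
 shows "\<delta> l (\<delta> (1 / l) x) = x" "\<delta> (1 / l) (\<delta> l x) = x"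
 using assms by (simp_all add: dilation_mult[OF assms(1)] dilation_1[OF assms(1)])

lemma dilation_Basis: "dilation w \<delta> ==> l > 0 ==> b \<in> Basis ==> \<delta> l b = (l powr w b) *\<^sub>R b"
 by (rule dilation_eqI) (auto simp: inner_Basis)

lemma dilation_dprod:
 assumes "dilation v \<delta>" "dilation w \<epsilon>"
 shows "dilation (wprod v w) (dprod \<delta> \<epsilon>)"
 using assms unfolding dilation_def wprod_def dprod_def
 by (auto simp: Basis_prod_def inner_prod_def dest: nonzero_Basis)

lemma dilation_real: "dilation (\<lambda>_. 2) (\<lambda>l t::real. l\<^sup>2 * t)"
 by (simp add: dilation_def powr_numeral)

lemma wvec_axis: "wvec \<sigma> (axis i 1) = \<sigma> i"
 by (simp add: wvec_def axis_def if_distrib sum.delta cong: if_cong)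

lemma dilation_dil: "(\<forall>j. 1 \<le> \<sigma> j) ==> dilation (wvec \<sigma>) (dil \<sigma>)"
 by (auto simp: dilation_def Basis_vec_def wvec_axis dil_def inner_axis)

lemma hdim_wvec: "hdim (wvec \<sigma>) = (\<Sum>j\<in>UNIV. \<sigma> j)"
proof -
 have "hdim (wvec \<sigma>) = (\<Sum>b\<in>(\<lambda>i. axis i (1::real)) ` UNIV. wvec \<sigma> b)"
  by (auto simp: hdim_def Basis_vec_def intro!: sum.cong)
 also have "\<dots> = (\<Sum>j\<in>UNIV. \<sigma> j)"
  by (subst sum.reindex) (auto simp: inj_on_def axis_eq_axis wvec_axis)
 finally show ?thesis .
qed

lemma hdim_wprod: "hdim (wprod v w) = hdim v + hdim w"
proof -
 have "hdim (wprod v w) = (\<Sum>b\<in>(\<lambda>u. (u, 0)) ` Basis. wprod v w b) + (\<Sum>b\<in>(\<lambda>u. (0, u)) ` Basis. wprod v w b)"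
  unfolding hdim_def Basis_prod_def by (rule sum.union_disjoint) (auto dest: nonzero_Basis)
 then show ?thesis
  by (simp add: hdim_def sum.reindex inj_on_def wprod_def) (auto intro!: sum.cong dest: nonzero_Basis)
qed

lemma hdim_real: "hdim (\<lambda>_::real. 2) = 2"
 by (simp add: hdim_def)

lemma hdim_ge_1: "dilation (w :: 'a::euclidean_space => real) \<delta> ==> hdim w \<ge> 1"
proof -
 assume d: "dilation w \<delta>"
 obtain b :: 'a where b: "b \<in> Basis" using nonempty_Basis by blast
 have "1 \<le> w b" using dilationD(1)[OF d b] .
 also have "\<dots> \<le> hdim w" unfolding hdim_def
  by (rule member_le_sum[OF b]) (use dilationD(1)[OF d] in force)+
 finally show ?thesis .
qed

lemma hn_nonneg: "hn w x \<ge> 0"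
 by (simp add: hn_def sum_nonneg)

lemma hn_dilation:
 assumes "dilation w \<delta>" "l > 0"
 shows "hn w (\<delta> l x) = l * hn w x"
proof -
 have "\<bar>l powr w b * (x \<bullet> b)\<bar> powr (1 / w b) = l * \<bar>x \<bullet> b\<bar> powr (1 / w b)" if "b \<in> Basis" for b
  using dilationD(1)[OF assms(1) that] assms(2) by (simp add: abs_mult powr_mult powr_powr)
 then show ?thesis
  unfolding hn_def sum_distrib_left using assms by (intro sum.cong) (auto simp: dilationD)
qed

lemma hn_component:
 assumes "dilation w \<delta>" "b \<in> Basis"
 shows "\<bar>x \<bullet> b\<bar> \<le> hn w x powr w b"
proof -
 have w: "w b \<ge> 1" using dilationD(1)[OF assms] .
 have "\<bar>x \<bullet> b\<bar> powr (1 / w b) \<le> hn w x" unfolding hn_def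
  by (rule member_le_sum[OF assms(2)]) auto
 then have "(\<bar>x \<bullet> b\<bar> powr (1 / w b)) powr w b \<le> hn w x powr w b"
  using w by (intro powr_mono2) auto
 then show ?thesis using w by (simp add: powr_powr)
qed

lemma hn_eq_0: "dilation w \<delta> ==> hn w x = 0 \<longleftrightarrow> x = 0"
proof
 assume "dilation w \<delta>" "hn w x = 0"
 show "x = 0"
 proof (rule euclidean_eqI)
  fix b :: 'a assume "b \<in> Basis"
  then have "\<bar>x \<bullet> b\<bar> \<le> 0" using hn_component[OF \<open>dilation w \<delta>\<close>, of b x] \<open>hn w x = 0\<close> by simp
  then show "x \<bullet> b = 0 \<bullet> b" by simp
 qed
qed (simp add: hn_def)

lemma continuous_on_hn: "dilation w \<delta> ==> continuous_on S (hn w)"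
 unfolding hn_def
 by (intro continuous_on_sum continuous_on_powr' continuous_intros) (use dilationD(1) in fastforce)+

lemma hn_bounded: "dilation w \<delta> ==> bounded {x. hn w x \<le> r}"
proof -
 assume d: "dilation w \<delta>"
 have "norm x \<le> (\<Sum>b\<in>Basis. \<bar>r\<bar> powr w b)" if "hn w x \<le> r" for x
 proof -
  have "norm x \<le> (\<Sum>b\<in>Basis. \<bar>x \<bullet> b\<bar>)" by (rule norm_le_l1)
  also have "\<dots> \<le> (\<Sum>b\<in>Basis. \<bar>r\<bar> powr w b)"
  proof (rule sum_mono)
   fix b :: 'a assume b: "b \<in> Basis"
   have "hn w x powr w b \<le> \<bar>r\<bar> powr w b"
    using that dilationD(1)[OF d b] hn_nonneg[of w x] by (intro powr_mono2) auto
   then show "\<bar>x \<bullet> b\<bar> \<le> \<bar>r\<bar> powr w b" using hn_component[OF d b, of x] by simp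
  qed
  finally show ?thesis .
 qed
 then show ?thesis by (auto simp: bounded_iff)
qed

lemma hn_compact: "dilation w \<delta> ==> compact {x. hn w x \<le> r}" "dilation w \<delta> ==> compact {x. hn w x = r}"
proof -
 assume d: "dilation w \<delta>"
 have c: "continuous_on UNIV (hn w)" by (rule continuous_on_hn[OF d])
 have "closed {x. hn w x \<le> r}" "closed {x. hn w x = r}"
  using closed_Collect_le[OF c continuous_on_const] closed_Collect_eq[OF c continuous_on_const] by auto
 moreover have "bounded {x. hn w x = r}" by (rule bounded_subset[OF hn_bounded[OF d, of r]]) auto
 ultimately show "compact {x. hn w x \<le> r}" "compact {x. hn w x = r}"
  using hn_bounded[OF d, of r] by (auto simp: compact_eq_bounded_closed)
qed

lemma hn_at_infinity: "dilation w \<delta> ==> filterlim (hn w) at_top at_infinity"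
proof -
 assume d: "dilation w \<delta>"
 have "\<forall>\<^sub>F x in at_infinity. r \<le> hn w x" for r
 proof -
  obtain B where "\<And>x. hn w x \<le> r ==> norm x \<le> B" using hn_bounded[OF d, of r] by (auto simp: bounded_iff)
  then have "r \<le> hn w x" if "B + 1 \<le> norm x" for x
   using that by (cases "hn w x \<le> r") fastforce+
  then show ?thesis unfolding eventually_at_infinity by blast
 qed
 then show ?thesis by (simp add: filterlim_at_top)
qed

lemma dilation_small:
 assumes "dilation w \<delta>" "l \<ge> 1"
 shows "norm (\<delta> (1 / l) x) \<le> (1 / l) * (\<Sum>b\<in>Basis. \<bar>x \<bullet> b\<bar>)"
proof -
 have "norm (\<delta> (1 / l) x) \<le> (\<Sum>b\<in>Basis. \<bar>\<delta> (1 / l) x \<bullet> b\<bar>)" by (rule norm_le_l1)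
 also have "\<dots> \<le> (\<Sum>b\<in>Basis. (1 / l) * \<bar>x \<bullet> b\<bar>)"
 proof (rule sum_mono)
  fix b :: 'a assume b: "b \<in> Basis"
  have "(1 / l) powr w b \<le> (1 / l) powr 1"
   using dilationD(1)[OF assms(1) b] assms(2) by (intro powr_mono') auto
  then show "\<bar>\<delta> (1 / l) x \<bullet> b\<bar> \<le> (1 / l) * \<bar>x \<bullet> b\<bar>"
   using assms b mult_right_mono[of "(1 / l) powr w b" "1 / l" "\<bar>x \<bullet> b\<bar>"]
   by (simp add: dilationD[OF assms(1)] abs_mult)
 qed
 finally show ?thesis by (simp add: sum_distrib_left)
qed

lemma dilation_tendsto_0: "dilation w \<delta> ==> ((\<lambda>l. \<delta> (1 / l) x) \<longlongrightarrow> 0) at_top"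
proof -
 assume d: "dilation w \<delta>"
 have "((\<lambda>l. (1 / l) * (\<Sum>b\<in>Basis. \<bar>x \<bullet> b\<bar>)) \<longlongrightarrow> 0) at_top"
  by (intro tendsto_mult_left_zero) (auto intro!: tendsto_divide_0 filterlim_at_top_imp_at_infinity filterlim_ident)
 moreover have "\<forall>\<^sub>F l in at_top. norm (\<delta> (1 / l) x) \<le> (1 / l) * (\<Sum>b\<in>Basis. \<bar>x \<bullet> b\<bar>)"
  using eventually_ge_at_top[of 1] by eventually_elim (rule dilation_small[OF d])
 ultimately show ?thesis by (rule Lim_null_comparison[rotated])
qed

lemma homogD:
 assumes "homog \<delta> d W f" "l > 0" "x \<in> W"
 shows "\<delta> l x \<in> W" "f (\<delta> l x) = l powr d * f x"
 using assms by (auto simp: homog_def)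

text \<open>Differentiate the homogeneity relation at \<open>x\<close> along \<open>b\<close> in two
  ways; the inner dilation multiplies \<open>b\<close> by \<open>l powr w b\<close>.\<close>

lemma homog_ddir:
 assumes "dilation w \<delta>" "open W" "homog \<delta> d W f" "\<And>x. x \<in> W ==> f differentiable (at x)" "b \<in> Basis"
 shows "homog \<delta> (d - w b) W (ddir b f)"
 unfolding homog_def
proof (intro allI impI ballI conjI)
 fix l :: real and x assume l: "l > 0" and x: "x \<in> W"
 show x': "\<delta> l x \<in> W" using homogD[OF assms(3) l x] by simp
 have dl: "(\<delta> l has_derivative \<delta> l) (at x)"
  by (rule bounded_linear_imp_has_derivative[OF dilation_bounded_linear[OF assms(1) l]])
 have "((\<lambda>x. f (\<delta> l x)) has_derivative (\<lambda>v. frechet_derivative f (at (\<delta> l x)) (\<delta> l v))) (at x)"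
  by (rule has_derivative_compose[OF dl has_derivative_frechet[OF assms(4)[OF x']]])
 moreover have "((\<lambda>x. f (\<delta> l x)) has_derivative (\<lambda>v. l powr d * frechet_derivative f (at x) v)) (at x)"
  by (rule has_derivative_transform_within_open[OF has_derivative_mult_right[OF has_derivative_frechet[OF assms(4)[OF x]]] assms(2) x])
   (use homogD(2)[OF assms(3) l] in simp)
 ultimately have "frechet_derivative f (at (\<delta> l x)) (\<delta> l b) = l powr d * frechet_derivative f (at x) b"
  using has_derivative_unique by metis
 then have "l powr w b * ddir b f (\<delta> l x) = l powr d * ddir b f x"
  using frechet_derivative_linear(1)[OF assms(4)[OF x']] by (simp add: dilation_Basis[OF assms(1) l assms(5)])
 then show "ddir b f (\<delta> l x) = l powr (d - w b) * ddir b f x"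
  using l by (simp add: powr_diff field_simps)
qed

text \<open>Divide out the gauge of \<open>h\<close>: the second component lands on the compact unit
  sphere of the gauge, while the first is contracted to the origin uniformly on \<open>K\<close>. So
  \<open>f\<close> is only evaluated near the compact set of points \<open>(0, h)\<close> with
  \<open>h\<close> on that sphere, where it is bounded.\<close>

lemma homog_decay:
 fixes f :: "'a::euclidean_space \<times> 'b::euclidean_space => real"
 assumes v: "dilation v \<delta>" and w: "dilation w \<epsilon>" and W: "open W" "homog (dprod \<delta> \<epsilon>) d W f" "continuous_on W f"
  and axis: "\<And>h. h \<noteq> 0 ==> (0, h) \<in> W" and K: "compact K"
 obtains R C where "R \<ge> 1" "C \<ge> 0"
  "\<And>p h. p \<in> K ==> hn w h \<ge> R ==> (p, h) \<in> W \<and> \<bar>f (p, h)\<bar> \<le> C * hn w h powr d"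
proof -
 define S where "S = {h. hn w h = 1}"
 have S: "compact S" unfolding S_def by (rule hn_compact(2)[OF w])
 have "compact ({0::'a} \<times> S)" using S by (intro compact_Times) auto
 moreover have "{0} \<times> S \<subseteq> W" using axis by (auto simp: S_def hn_def intro!: axis)
 ultimately obtain e where e: "e > 0" "(\<Union>x\<in>{0} \<times> S. ball x e) \<subseteq> W"
  using compact_subset_open_imp_ball_epsilon_subset[OF _ W(1)] by metis
 define N where "N = cball (0::'a) (e / 2) \<times> S"
 have NW: "N \<subseteq> W"
 proof
  fix z assume "z \<in> N"
  then have "z \<in> ball (0, snd z) e" "snd z \<in> S" using e(1)
   by (auto simp: N_def dist_Pair_Pair)
  then show "z \<in> W" using e(2) by blast
 qed
 have "compact N" unfolding N_def by (intro compact_Times S compact_cball)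
 then have "compact (f ` N)" using NW W(3) by (intro compact_continuous_image continuous_on_subset[OF W(3)])
 then obtain C where C: "\<And>z. z \<in> N ==> \<bar>f z\<bar> \<le> C"
  using bounded_iff[of "f ` N"] compact_imp_bounded[of "f ` N"] by auto
 obtain B where B: "\<And>p. p \<in> K ==> norm p \<le> B" using compact_imp_bounded[OF K] unfolding bounded_iff by metis
 \<comment> \<open>From this gauge on, the contraction brings every point of \<open>K\<close> within
   \<open>e / 2\<close> of the origin; the sum of coordinates is bounded by dimension times
   norm.\<close>
 define R where "R = max 1 (2 * (DIM('a) * \<bar>B\<bar>) / e)"
 have "(p, h) \<in> W \<and> \<bar>f (p, h)\<bar> \<le> \<bar>C\<bar> * hn w h powr d" if p: "p \<in> K" and h: "hn w h \<ge> R" for p h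
 proof -
  define l where "l = hn w h"
  have l: "l \<ge> 1" "l > 0" using h by (auto simp: l_def R_def)
  have "(\<Sum>b\<in>Basis. \<bar>p \<bullet> b\<bar>) \<le> (\<Sum>b\<in>(Basis::'a set). \<bar>B\<bar>)"
   using B[OF p] by (intro sum_mono) (smt (verit, best) Basis_le_norm)
  then have s: "(\<Sum>b\<in>Basis. \<bar>p \<bullet> b\<bar>) \<le> DIM('a) * \<bar>B\<bar>" by simp
  have "norm (\<delta> (1 / l) p) \<le> (1 / l) * (DIM('a) * \<bar>B\<bar>)"
   using dilation_small[OF v l(1), of p] s l by (smt (verit) divide_nonneg_nonneg mult_left_mono)
  also have "\<dots> \<le> e / 2"
  proof -
   have "2 * (DIM('a) * \<bar>B\<bar>) / e \<le> l" using h by (auto simp: l_def R_def)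
   then show ?thesis using e(1) l by (simp add: field_simps)
  qed
  finally have "(\<delta> (1 / l) p, \<epsilon> (1 / l) h) \<in> N"
   using l hn_dilation[OF w, of "1 / l" h] by (simp add: N_def S_def l_def)
  moreover have eq: "(p, h) = dprod \<delta> \<epsilon> l (\<delta> (1 / l) p, \<epsilon> (1 / l) h)"
   by (simp add: dprod_def dilation_inverse[OF v l(2)] dilation_inverse[OF w l(2)])
  ultimately have *: "(p, h) \<in> W" "f (p, h) = l powr d * f (\<delta> (1 / l) p, \<epsilon> (1 / l) h)" "\<bar>f (\<delta> (1 / l) p, \<epsilon> (1 / l) h)\<bar> \<le> C"
   using homogD[OF W(2) l(2)] NW C by auto
  have "\<bar>f (p, h)\<bar> = l powr d * \<bar>f (\<delta> (1 / l) p, \<epsilon> (1 / l) h)\<bar>" by (simp add: *(2) abs_mult)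
  also have "\<dots> \<le> l powr d * \<bar>C\<bar>" using *(3) by (intro mult_left_mono) auto
  finally show ?thesis using *(1) by (simp add: l_def mult.commute)
 qed
 then show thesis by (intro that[of R "\<bar>C\<bar>"]) (auto simp: R_def)
qed

text \<open>Extends the decay at infinity to all of \<open>S\<close>: the part of bounded gauge is
  compact inside \<open>W\<close>. Using \<open>1 + hn w h\<close> keeps the majorant finite at the
  origin, and \<open>d \<le> 0\<close> allows the comparison of the two gauges.\<close>

lemma homog_dominated:
 fixes f :: "'a::euclidean_space \<times> 'b::euclidean_space => real"
 assumes v: "dilation v \<delta>" and w: "dilation w \<epsilon>" and W: "open W" "homog (dprod \<delta> \<epsilon>) d W f" "continuous_on W f"
  and axis: "\<And>h. h \<noteq> 0 ==> (0, h) \<in> W" and K: "compact K" and S: "closed S" "K \<times> S \<subseteq> W" and d: "d \<le> 0"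
 obtains C where "\<And>p h. p \<in> K ==> h \<in> S ==> \<bar>f (p, h)\<bar> \<le> C * (1 + hn w h) powr d"
proof -
 obtain R C where RC: "R \<ge> 1" "C \<ge> 0"
  "\<And>p h. p \<in> K ==> hn w h \<ge> R ==> (p, h) \<in> W \<and> \<bar>f (p, h)\<bar> \<le> C * hn w h powr d"
  using homog_decay[OF v w W axis K] by metis
 define T where "T = K \<times> ({h. hn w h \<le> R} \<inter> S)"
 have "compact T" unfolding T_def using hn_compact(1)[OF w, of R] S(1) K by (intro compact_Times compact_Int_closed)
 moreover have "T \<subseteq> W" using S(2) by (auto simp: T_def)
 ultimately have "compact (f ` T)" using W(3) by (intro compact_continuous_image continuous_on_subset[OF W(3)])
 then obtain B where B: "\<And>z. z \<in> T ==> \<bar>f z\<bar> \<le> B"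
  using bounded_iff[of "f ` T"] compact_imp_bounded[of "f ` T"] by auto
 define D where "D = \<bar>B\<bar> * (1 + R) powr (- d) + C * 2 powr (- d)"
 have "\<bar>f (p, h)\<bar> \<le> D * (1 + hn w h) powr d" if "p \<in> K" "h \<in> S" for p h
 proof (cases "hn w h \<le> R")
  case True
  have "1 = (1 + R) powr (- d) * (1 + R) powr d" using RC(1) by (simp add: powr_minus)
  also have "\<dots> \<le> (1 + R) powr (- d) * (1 + hn w h) powr d"
   using True d hn_nonneg[of w h] by (intro mult_left_mono powr_mono2') auto
  finally have "\<bar>B\<bar> * 1 \<le> \<bar>B\<bar> * ((1 + R) powr (- d) * (1 + hn w h) powr d)" by (intro mult_left_mono) auto
  moreover have "\<bar>f (p, h)\<bar> \<le> \<bar>B\<bar>" using B[of "(p, h)"] that True by (auto simp: T_def)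
  moreover have "0 \<le> C * 2 powr (- d) * (1 + hn w h) powr d" using RC(2) by simp
  ultimately show ?thesis unfolding D_def distrib_right mult.assoc by linarith
 next
  case False
  have h: "hn w h \<ge> 1" using False RC(1) by simp
  have "hn w h powr d \<le> ((1 + hn w h) / 2) powr d"
   using h d by (intro powr_mono2') auto
  also have "\<dots> = 2 powr (- d) * (1 + hn w h) powr d" using h
   by (subst powr_divide) (simp_all add: powr_minus_divide)
  finally have "C * hn w h powr d \<le> C * (2 powr (- d) * (1 + hn w h) powr d)" using RC(2) by (intro mult_left_mono)
  moreover have "\<bar>f (p, h)\<bar> \<le> C * hn w h powr d" using RC(3)[OF that(1)] False by auto
  moreover have "0 \<le> \<bar>B\<bar> * (1 + R) powr (- d) * (1 + hn w h) powr d" by simp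
  ultimately show ?thesis unfolding D_def distrib_right mult.assoc by linarith
 qed
 then show thesis by (rule that)
qed

lemma measurable_hn [measurable]: "hn w \<in> borel_measurable borel"
 unfolding hn_def by measurable

text \<open>Dyadic summation. The set of gauge at most \<open>2 ^ k\<close> lies in a box of volume
  proportional to \<open>(2 ^ k) powr hdim w\<close>, and on it the integrand is charged with a
  multiple of \<open>(2 ^ k) powr (- s)\<close>; this leaves a geometric series of ratio
  \<open>2 powr (hdim w - s) < 1\<close>.\<close>

lemma integrable_hn:
 fixes w :: "'a::euclidean_space => real"
 assumes w: "dilation w \<delta>" and s: "s > hdim w"
 shows "integrable lborel (\<lambda>h. (1 + hn w h) powr (- s))"
proof (rule integrableI_nonneg)
 let ?q = "2 powr (hdim w - s) :: real"
 let ?A = "\<lambda>k::nat. {h. hn w h \<le> 2 ^ k}"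
 have meas: "?A k \<in> sets lborel" for k by measurable
 have vol: "emeasure lborel (?A k) \<le> ennreal (2 ^ DIM('a) * (2 ^ k) powr hdim w)" for k
 proof -
  define a where "a = (\<Sum>b\<in>Basis. ((2 ^ k) powr w b) *\<^sub>R b)"
  have a: "a \<bullet> b = (2 ^ k) powr w b" if "b \<in> Basis" for b
   using that by (simp add: a_def)
  have "?A k \<subseteq> cbox (- a) a"
  proof
   fix h assume "h \<in> ?A k"
   then have h: "hn w h \<le> 2 ^ k" by simp
   have "\<bar>h \<bullet> b\<bar> \<le> (2 ^ k) powr w b" if "b \<in> Basis" for b
   proof -
    have "hn w h powr w b \<le> (2 ^ k) powr w b"
     using h dilationD(1)[OF w that] hn_nonneg[of w h] by (intro powr_mono2) auto
    then show ?thesis using hn_component[OF w that, of h] by simp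
   qed
   then show "h \<in> cbox (- a) a"
    by (auto simp: mem_box abs_le_iff a minus_le_iff)
  qed
  then have "emeasure lborel (?A k) \<le> emeasure lborel (cbox (- a) a)"
   by (intro emeasure_mono) auto
  also have "\<dots> = ennreal (\<Prod>b\<in>(Basis::'a set). 2 * (2 ^ k) powr w b)"
   by (subst emeasure_lborel_cbox) (auto simp: a inner_diff_left inner_add_left intro!: prod.cong arg_cong[where f=ennreal])
  also have "(\<Prod>b\<in>(Basis::'a set). 2 * (2 ^ k) powr w b) = 2 ^ DIM('a) * (2 ^ k) powr hdim w"
   by (simp add: prod.distrib hdim_def powr_sum)
  finally show ?thesis .
 qed
 have q: "0 \<le> ?q" "?q < 1" using s powr_less_mono[of "hdim w - s" 0 2] by auto
 have "(\<integral>\<^sup>+ h. ennreal (norm ((1 + hn w h) powr (- s))) \<partial>lborel)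
  \<le> (\<integral>\<^sup>+ h. (\<Sum>k. ennreal (2 powr s * (2 ^ k) powr (- s)) * indicator (?A k) h) \<partial>lborel)"
 proof (rule nn_integral_mono)
  fix h :: 'a
  have h0: "hn w h \<ge> 0" by (rule hn_nonneg)
  obtain k' :: nat where k0: "hn w h \<le> 2 ^ k'" using real_arch_pow[of 2 "hn w h"] by (auto intro: less_imp_le)
  \<comment> \<open>The first dyadic level reaching \<open>h\<close>: unless it is level 0, the
    previous level lies below the gauge, which bounds the integrand from above.\<close>
  define k where "k = (LEAST k::nat. hn w h \<le> 2 ^ k)"
  have k: "hn w h \<le> 2 ^ k" using k0 unfolding k_def by (rule LeastI)
  have k': "2 ^ k / 2 \<le> 1 + hn w h"
  proof (cases k)
   case (Suc j)
   then have "\<not> hn w h \<le> 2 ^ j" using not_less_Least[of j "\<lambda>k. hn w h \<le> 2 ^ k"] by (simp add: k_def)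
   then show ?thesis using Suc by simp
  qed (use h0 in simp)
  have "(1 + hn w h) powr (- s) \<le> (2 ^ k / 2) powr (- s)"
   using k' s hdim_ge_1[OF w] by (intro powr_mono2') auto
  also have "\<dots> = 2 powr s * (2 ^ k) powr (- s)"
   by (subst powr_divide) (simp_all add: powr_minus_divide)
  finally have "ennreal (norm ((1 + hn w h) powr (- s))) \<le> ennreal (2 powr s * (2 ^ k) powr (- s)) * indicator (?A k) h"
   using k by (simp add: ennreal_leI)
  also have "\<dots> = (\<Sum>j\<in>{k}. ennreal (2 powr s * (2 ^ j) powr (- s)) * indicator (?A j) h)"
   by (subst sum.insert[OF finite.emptyI]) (simp_all only: sum.empty add_0_right empty_iff not_False_eq_True)
  also have "\<dots> \<le> (\<Sum>k. ennreal (2 powr s * (2 ^ k) powr (- s)) * indicator (?A k) h)"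
   by (rule sum_le_suminf) auto
  finally show "ennreal (norm ((1 + hn w h) powr (- s))) \<le> (\<Sum>k. ennreal (2 powr s * (2 ^ k) powr (- s)) * indicator (?A k) h)" .
 qed
 also have "\<dots> = (\<Sum>k. ennreal (2 powr s * (2 ^ k) powr (- s)) * emeasure lborel (?A k))"
  using meas by (subst nn_integral_suminf) (auto simp: nn_integral_cmult_indicator)
 also have "\<dots> \<le> (\<Sum>k. ennreal (2 powr s * 2 ^ DIM('a) * ?q ^ k))"
 proof (rule suminf_le)
  fix k :: nat
  have "ennreal (2 powr s * (2 ^ k) powr (- s)) * emeasure lborel (?A k)
   \<le> ennreal (2 powr s * (2 ^ k) powr (- s)) * ennreal (2 ^ DIM('a) * (2 ^ k) powr hdim w)"
   by (intro mult_left_mono vol) auto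
  also have "\<dots> = ennreal (2 powr s * 2 ^ DIM('a) * ((2 ^ k) powr (- s) * (2 ^ k) powr hdim w))"
   by (simp add: ennreal_mult'[symmetric] mult_ac)
  also have "(2 ^ k) powr (- s) * (2 ^ k) powr hdim w = ?q ^ k"
  proof -
   have "(2 ^ k) powr (- s) * (2 ^ k) powr hdim w = (2 powr real k) powr (hdim w - s)"
    by (simp add: powr_add[symmetric] powr_realpow)
   also have "\<dots> = ?q powr real k" by (simp add: powr_powr mult.commute)
   also have "\<dots> = ?q ^ k" by (simp add: powr_realpow)
   finally show ?thesis .
  qed
  finally show "ennreal (2 powr s * (2 ^ k) powr (- s)) * emeasure lborel (?A k) \<le> ennreal (2 powr s * 2 ^ DIM('a) * ?q ^ k)" .
 qed auto
 also have "\<dots> < \<infinity>"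
  using q by (subst suminf_ennreal2) (auto intro!: summable_mult summable_geometric)
 finally show "(\<integral>\<^sup>+ h. ennreal ((1 + hn w h) powr (- s)) \<partial>lborel) < \<infinity>" by simp
qed auto

section \<open>Differentiation under the integral sign\<close>

text \<open>The majorant of the partial derivatives bounds the difference quotients by the mean
  value inequality, so dominated convergence applies along every sequence tending to
  \<open>p0\<close>.\<close>

lemma has_derivative_integral_dominated:
 fixes F :: "'a::euclidean_space => 'h => real"
 assumes e: "e > 0"
  and d: "\<And>p h. p \<in> ball p0 e ==> h \<in> space M ==> (\<lambda>p. F p h) differentiable (at p)"
  and int: "\<And>p. p \<in> ball p0 e ==> integrable M (F p)"
  and meas: "\<And>b. b \<in> Basis ==> (\<lambda>h. ddir b (\<lambda>p. F p h) p0) \<in> borel_measurable M"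
  and dom: "\<And>b p h. b \<in> Basis ==> p \<in> ball p0 e ==> h \<in> space M ==> \<bar>ddir b (\<lambda>p. F p h) p\<bar> \<le> B h"
  and B: "integrable M B"
 shows "((\<lambda>p. \<integral>h. F p h \<partial>M) has_derivative (\<lambda>v. \<Sum>b\<in>Basis. (v \<bullet> b) * (\<integral>h. ddir b (\<lambda>p. F p h) p0 \<partial>M))) (at p0)"
proof -
 define D where "D h v = ddir v (\<lambda>p. F p h) p0" for h v
 define L where "L v = (\<Sum>b\<in>Basis. (v \<bullet> b) * (\<integral>h. D h b \<partial>M))" for v
 have p0: "p0 \<in> ball p0 e" using e by simp
 have intD: "integrable M (\<lambda>h. D h b)" if "b \<in> Basis" for b
  by (rule Bochner_Integration.integrable_bound[OF B])
   (use meas[OF that] dom[OF that p0] in \<open>auto simp: D_def intro: order_trans[OF _ abs_ge_self]\<close>)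
 have Deq: "D h v = (\<Sum>b\<in>Basis. (v \<bullet> b) * D h b)" if "h \<in> space M" for h v
  unfolding D_def by (rule frechet_derivative_basis[OF d[OF p0 that]])
 have intDv: "integrable M (\<lambda>h. D h v)" and LD: "L v = (\<integral>h. D h v \<partial>M)" for v
 proof -
  have i: "integrable M (\<lambda>h. \<Sum>b\<in>Basis. (v \<bullet> b) * D h b)"
   by (intro Bochner_Integration.integrable_sum integrable_mult_right intD)
  then show "integrable M (\<lambda>h. D h v)"
   by (subst Bochner_Integration.integrable_cong[OF refl Deq])
  have "(\<integral>h. D h v \<partial>M) = (\<integral>h. (\<Sum>b\<in>Basis. (v \<bullet> b) * D h b) \<partial>M)"
   by (rule Bochner_Integration.integral_cong[OF refl Deq])
  also have "\<dots> = L v" unfolding L_def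
   by (subst Bochner_Integration.integral_sum) (auto intro!: integrable_mult_right intD)
  finally show "L v = (\<integral>h. D h v \<partial>M)" by simp
 qed
 have bnd: "\<bar>ddir v (\<lambda>p. F p h) p\<bar> \<le> (DIM('a) * B h) * norm v" if "p \<in> ball p0 e" "h \<in> space M" for p h v
 proof -
  have "\<bar>ddir v (\<lambda>p. F p h) p\<bar> = \<bar>\<Sum>b\<in>Basis. (v \<bullet> b) * ddir b (\<lambda>p. F p h) p\<bar>"
   by (subst frechet_derivative_basis[OF d[OF that]]) simp
  also have "\<dots> \<le> (\<Sum>b\<in>Basis. \<bar>(v \<bullet> b) * ddir b (\<lambda>p. F p h) p\<bar>)" by (rule sum_abs)
  also have "\<dots> \<le> (\<Sum>b\<in>(Basis::'a set). norm v * B h)"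
   using dom[OF _ that] Basis_le_norm by (intro sum_mono) (auto simp: abs_mult intro!: mult_mono)
  finally show ?thesis by (simp add: mult_ac)
 qed
 have mvt: "\<bar>F p h - F p0 h\<bar> \<le> (DIM('a) * B h) * norm (p - p0)" if p: "p \<in> ball p0 e" and h: "h \<in> space M" for p h
 proof -
  have "norm (F p h - F p0 h) \<le> (DIM('a) * B h) * norm (p - p0)"
  proof (rule differentiable_bound[OF convex_ball _ _ p p0])
   show "((\<lambda>p. F p h) has_derivative (\<lambda>v. ddir v (\<lambda>p. F p h) q)) (at q within ball p0 e)" if "q \<in> ball p0 e" for q
    using has_derivative_frechet[OF d[OF that h]] by (rule has_derivative_at_withinI)
   show "onorm (\<lambda>v. ddir v (\<lambda>p. F p h) q) \<le> DIM('a) * B h" if "q \<in> ball p0 e" for q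
    by (rule onorm_le) (use bnd[OF that h] in simp)
  qed
  then show ?thesis by simp
 qed
 have bl: "bounded_linear L" unfolding L_def
  by (intro bounded_linear_sum bounded_linear_mult_left bounded_linear_compose[OF bounded_linear_mult_left bounded_linear_inner_left])
 have "((\<lambda>p. norm ((\<integral>h. F p h \<partial>M) - (\<integral>h. F p0 h \<partial>M) - L (p - p0)) / norm (p - p0)) \<longlongrightarrow> 0) (at p0)"
  unfolding tendsto_at_iff_sequentially comp_def
 proof (intro allI impI)
  fix X assume X: "\<forall>i. X i \<in> UNIV - {p0}" "X \<longlonglongrightarrow> p0"
  \<comment> \<open>The domination is local, so the sequence is shifted until it stays in the ball;
    \<open>LIMSEQ_offset\<close> undoes the shift at the end.\<close>
  obtain N where N: "\<And>i. i \<ge> N ==> X i \<in> ball p0 e"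
   using tendstoD[OF X(2) e] by (auto simp: eventually_sequentially dist_commute)
  define Y where "Y i = X (i + N)" for i
  have Y: "Y i \<in> ball p0 e" "Y i \<noteq> p0" for i using N X(1) by (auto simp: Y_def)
  have Ylim: "Y \<longlonglongrightarrow> p0" unfolding Y_def by (rule LIMSEQ_ignore_initial_segment[OF X(2)])
  define G where "G i h = (F (Y i) h - F p0 h - D h (Y i - p0)) / norm (Y i - p0)" for i h
  have "(\<lambda>i. \<integral>h. G i h \<partial>M) \<longlonglongrightarrow> (\<integral>h. 0 \<partial>M)"
  proof (rule integral_dominated_convergence)
   show "integrable M (\<lambda>h. 2 * (DIM('a) * B h))" using B by simp
   show "G i \<in> borel_measurable M" for i
    unfolding G_def using borel_measurable_integrable[OF int[OF Y(1)]] borel_measurable_integrable[OF int[OF p0]]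
     borel_measurable_integrable[OF intDv] by measurable
   show "AE h in M. (\<lambda>i. G i h) \<longlonglongrightarrow> 0"
   proof (rule AE_I2)
    fix h assume h: "h \<in> space M"
    have "((\<lambda>p. norm (F p h - F p0 h - D h (p - p0)) / norm (p - p0)) \<longlongrightarrow> 0) (at p0)"
     using has_derivative_frechet[OF d[OF p0 h]] unfolding has_derivative_iff_norm D_def by simp
    then have "(\<lambda>i. norm (G i h)) \<longlonglongrightarrow> 0"
     unfolding tendsto_at_iff_sequentially comp_def G_def using Y(2) Ylim by simp
    then show "(\<lambda>i. G i h) \<longlonglongrightarrow> 0" by (rule tendsto_norm_zero_cancel)
   qed
   show "AE h in M. norm (G i h) \<le> 2 * (DIM('a) * B h)" for i
   proof (rule AE_I2)
    fix h assume h: "h \<in> space M"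
    have "\<bar>F (Y i) h - F p0 h - D h (Y i - p0)\<bar> \<le> 2 * (DIM('a) * B h) * norm (Y i - p0)"
     using mvt[OF Y(1)[of i] h] bnd[OF p0 h, of "Y i - p0"] unfolding D_def by (simp add: abs_le_iff)
    then show "norm (G i h) \<le> 2 * (DIM('a) * B h)"
     using Y(2)[of i] by (simp add: G_def divide_le_eq)
   qed
  qed auto
  moreover have "(\<integral>h. G i h \<partial>M) = ((\<integral>h. F (Y i) h \<partial>M) - (\<integral>h. F p0 h \<partial>M) - L (Y i - p0)) / norm (Y i - p0)" for i
   unfolding G_def LD using int[OF Y(1)[of i]] int[OF p0] intDv by simp
  ultimately have "(\<lambda>i. norm (((\<integral>h. F (Y i) h \<partial>M) - (\<integral>h. F p0 h \<partial>M) - L (Y i - p0)) / norm (Y i - p0))) \<longlonglongrightarrow> 0"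
   using tendsto_norm_zero by fastforce
  then have "(\<lambda>i. norm ((\<integral>h. F (X (i + N)) h \<partial>M) - (\<integral>h. F p0 h \<partial>M) - L (X (i + N) - p0)) / norm (X (i + N) - p0)) \<longlonglongrightarrow> 0"
   by (simp add: Y_def)
  then show "(\<lambda>i. norm ((\<integral>h. F (X i) h \<partial>M) - (\<integral>h. F p0 h \<partial>M) - L (X i - p0)) / norm (X i - p0)) \<longlonglongrightarrow> 0"
   by (rule LIMSEQ_offset)
 qed
 then have "((\<lambda>p. \<integral>h. F p h \<partial>M) has_derivative L) (at p0)"
  unfolding has_derivative_iff_norm using bl by simp
 then show ?thesis unfolding L_def D_def .
qed

text \<open>The functions that need a majorant if the parameter integral is to be smooth:
  \<open>f\<close> and all its iterated derivatives in the parameter.\<close>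

inductive_set pdc :: "('a::euclidean_space \<times> 'b::euclidean_space => real) => ('a \<times> 'b => real) set"
 for f where
 base: "f \<in> pdc f"
| step: "g \<in> pdc f ==> b \<in> Basis ==> ddir (b, 0) g \<in> pdc f"

lemma pdc_trans: "g \<in> pdc f ==> k \<in> pdc g ==> k \<in> pdc f"
 by (rotate_tac 1, induction rule: pdc.induct) (auto intro: pdc.step)

lemma pdc_smooth: "g \<in> pdc f ==> smooth_on W f ==> smooth_on W g"
 by (induction rule: pdc.induct) (auto intro: smooth_onD(3))

text \<open>Conditions under which \<open>p \<mapsto> \<integral> f (p, h) c h dh\<close> is smooth
  on \<open>U\<close>. The weight \<open>c\<close> is kept apart from \<open>f\<close> because it is
  only measurable and because \<open>f\<close> has to be smooth only where \<open>c\<close> is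
  nonzero: singularities can be hidden behind zeros of the weight.\<close>

definition good_kernel :: "'a::euclidean_space set => ('b::euclidean_space => real) => ('a \<times> 'b) set => ('a \<times> 'b => real) => bool" where
 "good_kernel U c W f \<longleftrightarrow> open U \<and> open W \<and> smooth_on W f \<and> (\<forall>p\<in>U. \<forall>h. c h \<noteq> 0 \<longrightarrow> (p, h) \<in> W)
  \<and> c \<in> borel_measurable borel
  \<and> (\<forall>g\<in>pdc f. \<forall>p0\<in>U. \<exists>e>0. \<exists>B. integrable lborel B \<and> (\<forall>p\<in>ball p0 e. \<forall>h. \<bar>g (p, h) * c h\<bar> \<le> B h))"

lemma good_kernelD:
 assumes "good_kernel U c W f"
 shows "open U" "open W" "smooth_on W f" "p \<in> U ==> c h \<noteq> 0 ==> (p, h) \<in> W" "c \<in> borel_measurable borel"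
  "g \<in> pdc f ==> p0 \<in> U ==> \<exists>e>0. \<exists>B. integrable lborel B \<and> (\<forall>p\<in>ball p0 e. \<forall>h. \<bar>g (p, h) * c h\<bar> \<le> B h)"
 using assms by (auto simp: good_kernel_def)

lemma good_kernel_pdc: "good_kernel U c W f ==> g \<in> pdc f ==> good_kernel U c W g"
 unfolding good_kernel_def using pdc_smooth pdc_trans by blast

lemma good_kernel_step: "good_kernel U c W f ==> b \<in> Basis ==> good_kernel U c W (ddir (b, 0) f)"
 by (rule good_kernel_pdc) (auto intro: pdc.intros)

lemma ddir_slice:
 fixes f :: "'a::euclidean_space \<times> 'b::euclidean_space => real"
 assumes "f differentiable (at (p, h))"
 shows "(\<lambda>p. f (p, h)) differentiable (at p)" "ddir v (\<lambda>p. f (p, h)) p = ddir (v, 0) f (p, h)"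
proof -
 have 1: "((\<lambda>p. (p, h)) has_derivative (\<lambda>v. (v, 0))) (at p)"
  by (intro has_derivative_Pair has_derivative_ident has_derivative_const)
 have "((\<lambda>p. f (p, h)) has_derivative (\<lambda>v. frechet_derivative f (at (p, h)) (v, 0))) (at p)"
  by (rule has_derivative_compose[OF 1 has_derivative_frechet[OF assms]])
 then show "(\<lambda>p. f (p, h)) differentiable (at p)" "ddir v (\<lambda>p. f (p, h)) p = ddir (v, 0) f (p, h)"
  by (auto simp: differentiable_def frechet_derivative_eqI)
qed

lemma good_kernel_integrable:
 assumes k: "good_kernel U c W f" and p: "p \<in> U"
 shows "integrable lborel (\<lambda>h. f (p, h) * c h)"
proof -
 obtain e B where e: "e > 0" "integrable lborel B" "\<forall>p\<in>ball p e. \<forall>h. \<bar>f (p, h) * c h\<bar> \<le> B h"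
  using good_kernelD(6)[OF k pdc.base p] by blast
 define S where "S = {h. (p, h) \<in> W}"
 note W = good_kernelD(2,3)[OF k]
 have S: "open S" using open_vimage[OF W(1), of "\<lambda>h. (p, h)"]
  by (simp add: S_def vimage_def continuous_on_Pair)
 have "continuous_on S (\<lambda>h. f (p, h))"
  by (rule continuous_on_compose2[OF smooth_onD(4)[OF W(2)]]) (auto simp: S_def intro!: continuous_intros)
 then have m: "(\<lambda>h. indicator S h *\<^sub>R f (p, h)) \<in> borel_measurable borel"
  using S by (intro borel_measurable_continuous_on_indicator) auto
 have eq: "f (p, h) * c h = (indicator S h *\<^sub>R f (p, h)) * c h" for h
  using k p by (cases "c h = 0") (auto simp: S_def indicator_def dest: good_kernelD(4))
 have "(\<lambda>h. f (p, h) * c h) \<in> borel_measurable borel"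
  unfolding eq using m k by (intro borel_measurable_times) (auto dest: good_kernelD(5))
 then show ?thesis
 proof (intro Bochner_Integration.integrable_bound[OF e(2)])
  have "norm (f (p, h) * c h) \<le> norm (B h)" for h
   using e(3)[rule_format, of p h] e(1) by simp
  then show "AE h in lborel. norm (f (p, h) * c h) \<le> norm (B h)" by simp
 qed simp
qed

lemma good_kernel_has_derivative:
 assumes k: "good_kernel U c W f" and p0: "p0 \<in> U"
 shows "((\<lambda>p. LINT h|lborel. f (p, h) * c h) has_derivative
   (\<lambda>v. \<Sum>b\<in>Basis. (v \<bullet> b) * (LINT h|lborel. ddir (b, 0) f (p0, h) * c h))) (at p0)"
proof -
 note W = good_kernelD(2,3,1)[OF k]
 have "\<exists>e B. e > 0 \<and> integrable lborel B \<and> (\<forall>p\<in>ball p0 e. \<forall>h. \<bar>ddir (b, 0) f (p, h) * c h\<bar> \<le> B h)" if "b \<in> Basis" for b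
  using good_kernelD(6)[OF k pdc.step[OF pdc.base that] p0] by blast
 then have "\<forall>b\<in>Basis. \<exists>e B. e > 0 \<and> integrable lborel B \<and> (\<forall>p\<in>ball p0 e. \<forall>h. \<bar>ddir (b, 0) f (p, h) * c h\<bar> \<le> B h)"
  by blast
 from bchoice[OF this] obtain E where "\<forall>b\<in>Basis. \<exists>B. E b > 0 \<and> integrable lborel B \<and> (\<forall>p\<in>ball p0 (E b). \<forall>h. \<bar>ddir (b, 0) f (p, h) * c h\<bar> \<le> B h)" ..
 from bchoice[OF this] obtain D where "\<forall>b\<in>Basis. E b > 0 \<and> integrable lborel (D b) \<and> (\<forall>p\<in>ball p0 (E b). \<forall>h. \<bar>ddir (b, 0) f (p, h) * c h\<bar> \<le> D b h)" ..
 then have ED: "E b > 0 \<and> integrable lborel (D b) \<and> (\<forall>p\<in>ball p0 (E b). \<forall>h. \<bar>ddir (b, 0) f (p, h) * c h\<bar> \<le> D b h)"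
  if "b \<in> Basis" for b using that by blast
 obtain r where r: "r > 0" "ball p0 r \<subseteq> U" using W(3) p0 open_contains_ball by blast
 \<comment> \<open>The majorants come separately for each basis direction; there are finitely many,
   so the smallest radius and the sum of the majorants serve all of them.\<close>
 define e where "e = Min (insert r (E ` Basis))"
 have "e > 0" unfolding e_def using ED r(1) by (subst Min_gr_iff) auto
 moreover have "e \<le> r" unfolding e_def by (rule Min_le) auto
 moreover have "e \<le> E b" if "b \<in> Basis" for b unfolding e_def by (rule Min_le) (use that in auto)
 ultimately have e: "e > 0" "e \<le> r" "\<And>b. b \<in> Basis ==> e \<le> E b" by blast+
 have U: "p \<in> U" if "p \<in> ball p0 e" for p using that e(2) r(2) by auto
 have sl: "(\<lambda>p. f (p, h) * c h) differentiable (at p)" "ddir v (\<lambda>p. f (p, h) * c h) p = ddir (v, 0) f (p, h) * c h"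
  if "p \<in> U" for p h v
 proof -
  show "(\<lambda>p. f (p, h) * c h) differentiable (at p)"
  proof (cases "c h = 0")
   case False
   then have "(p, h) \<in> W" using good_kernelD(4)[OF k that] by blast
   then show ?thesis using ddir_slice(1)[OF smooth_onD(2)[OF W(2)]] by (intro differentiable_mult) auto
  qed simp
  show "ddir v (\<lambda>p. f (p, h) * c h) p = ddir (v, 0) f (p, h) * c h"
  proof (cases "c h = 0")
   case False
   then have *: "(p, h) \<in> W" using good_kernelD(4)[OF k that] by blast
   show ?thesis
    using frechet_derivative_eqI[OF has_derivative_mult_left[OF has_derivative_frechet[OF ddir_slice(1)[OF smooth_onD(2)[OF W(2) *]]], of "c h"]]
     ddir_slice(2)[OF smooth_onD(2)[OF W(2) *], of v] by simp
  qed simp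
 qed
 have "((\<lambda>p. LINT h|lborel. f (p, h) * c h) has_derivative
   (\<lambda>v. \<Sum>b\<in>Basis. (v \<bullet> b) * (LINT h|lborel. ddir b (\<lambda>p. f (p, h) * c h) p0))) (at p0)"
 proof (rule has_derivative_integral_dominated[OF e(1), where B="\<lambda>h. \<Sum>b\<in>Basis. D b h"])
  show "integrable lborel (\<lambda>h. f (p, h) * c h)" if "p \<in> ball p0 e" for p
   by (rule good_kernel_integrable[OF k U[OF that]])
  show "(\<lambda>p. f (p, h) * c h) differentiable (at p)" if "p \<in> ball p0 e" for p h
   by (rule sl(1)[OF U[OF that]])
  show "(\<lambda>h. ddir b (\<lambda>p. f (p, h) * c h) p0) \<in> borel_measurable lborel" if "b \<in> Basis" for b
   using borel_measurable_integrable[OF good_kernel_integrable[OF good_kernel_step[OF k that] p0]]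
   by (simp add: sl(2)[OF p0])
  show "integrable lborel (\<lambda>h. \<Sum>b\<in>Basis. D b h)" using ED by (intro Bochner_Integration.integrable_sum) auto
  show "\<bar>ddir b (\<lambda>p. f (p, h) * c h) p\<bar> \<le> (\<Sum>b\<in>Basis. D b h)" if b: "b \<in> Basis" and p: "p \<in> ball p0 e" for b p h
  proof -
   have *: "\<bar>ddir (b, 0) f (p, h) * c h\<bar> \<le> D b h" if "b \<in> Basis" for b
    using ED[OF that] p e(3)[OF that] by auto
   have "D b h \<le> (\<Sum>b\<in>Basis. D b h)"
    by (rule member_le_sum[OF b order_trans[OF abs_ge_zero *]]) auto
   then show ?thesis using *[OF b] by (simp add: sl(2)[OF U[OF p]])
  qed
 qed
 then show ?thesis by (simp add: sl(2)[OF p0])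
qed

lemma good_kernel_ddir:
 assumes k: "good_kernel U c W f" and p: "p \<in> U"
 shows "ddir v (\<lambda>p. LINT h|lborel. f (p, h) * c h) p = (\<Sum>b\<in>Basis. (v \<bullet> b) * (LINT h|lborel. ddir (b, 0) f (p, h) * c h))"
  "b \<in> Basis ==> ddir b (\<lambda>p. LINT h|lborel. f (p, h) * c h) p = (LINT h|lborel. ddir (b, 0) f (p, h) * c h)"
proof -
 show *: "ddir v (\<lambda>p. LINT h|lborel. f (p, h) * c h) p = (\<Sum>b\<in>Basis. (v \<bullet> b) * (LINT h|lborel. ddir (b, 0) f (p, h) * c h))" for v
  by (simp add: frechet_derivative_eqI[OF good_kernel_has_derivative[OF assms]])
 show "b \<in> Basis ==> ddir b (\<lambda>p. LINT h|lborel. f (p, h) * c h) p = (LINT h|lborel. ddir (b, 0) f (p, h) * c h)"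
  unfolding * by (simp add: inner_Basis if_distrib[of "\<lambda>x. x * _"] sum.delta cong: if_cong)
qed

lemma good_kernel_smooth:
 assumes "good_kernel U c W f"
 shows "smooth_on U (\<lambda>p. LINT h|lborel. f (p, h) * c h)"
 unfolding smooth_on_def
proof
 fix k
 note U = good_kernelD(1)[OF assms]
 show "C_k_on k U (\<lambda>p. LINT h|lborel. f (p, h) * c h)"
  using assms
 proof (induction k arbitrary: f)
  case 0
  have "(\<lambda>p. LINT h|lborel. f (p, h) * c h) differentiable (at p)" if "p \<in> U" for p
   using good_kernel_has_derivative[OF 0 that] by (auto simp: differentiable_def)
  then show ?case
   by (simp add: continuous_on_eq_continuous_within differentiable_imp_continuous_within differentiable_at_withinI)
 next
  case (Suc k)
  have "C_k_on k U (ddir v (\<lambda>p. LINT h|lborel. f (p, h) * c h))" for v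
  proof (rule C_k_on_cong[OF U])
   show "C_k_on k U (\<lambda>p. \<Sum>b\<in>Basis. (v \<bullet> b) * (LINT h|lborel. ddir (b, 0) f (p, h) * c h))"
    by (intro C_k_on_sum C_k_on_cmult U Suc.IH good_kernel_step[OF Suc.prems])
  qed (simp add: good_kernel_ddir(1)[OF Suc.prems])
  then show ?case using good_kernel_has_derivative[OF Suc.prems]
   by (auto simp: C_k_on.simps(2) differentiable_def)
 qed
qed

lemma ddir_ddir_basis:
 fixes u :: "'a::euclidean_space => real"
 assumes "open U" "C_k_on 2 U u" "z \<in> U"
 shows "ddir v (ddir v u) z = (\<Sum>b\<in>Basis. (v \<bullet> b) * (\<Sum>b'\<in>Basis. (v \<bullet> b') * ddir b' (ddir b u) z))"
proof -
 have C: "C_k_on (Suc (Suc 0)) U u" using assms(2) by (simp add: numeral_2_eq_2)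
 note d2 = C_k_on_SucE(1)[OF C_k_on_SucE(2)[OF C] assms(3)]
 have "((\<lambda>y. \<Sum>b\<in>Basis. (v \<bullet> b) * ddir b u y) has_derivative
    (\<lambda>w. \<Sum>b\<in>Basis. (v \<bullet> b) * ddir w (ddir b u) z)) (at z)"
  by (intro has_derivative_sum has_derivative_mult_right has_derivative_frechet d2)
 then have "((ddir v u) has_derivative (\<lambda>w. \<Sum>b\<in>Basis. (v \<bullet> b) * ddir w (ddir b u) z)) (at z)"
  by (rule has_derivative_transform_within_open[OF _ assms(1,3)])
   (rule frechet_derivative_basis[OF C_k_on_SucE(1)[OF C], symmetric])
 then show ?thesis
  using frechet_derivative_basis[OF d2, of _ v] by (simp add: frechet_derivative_eqI)
qed

lemma good_kernel_heat_op:
 fixes f :: "(real \<times> 'a::euclidean_space) \<times> 'b::euclidean_space => real"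
 assumes k: "good_kernel U c W f" and p: "p \<in> U" and X: "\<forall>j<m. smooth_map (Xs j)"
 shows "heat_op e m Xs (\<lambda>p. LINT h|lborel. f (p, h) * c h) p = (LINT h|lborel. heat_op e m Xs (\<lambda>p. f (p, h)) p * c h)"
proof -
 note U = good_kernelD(1-3)[OF k]
 define I where "I g q = (LINT h|lborel. g (q, h) * c h)" for g :: "(real \<times> 'a) \<times> 'b => real" and q
 have C2: "C_k_on 2 U (I f)" unfolding I_def by (rule smooth_onD(1)[OF good_kernel_smooth[OF k]])
 have k1: "good_kernel U c W (ddir (b, 0) f)" if "b \<in> Basis" for b by (rule good_kernel_step[OF k that])
 have k2: "good_kernel U c W (ddir (b', 0) (ddir (b, 0) f))" if "b \<in> Basis" "b' \<in> Basis" for b b'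
  by (rule good_kernel_step[OF k1[OF that(1)] that(2)])
 have i1: "integrable lborel (\<lambda>h. ddir (b, 0) f (p, h) * c h)" if "b \<in> Basis" for b
  by (rule good_kernel_integrable[OF k1[OF that] p])
 have i2: "integrable lborel (\<lambda>h. ddir (b', 0) (ddir (b, 0) f) (p, h) * c h)" if "b \<in> Basis" "b' \<in> Basis" for b b'
  by (rule good_kernel_integrable[OF k2[OF that] p])
 have d1: "ddir v (I f) p = (LINT h|lborel. (\<Sum>b\<in>Basis. (v \<bullet> b) * (ddir (b, 0) f (p, h) * c h)))" for v
  unfolding I_def[abs_def] good_kernel_ddir(1)[OF k p]
  by (subst Bochner_Integration.integral_sum) (auto intro!: integrable_mult_right i1)
 have id1: "integrable lborel (\<lambda>h. (\<Sum>b\<in>Basis. (v \<bullet> b) * (ddir (b, 0) f (p, h) * c h)))" for v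
  by (auto intro!: integrable_mult_right i1)
 have d2: "ddir v (ddir v (I f)) p = (LINT h|lborel. (\<Sum>b\<in>Basis. (v \<bullet> b) * (\<Sum>b'\<in>Basis. (v \<bullet> b') * (ddir (b', 0) (ddir (b, 0) f) (p, h) * c h))))" for v
 proof -
  have "ddir b' (ddir b (I f)) p = (LINT h|lborel. ddir (b', 0) (ddir (b, 0) f) (p, h) * c h)"
   if "b \<in> Basis" "b' \<in> Basis" for b b'
  proof -
   have "ddir b' (ddir b (I f)) p = ddir b' (I (ddir (b, 0) f)) p"
    by (subst frechet_derivative_cong_open[OF U(1) p]) (simp_all add: I_def[abs_def] good_kernel_ddir(2)[OF k _ that(1)])
   then show ?thesis by (simp add: I_def[abs_def] good_kernel_ddir(2)[OF k1[OF that(1)] p that(2)])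
  qed
  then have "ddir v (ddir v (I f)) p = (\<Sum>b\<in>Basis. (v \<bullet> b) * (\<Sum>b'\<in>Basis. (v \<bullet> b') * (LINT h|lborel. ddir (b', 0) (ddir (b, 0) f) (p, h) * c h)))"
   by (simp add: ddir_ddir_basis[OF U(1) C2 p])
  also have "\<dots> = (LINT h|lborel. (\<Sum>b\<in>Basis. (v \<bullet> b) * (\<Sum>b'\<in>Basis. (v \<bullet> b') * (ddir (b', 0) (ddir (b, 0) f) (p, h) * c h))))"
   using i2 by (simp add: Bochner_Integration.integral_sum)
  finally show ?thesis .
 qed
 have id2: "integrable lborel (\<lambda>h. (\<Sum>b\<in>Basis. (v \<bullet> b) * (\<Sum>b'\<in>Basis. (v \<bullet> b') * (ddir (b', 0) (ddir (b, 0) f) (p, h) * c h))))" for v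
  by (auto intro!: integrable_mult_right i2)
 define x where "x = snd p"
 have pt: "heat_op e m Xs (\<lambda>p. f (p, h)) p * c h =
   (\<Sum>j<m. \<Sum>b\<in>Basis. ((0, Xs j x) \<bullet> b) * (\<Sum>b'\<in>Basis. ((0, Xs j x) \<bullet> b') * (ddir (b', 0) (ddir (b, 0) f) (p, h) * c h)))
   + (\<Sum>b\<in>Basis. ((0, drift m Xs x) \<bullet> b) * (ddir (b, 0) f (p, h) * c h))
   - e * (\<Sum>b\<in>Basis. ((1, 0) \<bullet> b) * (ddir (b, 0) f (p, h) * c h))" for h
 proof (cases "c h = 0")
  case False
  define V where "V = {q. (q, h) \<in> W}"
  have ph: "(p, h) \<in> W" using good_kernelD(4)[OF k p False] .
  have V: "open V" "p \<in> V" using open_vimage[OF U(2), of "\<lambda>q. (q, h)"] ph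
   by (simp_all add: V_def vimage_def continuous_on_Pair)
  have sV: "smooth_on V (\<lambda>q. f (q, h))"
   by (rule smooth_on_compose_map[OF V(1) _ U(3)]) (auto simp: V_def intro: smooth_map_Pair smooth_map_const)
  have e1: "ddir v (\<lambda>q. f (q, h)) q = ddir (v, 0) f (q, h)" if "q \<in> V" for v q
   by (rule ddir_slice(2)[OF smooth_onD(2)[OF U(3)]]) (use that in \<open>simp add: V_def\<close>)
  have e2: "ddir b' (ddir b (\<lambda>q. f (q, h))) p = ddir (b', 0) (ddir (b, 0) f) (p, h)" for b b'
  proof -
   have "ddir b' (ddir b (\<lambda>q. f (q, h))) p = ddir b' (\<lambda>q. ddir (b, 0) f (q, h)) p"
    by (subst frechet_derivative_cong_open[OF V]) (use e1 in auto)
   also have "\<dots> = ddir (b', 0) (ddir (b, 0) f) (p, h)"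
    by (rule ddir_slice(2)[OF smooth_onD(2)[OF smooth_onD(3)[OF U(3)] ph]])
   finally show ?thesis .
  qed
  have b1: "ddir v (\<lambda>q. f (q, h)) p = (\<Sum>b\<in>Basis. (v \<bullet> b) * ddir (b, 0) f (p, h))" for v
   by (subst frechet_derivative_basis[OF smooth_onD(2)[OF sV V(2)]]) (simp only: e1[OF V(2)])
  have b2: "ddir v (ddir v (\<lambda>q. f (q, h))) p
    = (\<Sum>b\<in>Basis. (v \<bullet> b) * (\<Sum>b'\<in>Basis. (v \<bullet> b') * ddir (b', 0) (ddir (b, 0) f) (p, h)))" for v
   using ddir_ddir_basis[OF V(1) smooth_onD(1)[OF sV] V(2), of v] by (simp only: e2)
  have "heat_op e m Xs (\<lambda>p. f (p, h)) p =
    (\<Sum>j<m. \<Sum>b\<in>Basis. ((0, Xs j x) \<bullet> b) * (\<Sum>b'\<in>Basis. ((0, Xs j x) \<bullet> b') * ddir (b', 0) (ddir (b, 0) f) (p, h)))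
    + (\<Sum>b\<in>Basis. ((0, drift m Xs x) \<bullet> b) * ddir (b, 0) f (p, h))
    - e * (\<Sum>b\<in>Basis. ((1, 0) \<bullet> b) * ddir (b, 0) f (p, h))"
   using heat_op_expand[OF V smooth_onD(1)[OF sV] X, of e] by (simp only: b1 b2 x_def)
  then show ?thesis
   by (simp only: left_diff_distrib distrib_right sum_distrib_right mult.assoc)
 qed simp
 show ?thesis
  unfolding I_def[symmetric] heat_op_expand[OF U(1) p C2 X] d1 d2 pt x_def[symmetric]
  using id1 id2 by (simp add: Bochner_Integration.integral_sum)
qed

section \<open>Change of variables for homogeneous families of maps\<close>

text \<open>The change of variables theorem of the library is stated for \<open>real^'k\<close> with a
 well-ordered index type; the type of basis vectors provides such an index type for every Euclidean space.\<close>

typedef (overloaded) 'a bidx = "Basis :: 'a::euclidean_space set"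
 using nonempty_Basis by blast

instance bidx :: (euclidean_space) finite
proof
 have "(UNIV :: 'a bidx set) = Abs_bidx ` Basis"
  using Rep_bidx Rep_bidx_inverse by (metis UNIV_eq_I imageI)
 then show "finite (UNIV :: 'a bidx set)" by (metis finite_Basis finite_imageI)
qed

instantiation bidx :: (euclidean_space) wellorder
begin

definition "i \<le> j \<longleftrightarrow> to_nat_on Basis (Rep_bidx i) \<le> to_nat_on Basis (Rep_bidx j)"
definition "i < j \<longleftrightarrow> to_nat_on Basis (Rep_bidx i) < to_nat_on Basis (Rep_bidx j)"

instance
proof
 fix i j k :: "'a bidx"
 show "i < j \<longleftrightarrow> i \<le> j \<and> \<not> j \<le> i" by (auto simp: less_eq_bidx_def less_bidx_def)
 show "i \<le> i" by (simp add: less_eq_bidx_def)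
 show "i \<le> j ==> j \<le> k ==> i \<le> k" by (simp add: less_eq_bidx_def)
 have c: "countable (Basis :: 'a set)" by (simp add: countable_finite)
 show "i = j" if "i \<le> j" "j \<le> i"
 proof -
  have "to_nat_on Basis (Rep_bidx i) = to_nat_on Basis (Rep_bidx j)"
   using that by (simp add: less_eq_bidx_def)
  then have "Rep_bidx i = Rep_bidx j"
   by (rule inj_onD[OF inj_on_to_nat_on[OF c] _ Rep_bidx Rep_bidx])
  then show ?thesis by (simp add: Rep_bidx_inject)
 qed
 show "i \<le> j \<or> j \<le> i" by (auto simp: less_eq_bidx_def)
next
 fix P :: "'a bidx => bool" and a :: "'a bidx"
 assume "\<And>i. (\<And>j. j < i ==> P j) ==> P i"
 then show "P a"
  by (rule measure_induct_rule[of "\<lambda>i. to_nat_on Basis (Rep_bidx i)"]) (simp add: less_bidx_def)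
qed

end

definition of_coord :: "real ^ ('a::euclidean_space) bidx => 'a" where
 "of_coord v = (\<Sum>i\<in>UNIV. v $ i *\<^sub>R Rep_bidx i)"

definition to_coord :: "'a::euclidean_space => real ^ 'a bidx" where
 "to_coord x = (\<chi> i. x \<bullet> Rep_bidx i)"

lemma sum_bidx: "(\<Sum>i\<in>UNIV. f (Rep_bidx i)) = (\<Sum>b\<in>Basis. f b)"
 by (rule sum.reindex_bij_betw) (auto simp: bij_betw_def inj_on_def Rep_bidx_inject intro: Rep_bidx elim: Rep_bidx_cases)

lemma of_to_coord [simp]: "of_coord (to_coord x) = x"
 using sum_bidx[of "\<lambda>b. (x \<bullet> b) *\<^sub>R b"] by (simp add: of_coord_def to_coord_def euclidean_representation)

lemma to_of_coord [simp]: "to_coord (of_coord v) = v"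
 by (simp add: of_coord_def to_coord_def vec_eq_iff inner_sum_left inner_Basis Rep_bidx Rep_bidx_inject
   if_distrib sum.delta cong: if_cong)

lemma bounded_linear_coord:
 "bounded_linear (of_coord :: real ^ ('a::euclidean_space) bidx => 'a)"
 "bounded_linear (to_coord :: 'a::euclidean_space => real ^ 'a bidx)"
proof -
 have "linear (of_coord :: real ^ 'a bidx => 'a)"
  by (simp add: linear_iff of_coord_def scaleR_left_distrib sum.distrib scaleR_sum_right)
 moreover have "linear (to_coord :: 'a => real ^ 'a bidx)"
  by (simp add: linear_iff to_coord_def vec_eq_iff inner_add_left)
 ultimately show "bounded_linear (of_coord :: real ^ 'a bidx => 'a)" "bounded_linear (to_coord :: 'a => real ^ 'a bidx)"
  by (simp_all add: linear_conv_bounded_linear)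
qed

lemma measurable_coord [measurable]: "of_coord \<in> borel \<rightarrow>\<^sub>M borel" "to_coord \<in> borel \<rightarrow>\<^sub>M borel"
 using bounded_linear_coord[THEN linear_continuous_on] by (auto intro!: borel_measurable_continuous_onI)

lemma distr_of_coord: "distr lborel borel of_coord = (lborel :: 'a::euclidean_space measure)"
proof (rule lborel_eqI[symmetric])
 fix l u :: 'a assume lu: "\<And>b. b \<in> Basis ==> l \<bullet> b \<le> u \<bullet> b"
 have co: "of_coord v \<bullet> b = v $ Abs_bidx b" if "b \<in> Basis" for v and b :: 'a
  using arg_cong[where f="\<lambda>w. w $ Abs_bidx b", OF to_of_coord[of v]] that
  by (simp add: to_coord_def Abs_bidx_inverse)
 have "of_coord -` box l u = box (to_coord l) (to_coord u)"
 proof (rule set_eqI)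
  fix v
  have "v \<in> of_coord -` box l u \<longleftrightarrow> (\<forall>i. to_coord l $ i < v $ i \<and> v $ i < to_coord u $ i)"
  proof
   assume v: "v \<in> of_coord -` box l u"
   show "\<forall>i. to_coord l $ i < v $ i \<and> v $ i < to_coord u $ i"
   proof
    fix i
    show "to_coord l $ i < v $ i \<and> v $ i < to_coord u $ i"
     using v co[OF Rep_bidx[of i], of v] Rep_bidx[of i] by (auto simp: mem_box to_coord_def Rep_bidx_inverse)
   qed
  next
   assume v: "\<forall>i. to_coord l $ i < v $ i \<and> v $ i < to_coord u $ i"
   show "v \<in> of_coord -` box l u"
   proof (simp add: mem_box, intro ballI)
    fix b :: 'a assume "b \<in> Basis"
    then show "l \<bullet> b < of_coord v \<bullet> b \<and> of_coord v \<bullet> b < u \<bullet> b"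
     using v[rule_format, of "Abs_bidx b"] by (simp add: co to_coord_def Abs_bidx_inverse)
   qed
  qed
  then show "v \<in> of_coord -` box l u \<longleftrightarrow> v \<in> box (to_coord l) (to_coord u)" by (simp add: mem_box_cart)
 qed
 then have "emeasure (distr lborel borel of_coord) (box l u) = emeasure lborel (box (to_coord l) (to_coord u))"
  by (subst emeasure_distr) auto
 also have "\<dots> = (\<Prod>b\<in>Basis. (to_coord u - to_coord l) \<bullet> b)"
  by (rule emeasure_lborel_box) (auto simp: Basis_vec_def inner_axis to_coord_def intro: lu[OF Rep_bidx])
 also have "(\<Prod>b\<in>Basis. (to_coord u - to_coord l) \<bullet> b) = (\<Prod>i\<in>UNIV. (u - l) \<bullet> Rep_bidx i)"
 proof -
  have "(\<Prod>b\<in>Basis. (to_coord u - to_coord l) \<bullet> b) = (\<Prod>b\<in>(\<lambda>i. axis i (1::real)) ` UNIV. (to_coord u - to_coord l) \<bullet> b)"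
   by (rule prod.cong) (auto simp: Basis_vec_def)
  also have "\<dots> = (\<Prod>i\<in>UNIV. (u - l) \<bullet> Rep_bidx i)"
   by (subst prod.reindex) (auto simp: inj_on_def axis_eq_axis inner_axis to_coord_def inner_diff_left)
  finally show ?thesis .
 qed
 also have "\<dots> = (\<Prod>b\<in>Basis. (u - l) \<bullet> b)"
  by (rule prod.reindex_bij_betw) (auto simp: bij_betw_def inj_on_def Rep_bidx_inject intro: Rep_bidx elim: Rep_bidx_cases)
 finally show "emeasure (distr lborel borel of_coord) (box l u) = (\<Prod>b\<in>Basis. (u - l) \<bullet> b)" .
qed simp

definition detL :: "('a::euclidean_space => 'a) => real" where
 "detL L = det (matrix (\<lambda>v. to_coord (L (of_coord v))))"

lemma detL_id: "detL (\<lambda>x. x) = 1"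
 by (simp add: detL_def matrix_id_mat_1[unfolded id_def])

lemma detL_compose:
 assumes "bounded_linear A" "bounded_linear B"
 shows "detL (\<lambda>x. A (B x)) = detL A * detL B"
proof -
 have l: "linear (\<lambda>v. to_coord (L (of_coord v)))" if "bounded_linear L" for L :: "'a => 'a"
  using bounded_linear_compose[OF bounded_linear_coord(2) bounded_linear_compose[OF that bounded_linear_coord(1)]]
  by (simp add: linear_conv_bounded_linear)
 have "(\<lambda>v. to_coord (A (B (of_coord v)))) = (\<lambda>v. to_coord (A (of_coord v))) \<circ> (\<lambda>v. to_coord (B (of_coord v)))"
  by auto
 then have "matrix (\<lambda>v. to_coord (A (B (of_coord v)))) = matrix (\<lambda>v. to_coord (A (of_coord v))) ** matrix (\<lambda>v. to_coord (B (of_coord v)))"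
  using matrix_compose[OF l[OF assms(2)] l[OF assms(1)]] by simp
 then show ?thesis by (simp add: detL_def det_mul)
qed

text \<open>The preimage of a box under \<open>\<Psi>\<close> is its image under
  \<open>\<Phi>\<close>, and the measure of this image is the integral of the absolute Jacobian,
  here 1. Boxes determine Lebesgue measure.\<close>

lemma distr_lborel_det1:
 fixes \<Phi> \<Psi> :: "'a::euclidean_space => 'a"
 assumes d: "\<And>x. (\<Phi> has_derivative \<Phi>' x) (at x)" and det: "\<And>x. \<bar>detL (\<Phi>' x)\<bar> = 1"
  and inv: "\<And>x. \<Psi> (\<Phi> x) = x" "\<And>x. \<Phi> (\<Psi> x) = x" and m: "\<Psi> \<in> borel_measurable borel"
 shows "distr lborel borel \<Psi> = lborel"
proof (rule lborel_eqI[symmetric])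
 fix l u :: 'a assume lu: "\<And>b. b \<in> Basis ==> l \<bullet> b \<le> u \<bullet> b"
 define \<phi> where "\<phi> v = to_coord (\<Phi> (of_coord v))" for v
 define S where "S = (of_coord -` box l u :: (real ^ 'a bidx) set)"
 have S: "S \<in> sets borel" unfolding S_def using measurable_sets[OF measurable_coord(1), of "box l u"] by simp
 have eS: "emeasure lborel (of_coord -` A) = emeasure lborel A" if "A \<in> sets borel" for A :: "'a set"
  using that by (subst (2) distr_of_coord[symmetric], subst emeasure_distr) auto
 have fin: "emeasure lborel S \<noteq> \<infinity>" unfolding S_def using eS[of "box l u"] emeasure_lborel_box_finite[of l u] by auto
 then have Sl: "S \<in> lmeasurable" using S by (auto simp: fmeasurable_def top.not_eq_extremum)
 have d\<phi>: "(\<phi> has_derivative (\<lambda>v. to_coord (\<Phi>' (of_coord x) (of_coord v)))) (at x within S)" for x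
  unfolding \<phi>_def
  by (intro bounded_linear.has_derivative[OF bounded_linear_coord(2)]
    has_derivative_compose[OF bounded_linear_imp_has_derivative[OF bounded_linear_coord(1)] d])
 have inj: "inj_on \<phi> S"
 proof (rule inj_onI)
  fix x y assume "\<phi> x = \<phi> y"
  then have "of_coord (\<phi> x) = of_coord (\<phi> y)" by simp
  then have "\<Phi> (of_coord x) = \<Phi> (of_coord y)" by (simp add: \<phi>_def)
  then have "of_coord x = of_coord y" using inv(1) by metis
  then show "x = y" using to_of_coord by metis
 qed
 have det1: "\<bar>det (matrix (\<lambda>v. to_coord (\<Phi>' (of_coord x) (of_coord v))))\<bar> = 1" for x
  using det[of "of_coord x"] by (simp add: detL_def)
 have i: "(\<lambda>x. \<bar>det (matrix (\<lambda>v. to_coord (\<Phi>' (of_coord x) (of_coord v))))\<bar>) integrable_on S"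
  unfolding det1 using Sl by (simp add: integrable_on_const)
 have SL: "S \<in> sets lebesgue" using S by simp
 have L: "\<phi> ` S \<in> lmeasurable"
  using measurable_differentiable_image_eq[OF SL d\<phi> inj] i by simp
 have M: "measure lebesgue (\<phi> ` S) = measure lebesgue S"
  using measure_differentiable_image_eq[OF SL d\<phi> inj i] unfolding det1 by (simp add: lmeasure_integral[OF Sl])
 have im: "\<phi> ` S = of_coord -` (\<Psi> -` box l u)"
 proof safe
  fix v assume "v \<in> S" then show "\<phi> v \<in> of_coord -` (\<Psi> -` box l u)" by (simp add: S_def \<phi>_def inv)
 next
  fix v assume "\<Psi> (of_coord v) \<in> box l u"
  then have "to_coord (\<Psi> (of_coord v)) \<in> S" "\<phi> (to_coord (\<Psi> (of_coord v))) = v" by (auto simp: S_def \<phi>_def inv)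
  then show "v \<in> \<phi> ` S" by (metis imageI)
 qed
 have P: "\<Psi> -` box l u \<in> sets borel" using measurable_sets[OF m, of "box l u"] by simp
 have "of_coord -` (\<Psi> -` box l u) \<in> sets borel" using measurable_sets[OF measurable_coord(1) P] by simp
 then have b: "\<phi> ` S \<in> sets borel" using im by simp
 have "emeasure (distr lborel borel \<Psi>) (box l u) = emeasure lborel (\<Psi> -` box l u)"
  using m by (subst emeasure_distr) auto
 also have "\<dots> = emeasure lborel (\<phi> ` S)" using eS[OF P] im by simp
 also have "\<dots> = emeasure lebesgue (\<phi> ` S)" using b by (simp add: emeasure_completion)
 also have "\<dots> = emeasure lebesgue S" using M by (simp add: emeasure_eq_measure2[OF L] emeasure_eq_measure2[OF Sl])
 also have "\<dots> = emeasure lborel S" using S by simp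
 also have "\<dots> = emeasure lborel (box l u)" unfolding S_def by (rule eS) simp
 also have "\<dots> = (\<Prod>b\<in>Basis. (u - l) \<bullet> b)" using lu by (rule emeasure_lborel_box)
 finally show "emeasure (distr lborel borel \<Psi>) (box l u) = (\<Prod>b\<in>Basis. (u - l) \<bullet> b)" .
qed simp

lemma continuous_detL:
 fixes L :: "'c::topological_space => 'a::euclidean_space => 'a"
 assumes "\<And>v. continuous_on S (\<lambda>z. L z v)"
 shows "continuous_on S (\<lambda>z. detL (L z))"
 unfolding detL_def det_def matrix_def to_coord_def
 by (auto intro!: continuous_intros assms)

text \<open>The source of every invariance of Lebesgue measure below. Homogeneity makes the Jacobian
  determinant invariant under simultaneous dilation of parameter and point; contracting both to the
  origin shows, by continuity, that it is one constant. At parameter 0 the map is an involution, so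
  the square of the constant is 1. Asking for an involution instead of the identity covers group
  inversion too.\<close>

theorem homog_family_preserves:
 fixes \<Phi> \<Psi> :: "'c::euclidean_space => 'a::euclidean_space => 'a"
 assumes v: "dilation v \<delta>" and w: "dilation w \<epsilon>" and s: "smooth_map (\<lambda>z. \<Phi> (fst z) (snd z))"
  and h: "\<And>l c a. l > 0 ==> \<Phi> (\<delta> l c) (\<epsilon> l a) = \<epsilon> l (\<Phi> c a)"
  and inv: "\<And>c a. \<Psi> c (\<Phi> c a) = a" "\<And>c a. \<Phi> c (\<Psi> c a) = a"
  and m: "\<Psi> c \<in> borel_measurable borel" and inv0: "\<And>a. \<Phi> 0 (\<Phi> 0 a) = a"
 shows "distr lborel borel (\<Psi> c) = lborel"
proof -
 define D where "D z u = frechet_derivative (\<lambda>z. \<Phi> (fst z) (snd z)) (at z) (0, u)" for z u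
 have dD: "(\<Phi> c has_derivative D (c, a)) (at a)" for c a
 proof -
  have "((\<lambda>a. (c, a)) has_derivative (\<lambda>u. (0, u))) (at a)"
   by (intro has_derivative_Pair has_derivative_ident has_derivative_const)
  from has_derivative_compose[OF this has_derivative_frechet[OF smooth_mapD(1)[OF s]]]
  show ?thesis by (simp add: D_def[abs_def])
 qed
 note bD = has_derivative_bounded_linear[OF dD]
 have cD: "continuous_on UNIV (\<lambda>z. detL (D z))"
  by (rule continuous_detL) (simp add: D_def smooth_mapD(2)[OF smooth_map_frechet[OF s]])
 have J: "detL (D (\<delta> l c, \<epsilon> l a)) = detL (D (c, a))" if l: "l > 0" for l c a
 proof -
  note be = dilation_bounded_linear[OF w]
  have "((\<lambda>a. \<Phi> (\<delta> l c) (\<epsilon> l a)) has_derivative (\<lambda>u. D (\<delta> l c, \<epsilon> l a) (\<epsilon> l u))) (at a)"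
   by (rule has_derivative_compose[OF bounded_linear_imp_has_derivative[OF be[OF l]] dD])
  moreover have "((\<lambda>a. \<epsilon> l (\<Phi> c a)) has_derivative (\<lambda>u. \<epsilon> l (D (c, a) u))) (at a)"
   by (rule bounded_linear.has_derivative[OF be[OF l] dD])
  ultimately have "(\<lambda>u. D (\<delta> l c, \<epsilon> l a) (\<epsilon> l u)) = (\<lambda>u. \<epsilon> l (D (c, a) u))"
   using has_derivative_unique h[OF l] by simp
  then have "detL (D (\<delta> l c, \<epsilon> l a)) * detL (\<epsilon> l) = detL (\<epsilon> l) * detL (D (c, a))"
   by (metis detL_compose[OF bD be[OF l]] detL_compose[OF be[OF l] bD])
  \<comment> \<open>The dilation is invertible, so its determinant is nonzero and cancels.\<close>
  moreover have "detL (\<epsilon> l) * detL (\<epsilon> (1 / l)) = 1"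
   using detL_compose[OF be[OF l] be[of "1 / l"]] l detL_id[where 'a='a] dilation_inverse[OF w l] by simp
  ultimately show ?thesis by (metis mult.commute mult_cancel_left mult_zero_left zero_neq_one)
 qed
 have J0: "detL (D (c, a)) = detL (D (0, 0))" for c a
 proof -
  have "((\<lambda>l. (\<delta> (1 / l) c, \<epsilon> (1 / l) a)) \<longlongrightarrow> (0, 0)) at_top"
   by (intro tendsto_Pair dilation_tendsto_0[OF v] dilation_tendsto_0[OF w])
  then have "((\<lambda>l. detL (D (\<delta> (1 / l) c, \<epsilon> (1 / l) a))) \<longlongrightarrow> detL (D (0, 0))) at_top"
   using cD by (intro isCont_tendsto_compose[where g="\<lambda>z. detL (D z)"]) (simp_all add: continuous_on_eq_continuous_at)
  moreover have "\<forall>\<^sub>F l in at_top. detL (D (\<delta> (1 / l) c, \<epsilon> (1 / l) a)) = detL (D (c, a))"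
   using eventually_gt_at_top[of "0::real"] by eventually_elim (simp add: J)
  ultimately have "((\<lambda>l::real. detL (D (c, a))) \<longlongrightarrow> detL (D (0, 0))) at_top"
   by (simp add: tendsto_cong)
  then show ?thesis by (simp add: tendsto_const_iff)
 qed
 have "((\<lambda>a. \<Phi> 0 (\<Phi> 0 a)) has_derivative (\<lambda>u. D (0, \<Phi> 0 0) (D (0, 0) u))) (at 0)"
  by (rule has_derivative_compose[OF dD dD])
 moreover have "((\<lambda>a. \<Phi> 0 (\<Phi> 0 a)) has_derivative (\<lambda>u. u)) (at 0)"
  by (simp add: inv0)
 ultimately have "(\<lambda>u. D (0, \<Phi> 0 0) (D (0, 0) u)) = (\<lambda>u. u)" by (rule has_derivative_unique)
 note eq = this
 have "detL (D (0, \<Phi> 0 0)) * detL (D (0, 0)) = detL (\<lambda>u. D (0, \<Phi> 0 0) (D (0, 0) u))"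
  by (rule detL_compose[OF bD bD, symmetric])
 then have "detL (D (0, \<Phi> 0 0)) * detL (D (0, 0)) = 1" unfolding eq detL_id .
 then have "(detL (D (0, 0)))\<^sup>2 = 1" unfolding J0[of 0 "\<Phi> 0 0"] power2_eq_square .
 then have "\<bar>detL (D (0, 0))\<bar> = 1" by (simp only: abs_square_eq_1)
 then have "\<bar>detL (D (c, a))\<bar> = 1" for c a unfolding J0[of c a] .
 then show ?thesis
  by (intro distr_lborel_det1[OF dD _ inv m]) auto
qed

section \<open>The parabolic maximum principle\<close>

lemma ddir_line:
 fixes u :: "'a::euclidean_space => real"
 assumes "u differentiable (at (z + s *\<^sub>R v))"
 shows "((\<lambda>s. u (z + s *\<^sub>R v)) has_real_derivative ddir v u (z + s *\<^sub>R v)) (at s)"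
proof -
 have 1: "((\<lambda>s. z + s *\<^sub>R v) has_derivative (\<lambda>r. r *\<^sub>R v)) (at s)"
  by (auto intro!: derivative_eq_intros)
 have "((\<lambda>s. u (z + s *\<^sub>R v)) has_derivative (\<lambda>r. frechet_derivative u (at (z + s *\<^sub>R v)) (r *\<^sub>R v))) (at s)"
  by (rule has_derivative_compose[OF 1 has_derivative_frechet[OF assms]])
 then show ?thesis
  unfolding has_field_derivative_def
  by (rule has_derivative_eq_rhs) (simp add: frechet_derivative_linear(1)[OF assms] fun_eq_iff mult.commute)
qed

text \<open>Were the second derivative negative, the first derivative, which is 0 at the minimum,
  would be negative just to the right, and the mean value theorem would give a smaller value
  there.\<close>

lemma second_derivative_at_min:
 fixes u :: "'a::euclidean_space => real"
 assumes W: "open W" "z \<in> W" "C_k_on 2 W u" and e: "e > 0" "\<And>s. \<bar>s\<bar> < e ==> u z \<le> u (z + s *\<^sub>R v)"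
 shows "ddir v u z = 0" "ddir v (ddir v u) z \<ge> 0"
proof -
 have C: "C_k_on (Suc (Suc 0)) W u" using W(3) by (simp add: numeral_2_eq_2)
 define g where "g s = u (z + s *\<^sub>R v)" for s
 define g' where "g' s = ddir v u (z + s *\<^sub>R v)" for s
 have "\<forall>\<^sub>F s in at 0. z + s *\<^sub>R v \<in> W"
  by (rule topological_tendstoD[OF _ W(1)]) (auto intro!: tendsto_eq_intros simp: W(2))
 then obtain d where d: "d > 0" "\<And>s. \<bar>s\<bar> < d ==> z + s *\<^sub>R v \<in> W"
  using W(2) unfolding eventually_at by (auto simp: dist_real_def) (metis add.right_neutral scaleR_zero_left)
 have dg: "(g has_real_derivative g' s) (at s)" if "\<bar>s\<bar> < d" for s
  unfolding g_def g'_def by (rule ddir_line[OF C_k_on_SucE(1)[OF C d(2)[OF that]]])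
 have dg': "(g' has_real_derivative ddir v (ddir v u) z) (at 0)"
  unfolding g'_def using ddir_line[of "ddir v u" z 0 v] C_k_on_SucE(1)[OF C_k_on_SucE(2)[OF C] W(2)] by simp
 have min: "g 0 \<le> g s" if "\<bar>s\<bar> < e" for s using e(2)[OF that] by (simp add: g_def)
 have g'0: "g' 0 = 0"
  by (rule DERIV_local_min[OF dg, of 0 "e"]) (use d(1) e(1) min in auto)
 then show "ddir v u z = 0" by (simp add: g'_def)
 show "ddir v (ddir v u) z \<ge> 0"
 proof (rule ccontr)
  assume "\<not> ?thesis"
  then obtain r where r: "r > 0" "\<And>h. 0 < h ==> h < r ==> g' h < 0"
   using DERIV_neg_dec_right[OF dg'] g'0 by auto
  define s where "s = Min {r, d, e} / 2"
  have s: "0 < s" "s < r" "s < d" "s < e" using r(1) d(1) e(1) by (auto simp: s_def)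
  obtain x where x: "0 < x" "x < s" "g s - g 0 = (s - 0) * g' x"
   using MVT2[of 0 s g g'] dg s by auto
  have "g' x < 0" using r(2) x s by auto
  then have "g s < g 0" using x(3) mult_pos_neg[OF s(1)] by fastforce
  then show False using min[of s] s by auto
 qed
qed

lemma left_derivative_at_min:
 fixes u :: "'a::euclidean_space => real"
 assumes "u differentiable (at z)" and e: "e > 0" "\<And>s. 0 \<le> s ==> s < e ==> u z \<le> u (z - s *\<^sub>R v)"
 shows "ddir v u z \<le> 0"
proof (rule ccontr)
 assume "\<not> ?thesis"
 moreover have "((\<lambda>s. u (z + s *\<^sub>R v)) has_real_derivative ddir v u z) (at 0)"
  using ddir_line[of u z 0 v] assms(1) by simp
 ultimately obtain d where d: "d > 0" "\<And>h. 0 < h ==> h < d ==> u (z + (0 - h) *\<^sub>R v) < u (z + 0 *\<^sub>R v)"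
  using DERIV_pos_inc_left by (metis not_le)
 obtain t where t: "0 < t" "t < d" "t < e" using field_lbound_gt_zero[OF d(1) e(1)] by blast
 show False using d(2)[OF t(1,2)] e(2)[of t] t by simp
qed

text \<open>Adding a small multiple of elapsed time makes the supersolution strict while its minimum
  stays negative. At that minimum the spatial gradient vanishes, the pure second derivatives are
  nonnegative and the time derivative of the perturbed function is at most 0, so
  \<open>heat_op\<close> is positive. The time derivative is compared from the left only, since the
  minimum may lie on the final slice.\<close>

lemma max_principle:
 fixes u :: "real \<times> 'a::euclidean_space => real"
 assumes X: "\<forall>j<m. smooth_map (Xs j)"
  and cont: "continuous_on {z. T0 \<le> fst z \<and> fst z \<le> T1} u"
  and W: "open W" "{z. T0 < fst z \<and> fst z \<le> T1} \<subseteq> W" "C_k_on 2 W u"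
  and sup: "\<And>z. T0 < fst z ==> fst z \<le> T1 ==> heat_op 1 m Xs u z \<le> 0"
  and bot: "\<And>x. u (T0, x) \<ge> 0"
  and far: "\<And>\<epsilon>. \<epsilon> > 0 ==> \<exists>R. \<forall>z. T0 \<le> fst z \<and> fst z \<le> T1 \<and> norm z \<ge> R \<longrightarrow> u z \<ge> - \<epsilon>"
  and z0: "T0 \<le> fst z0" "fst z0 \<le> T1"
 shows "u z0 \<ge> 0"
proof (rule ccontr)
 assume neg: "\<not> ?thesis"
 \<comment> \<open>The depth in thirds: one third pays for the time perturbation and one bounds the
   values far out, so the minimum of \<open>v\<close> still lies strictly below both the far region
   and the initial slice.\<close>
 define \<mu> where "\<mu> = - u z0 / 3"
 have \<mu>: "\<mu> > 0" "u z0 = - 3 * \<mu>" using neg by (auto simp: \<mu>_def)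
 have "fst z0 \<noteq> T0" using bot[of "snd z0"] neg by (metis prod.collapse)
 then have T: "T0 < T1" using z0 by auto
 define \<kappa> where "\<kappa> = \<mu> / (T1 - T0)"
 have \<kappa>: "\<kappa> > 0" using T \<mu> by (simp add: \<kappa>_def)
 define v where "v z = u z + \<kappa> * (fst z - T0)" for z
 have vu: "u z \<le> v z" if "T0 \<le> fst z" for z using that \<kappa> by (simp add: v_def)
 have vz0: "v z0 \<le> - 2 * \<mu>"
 proof -
  have "\<kappa> * (fst z0 - T0) \<le> \<kappa> * (T1 - T0)" using \<kappa> z0 by (intro mult_left_mono) auto
  also have "\<dots> = \<mu>" using T by (simp add: \<kappa>_def)
  finally show ?thesis using \<mu>(2) by (simp add: v_def)
 qed
 obtain R where R: "\<And>z. T0 \<le> fst z ==> fst z \<le> T1 ==> norm z \<ge> R ==> u z \<ge> - \<mu>"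
  using far[OF \<mu>(1)] by blast
 define S where "S = {z :: real \<times> 'a. T0 \<le> fst z \<and> fst z \<le> T1}"
 define K where "K = S \<inter> cball 0 R"
 have "closed S" unfolding S_def
  by (intro closed_Collect_conj closed_Collect_le continuous_intros)
 then have K: "compact K" unfolding K_def by (metis compact_cball closed_Int_compact)
 have z0K: "z0 \<in> K"
  using z0 R[OF z0] vu[OF z0(1)] vz0 \<mu>(1) by (force simp: K_def S_def not_le)
 have "continuous_on K v" unfolding v_def
  using cont by (intro continuous_intros) (auto simp: K_def S_def intro: continuous_on_subset)
 then obtain z1 where z1: "z1 \<in> K" "\<And>z. z \<in> K ==> v z1 \<le> v z"
  using continuous_attains_inf[OF K] z0K by blast
 have v1: "v z1 \<le> - 2 * \<mu>" using z1(2)[OF z0K] vz0 by simp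
 have min: "v z1 \<le> v z" if "z \<in> S" for z
 proof (cases "z \<in> K")
  case False
  then have "u z \<ge> - \<mu>" using that R[of z] by (auto simp: K_def S_def)
  then show ?thesis using v1 \<mu>(1) vu[of z] that by (simp add: S_def)
 qed (rule z1(2))
 have "fst z1 \<noteq> T0" using bot[of "snd z1"] v1 \<mu>(1) by (auto simp: v_def)
 then have t1: "T0 < fst z1" "fst z1 \<le> T1" using z1(1) by (auto simp: K_def S_def)
 then have z1W: "z1 \<in> W" using W(2) by auto
 have C: "C_k_on (Suc (Suc 0)) W u" using W(3) by (simp add: numeral_2_eq_2)
 note du = C_k_on_SucE(1)[OF C z1W]
 have sp: "u z1 \<le> u (z1 + s *\<^sub>R (0, x))" for s x
  using min[of "z1 + s *\<^sub>R (0, x)"] t1 by (simp add: S_def v_def)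
 have s1: "ddir (0, x) u z1 = 0" "ddir (0, x) (ddir (0, x) u) z1 \<ge> 0" for x
  using second_derivative_at_min[OF W(1) z1W W(3), of 1 "(0, x)"] sp by auto
 have "ddir (1, 0) v z1 \<le> 0"
 proof (rule left_derivative_at_min[of _ _ "fst z1 - T0"])
  show "v differentiable (at z1)" unfolding v_def using du
   by (intro differentiable_add differentiable_mult differentiable_diff differentiable_const)
    (auto simp: differentiable_def intro: has_derivative_fst[OF has_derivative_ident])
  show "v z1 \<le> v (z1 - s *\<^sub>R (1, 0))" if "0 \<le> s" "s < fst z1 - T0" for s
   by (rule min) (use that t1 in \<open>simp add: S_def\<close>)
 qed (use t1 in auto)
 moreover have "ddir (1, 0) v z1 = ddir (1, 0) u z1 + \<kappa>"
 proof -
  have "(v has_derivative (\<lambda>h. frechet_derivative u (at z1) h + \<kappa> * fst h)) (at z1)"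
   unfolding v_def by (auto intro!: derivative_eq_intros has_derivative_frechet[OF du])
  then show ?thesis by (simp add: frechet_derivative_eqI)
 qed
 ultimately have "heat_op 1 m Xs u z1 > 0"
  unfolding heat_op_expand[OF W(1) z1W W(3) X] s1(1)
  using \<kappa> sum_nonneg[of "{..<m}" "\<lambda>j. ddir (0, Xs j (snd z1)) (ddir (0, Xs j (snd z1)) u) z1"] s1(2) by auto
 then show False using sup[OF t1] by simp
qed

lemma heat_op_shift:
 fixes u :: "real \<times> 'a::euclidean_space => real"
 assumes "\<forall>j<m. smooth_map (Xs j)" "open W" "z \<in> W" "C_k_on 2 W u"
 shows "heat_op e m Xs (\<lambda>z. a * u z + b) z = a * heat_op e m Xs u z"
proof -
 have "heat_op e m Xs (\<lambda>z. 1) z = 0"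
  using heat_op_expand[of UNIV z "\<lambda>_. 1" m Xs e] assms(1) by (simp add: frechet_derivative_const)
 then show ?thesis
  using heat_op_cmult_add[OF assms(2,3,4) _ assms(1), of "\<lambda>_. 1" e a b] by simp
qed

text \<open>No initial condition is required: decay makes the function nearly nonnegative on every
  sufficiently early slice as well as far out in space, and the added \<open>\<epsilon>\<close>
  absorbs the defect.\<close>

lemma vanishing_supersolution_nonneg:
 fixes u :: "real \<times> 'a::euclidean_space => real"
 assumes X: "\<forall>j<m. smooth_map (Xs j)" and C: "C_k_on 2 UNIV u" and lim: "(u \<longlongrightarrow> 0) at_infinity"
  and sup: "\<And>z. fst z \<le> T ==> heat_op 1 m Xs u z \<le> 0" and z: "fst z \<le> T"
 shows "u z \<ge> 0"
proof (rule field_le_epsilon)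
 fix \<epsilon> :: real assume \<epsilon>: "\<epsilon> > 0"
 obtain R where R: "\<And>z. norm z \<ge> R ==> \<bar>u z\<bar> < \<epsilon>"
  using tendstoD[OF lim \<epsilon>] by (auto simp: eventually_at_infinity)
 \<comment> \<open>So early that every point of this slice has norm at least \<open>R\<close>, and
   not later than \<open>z\<close>.\<close>
 define T0 where "T0 = - (\<bar>R\<bar> + \<bar>fst z\<bar>)"
 have "1 * u z + \<epsilon> \<ge> 0"
 proof (rule max_principle[OF X, where W=UNIV and ?T0.0=T0 and ?T1.0="fst z" and u="\<lambda>z. 1 * u z + \<epsilon>"])
  show C': "C_k_on 2 UNIV (\<lambda>z. 1 * u z + \<epsilon>)" by (intro C_k_on_add C_k_on_cmult C) auto
  show "continuous_on {y. T0 \<le> fst y \<and> fst y \<le> fst z} (\<lambda>z. 1 * u z + \<epsilon>)"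
   using C_k_on_imp_continuous_on[OF C'] continuous_on_subset subset_UNIV by blast
  show "heat_op 1 m Xs (\<lambda>z. 1 * u z + \<epsilon>) y \<le> 0" if "fst y \<le> fst z" for y
   unfolding heat_op_shift[OF X open_UNIV UNIV_I C] using sup[of y] that z by simp
  show "0 \<le> 1 * u (T0, x) + \<epsilon>" for x
  proof -
   have "R \<le> norm (T0, x)" using norm_fst_le[of T0 x] by (simp add: T0_def)
   then show ?thesis using R[of "(T0, x)"] by simp
  qed
  show "\<exists>R. \<forall>y. T0 \<le> fst y \<and> fst y \<le> fst z \<and> R \<le> norm y \<longrightarrow> - e \<le> 1 * u y + \<epsilon>" if "e > 0" for e
   using R that by (intro exI[of _ R]) (smt (verit))
 qed (auto simp: T0_def)
 then show "0 \<le> u z + \<epsilon>" by simp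
qed

lemma vanishing_solution_zero:
 fixes u :: "real \<times> 'a::euclidean_space => real"
 assumes X: "\<forall>j<m. smooth_map (Xs j)" and C: "C_k_on 2 UNIV u" and lim: "(u \<longlongrightarrow> 0) at_infinity"
  and sol: "\<And>z. fst z \<le> T ==> heat_op 1 m Xs u z = 0" and z: "fst z \<le> T"
 shows "u z = 0"
proof -
 have "heat_op 1 m Xs (\<lambda>z. - 1 * u z + 0) y = 0" if "fst y \<le> T" for y
  unfolding heat_op_shift[OF X open_UNIV UNIV_I C] using sol[OF that] by simp
 then have "0 \<le> - u z"
  by (intro vanishing_supersolution_nonneg[OF X _ _ _ z, of "\<lambda>z. - u z"])
   (use tendsto_minus[OF lim] C_k_on_minus[OF open_UNIV C] in auto)
 moreover have "0 \<le> u z"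
  by (rule vanishing_supersolution_nonneg[OF X C lim _ z]) (simp add: sol)
 ultimately show ?thesis by simp
qed

text \<open>A barrier handles data that are merely bounded. The dilated function
  \<open>\<theta>\<close> equals 1 far out, and homogeneity of the fields shrinks its image under
  the operator to at most \<open>\<bar>B\<bar> / R\<^sup>2\<close>; a term linear in time with the
  same coefficient compensates that. The barrier dominates the solution and tends to 0 at each fixed
  point as \<open>R\<close> grows.\<close>

lemma bounded_cauchy_unique:
 fixes v :: "real \<times> 'a::euclidean_space => real"
 assumes X: "\<forall>j<m. smooth_map (Xs j)" and dil: "dilation w \<delta>"
  and hom: "\<forall>j<m. \<forall>l>0. \<forall>x. \<delta> l (Xs j x) = l *\<^sub>R Xs j (\<delta> l x)"
  and cont: "continuous_on {z. 0 \<le> fst z} v" and C: "C_k_on 2 {z. 0 < fst z} v"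
  and sol: "\<And>z. 0 < fst z ==> heat_op 1 m Xs v z = 0" and ini: "\<And>x. v (0, x) = 0"
  and bd: "\<And>z. 0 < fst z ==> \<bar>v z\<bar> \<le> M" and z: "0 \<le> fst z"
 shows "v z = 0"
proof -
 \<comment> \<open>Independent of time, 0 on the unit ball and 1 beyond radius 2. The vanishing near
   the origin makes the barrier disappear in the limit.\<close>
 define \<theta> :: "real \<times> 'a => real" where "\<theta> z = 1 - cutoff 1 (snd z)" for z
 have \<theta>: "smooth_on UNIV \<theta>" unfolding \<theta>_def
  by (intro smooth_on_diff smooth_on_const open_UNIV smooth_on_compose_map[OF _ smooth_map_snd smooth_on_cutoff]) auto
 have \<theta>b: "0 \<le> \<theta> z" "\<theta> z \<le> 1" for z using cutoff_range[of 1 "snd z"] by (auto simp: \<theta>_def)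
 have op: "open {z :: real \<times> 'a. 0 < fst z}" by (intro open_Collect_less continuous_intros)
 define q where "q x = heat_op 1 m Xs \<theta> (0, x)" for x
 have q: "heat_op 1 m Xs \<theta> y = q (snd y)" for y
 proof -
  have "heat_op 1 m Xs (\<lambda>z. \<theta> (1 * fst z + fst y, snd z)) (0, snd y) = 1\<^sup>2 * heat_op 1 m Xs \<theta> (1 * fst (0::real, snd y) + fst y, snd (0::real, snd y))"
   by (rule heat_op_related[OF open_UNIV UNIV_I smooth_onD(1)[OF \<theta>] smooth_map_ident X])
    (auto simp: frechet_derivative_eqI[OF has_derivative_ident])
  moreover have "(\<lambda>z. \<theta> (1 * fst z + fst y, snd z)) = \<theta>" by (simp add: \<theta>_def fun_eq_iff)
  ultimately show ?thesis by (simp add: q_def)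
 qed
 have q0: "q x = 0" if "norm x > 2" for x
 proof -
  have o: "open {y :: real \<times> 'a. norm (snd y) > 2}" by (intro open_Collect_less continuous_intros)
  have "q x = heat_op 1 m Xs (\<lambda>y. 1) (0, x)" unfolding q_def
   by (rule heat_op_cong[OF o]) (use that cutoff_zero[where r=1 and 'a='a] in \<open>auto simp: \<theta>_def\<close>)
  then show ?thesis using heat_op_shift[OF X open_UNIV UNIV_I, of "\<lambda>_. 0" "1" 0 1 "(0,x)"]
    heat_op_expand[of UNIV "(0, x)" "\<lambda>_. 1" m Xs 1] X by (simp add: frechet_derivative_const)
 qed
 have "continuous_on UNIV q" unfolding q_def
  by (rule continuous_on_compose2[OF smooth_onD(4)[OF smooth_on_heat_op[OF open_UNIV \<theta> X]]]) (auto intro!: continuous_intros)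
 then have "compact (q ` cball 0 2)" by (intro compact_continuous_image) (auto intro: continuous_on_subset)
 from bounded_iff[THEN iffD1, OF compact_imp_bounded[OF this]]
 obtain B where "\<forall>y\<in>q ` cball 0 2. norm y \<le> B" ..
 then have B: "\<bar>q x\<bar> \<le> B" if "x \<in> cball 0 2" for x using that by simp
 have qB: "q x \<le> \<bar>B\<bar>" for x using B[of x] q0[of x] by (cases "norm x > 2") auto
 define M' where "M' = \<bar>M\<bar>"
 have M': "M' \<ge> 0" "\<And>z. 0 < fst z ==> \<bar>v z\<bar> \<le> M'" using order_trans[OF bd abs_ge_self] by (auto simp: M'_def)
 \<comment> \<open>The values \<open>c = 1\<close> and \<open>c = - 1\<close> give the two sides of
   the estimate.\<close>
 have key: "c * v z \<ge> - M' * (\<bar>B\<bar> * fst z / R\<^sup>2 + \<theta> (0, \<delta> (1 / R) (snd z)))" if R: "R \<ge> 1" and c: "\<bar>c\<bar> = 1" for R c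
 proof -
  have R0: "1 / R > 0" using R by simp
  define g where "g z = \<theta> ((1 / R)\<^sup>2 * fst z + 0, \<delta> (1 / R) (snd z))" for z
  have sd: "smooth_map (\<delta> (1 / R))" by (rule smooth_map_linear[OF dilation_bounded_linear[OF dil R0]])
  have sg: "smooth_on UNIV g" unfolding g_def
   by (rule smooth_on_compose_map[OF open_UNIV _ \<theta>])
    (auto intro!: smooth_map_Pair smooth_map_compose[OF sd] simp: smooth_map_real
     intro: smooth_on_mult[OF open_UNIV smooth_on_const smooth_on_linear[OF bounded_linear_fst]])
  have hg: "heat_op 1 m Xs g y = (1 / R)\<^sup>2 * q (\<delta> (1 / R) (snd y))" for y
  proof -
   have "heat_op 1 m Xs g y = (1 / R)\<^sup>2 * heat_op 1 m Xs \<theta> ((1 / R)\<^sup>2 * fst y + 0, \<delta> (1 / R) (snd y))"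
    unfolding g_def by (rule heat_op_related[OF open_UNIV UNIV_I smooth_onD(1)[OF \<theta>] sd X])
     (use hom R0 in \<open>auto simp: frechet_derivative_eqI[OF bounded_linear_imp_has_derivative[OF dilation_bounded_linear[OF dil R0]]]\<close>)
   then show ?thesis by (simp add: q)
  qed
  define p :: "real \<times> 'a => real" where "p z = fst z" for z
  have sp: "smooth_on UNIV p" unfolding p_def by (intro smooth_on_linear bounded_linear_fst)
  have hp: "heat_op 1 m Xs p y = - 1" for y
  proof -
   have "frechet_derivative p (at y) = fst" for y unfolding p_def
    by (intro frechet_derivative_eqI has_derivative_fst has_derivative_ident)
   then show ?thesis using heat_op_expand[OF open_UNIV UNIV_I smooth_onD(1)[OF sp] X, of 1 y]
    by (simp add: frechet_derivative_const)
  qed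
  define W where "W z = M' * g z + (M' * \<bar>B\<bar> / R\<^sup>2) * p z" for z
  have sW: "smooth_on UNIV W" unfolding W_def by (intro smooth_on_add smooth_on_mult smooth_on_const sg sp open_UNIV)
  have hW: "heat_op 1 m Xs W y \<le> 0" for y
  proof -
   have "heat_op 1 m Xs W y = M' * ((1 / R)\<^sup>2 * q (\<delta> (1 / R) (snd y))) + (M' * \<bar>B\<bar> / R\<^sup>2) * (- 1)"
    unfolding W_def heat_op_cmult_add[OF open_UNIV UNIV_I smooth_onD(1)[OF sg] smooth_onD(1)[OF sp] X] hg hp ..
   also have "\<dots> = (M' * (1 / R)\<^sup>2) * (q (\<delta> (1 / R) (snd y)) - \<bar>B\<bar>)"
    by (simp add: power_divide right_diff_distrib diff_divide_distrib mult_ac)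
   also have "\<dots> \<le> 0" using M'(1) qB by (intro mult_nonneg_nonpos) auto
   finally show ?thesis .
  qed
  have "0 \<le> 1 * W z + c * v z"
  proof (rule max_principle[OF X, where W="{z. 0 < fst z}" and ?T0.0=0 and ?T1.0="fst z" and u="\<lambda>z. 1 * W z + c * v z"])
   show "continuous_on {y. 0 \<le> fst y \<and> fst y \<le> fst z} (\<lambda>z. 1 * W z + c * v z)"
    using smooth_onD(4)[OF sW] cont by (intro continuous_intros) (auto intro: continuous_on_subset)
   show C2: "C_k_on 2 {z. 0 < fst z} (\<lambda>z. 1 * W z + c * v z)"
    using smooth_onD(1)[OF smooth_on_subset[OF sW subset_UNIV]] by (intro C_k_on_add C_k_on_cmult op C)
   show "heat_op 1 m Xs (\<lambda>z. 1 * W z + c * v z) y \<le> 0" if "0 < fst y" for y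
    using heat_op_cmult_add[OF op _ smooth_onD(1)[OF smooth_on_subset[OF sW subset_UNIV]] C X, of y 1 1 c] that sol[OF that] hW[of y] by simp
   show "0 \<le> 1 * W (0, x) + c * v (0, x)" for x using \<theta>b M'(1) by (simp add: W_def g_def p_def ini)
   show "\<exists>S. \<forall>y. 0 \<le> fst y \<and> fst y \<le> fst z \<and> S \<le> norm y \<longrightarrow> - e \<le> 1 * W y + c * v y" if "e > 0" for e
   proof -
    have "bounded (\<delta> R ` cball 0 2)"
     using dilation_bounded_linear[OF dil, of R] R by (intro bounded_linear_image bounded_cball) auto
    from bounded_iff[THEN iffD1, OF this] obtain S where "\<forall>y\<in>\<delta> R ` cball 0 2. norm y \<le> S" ..
    then have S: "norm (\<delta> R x) \<le> S" if "x \<in> cball 0 2" for x using that by simp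
    have "- e \<le> 1 * W y + c * v y" if y: "0 \<le> fst y" "fst y \<le> fst z" "S + fst z + 1 \<le> norm y" for y
    proof -
     have "norm y \<le> norm (fst y) + norm (snd y)" by (metis norm_Pair_le prod.collapse)
     then have "norm (snd y) > S" using y by auto
     moreover have "snd y = \<delta> R (\<delta> (1 / R) (snd y))" using R by (simp add: dilation_inverse[OF dil])
     ultimately have "\<delta> (1 / R) (snd y) \<notin> cball 0 2" using S by (metis not_le)
     then have "g y = 1" using cutoff_zero[of 1 "\<delta> (1 / R) (snd y)"] by (simp add: g_def \<theta>_def)
     then have "W y \<ge> M'" using y(1) M'(1) by (simp add: W_def p_def)
     moreover have "\<bar>c * v y\<bar> \<le> M'"
     proof (cases "fst y = 0")
      case True
      then have "v y = 0" using ini[of "snd y"] by (metis prod.collapse)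
      then show ?thesis using M'(1) by simp
     qed (use M'(2)[of y] c y(1) in \<open>simp add: abs_mult\<close>)
     ultimately show ?thesis using \<open>e > 0\<close> by linarith
    qed
    then show ?thesis by blast
   qed
  qed (use op z in auto)
  then show ?thesis by (simp add: W_def g_def p_def \<theta>_def algebra_simps)
 qed
 have lim: "((\<lambda>R. - M' * (\<bar>B\<bar> * fst z / R\<^sup>2 + \<theta> (0, \<delta> (1 / R) (snd z)))) \<longlongrightarrow> - M' * (0 + \<theta> (0, 0))) at_top"
 proof (intro tendsto_mult tendsto_add tendsto_const)
  show "((\<lambda>R. \<bar>B\<bar> * fst z / R\<^sup>2) \<longlongrightarrow> 0) at_top"
   by (intro tendsto_divide_0[OF tendsto_const] filterlim_at_top_imp_at_infinity filterlim_pow_at_top filterlim_ident) auto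
  show "((\<lambda>R. \<theta> (0, \<delta> (1 / R) (snd z))) \<longlongrightarrow> \<theta> (0, 0)) at_top"
   by (rule isCont_tendsto_compose[where g=\<theta>])
    (use smooth_onD(4)[OF \<theta>] dilation_tendsto_0[OF dil] in \<open>auto simp: continuous_on_eq_continuous_at intro!: tendsto_Pair\<close>)
 qed
 have "c * v z \<ge> 0" if "\<bar>c\<bar> = 1" for c
 proof -
  have "c * v z \<ge> - M' * (0 + \<theta> (0, 0))"
   by (rule tendsto_le[OF _ tendsto_const lim])
    (auto intro!: eventually_mono[OF eventually_ge_at_top[of "1::real"]] key[OF _ that, simplified])
  then show ?thesis using cutoff_one[of 1 "0::'a"] by (simp add: \<theta>_def)
 qed
 from this[of 1] this[of "-1"] show ?thesis by simp
qed

section \<open>Homogeneous groups\<close>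

lemma preserved_integral:
 fixes T :: "'a::euclidean_space => 'a" and f :: "'a => real" and g :: "'a => ennreal"
 assumes T: "distr lborel borel T = lborel" "T \<in> borel_measurable borel"
 shows "f \<in> borel_measurable borel ==> (LINT x|lborel. f (T x)) = (LINT x|lborel. f x)"
  and "f \<in> borel_measurable borel ==> integrable lborel (\<lambda>x. f (T x)) \<longleftrightarrow> integrable lborel f"
  and "g \<in> borel_measurable borel ==> (\<integral>\<^sup>+x. g (T x) \<partial>lborel) = (\<integral>\<^sup>+x. g x \<partial>lborel)"
proof -
 have T': "T \<in> lborel \<rightarrow>\<^sub>M borel" using T(2) by simp
 show "f \<in> borel_measurable borel ==> (LINT x|lborel. f (T x)) = (LINT x|lborel. f x)"
  using integral_distr[OF T', of f] T(1) by simp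
 show "f \<in> borel_measurable borel ==> integrable lborel (\<lambda>x. f (T x)) \<longleftrightarrow> integrable lborel f"
  using integrable_distr_eq[OF T', of f] T(1) by simp
 show "g \<in> borel_measurable borel ==> (\<integral>\<^sup>+x. g (T x) \<partial>lborel) = (\<integral>\<^sup>+x. g x \<partial>lborel)"
  using nn_integral_distr[OF T', of g] T(1) by simp
qed

lemma lborel_dilation:
 fixes w :: "'a::euclidean_space => real"
 assumes "dilation w \<delta>" "l > 0"
 shows "lborel = density (distr lborel borel (\<delta> l)) (\<lambda>_. ennreal (l powr hdim w))"
proof -
 have eq: "(\<lambda>x. 0 + (\<Sum>j\<in>Basis. (l powr w j * (x \<bullet> j)) *\<^sub>R j)) = \<delta> l"
  by (rule ext, rule dilation_eqI[OF assms, symmetric]) simp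
 have "(\<Prod>j\<in>Basis. \<bar>l powr w j\<bar>) = l powr hdim w"
  using assms(2) by (simp add: hdim_def powr_sum)
 then show ?thesis
  using lborel_affine_euclidean[of "\<lambda>j. l powr w j" 0] eq assms(2) by simp
qed

lemma integral_dilation:
 fixes w :: "'a::euclidean_space => real" and f :: "'a => real"
 assumes d: "dilation w \<delta>" "l > 0" and f: "f \<in> borel_measurable borel"
 shows "(LINT x|lborel. f x) = l powr hdim w * (LINT x|lborel. f (\<delta> l x))"
  and "integrable lborel f \<longleftrightarrow> integrable lborel (\<lambda>x. f (\<delta> l x))"
proof -
 have m: "\<delta> l \<in> lborel \<rightarrow>\<^sub>M borel"
  using linear_continuous_on[OF dilation_bounded_linear[OF d]] by (simp add: borel_measurable_continuous_onI)
 have l: "l powr hdim w > 0" using d(2) by simp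
 have "(LINT x|lborel. f x) = (LINT x|density (distr lborel borel (\<delta> l)) (\<lambda>_. ennreal (l powr hdim w)). f x)"
  using lborel_dilation[OF d] by simp
 also have "\<dots> = (LINT x|distr lborel borel (\<delta> l). l powr hdim w *\<^sub>R f x)"
  by (rule integral_density) (use f in auto)
 also have "\<dots> = l powr hdim w * (LINT x|lborel. f (\<delta> l x))"
  using f m by (subst integral_distr) auto
 finally show "(LINT x|lborel. f x) = l powr hdim w * (LINT x|lborel. f (\<delta> l x))" .
 have "integrable lborel f \<longleftrightarrow> integrable (density (distr lborel borel (\<delta> l)) (\<lambda>_. ennreal (l powr hdim w))) f"
  using lborel_dilation[OF d] by simp
 also have "\<dots> \<longleftrightarrow> integrable (distr lborel borel (\<delta> l)) (\<lambda>x. l powr hdim w *\<^sub>R f x)"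
  by (rule integrable_density) (use f in auto)
 also have "\<dots> \<longleftrightarrow> integrable lborel (\<lambda>x. f (\<delta> l x))"
  using f m l by (subst integrable_distr_eq) auto
 finally show "integrable lborel f \<longleftrightarrow> integrable lborel (\<lambda>x. f (\<delta> l x))" .
qed

text \<open>Abstract in the underlying Euclidean space, so that the group and its product with the
  time axis are both instances.\<close>

locale hgroup =
 fixes mul :: "'g::euclidean_space => 'g => 'g" and ginv :: "'g => 'g"
  and \<delta> :: "real => 'g => 'g" and w :: "'g => real"
 assumes assoc: "mul (mul a b) c = mul a (mul b c)"
  and unit [simp]: "mul 0 a = a" "mul a 0 = a"
  and inverse [simp]: "mul (ginv a) a = 0" "mul a (ginv a) = 0"
  and smooth: "smooth_map (\<lambda>p. mul (fst p) (snd p))" "smooth_map ginv"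
  and dil: "dilation w \<delta>"
  and aut: "l > 0 ==> mul (\<delta> l a) (\<delta> l b) = \<delta> l (mul a b)"
begin

lemma cancel [simp]: "mul (ginv a) (mul a b) = b" "mul a (mul (ginv a) b) = b"
 by (simp_all add: assoc[symmetric])

lemma cancel' [simp]: "mul (mul b a) (ginv a) = b" "mul (mul b (ginv a)) a = b"
 by (simp_all add: assoc)

lemma inv_unique: "mul a b = 0 ==> ginv a = b"
 by (metis cancel(1) unit(2))

lemma inv_simps [simp]: "ginv 0 = 0" "ginv (ginv a) = a" "ginv (mul a b) = mul (ginv b) (ginv a)"
 by (rule inv_unique, simp add: assoc)+

lemma inv_eq_iff: "mul (ginv a) b = 0 \<longleftrightarrow> a = b"
 by (metis cancel(2) inverse(1) unit(2))

lemma inv_dil: "l > 0 ==> ginv (\<delta> l a) = \<delta> l (ginv a)"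
 by (rule inv_unique) (simp add: aut dilation_0[OF dil])

lemma smooth_map_mul: "smooth_map F ==> smooth_map G ==> smooth_map (\<lambda>x. mul (F x) (G x))"
 using smooth_map_compose[OF smooth(1) smooth_map_Pair] by simp

lemma smooth_map_inv: "smooth_map F ==> smooth_map (\<lambda>x. ginv (F x))"
 by (rule smooth_map_compose[OF smooth(2)])

lemma smooth_mul_left: "smooth_map (mul a)" and smooth_mul_right: "smooth_map (\<lambda>x. mul x a)"
 by (intro smooth_map_mul smooth_map_const smooth_map_ident)+

lemma measurable_mul [measurable]: "F \<in> borel_measurable M ==> G \<in> borel_measurable M ==> (\<lambda>x. mul (F x) (G x)) \<in> borel_measurable M"
 using measurable_compose[OF borel_measurable_Pair smooth_mapD(3)[OF smooth(1)], of F M G] by simp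

lemma measurable_inv [measurable]: "F \<in> borel_measurable M ==> (\<lambda>x. ginv (F x)) \<in> borel_measurable M"
 by (rule measurable_compose[OF _ smooth_mapD(3)[OF smooth(2)]])

lemma continuous_on_mul: "continuous_on S F ==> continuous_on S G ==> continuous_on S (\<lambda>x. mul (F x) (G x))"
 using continuous_on_compose2[OF smooth_mapD(2)[OF smooth(1), of UNIV], of S "\<lambda>x. (F x, G x)"] continuous_on_Pair by auto

lemma continuous_on_inv: "continuous_on S F ==> continuous_on S (\<lambda>x. ginv (F x))"
 using continuous_on_compose2[OF smooth_mapD(2)[OF smooth(2), of UNIV]] by auto

text \<open>Translations form a family that is homogeneous jointly in the group element and the
  point. The same argument for right translations and inversion makes Lebesgue measure a two-sided,
  inversion-invariant Haar measure.\<close>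

lemma preserved_left: "distr lborel borel (mul a) = lborel"
proof (rule homog_family_preserves[OF dil dil, where \<Phi>="\<lambda>c. mul (ginv c)" and \<Psi>=mul])
 show "smooth_map (\<lambda>z. mul (ginv (fst z)) (snd z))"
  by (intro smooth_map_mul smooth_map_inv smooth_map_fst smooth_map_snd)
qed (auto simp: inv_dil aut smooth_mapD(3)[OF smooth_mul_left])

lemma preserved_right: "distr lborel borel (\<lambda>x. mul x a) = lborel"
proof (rule homog_family_preserves[OF dil dil, where \<Phi>="\<lambda>c x. mul x (ginv c)" and \<Psi>="\<lambda>c x. mul x c"])
 show "smooth_map (\<lambda>z. mul (snd z) (ginv (fst z)))"
  by (intro smooth_map_mul smooth_map_inv smooth_map_fst smooth_map_snd)
qed (auto simp: inv_dil aut smooth_mapD(3)[OF smooth_mul_right])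

lemma preserved_inv: "distr lborel borel ginv = lborel"
proof (rule homog_family_preserves[OF dil dil, where \<Phi>="\<lambda>c. ginv" and \<Psi>="\<lambda>c. ginv"])
 show "smooth_map (\<lambda>z::'g \<times> 'g. ginv (snd z))" by (intro smooth_map_inv smooth_map_snd)
qed (auto simp: inv_dil smooth_mapD(3)[OF smooth(2)])

lemmas integral_left = preserved_integral[OF preserved_left smooth_mapD(3)[OF smooth_mul_left]]
lemmas integral_right = preserved_integral[OF preserved_right smooth_mapD(3)[OF smooth_mul_right]]
lemmas integral_inv = preserved_integral[OF preserved_inv smooth_mapD(3)[OF smooth(2)]]

end

definition tmul :: "('g => 'g => 'g) => real \<times> 'g => real \<times> 'g => real \<times> 'g" where
 "tmul mul a b = (fst a + fst b, mul (snd a) (snd b))"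

definition tinv :: "('g => 'g) => real \<times> 'g => real \<times> 'g" where
 "tinv ginv a = (- fst a, ginv (snd a))"

abbreviation tdil :: "(real => 'g => 'g) => real => real \<times> 'g => real \<times> 'g" where
 "tdil \<equiv> dprod (\<lambda>l t. l\<^sup>2 * t)"

abbreviation twt :: "('g::euclidean_space => real) => real \<times> 'g => real" where
 "twt \<equiv> wprod (\<lambda>_. 2)"

context hgroup
begin

text \<open>Time is a commuting factor of weight two, matching one time derivative against two
  derivatives along the fields.\<close>

lemma hgroup_time: "hgroup (tmul mul) (tinv ginv) (tdil \<delta>) (twt w)"
proof
 show "smooth_map (\<lambda>p. tmul mul (fst p) (snd p))" unfolding tmul_def
  by (intro smooth_map_Pair smooth_map_add smooth_map_mul smooth_map_fst' smooth_map_snd' smooth_map_fst smooth_map_snd smooth_map_ident)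
 show "smooth_map (tinv ginv)" unfolding tinv_def
 proof (intro smooth_map_Pair smooth_map_inv smooth_map_snd)
  show "smooth_map (\<lambda>x::real \<times> 'g. - fst x)"
   by (intro smooth_map_linear bounded_linear_minus bounded_linear_fst)
 qed
 show "dilation (twt w) (tdil \<delta>)" by (rule dilation_dprod[OF dilation_real dil])
qed (auto simp: tmul_def tinv_def dprod_def assoc aut algebra_simps zero_prod_def)

end

section \<open>Test functions and potentials\<close>

lemma measurable_off_point:
 fixes f :: "'a::euclidean_space => real"
 assumes "continuous_on (UNIV - {a}) f"
 shows "f \<in> borel_measurable borel"
proof -
 have "(\<lambda>x. indicator (UNIV - {a}) x *\<^sub>R f x) \<in> borel_measurable borel"
  by (rule borel_measurable_continuous_on_indicator[OF _ assms]) simp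
 then have "(\<lambda>x. indicator (UNIV - {a}) x *\<^sub>R f x + indicator {a} x * f a) \<in> borel_measurable borel"
  by measurable
 moreover have "(\<lambda>x. indicator (UNIV - {a}) x *\<^sub>R f x + indicator {a} x * f a) = f"
  by (auto simp: indicator_def)
 ultimately show ?thesis by simp
qed

lemma integral_pos_point:
 fixes g :: "'a::euclidean_space => real"
 assumes "\<And>x. 0 \<le> g x" "integrable lborel g" "open U" "x0 \<in> U" "continuous_on U g" "g x0 > 0"
 shows "0 < (LINT x|lborel. g x)"
proof -
 have "isCont g x0" using assms by (simp add: continuous_on_eq_continuous_at)
 then obtain r where r: "r > 0" "\<And>x. x \<in> ball x0 r ==> g x0 / 2 < g x"
 proof -
  have "\<forall>\<^sub>F x in at x0. g x0 / 2 < g x"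
   using \<open>isCont g x0\<close> assms(6) by (intro order_tendstoD(1)[of g "g x0"]) (auto simp: isCont_def)
  then obtain r where "r > 0" "\<And>x. x \<noteq> x0 ==> dist x x0 < r ==> g x0 / 2 < g x"
   by (auto simp: eventually_at)
  then show thesis using that[of r] assms(6) by (metis dist_commute half_gt_zero_iff mem_ball field_sum_of_halves less_add_same_cancel1)
 qed
 have "0 < g x0 / 2 * measure lborel (ball x0 r)" using r(1) assms(6) content_ball_pos[OF r(1), of x0] by simp
 also have "\<dots> = (LINT x|lborel. g x0 / 2 * indicator (ball x0 r) x)" by simp
 also have "\<dots> \<le> (LINT x|lborel. g x)"
 proof (rule integral_mono[OF _ assms(2)])
  show "integrable lborel (\<lambda>x. g x0 / 2 * indicator (ball x0 r) x)"
   using emeasure_lborel_ball_finite[of x0 r] by (intro integrable_mult_right integrable_real_indicator) auto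
  show "g x0 / 2 * indicator (ball x0 r) x \<le> g x" for x
   using r(2)[of x] assms(1)[of x] by (auto simp: indicator_def)
 qed
 finally show ?thesis .
qed

lemma integrable_compact_support:
 fixes g :: "'a::euclidean_space => real"
 assumes "compact K" "g \<in> borel_measurable borel" "\<And>x. x \<in> K ==> \<bar>g x\<bar> \<le> B" "\<And>x. x \<notin> K ==> g x = 0"
 shows "integrable lborel g"
proof (rule Bochner_Integration.integrable_bound)
 show "integrable lborel (\<lambda>x. B * indicator K x)"
  using emeasure_compact_finite[OF assms(1)] assms(1)
  by (intro integrable_mult_right integrable_real_indicator) (auto intro: borel_compact)
 show "AE x in lborel. norm (g x) \<le> norm (B * indicator K x)"
  using assms(3,4) by (intro AE_I2) (force simp: indicator_def)
qed (use assms in simp)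

text \<open>The bridge from weak to pointwise statements: a strict sign at one point of continuity
  is seen by a small bump around it.\<close>

lemma test_fun_detect:
 fixes f :: "'a::euclidean_space => real"
 assumes "open U" "continuous_on U f" "f \<in> borel_measurable borel" "x0 \<in> U" "f x0 > 0"
 obtains \<psi> where "test_fun \<psi>" "\<And>x. \<psi> x \<ge> 0" "\<And>x. \<psi> x \<noteq> 0 ==> x \<in> U" "(LINT x|lborel. f x * \<psi> x) > 0"
proof -
 have "open {x \<in> U. f x > 0}"
  using continuous_open_preimage[OF assms(2,1), of "{0<..}"] by (simp add: vimage_def Int_def)
 then obtain r where r: "r > 0" "cball x0 r \<subseteq> {x \<in> U. f x > 0}"
  using assms(4,5) open_contains_cball by blast
 define \<psi> where "\<psi> = bump x0 r"
 have p: "test_fun \<psi>" "\<And>x. \<psi> x \<ge> 0" "\<And>x. \<psi> x > 0 \<longleftrightarrow> x \<in> ball x0 r" "smooth_on UNIV \<psi>"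
  unfolding \<psi>_def using r(1) by (auto intro: test_fun_bump bump_nonneg smooth_on_bump simp: bump_pos)
 have z: "\<psi> x = 0" if "x \<notin> ball x0 r" for x using p(2,3) that by (metis less_le)
 have c: "continuous_on (cball x0 r) (\<lambda>x. f x * \<psi> x)"
  using smooth_onD(4)[OF p(4)] assms(2) r(2) by (intro continuous_intros) (auto intro: continuous_on_subset)
 have m: "(\<lambda>x. f x * \<psi> x) \<in> borel_measurable borel"
  by (rule borel_measurable_times[OF assms(3) borel_measurable_continuous_onI[OF smooth_onD(4)[OF p(4)]]])
 have "compact ((\<lambda>x. f x * \<psi> x) ` cball x0 r)" by (intro compact_continuous_image c compact_cball)
 from bounded_iff[THEN iffD1, OF compact_imp_bounded[OF this]]
 obtain B where B: "\<forall>y\<in>(\<lambda>x. f x * \<psi> x) ` cball x0 r. norm y \<le> B" ..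
 have i: "integrable lborel (\<lambda>x. f x * \<psi> x)"
  by (rule integrable_compact_support[OF compact_cball m, of x0 r B]) (use B z in auto)
 have "0 < (LINT x|lborel. f x * \<psi> x)"
 proof (rule integral_pos_point[OF _ i open_ball])
  show "0 \<le> f x * \<psi> x" for x
   using r(2) z[of x] p(2)[of x] by (cases "x \<in> ball x0 r") (auto simp: subset_iff less_imp_le)
  show "continuous_on (ball x0 r) (\<lambda>x. f x * \<psi> x)" using c by (rule continuous_on_subset) auto
  show "0 < f x0 * \<psi> x0" using p(3)[of x0] r(1) assms(5) by simp
 qed (use r(1) in auto)
 then show thesis using that[of \<psi>] p z r(2) by (metis (no_types, lifting) ball_subset_cball mem_Collect_eq subset_iff)
qed

lemma fubini_dominated:
 fixes f :: "'a::euclidean_space \<times> 'b::euclidean_space => real"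
 assumes m: "f \<in> borel_measurable borel" and "integrable lborel a" "integrable lborel b"
  and le: "\<And>x y. \<bar>f (x, y)\<bar> \<le> a x * b y"
 shows "(LINT x|lborel. LINT y|lborel. f (x, y)) = (LINT y|lborel. LINT x|lborel. f (x, y))"
proof -
 have ab: "integrable (lborel \<Otimes>\<^sub>M lborel) (\<lambda>z. a (fst z) * b (snd z))"
  by (rule lborel_pair.Fubini_integrable) (use assms in \<open>auto simp: abs_mult intro!: AE_I2\<close>)
 have "integrable (lborel \<Otimes>\<^sub>M lborel) f"
 proof (rule Bochner_Integration.integrable_bound[OF ab])
  have "norm (f z) \<le> norm (a (fst z) * b (snd z))" for z using le[of "fst z" "snd z"] by simp
  then show "AE z in lborel \<Otimes>\<^sub>M lborel. norm (f z) \<le> norm (a (fst z) * b (snd z))" by simp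
 qed (use m in \<open>simp add: lborel_prod\<close>)
 then have "integrable (lborel \<Otimes>\<^sub>M lborel) (\<lambda>(x, y). f (x, y))" by simp
 from lborel_pair.Fubini_integral[OF this] show ?thesis by simp
qed

lemma pdc_zero_on:
 assumes "g \<in> pdc f" "open V" "\<And>q. q \<in> V ==> f q = 0" "q \<in> V"
 shows "g q = 0"
 using assms(1,4)
proof (induction arbitrary: q rule: pdc.induct)
 case (step g b)
 have "ddir (b, 0) g q = ddir (b, 0) (\<lambda>_. 0) q"
  by (subst frechet_derivative_cong_open[OF assms(2) step.prems]) (auto simp: step.IH)
 then show ?case by (simp add: frechet_derivative_const)
qed (use assms(3) in auto)

text \<open>All derivatives fall on the test function, so local integrability of the weight is
  enough. Properness of \<open>\<Theta>\<close> confines \<open>h\<close> to a compact set, locally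
  uniformly in the parameter.\<close>

lemma good_kernel_test:
 fixes \<Theta> :: "'a::euclidean_space \<times> 'b::euclidean_space => 'c::euclidean_space"
 assumes \<Theta>: "smooth_map \<Theta>" and \<psi>: "smooth_on UNIV \<psi>" and S: "compact S" "\<And>x. x \<notin> S ==> \<psi> x = 0"
  and c: "loc_int c" "c \<in> borel_measurable borel"
  and proper: "\<And>K. compact K ==> \<exists>K'. compact K' \<and> (\<forall>p\<in>K. \<forall>h. \<Theta> (p, h) \<in> S \<longrightarrow> h \<in> K')"
 shows "good_kernel UNIV c UNIV (\<lambda>q. \<psi> (\<Theta> q))"
 unfolding good_kernel_def
proof (intro conjI ballI allI impI)
 show s: "smooth_on UNIV (\<lambda>q. \<psi> (\<Theta> q))" by (rule smooth_on_compose_map[OF open_UNIV \<Theta> \<psi>]) simp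
 fix g p0 assume g: "g \<in> pdc (\<lambda>q. \<psi> (\<Theta> q))"
 obtain K' where K': "compact K'" "\<And>p h. p \<in> cball p0 1 ==> \<Theta> (p, h) \<in> S ==> h \<in> K'"
  using proper[OF compact_cball[of p0 1]] by blast
 have V: "open (\<Theta> -` (- S))" using compact_imp_closed[OF S(1)] smooth_mapD(2)[OF \<Theta>, of UNIV]
  by (intro open_vimage) auto
 have gz: "g (p, h) = 0" if "\<Theta> (p, h) \<notin> S" for p h
  by (rule pdc_zero_on[OF g V]) (use that S(2) in auto)
 have "compact (g ` (cball p0 1 \<times> K'))"
  using smooth_onD(4)[OF pdc_smooth[OF g s]] K'(1)
  by (intro compact_continuous_image compact_Times compact_cball) (auto intro: continuous_on_subset)
 from bounded_iff[THEN iffD1, OF compact_imp_bounded[OF this]]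
 obtain B where B: "\<forall>y\<in>g ` (cball p0 1 \<times> K'). norm y \<le> B" ..
 have "integrable lborel (\<lambda>h. B * \<bar>indicator K' h *\<^sub>R c h\<bar>)"
  using c(1) K'(1) by (intro integrable_mult_right integrable_abs) (auto simp: loc_int_def set_integrable_def)
 moreover have "\<bar>g (p, h) * c h\<bar> \<le> B * \<bar>indicator K' h *\<^sub>R c h\<bar>" if p: "p \<in> ball p0 1" for p h
 proof (cases "h \<in> K'")
  case True
  then have "\<bar>g (p, h)\<bar> \<le> B" using B p by force
  then show ?thesis using True by (simp add: abs_mult mult_right_mono)
 next
  case False
  then have "\<Theta> (p, h) \<notin> S" using K'(2)[of p h] p by auto
  then show ?thesis using False gz by simp
 qed
 ultimately show "\<exists>e>0. \<exists>B. integrable lborel B \<and> (\<forall>p\<in>ball p0 e. \<forall>h. \<bar>g (p, h) * c h\<bar> \<le> B h)"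
  by (intro exI[of _ 1] conjI exI[of _ "\<lambda>h. B * \<bar>indicator K' h *\<^sub>R c h\<bar>"]) auto
qed (use c in auto)

text \<open>For \<open>p\<close> far out the support condition forces \<open>h\<close> far out,
  where the weight is small, while the total mass \<open>J\<close> of the other factor does not
  depend on \<open>p\<close>.\<close>

lemma potential_vanishes:
 fixes \<Theta> :: "'a::euclidean_space => 'b::euclidean_space => 'c::euclidean_space" and \<psi> :: "'c => real" and c :: "'b => real"
 assumes c: "(c \<longlongrightarrow> 0) at_infinity" and S: "\<And>x. x \<notin> S ==> \<psi> x = 0"
  and i: "\<And>p. integrable lborel (\<lambda>h. \<bar>\<psi> (\<Theta> p h)\<bar>)" "\<And>p. (LINT h|lborel. \<bar>\<psi> (\<Theta> p h)\<bar>) = J"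
  and proper: "\<And>R. \<exists>R'. \<forall>p. norm p \<ge> R' \<longrightarrow> (\<forall>h. \<Theta> p h \<in> S \<longrightarrow> norm h \<ge> R)"
 shows "((\<lambda>p. LINT h|lborel. \<psi> (\<Theta> p h) * c h) \<longlongrightarrow> 0) at_infinity"
proof (rule tendstoI)
 fix e :: real assume e: "e > 0"
 have J: "J \<ge> 0" using i(2)[of 0] by (metis abs_ge_zero integral_nonneg_AE AE_I2)
 define k where "k = e / (J + 1)"
 have k: "k > 0" "k * J < e" using e J by (auto simp: k_def field_simps)
 obtain R where R: "\<And>h. norm h \<ge> R ==> \<bar>c h\<bar> < k"
  using tendstoD[OF c k(1)] by (auto simp: eventually_at_infinity)
 obtain R' where R': "\<And>p h. norm p \<ge> R' ==> \<Theta> p h \<in> S ==> norm h \<ge> R" using proper[of R] by blast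
 have "\<bar>LINT h|lborel. \<psi> (\<Theta> p h) * c h\<bar> < e" if p: "norm p \<ge> R'" for p
 proof -
  have "\<bar>LINT h|lborel. \<psi> (\<Theta> p h) * c h\<bar> \<le> (LINT h|lborel. \<bar>\<psi> (\<Theta> p h) * c h\<bar>)"
   using integral_norm_bound[of lborel "\<lambda>h. \<psi> (\<Theta> p h) * c h"] by simp
  also have "\<dots> \<le> (LINT h|lborel. k * \<bar>\<psi> (\<Theta> p h)\<bar>)"
  proof (rule integral_mono')
   show "\<bar>\<psi> (\<Theta> p h) * c h\<bar> \<le> k * \<bar>\<psi> (\<Theta> p h)\<bar>" for h
    using R[of h] R'[OF p, of h] S[of "\<Theta> p h"] by (cases "\<Theta> p h \<in> S") (auto simp: abs_mult mult.commute intro!: mult_right_mono)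
   show "0 \<le> k * \<bar>\<psi> (\<Theta> p h)\<bar>" for h using k by simp
  qed (use i in simp)
  also have "\<dots> = k * J" using i by simp
  finally show ?thesis using k(2) by simp
 qed
 then show "\<forall>\<^sub>F p in at_infinity. dist (LINT h|lborel. \<psi> (\<Theta> p h) * c h) 0 < e"
  by (auto simp: eventually_at_infinity)
qed

lemma test_funI':
 assumes "smooth_on UNIV f" "compact K" "\<And>x. f x \<noteq> 0 ==> x \<in> K"
 shows "test_fun f"
 using assms by (intro test_funI[of f K]) auto

lemma test_fun_integrable:
 assumes "test_fun \<psi>"
 shows "integrable lborel \<psi>" "\<exists>B\<ge>0. \<forall>x. \<bar>\<psi> x\<bar> \<le> B" "\<psi> \<in> borel_measurable borel" "continuous_on UNIV \<psi>"
proof -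
 obtain K where K: "compact K" "\<And>x. x \<notin> K ==> \<psi> x = 0" "smooth_on UNIV \<psi>" using test_funE[OF assms] by metis
 show c: "continuous_on UNIV \<psi>" by (rule smooth_onD(4)[OF K(3)])
 then show m: "\<psi> \<in> borel_measurable borel" by (rule borel_measurable_continuous_onI)
 have "compact (\<psi> ` K)" by (intro compact_continuous_image K(1)) (auto intro: continuous_on_subset[OF c])
 from bounded_iff[THEN iffD1, OF compact_imp_bounded[OF this]]
 obtain B where B: "\<forall>y\<in>\<psi> ` K. norm y \<le> B" ..
 have B': "\<bar>\<psi> x\<bar> \<le> \<bar>B\<bar>" for x using B K(2)[of x] by (cases "x \<in> K") force+
 then show "\<exists>B\<ge>0. \<forall>x. \<bar>\<psi> x\<bar> \<le> B" by (intro exI[of _ "\<bar>B\<bar>"]) auto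
 show "integrable lborel \<psi>" by (rule integrable_compact_support[OF K(1) m B' K(2)])
qed

lemma test_fun_heat_op:
 assumes "test_fun \<psi>" "\<forall>j<m. smooth_map (Xs j)"
 shows "test_fun (heat_op e m Xs \<psi>)"
proof -
 obtain K where K: "compact K" "\<And>x. x \<notin> K ==> \<psi> x = 0" "smooth_on UNIV \<psi>" using test_funE[OF assms(1)] by metis
 have "heat_op e m Xs \<psi> z = 0" if "z \<notin> K" for z
 proof -
  have "heat_op e m Xs \<psi> z = heat_op e m Xs (\<lambda>_. 0 * \<psi> z + 0) z"
   by (rule heat_op_cong[of "- K"]) (use compact_imp_closed[OF K(1)] that K(2) in auto)
  then show ?thesis using heat_op_shift[OF assms(2) open_UNIV UNIV_I smooth_onD(1)[OF K(3)], of e 0 0] by (simp add: vf_def heat_op_def frechet_derivative_const)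
 qed
 then show ?thesis by (rule test_funI[OF smooth_on_heat_op[OF open_UNIV K(3) assms(2)] K(1)])
qed

lemma loc_int_const: "loc_int (\<lambda>x. c)"
 unfolding loc_int_def set_integrable_def
 using emeasure_compact_finite by (auto intro!: integrable_mult_left integrable_real_indicator borel_compact)

section \<open>The heat operator of a homogeneous group\<close>

lemma fubini_curried:
 fixes f :: "'a::euclidean_space => 'b::euclidean_space => real"
 assumes "(\<lambda>z. f (fst z) (snd z)) \<in> borel_measurable borel" "integrable lborel a" "integrable lborel b"
  "\<And>x y. \<bar>f x y\<bar> \<le> a x * b y"
 shows "(LINT x|lborel. LINT y|lborel. f x y) = (LINT y|lborel. LINT x|lborel. f x y)"
 using fubini_dominated[of "\<lambda>z. f (fst z) (snd z)" a b] assms by simp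

text \<open>Invariance and homogeneity of the fields appear in pointwise form, as identities between
  vectors. The equation for \<open>\<gamma>\<close> is tested at the origin; left translation
  carries it to every other pole.\<close>

locale heat_group = hgroup mul ginv \<delta> w
 for mul :: "'g::euclidean_space => 'g => 'g" and ginv \<delta> w +
 fixes m :: nat and Zs :: "nat => 'g => 'g" and \<gamma> :: "real \<times> 'g => real"
 assumes Zs_smooth: "\<forall>j<m. smooth_map (Zs j)"
  and Zs_left: "\<forall>j<m. \<forall>a x. frechet_derivative (mul a) (at x) (Zs j x) = Zs j (mul a x)"
  and Zs_hom: "\<forall>j<m. \<forall>l>0. \<forall>x. \<delta> l (Zs j x) = l *\<^sub>R Zs j (\<delta> l x)"
  and gam_smooth: "smooth_on (UNIV - {0}) \<gamma>"
  and gam_locint: "loc_int \<gamma>"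
  and gam_fund: "\<And>\<phi>. test_fun \<phi> ==> (LINT \<zeta>|lborel. \<gamma> \<zeta> * heat_op (-1) m Zs \<phi> \<zeta>) = - \<phi> 0"
  and gam_infty: "(\<gamma> \<longlongrightarrow> 0) at_infinity"
begin

sublocale T: hgroup "tmul mul" "tinv ginv" "tdil \<delta>" "twt w"
 by (rule hgroup_time)

abbreviation tm (infixl "\<star>" 70) where "a \<star> b \<equiv> tmul mul a b"
abbreviation ti where "ti \<equiv> tinv ginv"
abbreviation heat where "heat e \<equiv> heat_op e m Zs"

lemma heat_left:
 assumes "open W" "a \<star> z \<in> W" "C_k_on 2 W u"
 shows "heat e (\<lambda>z. u (a \<star> z)) z = heat e u (a \<star> z)"
proof -
 have eq: "a \<star> z = (1 * fst z + fst a, mul (snd a) (snd z))" for z by (simp add: tmul_def)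
 show ?thesis using assms(2) unfolding eq
  by (subst heat_op_related[OF assms(1) _ assms(3) smooth_mul_left Zs_smooth, where c=1 and e'=e])
   (use Zs_left in auto)
qed

lemma heat_dil:
 assumes "open W" "tdil \<delta> l z \<in> W" "C_k_on 2 W u" "l > 0"
 shows "heat e (\<lambda>z. u (tdil \<delta> l z)) z = l\<^sup>2 * heat e u (tdil \<delta> l z)"
proof -
 have eq: "tdil \<delta> l z = (l\<^sup>2 * fst z + 0, \<delta> l (snd z))" for z by (simp add: dprod_def)
 have d: "frechet_derivative (\<delta> l) (at x) = \<delta> l" for x
  by (rule frechet_derivative_eqI[OF bounded_linear_imp_has_derivative[OF dilation_bounded_linear[OF dil assms(4)]]])
 show ?thesis using assms(2) unfolding eq
  by (subst heat_op_related[OF assms(1) _ assms(3) smooth_map_linear[OF dilation_bounded_linear[OF dil assms(4)]] Zs_smooth, where c=l and e'=e])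
   (use Zs_hom assms(4) in \<open>auto simp: d\<close>)
qed

lemma gam_cont: "continuous_on (UNIV - {0}) \<gamma>"
 by (rule smooth_onD(4)[OF gam_smooth])

lemma gam_meas [measurable]: "\<gamma> \<in> borel_measurable borel"
 by (rule measurable_off_point[OF gam_cont])

lemma compact_mul: "compact K ==> compact L ==> compact {a \<star> b | a b. a \<in> K \<and> b \<in> L}"
proof -
 assume "compact K" "compact L"
 then have "compact ((\<lambda>p. fst p \<star> snd p) ` (K \<times> L))"
  by (intro compact_continuous_image compact_Times T.continuous_on_mul continuous_on_fst continuous_on_snd continuous_on_id)
 moreover have "(\<lambda>p. fst p \<star> snd p) ` (K \<times> L) = {a \<star> b | a b. a \<in> K \<and> b \<in> L}" by force
 ultimately show ?thesis by simp
qed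

lemma compact_inv: "compact K ==> compact (ti ` K)"
 by (intro compact_continuous_image T.continuous_on_inv continuous_on_id)

lemma test_fun_left: "test_fun \<psi> ==> test_fun (\<lambda>z. \<psi> (a \<star> z))"
proof -
 assume "test_fun \<psi>"
 then obtain K where K: "compact K" "\<And>x. x \<notin> K ==> \<psi> x = 0" "smooth_on UNIV \<psi>" using test_funE by metis
 show ?thesis
 proof (rule test_funI'[OF _ compact_mul[OF _ K(1), of "{ti a}"]])
  show "smooth_on UNIV (\<lambda>z. \<psi> (a \<star> z))"
   by (rule smooth_on_compose_map[OF open_UNIV T.smooth_mul_left K(3)]) simp
  show "z \<in> {b \<star> c | b c. b \<in> {ti a} \<and> c \<in> K}" if "\<psi> (a \<star> z) \<noteq> 0" for z
  proof -
   have "z = ti a \<star> (a \<star> z)" "a \<star> z \<in> K" using K(2)[of "a \<star> z"] that by auto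
   then show ?thesis by blast
  qed
 qed simp
qed

lemma test_fun_inv: "test_fun \<psi> ==> test_fun (\<lambda>z. \<psi> (ti z))"
proof -
 assume "test_fun \<psi>"
 then obtain K where K: "compact K" "\<And>x. x \<notin> K ==> \<psi> x = 0" "smooth_on UNIV \<psi>" using test_funE by metis
 show ?thesis
 proof (rule test_funI'[OF _ compact_inv[OF K(1)]])
  show "smooth_on UNIV (\<lambda>z. \<psi> (ti z))"
   by (rule smooth_on_compose_map[OF open_UNIV T.smooth(2) K(3)]) simp
  show "z \<in> ti ` K" if "\<psi> (ti z) \<noteq> 0" for z
   using K(2)[of "ti z"] that T.inv_simps(2)[of z] by (metis imageI)
 qed
qed

lemma tm_deriv:
 "(tmul mul z has_derivative (\<lambda>v. (fst v, frechet_derivative (mul (snd z)) (at (snd y)) (snd v)))) (at y)"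
proof -
 have 1: "(snd has_derivative snd) (at y)" by (rule bounded_linear_imp_has_derivative[OF bounded_linear_snd])
 have "((\<lambda>y. mul (snd z) (snd y)) has_derivative (\<lambda>v. frechet_derivative (mul (snd z)) (at (snd y)) (snd v))) (at y)"
  by (rule has_derivative_compose[OF 1 has_derivative_frechet[OF smooth_mapD(1)[OF smooth_mul_left]]])
 moreover have "((\<lambda>y. fst z + fst y) has_derivative fst) (at y)"
  by (auto intro!: derivative_eq_intros)
 ultimately show ?thesis unfolding tmul_def by (intro has_derivative_Pair)
qed

text \<open>Right translations preserve the measure, and differentiating along them gives the left-invariant fields.\<close>

lemma integral_left_invariant_derivative:
 assumes "test_fun f"
 shows "(LINT z|lborel. frechet_derivative f (at z) (frechet_derivative (tmul mul z) (at 0) v)) = 0"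
proof -
 obtain S where S: "compact S" "\<And>x. x \<notin> S ==> f x = 0" "smooth_on UNIV f" using test_funE[OF assms] by metis
 define \<Theta> where "\<Theta> q = snd q \<star> (fst q *\<^sub>R v)" for q :: "real \<times> real \<times> 'g"
 have s\<Theta>: "smooth_map \<Theta>" unfolding \<Theta>_def
  by (intro T.smooth_map_mul smooth_map_snd smooth_map_linear bounded_linear_scaleR_left[THEN bounded_linear_compose] bounded_linear_fst)
 have k: "good_kernel UNIV (\<lambda>_. 1) UNIV (\<lambda>q. f (\<Theta> q))"
 proof (rule good_kernel_test[OF s\<Theta> S(3,1,2) loc_int_const])
  fix K :: "real set" assume "compact K"
  then have "compact ((\<lambda>t. t *\<^sub>R v) ` K)" by (intro compact_continuous_image continuous_intros)
  then have c: "compact {a \<star> b | a b. a \<in> S \<and> b \<in> ti ` (\<lambda>t. t *\<^sub>R v) ` K}"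
   by (intro compact_mul S(1) compact_inv)
  show "\<exists>K'. compact K' \<and> (\<forall>p\<in>K. \<forall>h. \<Theta> (p, h) \<in> S \<longrightarrow> h \<in> K')"
  proof (intro exI conjI ballI allI impI, rule c)
   fix p h assume p: "p \<in> K" "\<Theta> (p, h) \<in> S"
   have "h = \<Theta> (p, h) \<star> ti (p *\<^sub>R v)" by (simp add: \<Theta>_def T.cancel')
   then show "h \<in> {a \<star> b | a b. a \<in> S \<and> b \<in> ti ` (\<lambda>t. t *\<^sub>R v) ` K}" using p by blast
  qed
 qed auto
 have fm: "f \<in> borel_measurable borel" by (rule test_fun_integrable(3)[OF assms])
 have const: "(LINT h|lborel. f (\<Theta> (s, h)) * 1) = (LINT h|lborel. f h)" for s
  using T.integral_right(1)[OF fm, of "s *\<^sub>R v"] by (simp add: \<Theta>_def)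
 have chain: "ddir (1, 0) (\<lambda>q. f (\<Theta> q)) (0, h) = frechet_derivative f (at h) (frechet_derivative (tmul mul h) (at 0) v)" for h
 proof -
  have "ddir (1, 0) (\<lambda>q. f (\<Theta> q)) (0, h) = ddir 1 (\<lambda>s. f (\<Theta> (s, h))) 0"
   by (rule ddir_slice(2)[symmetric, OF smooth_onD(2)[OF smooth_on_compose_map[OF open_UNIV s\<Theta> S(3)]]]) auto
  also have "\<dots> = frechet_derivative f (at h) (frechet_derivative (tmul mul h) (at 0) v)"
  proof -
   have 1: "((\<lambda>s. s *\<^sub>R v) has_derivative (\<lambda>r. r *\<^sub>R v)) (at 0)" by (auto intro!: derivative_eq_intros)
   have 2: "(tmul mul h has_derivative frechet_derivative (tmul mul h) (at 0)) (at (0 *\<^sub>R v))"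
    using has_derivative_frechet[OF smooth_mapD(1)[OF T.smooth_mul_left]] by simp
   have 3: "((\<lambda>s. h \<star> (s *\<^sub>R v)) has_derivative (\<lambda>r. frechet_derivative (tmul mul h) (at 0) (r *\<^sub>R v))) (at 0)"
    by (rule has_derivative_compose[OF 1 2])
   have 4: "(f has_derivative frechet_derivative f (at h)) (at (h \<star> (0 *\<^sub>R v)))"
    using has_derivative_frechet[OF smooth_onD(2)[OF S(3)]] by simp
   have "((\<lambda>s. f (h \<star> (s *\<^sub>R v))) has_derivative (\<lambda>r. frechet_derivative f (at h) (frechet_derivative (tmul mul h) (at 0) (r *\<^sub>R v)))) (at 0)"
    by (rule has_derivative_compose[OF 3 4])
   then show ?thesis by (simp add: \<Theta>_def frechet_derivative_eqI)
  qed
  finally show ?thesis .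
 qed
 have "0 = ddir 1 (\<lambda>s. LINT h|lborel. f (\<Theta> (s, h)) * 1) 0"
  unfolding const by (simp add: frechet_derivative_const)
 also have "\<dots> = (LINT h|lborel. ddir (1, 0) (\<lambda>q. f (\<Theta> q)) (0, h) * 1)"
  by (rule good_kernel_ddir(2)[OF k UNIV_I]) simp
 also have "\<dots> = (LINT h|lborel. frechet_derivative f (at h) (frechet_derivative (tmul mul h) (at 0) v))"
  by (simp only: chain mult_1_right)
 finally show ?thesis ..
qed

lemma integral_vf_zero:
 assumes "test_fun f"
 shows "j < m ==> (LINT z|lborel. vf (tvf (Zs j)) f z) = 0" and "(LINT z|lborel. ddir (1, 0) f z) = 0"
proof -
 assume j: "j < m"
 have "frechet_derivative (tmul mul z) (at 0) (0, Zs j 0) = tvf (Zs j) z" for z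
  using Zs_left[rule_format, OF j, of "snd z" 0] by (simp add: frechet_derivative_eqI[OF tm_deriv] tvf_def)
 then show "(LINT z|lborel. vf (tvf (Zs j)) f z) = 0"
  using integral_left_invariant_derivative[OF assms, of "(0, Zs j 0)"] by (simp add: vf_def)
next
 have "frechet_derivative (tmul mul z) (at 0) (1, 0) = (1, 0)" for z
  using frechet_derivative_linear(3)[OF smooth_mapD(1)[OF smooth_mul_left]] by (simp add: frechet_derivative_eqI[OF tm_deriv])
 then show "(LINT z|lborel. ddir (1, 0) f z) = 0"
  using integral_left_invariant_derivative[OF assms, of "(1, 0)"] by simp
qed

lemma test_fun_times: "smooth_on UNIV u ==> test_fun \<phi> ==> test_fun (\<lambda>z. u z * \<phi> z)"
proof -
 assume u: "smooth_on UNIV u" and "test_fun \<phi>"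
 then obtain K where K: "compact K" "\<And>x. x \<notin> K ==> \<phi> x = 0" "smooth_on UNIV \<phi>" using test_funE by metis
 show ?thesis by (rule test_funI[OF smooth_on_mult[OF open_UNIV u K(3)] K(1)]) (simp add: K(2))
qed

lemma test_fun_deriv: "test_fun \<phi> ==> test_fun (ddir v \<phi>)" "test_fun \<phi> ==> j < m ==> test_fun (vf (tvf (Zs j)) \<phi>)"
proof -
 assume "test_fun \<phi>"
 then obtain K where K: "compact K" "\<And>x. x \<notin> K ==> \<phi> x = 0" "smooth_on UNIV \<phi>" using test_funE by metis
 have z: "frechet_derivative \<phi> (at x) v = 0" if "x \<notin> K" for x v
  by (subst frechet_derivative_cong_open[of "- K" _ _ "\<lambda>_. 0"])
   (use compact_imp_closed[OF K(1)] that K(2) in \<open>auto simp: frechet_derivative_const\<close>)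
 show "test_fun (ddir v \<phi>)" by (rule test_funI[OF smooth_onD(3)[OF K(3)] K(1)]) (simp add: z)
 show "j < m ==> test_fun (vf (tvf (Zs j)) \<phi>)"
  by (rule test_funI[OF smooth_on_vf_tvf[OF open_UNIV K(3)] K(1)]) (use Zs_smooth in \<open>auto simp: vf_def z\<close>)
qed

lemma integrable_times_test: "smooth_on UNIV u ==> test_fun \<phi> ==> integrable lborel (\<lambda>z. u z * \<phi> z)"
 by (rule test_fun_integrable(1)[OF test_fun_times])

lemma frechet_derivative_mult:
 fixes f g :: "'a::euclidean_space => real"
 assumes "f differentiable (at x)" "g differentiable (at x)"
 shows "frechet_derivative (\<lambda>x. f x * g x) (at x) v = f x * frechet_derivative g (at x) v + frechet_derivative f (at x) v * g x"
 using frechet_derivative_eqI[OF has_derivative_mult[OF has_derivative_frechet[OF assms(1)] has_derivative_frechet[OF assms(2)]]]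
 by simp

text \<open>The integral of a left-invariant derivative of a test function is 0, so each field is
  skew-adjoint and its square self-adjoint, whereas the time derivative changes sign. This turns
  \<open>e\<close> into \<open>- e\<close>.\<close>

lemma integration_by_parts:
 assumes u: "smooth_on UNIV u" and \<phi>: "test_fun \<phi>"
 shows "(LINT z|lborel. u z * heat e \<phi> z) = (LINT z|lborel. heat (-e) u z * \<phi> z)"
proof -
 have s\<phi>: "smooth_on UNIV \<phi>" using test_funE[OF \<phi>] by metis
 have Z: "(LINT z|lborel. u z * vf (tvf (Zs j)) \<phi> z) = - (LINT z|lborel. vf (tvf (Zs j)) u z * \<phi> z)"
  if "smooth_on UNIV u" "test_fun \<phi>" "j < m" for u \<phi> j
 proof -
  have s: "smooth_on UNIV \<phi>" using test_funE[OF that(2)] by metis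
  have su: "smooth_on UNIV (vf (tvf (Zs j)) u)" using smooth_on_vf_tvf[OF open_UNIV that(1)] Zs_smooth that(3) by simp
  have "0 = (LINT z|lborel. vf (tvf (Zs j)) (\<lambda>z. u z * \<phi> z) z)"
   using integral_vf_zero(1)[OF test_fun_times[OF that(1,2)] that(3)] by simp
  also have "\<dots> = (LINT z|lborel. u z * vf (tvf (Zs j)) \<phi> z + vf (tvf (Zs j)) u z * \<phi> z)"
   by (simp add: vf_def frechet_derivative_mult smooth_onD(2)[OF s] smooth_onD(2)[OF that(1)])
  also have "\<dots> = (LINT z|lborel. u z * vf (tvf (Zs j)) \<phi> z) + (LINT z|lborel. vf (tvf (Zs j)) u z * \<phi> z)"
   by (intro Bochner_Integration.integral_add integrable_times_test that su test_fun_deriv(2))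
  finally show ?thesis by simp
 qed
 have ZZ: "(LINT z|lborel. u z * vf (tvf (Zs j)) (vf (tvf (Zs j)) \<phi>) z) = (LINT z|lborel. vf (tvf (Zs j)) (vf (tvf (Zs j)) u) z * \<phi> z)"
  if "j < m" for j
  using Z[OF u test_fun_deriv(2)[OF \<phi> that] that] Z[OF smooth_on_vf_tvf[OF open_UNIV u] \<phi> that] Zs_smooth that by simp
 have t: "(LINT z|lborel. u z * ddir (1, 0) \<phi> z) = - (LINT z|lborel. ddir (1, 0) u z * \<phi> z)"
 proof -
  have "0 = (LINT z|lborel. ddir (1, 0) (\<lambda>z. u z * \<phi> z) z)"
   using integral_vf_zero(2)[OF test_fun_times[OF u \<phi>]] by simp
  also have "\<dots> = (LINT z|lborel. u z * ddir (1, 0) \<phi> z + ddir (1, 0) u z * \<phi> z)"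
   by (simp add: frechet_derivative_mult smooth_onD(2)[OF u] smooth_onD(2)[OF s\<phi>])
  also have "\<dots> = (LINT z|lborel. u z * ddir (1, 0) \<phi> z) + (LINT z|lborel. ddir (1, 0) u z * \<phi> z)"
   by (intro Bochner_Integration.integral_add integrable_times_test u \<phi> smooth_onD(3) test_fun_deriv(1))
  finally show ?thesis by simp
 qed
 have i1: "integrable lborel (\<lambda>z. u z * vf (tvf (Zs j)) (vf (tvf (Zs j)) \<phi>) z)" if "j < m" for j
  by (intro integrable_times_test u test_fun_deriv(2) \<phi> that)
 have i2: "integrable lborel (\<lambda>z. vf (tvf (Zs j)) (vf (tvf (Zs j)) u) z * \<phi> z)" if "j < m" for j
  by (intro integrable_times_test \<phi> smooth_on_vf_tvf open_UNIV u) (use Zs_smooth that in auto)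
 have i3: "integrable lborel (\<lambda>z. u z * ddir (1, 0) \<phi> z)" "integrable lborel (\<lambda>z. ddir (1, 0) u z * \<phi> z)"
  by (intro integrable_times_test u \<phi> smooth_onD(3) test_fun_deriv(1))+
 have "(LINT z|lborel. u z * heat e \<phi> z)
  = (LINT z|lborel. (\<Sum>j<m. u z * vf (tvf (Zs j)) (vf (tvf (Zs j)) \<phi>) z) - e * (u z * ddir (1, 0) \<phi> z))"
  by (simp add: heat_op_def right_diff_distrib sum_distrib_left mult_ac)
 also have "\<dots> = (\<Sum>j<m. LINT z|lborel. u z * vf (tvf (Zs j)) (vf (tvf (Zs j)) \<phi>) z) - e * (LINT z|lborel. u z * ddir (1, 0) \<phi> z)"
 proof -
  have A: "integrable lborel (\<lambda>z. \<Sum>j<m. u z * vf (tvf (Zs j)) (vf (tvf (Zs j)) \<phi>) z)"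
   by (rule Bochner_Integration.integrable_sum) (simp add: i1)
  have "(LINT z|lborel. (\<Sum>j<m. u z * vf (tvf (Zs j)) (vf (tvf (Zs j)) \<phi>) z))
    = (\<Sum>j<m. LINT z|lborel. u z * vf (tvf (Zs j)) (vf (tvf (Zs j)) \<phi>) z)"
   by (rule Bochner_Integration.integral_sum) (simp add: i1)
  then show ?thesis
   using Bochner_Integration.integral_diff[OF A integrable_mult_right[OF i3(1), of e]] by simp
 qed
 also have "\<dots> = (\<Sum>j<m. LINT z|lborel. vf (tvf (Zs j)) (vf (tvf (Zs j)) u) z * \<phi> z) + e * (LINT z|lborel. ddir (1, 0) u z * \<phi> z)"
  using ZZ t by simp
 also have "\<dots> = (LINT z|lborel. (\<Sum>j<m. vf (tvf (Zs j)) (vf (tvf (Zs j)) u) z * \<phi> z) + e * (ddir (1, 0) u z * \<phi> z))"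
 proof -
  have A: "integrable lborel (\<lambda>z. \<Sum>j<m. vf (tvf (Zs j)) (vf (tvf (Zs j)) u) z * \<phi> z)"
   by (rule Bochner_Integration.integrable_sum) (simp add: i2)
  have "(LINT z|lborel. (\<Sum>j<m. vf (tvf (Zs j)) (vf (tvf (Zs j)) u) z * \<phi> z))
    = (\<Sum>j<m. LINT z|lborel. vf (tvf (Zs j)) (vf (tvf (Zs j)) u) z * \<phi> z)"
   by (rule Bochner_Integration.integral_sum) (simp add: i2)
  then show ?thesis
   using Bochner_Integration.integral_add[OF A integrable_mult_right[OF i3(2), of e]] by simp
 qed
 also have "\<dots> = (LINT z|lborel. heat (-e) u z * \<phi> z)"
  by (simp add: heat_op_def distrib_right sum_distrib_right mult.assoc)
 finally show ?thesis .
qed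

text \<open>With \<open>z = \<zeta> \<star> ti h\<close> this is the integral of
  \<open>\<phi> z * \<gamma> (ti z \<star> \<zeta>)\<close> in \<open>z\<close>, the superposition
  of fundamental solutions with poles \<open>z\<close>. The function \<open>potA\<close> below is
  its transpose.\<close>

definition potB :: "(real \<times> 'g => real) => real \<times> 'g => real" where
 "potB \<phi> \<zeta> = (LINT h|lborel. \<phi> (\<zeta> \<star> ti h) * \<gamma> h)"

definition potA :: "(real \<times> 'g => real) => real \<times> 'g => real" where
 "potA \<psi> z = (LINT h|lborel. \<psi> (z \<star> h) * \<gamma> h)"

lemma pot_smooth:
 assumes "test_fun \<phi>"
 shows "smooth_on UNIV (potB \<phi>)" "smooth_on UNIV (potA \<phi>)"
proof -
 obtain S where S: "compact S" "\<And>x. x \<notin> S ==> \<phi> x = 0" "smooth_on UNIV \<phi>" using test_funE[OF assms] by metis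
 have "good_kernel UNIV \<gamma> UNIV (\<lambda>q. \<phi> (fst q \<star> ti (snd q)))"
 proof (rule good_kernel_test[OF _ S(3,1,2) gam_locint gam_meas])
  show "smooth_map (\<lambda>q. fst q \<star> ti (snd q))" by (intro T.smooth_map_mul T.smooth_map_inv smooth_map_fst smooth_map_snd)
  fix K :: "(real \<times> 'g) set" assume K: "compact K"
  show "\<exists>K'. compact K' \<and> (\<forall>p\<in>K. \<forall>h. fst (p, h) \<star> ti (snd (p, h)) \<in> S \<longrightarrow> h \<in> K')"
  proof (intro exI conjI ballI allI impI, rule compact_mul[OF compact_inv[OF S(1)] K])
   fix p h assume p: "p \<in> K" "fst (p, h) \<star> ti (snd (p, h)) \<in> S"
   have "h = ti (p \<star> ti h) \<star> p" by (simp add: T.assoc)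
   moreover have "p \<star> ti h \<in> S" using p(2) by simp
   ultimately show "h \<in> {a \<star> b | a b. a \<in> ti ` S \<and> b \<in> K}" using p(1) by blast
  qed
 qed
 from good_kernel_smooth[OF this] show "smooth_on UNIV (potB \<phi>)" by (simp add: potB_def[abs_def])
 have "good_kernel UNIV \<gamma> UNIV (\<lambda>q. \<phi> (fst q \<star> snd q))"
 proof (rule good_kernel_test[OF _ S(3,1,2) gam_locint gam_meas])
  show "smooth_map (\<lambda>q. fst q \<star> snd q)" by (intro T.smooth_map_mul smooth_map_fst smooth_map_snd)
  fix K :: "(real \<times> 'g) set" assume K: "compact K"
  show "\<exists>K'. compact K' \<and> (\<forall>p\<in>K. \<forall>h. fst (p, h) \<star> snd (p, h) \<in> S \<longrightarrow> h \<in> K')"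
  proof (intro exI conjI ballI allI impI, rule compact_mul[OF compact_inv[OF K] S(1)])
   fix p h assume p: "p \<in> K" "fst (p, h) \<star> snd (p, h) \<in> S"
   have "h = ti p \<star> (p \<star> h)" by simp
   moreover have "p \<star> h \<in> S" using p(2) by simp
   ultimately show "h \<in> {a \<star> b | a b. a \<in> ti ` K \<and> b \<in> S}" using p(1) by blast
  qed
 qed
 from good_kernel_smooth[OF this] show "smooth_on UNIV (potA \<phi>)" by (simp add: potA_def[abs_def])
qed

text \<open>The mass required by \<open>potential_vanishes\<close> is independent of the point
  because translations and inversion preserve the measure.\<close>

lemma pot_lim:
 assumes "test_fun \<phi>"
 shows "(potB \<phi> \<longlongrightarrow> 0) at_infinity" "(potA \<phi> \<longlongrightarrow> 0) at_infinity"
proof -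
 obtain S where S: "compact S" "\<And>x. x \<notin> S ==> \<phi> x = 0" "smooth_on UNIV \<phi>" using test_funE[OF assms] by metis
 have i: "integrable lborel (\<lambda>z. \<bar>\<phi> z\<bar>)" and [measurable]: "\<phi> \<in> borel_measurable borel"
  using test_fun_integrable(1,3)[OF assms] by auto
 have il: "integrable lborel (\<lambda>h. \<bar>\<phi> (p \<star> h)\<bar>)" "(LINT h|lborel. \<bar>\<phi> (p \<star> h)\<bar>) = (LINT h|lborel. \<bar>\<phi> h\<bar>)" for p
  using T.integral_left(1,2)[of "\<lambda>z. \<bar>\<phi> z\<bar>" p] i by auto
 show "(potA \<phi> \<longlongrightarrow> 0) at_infinity"
  unfolding potA_def[abs_def]
 proof (rule potential_vanishes[where c=\<gamma> and \<psi>=\<phi> and \<Theta>="\<lambda>p h. p \<star> h", OF gam_infty S(2) il])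
  fix R :: real
  have "compact {a \<star> b | a b. a \<in> S \<and> b \<in> ti ` cball 0 R}" by (intro compact_mul S(1) compact_inv compact_cball)
  from bounded_iff[THEN iffD1, OF compact_imp_bounded[OF this]]
  obtain B where B: "\<forall>x\<in>{a \<star> b | a b. a \<in> S \<and> b \<in> ti ` cball 0 R}. norm x \<le> B" ..
  have "R \<le> norm h" if "B + 1 \<le> norm p" "p \<star> h \<in> S" for p h
  proof (rule ccontr)
   assume "\<not> R \<le> norm h"
   then have "ti h \<in> ti ` cball 0 R" by auto
   moreover have "p = (p \<star> h) \<star> ti h" by simp
   ultimately have "norm p \<le> B" using B that(2) by blast
   then show False using that(1) by simp
  qed
  then show "\<exists>R'. \<forall>p. R' \<le> norm p \<longrightarrow> (\<forall>h. p \<star> h \<in> S \<longrightarrow> R \<le> norm h)" by blast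
 qed
 have ir: "integrable lborel (\<lambda>h. \<bar>\<phi> (p \<star> ti h)\<bar>)" "(LINT h|lborel. \<bar>\<phi> (p \<star> ti h)\<bar>) = (LINT h|lborel. \<bar>\<phi> h\<bar>)" for p
  using T.integral_inv(1,2)[of "\<lambda>z. \<bar>\<phi> (p \<star> z)\<bar>"] il[of p] by auto
 show "(potB \<phi> \<longlongrightarrow> 0) at_infinity"
  unfolding potB_def[abs_def]
 proof (rule potential_vanishes[where c=\<gamma> and \<psi>=\<phi> and \<Theta>="\<lambda>p h. p \<star> ti h", OF gam_infty S(2) ir])
  fix R :: real
  have "compact {a \<star> b | a b. a \<in> S \<and> b \<in> cball 0 R}" by (intro compact_mul S(1) compact_cball)
  from bounded_iff[THEN iffD1, OF compact_imp_bounded[OF this]]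
  obtain B where B: "\<forall>x\<in>{a \<star> b | a b. a \<in> S \<and> b \<in> cball 0 R}. norm x \<le> B" ..
  have "R \<le> norm h" if "B + 1 \<le> norm p" "p \<star> ti h \<in> S" for p h
  proof (rule ccontr)
   assume "\<not> R \<le> norm h"
   then have "h \<in> cball 0 R" by auto
   moreover have "p = (p \<star> ti h) \<star> h" by simp
   ultimately have "norm p \<le> B" using B that(2) by blast
   then show False using that(1) by simp
  qed
  then show "\<exists>R'. \<forall>p. R' \<le> norm p \<longrightarrow> (\<forall>h. p \<star> ti h \<in> S \<longrightarrow> R \<le> norm h)" by blast
 qed
qed

text \<open>The operator commutes with the left translation by \<open>z\<close>, so the equation at
  the origin can be applied to the translated test function.\<close>

lemma potA_heat:
 assumes "test_fun \<psi>"
 shows "potA (heat (-1) \<psi>) z = - \<psi> z"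
proof -
 have s: "smooth_on UNIV \<psi>" using test_funE[OF assms] by metis
 have "- \<psi> z = (LINT h|lborel. \<gamma> h * heat (-1) (\<lambda>y. \<psi> (z \<star> y)) h)"
  using gam_fund[OF test_fun_left[OF assms, of z]] by simp
 also have "\<dots> = (LINT h|lborel. heat (-1) \<psi> (z \<star> h) * \<gamma> h)"
  by (simp add: heat_left[OF open_UNIV UNIV_I smooth_onD(1)[OF s]] mult.commute)
 finally show ?thesis by (simp add: potA_def)
qed

text \<open>Fubini, with a right translation in between. Whenever both test functions contribute,
  \<open>h\<close> lies in a fixed compact set, so local integrability of \<open>\<gamma>\<close>
  justifies both exchanges.\<close>

lemma potB_weak:
 assumes \<phi>: "test_fun \<phi>" and \<rho>: "test_fun \<rho>"
 shows "(LINT \<zeta>|lborel. potB \<phi> \<zeta> * \<rho> \<zeta>) = (LINT z|lborel. \<phi> z * potA \<rho> z)"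
proof -
 obtain S where S: "compact S" "\<And>x. x \<notin> S ==> \<phi> x = 0" using test_funE[OF \<phi>] by metis
 obtain R where R: "compact R" "\<And>x. x \<notin> R ==> \<rho> x = 0" using test_funE[OF \<rho>] by metis
 obtain C where C: "C \<ge> 0" "\<And>x. \<bar>\<phi> x\<bar> \<le> C" using test_fun_integrable(2)[OF \<phi>] by blast
 obtain D where D: "D \<ge> 0" "\<And>x. \<bar>\<rho> x\<bar> \<le> D" using test_fun_integrable(2)[OF \<rho>] by blast
 have [measurable]: "\<phi> \<in> borel_measurable borel" "\<rho> \<in> borel_measurable borel"
  using test_fun_integrable(3) \<phi> \<rho> by auto
 define K where "K = {a \<star> b | a b. a \<in> ti ` S \<and> b \<in> R}"
 have K: "compact K" unfolding K_def by (intro compact_mul compact_inv S(1) R(1))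
 have iK: "integrable lborel (\<lambda>h. c * \<bar>indicator K h *\<^sub>R \<gamma> h\<bar>)" for c
  using gam_locint K by (intro integrable_mult_right integrable_abs) (auto simp: loc_int_def set_integrable_def)
 have ia: "integrable lborel (\<lambda>h. \<bar>\<rho> h\<bar>)" "integrable lborel (\<lambda>h. \<bar>\<phi> h\<bar>)"
  using test_fun_integrable(1) \<phi> \<rho> by auto
 have "(LINT \<zeta>|lborel. potB \<phi> \<zeta> * \<rho> \<zeta>) = (LINT \<zeta>|lborel. LINT h|lborel. \<phi> (\<zeta> \<star> ti h) * \<gamma> h * \<rho> \<zeta>)"
  by (simp add: potB_def)
 also have "\<dots> = (LINT h|lborel. LINT \<zeta>|lborel. \<phi> (\<zeta> \<star> ti h) * \<gamma> h * \<rho> \<zeta>)"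
 proof (rule fubini_curried[OF _ ia(1) iK[of C]])
  show "(\<lambda>z. \<phi> (fst z \<star> ti (snd z)) * \<gamma> (snd z) * \<rho> (fst z)) \<in> borel_measurable borel"
   by (subst borel_prod[symmetric]) measurable
  show "\<bar>\<phi> (\<zeta> \<star> ti h) * \<gamma> h * \<rho> \<zeta>\<bar> \<le> \<bar>\<rho> \<zeta>\<bar> * (C * \<bar>indicator K h *\<^sub>R \<gamma> h\<bar>)" for \<zeta> h
  proof (cases "\<zeta> \<star> ti h \<in> S \<and> \<zeta> \<in> R")
   case True
   have "h = ti (\<zeta> \<star> ti h) \<star> \<zeta>" by (simp add: T.assoc)
   then have "h \<in> K" using True unfolding K_def by blast
   then show ?thesis using mult_right_mono[OF C(2)[of "\<zeta> \<star> ti h"], of "\<bar>\<gamma> h\<bar> * \<bar>\<rho> \<zeta>\<bar>"]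
    by (simp add: abs_mult mult_ac)
  next
   case False
   then have "\<phi> (\<zeta> \<star> ti h) * \<rho> \<zeta> = 0" using S(2)[of "\<zeta> \<star> ti h"] R(2)[of \<zeta>] by auto
   then have zero: "\<phi> (\<zeta> \<star> ti h) * \<gamma> h * \<rho> \<zeta> = 0" by auto
   show ?thesis unfolding zero using C(1) by simp
  qed
 qed
 also have "\<dots> = (LINT h|lborel. LINT z|lborel. \<phi> z * \<gamma> h * \<rho> (z \<star> h))"
 proof (rule Bochner_Integration.integral_cong[OF refl])
  fix h
  have "(LINT z|lborel. \<phi> ((z \<star> h) \<star> ti h) * \<gamma> h * \<rho> (z \<star> h)) = (LINT \<zeta>|lborel. \<phi> (\<zeta> \<star> ti h) * \<gamma> h * \<rho> \<zeta>)"
   by (rule T.integral_right(1)) measurable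
  then show "(LINT \<zeta>|lborel. \<phi> (\<zeta> \<star> ti h) * \<gamma> h * \<rho> \<zeta>) = (LINT z|lborel. \<phi> z * \<gamma> h * \<rho> (z \<star> h))" by simp
 qed
 also have "\<dots> = (LINT z|lborel. LINT h|lborel. \<phi> z * \<gamma> h * \<rho> (z \<star> h))"
 proof (rule fubini_curried[OF _ iK[of D] ia(2)])
  show "(\<lambda>z. \<phi> (snd z) * \<gamma> (fst z) * \<rho> (snd z \<star> fst z)) \<in> borel_measurable borel"
   by (subst borel_prod[symmetric]) measurable
  show "\<bar>\<phi> z * \<gamma> h * \<rho> (z \<star> h)\<bar> \<le> D * \<bar>indicator K h *\<^sub>R \<gamma> h\<bar> * \<bar>\<phi> z\<bar>" for z h
  proof (cases "z \<in> S \<and> z \<star> h \<in> R")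
   case True
   have "h = ti z \<star> (z \<star> h)" by simp
   then have "h \<in> K" using True unfolding K_def by blast
   then show ?thesis using mult_right_mono[OF D(2)[of "z \<star> h"], of "\<bar>\<gamma> h\<bar> * \<bar>\<phi> z\<bar>"]
    by (simp add: abs_mult mult_ac)
  next
   case False
   then have "\<phi> z * \<rho> (z \<star> h) = 0" using S(2)[of z] R(2)[of "z \<star> h"] by auto
   then have zero: "\<phi> z * \<gamma> h * \<rho> (z \<star> h) = 0" by auto
   show ?thesis unfolding zero using D(1) by simp
  qed
 qed
 also have "\<dots> = (LINT z|lborel. \<phi> z * potA \<rho> z)"
  by (simp add: potA_def mult_ac integral_mult_right_zero[symmetric] del: integral_mult_right_zero)
 finally show ?thesis .
qed

lemma weak_zero:
 assumes "continuous_on UNIV g" "\<And>\<psi>. test_fun \<psi> ==> (LINT z|lborel. g z * \<psi> z) = 0"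
 shows "g z = (0::real)"
proof (rule ccontr)
 assume nz: "g z \<noteq> 0"
 define f where "f y = sgn (g z) * g y" for y
 have c: "continuous_on UNIV f" unfolding f_def by (intro continuous_intros assms(1))
 have "f z > 0" using nz by (simp add: f_def sgn_if)
 from test_fun_detect[OF open_UNIV c borel_measurable_continuous_onI[OF c] UNIV_I this]
 obtain \<psi> where p: "test_fun \<psi>" "(LINT x|lborel. f x * \<psi> x) > 0" by metis
 then show False using assms(2)[OF p(1)] by (simp add: f_def mult.assoc)
qed

text \<open>The operator is left-invariant but not right-invariant, so it cannot simply be moved
  onto \<open>\<phi> (\<zeta> \<star> ti h)\<close> under the integral. It is instead transferred to
  a test function, carried over to \<open>potA\<close> by duality, and evaluated there.\<close>

lemma potB_heat:
 assumes "test_fun \<phi>"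
 shows "heat 1 (potB \<phi>) z = - \<phi> z"
proof -
 have s: "smooth_on UNIV \<phi>" using test_funE[OF assms] by metis
 have sH: "smooth_on UNIV (heat 1 (potB \<phi>))" by (rule smooth_on_heat_op[OF open_UNIV pot_smooth(1)[OF assms] Zs_smooth])
 have "heat 1 (potB \<phi>) z + \<phi> z = 0"
 proof (rule weak_zero[where g="\<lambda>z. heat 1 (potB \<phi>) z + \<phi> z"])
  show "continuous_on UNIV (\<lambda>z. heat 1 (potB \<phi>) z + \<phi> z)"
   by (rule smooth_onD(4)[OF smooth_on_add[OF open_UNIV sH s]])
  fix \<psi> :: "real \<times> 'g => real" assume \<psi>: "test_fun \<psi>"
  have "(LINT z|lborel. heat 1 (potB \<phi>) z * \<psi> z) = (LINT z|lborel. potB \<phi> z * heat (-1) \<psi> z)"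
   using integration_by_parts[OF pot_smooth(1)[OF assms] \<psi>, of "-1"] by simp
  also have "\<dots> = (LINT z|lborel. \<phi> z * potA (heat (-1) \<psi>) z)"
   by (rule potB_weak[OF assms test_fun_heat_op[OF \<psi> Zs_smooth]])
  also have "\<dots> = - (LINT z|lborel. \<phi> z * \<psi> z)" by (simp add: potA_heat[OF \<psi>])
  finally have "(LINT z|lborel. heat 1 (potB \<phi>) z * \<psi> z) + (LINT z|lborel. \<phi> z * \<psi> z) = 0" by simp
  then show "(LINT z|lborel. (heat 1 (potB \<phi>) z + \<phi> z) * \<psi> z) = 0"
   using integrable_times_test[OF sH \<psi>] integrable_times_test[OF s \<psi>] by (simp add: distrib_right)
 qed
 then show ?thesis by simp
qed

end

section \<open>Properties of the fundamental solution on the group\<close>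

lemma test_fun_lim:
 assumes "test_fun \<phi>"
 shows "(\<phi> \<longlongrightarrow> 0) at_infinity"
proof -
 obtain K where K: "compact K" "\<And>x. x \<notin> K ==> \<phi> x = 0" using test_funE[OF assms] by metis
 from bounded_iff[THEN iffD1, OF compact_imp_bounded[OF K(1)]] obtain B where B: "\<forall>x\<in>K. norm x \<le> B" ..
 have "\<phi> x = 0" if "B + 1 \<le> norm x" for x using B K(2)[of x] that by force
 then have "\<forall>\<^sub>F x in at_infinity. \<phi> x = 0" unfolding eventually_at_infinity by blast
 then show ?thesis by (rule tendsto_eventually)
qed

context heat_group
begin

abbreviation Q where "Q \<equiv> hdim w"

lemma integrable_loc_test:
 assumes "loc_int f" "test_fun \<psi>"
 shows "integrable lborel (\<lambda>h. f h * \<psi> h)"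
proof -
 obtain K where K: "compact K" "\<And>x. x \<notin> K ==> \<psi> x = 0" using test_funE[OF assms(2)] by metis
 obtain C where C: "C \<ge> 0" "\<And>x. \<bar>\<psi> x\<bar> \<le> C" using test_fun_integrable(2)[OF assms(2)] by blast
 have i: "integrable lborel (\<lambda>h. indicator K h *\<^sub>R f h)"
  using assms(1) K(1) by (simp add: loc_int_def set_integrable_def)
 have "(\<lambda>h. (indicator K h *\<^sub>R f h) * \<psi> h) = (\<lambda>h. f h * \<psi> h)"
 proof (rule ext)
  show "(indicator K h *\<^sub>R f h) * \<psi> h = f h * \<psi> h" for h by (cases "h \<in> K") (simp_all add: K(2))
 qed
 moreover have "integrable lborel (\<lambda>h. (indicator K h *\<^sub>R f h) * \<psi> h)"
 proof (rule Bochner_Integration.integrable_bound[OF integrable_mult_right[OF i, of C]])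
  show "(\<lambda>h. (indicator K h *\<^sub>R f h) * \<psi> h) \<in> borel_measurable lborel"
   using borel_measurable_integrable[OF i] test_fun_integrable(3)[OF assms(2)] by (intro borel_measurable_times) auto
  have "norm ((indicator K h *\<^sub>R f h) * \<psi> h) \<le> norm (C * (indicator K h *\<^sub>R f h))" for h
   using C(1) mult_left_mono[OF C(2)[of h], of "\<bar>indicator K h *\<^sub>R f h\<bar>"] by (simp add: abs_mult mult_ac)
  then show "AE h in lborel. norm ((indicator K h *\<^sub>R f h) * \<psi> h) \<le> norm (C * (indicator K h *\<^sub>R f h))" by simp
 qed
 ultimately show ?thesis by simp
qed

lemma open_off_zero: "open (UNIV - {0 :: real \<times> 'g})"
 by auto

text \<open>Every pairing of \<open>\<gamma>\<close> with a test function is the value of a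
  potential at the identity. In this way maximum principles for potentials become statements about
  \<open>\<gamma>\<close>.\<close>

lemma integral_gam_test: "(LINT h|lborel. \<gamma> h * \<psi> h) = potB (\<lambda>z. \<psi> (ti z)) 0"
 by (simp add: potB_def mult.commute)

lemma potB_nonneg:
 assumes "test_fun \<phi>" "\<And>z. \<phi> z \<ge> 0"
 shows "potB \<phi> z \<ge> 0"
 by (rule vanishing_supersolution_nonneg[OF Zs_smooth smooth_onD(1)[OF pot_smooth(1)[OF assms(1)]] pot_lim(1)[OF assms(1)], of "fst z"])
  (use assms in \<open>simp_all add: potB_heat\<close>)

lemma gam_nonneg: "z \<noteq> 0 ==> \<gamma> z \<ge> 0"
proof (rule ccontr)
 assume z: "z \<noteq> 0" "\<not> \<gamma> z \<ge> 0"
 have "continuous_on (UNIV - {0}) (\<lambda>z. - \<gamma> z)" by (intro continuous_intros gam_cont)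
 moreover have "z \<in> UNIV - {0}" "0 < - \<gamma> z" using z by auto
 ultimately obtain \<psi> where p: "test_fun \<psi>" "\<And>x. \<psi> x \<ge> 0" "(LINT x|lborel. - \<gamma> x * \<psi> x) > 0"
  using test_fun_detect[OF open_off_zero _ measurable_off_point] by blast
 have "potB (\<lambda>z. \<psi> (ti z)) 0 \<ge> 0" by (rule potB_nonneg) (use p test_fun_inv in auto)
 then show False using p(3) by (simp add: integral_gam_test[symmetric])
qed

text \<open>A test function living in negative time becomes, after inversion, a source in positive
  time. Its potential solves the homogeneous equation up to time 0 and vanishes at infinity, hence
  is 0 at the origin. The slice at time 0 follows by continuity off the pole.\<close>

lemma gam_zero: "z \<noteq> 0 ==> fst z \<le> 0 ==> \<gamma> z = 0"
proof -
 have neg: "\<gamma> z = 0" if z: "fst z < 0" for z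
 proof (rule ccontr)
  assume "\<gamma> z \<noteq> 0"
  moreover have "z \<noteq> 0" using z by auto
  ultimately have pos: "\<gamma> z > 0" using gam_nonneg[of z] by simp
  have U: "open {z :: real \<times> 'g. fst z < 0}" by (intro open_Collect_less continuous_intros)
  have c: "continuous_on {z. fst z < 0} \<gamma>" by (rule continuous_on_subset[OF gam_cont]) auto
  have zU: "z \<in> {z. fst z < 0}" using z by simp
  obtain \<psi> where p: "test_fun \<psi>" "\<And>x. \<psi> x \<noteq> 0 ==> x \<in> {z. fst z < 0}" "(LINT x|lborel. \<gamma> x * \<psi> x) > 0"
   using test_fun_detect[OF U c gam_meas zU pos] by metis
  have t: "test_fun (\<lambda>z. \<psi> (ti z))" by (rule test_fun_inv[OF p(1)])
  have "potB (\<lambda>z. \<psi> (ti z)) 0 = 0"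
  proof (rule vanishing_solution_zero[OF Zs_smooth smooth_onD(1)[OF pot_smooth(1)[OF t]] pot_lim(1)[OF t], of 0])
   fix y :: "real \<times> 'g" assume "fst y \<le> 0"
   then have "\<not> fst (ti y) < 0" by (simp add: tinv_def)
   then have "\<psi> (ti y) = 0" using p(2)[of "ti y"] by blast
   then show "heat 1 (potB (\<lambda>z. \<psi> (ti z))) y = 0" by (simp only: potB_heat[OF t] neg_equal_0_iff_equal)
  qed simp
  then show False using p(3) by (simp add: integral_gam_test)
 qed
 assume z: "z \<noteq> 0" "fst z \<le> 0"
 show ?thesis
 proof (cases "fst z < 0")
  case False
  then have z0: "z = (0, snd z)" using z(2) by (simp add: prod_eq_iff)
  have "isCont \<gamma> z" using gam_cont z(1) continuous_on_eq_continuous_at[OF open_off_zero] by blast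
  moreover have "(\<lambda>n. (- inverse (real (Suc n)), snd z)) \<longlonglongrightarrow> (- 0, snd z)"
   by (intro tendsto_Pair tendsto_minus LIMSEQ_inverse_real_of_nat tendsto_const)
  ultimately have "(\<lambda>n. \<gamma> (- inverse (real (Suc n)), snd z)) \<longlonglongrightarrow> \<gamma> z"
   using z0 isCont_tendsto_compose[of z \<gamma>] by (metis neg_equal_0_iff_equal)
  moreover have "\<gamma> (- inverse (real (Suc n)), snd z) = 0" for n by (rule neg) simp
  ultimately show ?thesis by (simp add: LIMSEQ_const_iff)
 qed (rule neg)
qed

lemma off_zero_eqI:
 fixes f g :: "real \<times> 'g => real"
 assumes "continuous_on (UNIV - {0}) f" "continuous_on (UNIV - {0}) g" "loc_int f" "loc_int g"
  and eq: "\<And>\<psi>. test_fun \<psi> ==> (LINT h|lborel. f h * \<psi> h) = (LINT h|lborel. g h * \<psi> h)" and z: "z \<noteq> 0"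
 shows "f z = g z"
proof -
 have le: "f z \<le> g z" if "continuous_on (UNIV - {0}) f" "continuous_on (UNIV - {0}) g" "loc_int f" "loc_int g"
  "\<And>\<psi>. test_fun \<psi> ==> (LINT h|lborel. f h * \<psi> h) = (LINT h|lborel. g h * \<psi> h)" for f g :: "real \<times> 'g => real"
 proof (rule ccontr)
  assume n: "\<not> f z \<le> g z"
  have c: "continuous_on (UNIV - {0}) (\<lambda>z. f z - g z)" by (intro continuous_intros that)
  have "z \<in> UNIV - {0}" "0 < f z - g z" using n z by auto
  then obtain \<psi> where p: "test_fun \<psi>" "(LINT x|lborel. (f x - g x) * \<psi> x) > 0"
   using test_fun_detect[OF open_off_zero c measurable_off_point[OF c]] by blast
  have "(LINT x|lborel. (f x - g x) * \<psi> x) = (LINT h|lborel. f h * \<psi> h) - (LINT h|lborel. g h * \<psi> h)"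
   using integrable_loc_test[OF that(3) p(1)] integrable_loc_test[OF that(4) p(1)] by (simp add: left_diff_distrib)
  then show False using p that(5)[OF p(1)] by simp
 qed
 show ?thesis by (rule antisym; rule le) (use assms in auto)
qed

text \<open>Serves to identify \<open>\<gamma>\<close> with a rescaled copy of itself: the two
  potentials of one test function differ by a vanishing solution without source.\<close>

lemma gam_unique:
 assumes "heat_group mul ginv \<delta> w m Zs \<gamma>'" "z \<noteq> 0"
 shows "\<gamma>' z = \<gamma> z"
proof -
 interpret G: heat_group mul ginv \<delta> w m Zs \<gamma>' by (rule assms(1))
 show ?thesis
 proof (rule off_zero_eqI[OF G.gam_cont gam_cont G.gam_locint gam_locint _ assms(2)])
  fix \<psi> :: "real \<times> 'g => real" assume "test_fun \<psi>"
  then have t: "test_fun (\<lambda>z. \<psi> (ti z))" by (rule test_fun_inv)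
  define u where "u z = 1 * G.potB (\<lambda>z. \<psi> (ti z)) z + (- 1) * potB (\<lambda>z. \<psi> (ti z)) z" for z
  have C: "C_k_on 2 UNIV (G.potB (\<lambda>z. \<psi> (ti z)))" "C_k_on 2 UNIV (potB (\<lambda>z. \<psi> (ti z)))"
   using G.pot_smooth(1)[OF t] pot_smooth(1)[OF t] smooth_onD(1) by blast+
  have "u 0 = 0"
  proof (rule vanishing_solution_zero[OF Zs_smooth, of u 0])
   show "C_k_on 2 UNIV u" unfolding u_def by (intro C_k_on_add C_k_on_cmult C open_UNIV)
   have "(u \<longlongrightarrow> 1 * 0 + (- 1) * 0) at_infinity" unfolding u_def
    by (intro tendsto_intros G.pot_lim pot_lim t)
   then show "(u \<longlongrightarrow> 0) at_infinity" by simp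
   show "heat 1 u y = 0" for y unfolding u_def
    by (subst heat_op_cmult_add[OF open_UNIV UNIV_I C Zs_smooth]) (simp add: potB_heat[OF t] G.potB_heat[OF t])
  qed simp
  then show "(LINT h|lborel. \<gamma>' h * \<psi> h) = (LINT h|lborel. \<gamma> h * \<psi> h)"
   by (simp add: u_def integral_gam_test G.integral_gam_test)
 qed
qed

lemma tdil_nz: "l > 0 ==> z \<noteq> 0 ==> tdil \<delta> l z \<noteq> 0"
 using dilation_inverse(2)[OF T.dil] dilation_0[OF T.dil, of "1/l"] by (metis zero_less_divide_1_iff)

text \<open>The rescaled function satisfies the same axioms and so equals \<open>\<gamma>\<close>.
  The exponent arises from the volume factor \<open>l powr (Q + 2)\<close> of the space-time
  dilation against the factor \<open>1 / l\<^sup>2\<close> from the operator.\<close>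

lemma gam_homog: "homog (tdil \<delta>) (- Q) (UNIV - {0}) \<gamma>"
 unfolding homog_def
proof (intro allI impI ballI conjI)
 fix l :: real and z :: "real \<times> 'g" assume l: "l > 0" and z: "z \<in> UNIV - {0}"
 show "tdil \<delta> l z \<in> UNIV - {0}" using tdil_nz[OF l] z by simp
 define \<gamma>' where "\<gamma>' z = l powr Q * \<gamma> (tdil \<delta> l z)" for z
 have l1: "1 / l > 0" using l by simp
 have bl: "bounded_linear (tdil \<delta> l)" by (rule dilation_bounded_linear[OF T.dil l])
 have bl1: "bounded_linear (tdil \<delta> (1 / l))" by (rule dilation_bounded_linear[OF T.dil l1])
 have "heat_group mul ginv \<delta> w m Zs \<gamma>'"
 proof
  have "smooth_on (UNIV - {0}) (\<lambda>z. \<gamma> (tdil \<delta> l z))"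
   by (rule smooth_on_compose_map[OF _ smooth_map_linear[OF bl] gam_smooth]) (use tdil_nz[OF l] in auto)
  then show "smooth_on (UNIV - {0}) \<gamma>'" unfolding \<gamma>'_def
   by (intro smooth_on_mult smooth_on_const) auto
  show "loc_int \<gamma>'" unfolding loc_int_def set_integrable_def
  proof (intro allI impI)
   fix K :: "(real \<times> 'g) set" assume K: "compact K"
   have cK: "compact (tdil \<delta> l ` K)" by (intro compact_continuous_image K linear_continuous_on bl)
   define f where "f y = indicator (tdil \<delta> l ` K) y *\<^sub>R \<gamma> y" for y
   have fi: "integrable lborel f" unfolding f_def using gam_locint cK by (simp add: loc_int_def set_integrable_def)
   have fm: "f \<in> borel_measurable borel" using borel_measurable_integrable[OF fi] by simp
   have "inj (tdil \<delta> l)" using dilation_inverse(2)[OF T.dil l] by (metis injI)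
   then have "f (tdil \<delta> l x) = indicator K x *\<^sub>R \<gamma> (tdil \<delta> l x)" for x
    by (auto simp: f_def indicator_def dest: injD)
   then have "integrable lborel (\<lambda>x. indicator K x *\<^sub>R \<gamma> (tdil \<delta> l x))"
    using integral_dilation(2)[OF T.dil l fm] fi by simp
   from integrable_mult_right[OF this, of "l powr Q"]
   show "integrable lborel (\<lambda>x. indicator K x *\<^sub>R \<gamma>' x)" by (simp add: \<gamma>'_def mult_ac)
  qed
  fix \<phi> :: "real \<times> 'g => real" assume \<phi>: "test_fun \<phi>"
  obtain S where S: "compact S" "\<And>x. x \<notin> S ==> \<phi> x = 0" "smooth_on UNIV \<phi>" using test_funE[OF \<phi>] by metis
  define \<rho> where "\<rho> y = \<phi> (tdil \<delta> (1 / l) y)" for y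
  have \<rho>: "test_fun \<rho>"
  proof (rule test_funI')
   show "smooth_on UNIV \<rho>" unfolding \<rho>_def
    by (rule smooth_on_compose_map[OF open_UNIV smooth_map_linear[OF bl1] S(3)]) simp
   show "compact (tdil \<delta> l ` S)" by (intro compact_continuous_image S(1) linear_continuous_on bl)
   show "y \<in> tdil \<delta> l ` S" if "\<rho> y \<noteq> 0" for y
    using that S(2)[of "tdil \<delta> (1 / l) y"] dilation_inverse(1)[OF T.dil l, of y] unfolding \<rho>_def by (metis imageI)
  qed
  have h\<rho>: "heat (-1) \<rho> y = (1 / l)\<^sup>2 * heat (-1) \<phi> (tdil \<delta> (1 / l) y)" for y
   unfolding \<rho>_def by (rule heat_dil[OF open_UNIV UNIV_I smooth_onD(1)[OF S(3)] l1])
  have m: "(\<lambda>y. \<gamma> y * heat (-1) \<rho> y) \<in> borel_measurable borel"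
   using test_fun_integrable(3)[OF test_fun_heat_op[OF \<rho> Zs_smooth]] by measurable
  have "- \<phi> 0 = (LINT y|lborel. \<gamma> y * heat (-1) \<rho> y)"
   using gam_fund[OF \<rho>] dilation_0[OF T.dil l1] by (simp add: \<rho>_def)
  also have "\<dots> = l powr hdim (twt w) * (LINT x|lborel. \<gamma> (tdil \<delta> l x) * heat (-1) \<rho> (tdil \<delta> l x))"
   by (rule integral_dilation(1)[OF T.dil l m])
  also have "\<dots> = l powr hdim (twt w) * (LINT x|lborel. (1 / l)\<^sup>2 * (\<gamma> (tdil \<delta> l x) * heat (-1) \<phi> x))"
   by (simp only: h\<rho> dilation_inverse(2)[OF T.dil l] mult.left_commute)
  also have "\<dots> = (l powr hdim (twt w) * (1 / l)\<^sup>2) * (LINT x|lborel. \<gamma> (tdil \<delta> l x) * heat (-1) \<phi> x)"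
   by simp
  also have "l powr hdim (twt w) * (1 / l)\<^sup>2 = l powr Q"
   using l by (simp add: hdim_wprod hdim_real powr_add powr_numeral power_divide)
  also have "l powr Q * (LINT x|lborel. \<gamma> (tdil \<delta> l x) * heat (-1) \<phi> x) = (LINT x|lborel. \<gamma>' x * heat (-1) \<phi> x)"
   by (simp add: \<gamma>'_def mult.assoc)
  finally show "(LINT \<zeta>|lborel. \<gamma>' \<zeta> * heat (-1) \<phi> \<zeta>) = - \<phi> 0" by simp
 next
  have "filterlim (tdil \<delta> l) at_infinity at_infinity"
   unfolding filterlim_at_infinity[OF order_refl]
  proof (intro allI impI)
   fix r :: real assume "r > 0"
   have "bounded (tdil \<delta> (1 / l) ` cball 0 r)" by (intro bounded_linear_image bounded_cball bl1)
   from bounded_iff[THEN iffD1, OF this] obtain B where B: "\<forall>x\<in>tdil \<delta> (1 / l) ` cball 0 r. norm x \<le> B" ..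
   have "r \<le> norm (tdil \<delta> l x)" if "B + 1 \<le> norm x" for x
   proof (rule ccontr)
    assume "\<not> r \<le> norm (tdil \<delta> l x)"
    then have "norm (tdil \<delta> (1 / l) (tdil \<delta> l x)) \<le> B" using B by auto
    then show False using that by (simp add: dilation_inverse(2)[OF T.dil l])
   qed
   then show "\<forall>\<^sub>F x in at_infinity. r \<le> norm (tdil \<delta> l x)" unfolding eventually_at_infinity by blast
  qed
  from filterlim_compose[OF gam_infty this]
  have "((\<lambda>x. l powr Q * \<gamma> (tdil \<delta> l x)) \<longlongrightarrow> l powr Q * 0) at_infinity" by (intro tendsto_intros)
  then show "(\<gamma>' \<longlongrightarrow> 0) at_infinity" by (simp add: \<gamma>'_def[abs_def])
 qed (use Zs_smooth Zs_left Zs_hom in auto)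
 from gam_unique[OF this, of z] z have "l powr Q * \<gamma> (tdil \<delta> l z) = \<gamma> z" by (simp add: \<gamma>'_def)
 then show "\<gamma> (tdil \<delta> l z) = l powr (- Q) * \<gamma> z" using l by (simp add: powr_minus field_simps)
qed

lemma heat_reflect:
 assumes "open W" "(- fst z, snd z) \<in> W" "C_k_on 2 W u"
 shows "heat e (\<lambda>z. u (- fst z, snd z)) z = heat (- e) u (- fst z, snd z)"
proof -
 have "heat e (\<lambda>z. u (-1 * fst z + 0, snd z)) z = 1\<^sup>2 * heat (- e) u (-1 * fst z + 0, snd z)"
  by (rule heat_op_related[OF assms(1) _ assms(3) smooth_map_ident Zs_smooth])
   (use assms(2) in \<open>auto simp: frechet_derivative_eqI[OF has_derivative_ident]\<close>)
 then show ?thesis by simp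
qed

lemma smooth_map_reflect: "smooth_map (\<lambda>z::real \<times> 'g. (- fst z, snd z))"
 by (intro smooth_map_Pair smooth_map_snd smooth_map_linear bounded_linear_minus bounded_linear_fst)

text \<open>The mirror image of \<open>potB_heat\<close>. Here
  \<open>potB (heat 1 \<phi>) = - \<phi>\<close> comes from uniqueness, since both sides vanish at
  infinity and have the same image under the operator; duality then transfers it.\<close>

lemma potA_heat':
 assumes \<psi>: "test_fun \<psi>"
 shows "heat (-1) (potA \<psi>) z = - \<psi> z"
proof -
 have s\<psi>: "smooth_on UNIV \<psi>" using test_funE[OF \<psi>] by metis
 have BH: "potB (heat 1 \<phi>) z = - \<phi> z" if \<phi>: "test_fun \<phi>" for \<phi> z
 proof -
  have s: "smooth_on UNIV \<phi>" using test_funE[OF \<phi>] by metis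
  have t: "test_fun (heat 1 \<phi>)" by (rule test_fun_heat_op[OF \<phi> Zs_smooth])
  note C = smooth_onD(1)[OF pot_smooth(1)[OF t], of 2] smooth_onD(1)[OF s, of 2]
  have "1 * potB (heat 1 \<phi>) z + 1 * \<phi> z = 0"
  proof (rule vanishing_solution_zero[OF Zs_smooth, where T="fst z"])
   show "C_k_on 2 UNIV (\<lambda>z. 1 * potB (heat 1 \<phi>) z + 1 * \<phi> z)" by (intro C_k_on_add C_k_on_cmult C open_UNIV)
   have "((\<lambda>z. 1 * potB (heat 1 \<phi>) z + 1 * \<phi> z) \<longlongrightarrow> 1 * 0 + 1 * 0) at_infinity"
    by (intro tendsto_intros pot_lim t test_fun_lim \<phi>)
   then show "((\<lambda>z. 1 * potB (heat 1 \<phi>) z + 1 * \<phi> z) \<longlongrightarrow> 0) at_infinity" by simp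
   show "heat 1 (\<lambda>z. 1 * potB (heat 1 \<phi>) z + 1 * \<phi> z) y = 0" for y
    by (subst heat_op_cmult_add[OF open_UNIV UNIV_I C Zs_smooth]) (simp add: potB_heat[OF t])
  qed simp
  then show ?thesis by simp
 qed
 have sH: "smooth_on UNIV (heat (-1) (potA \<psi>))" by (rule smooth_on_heat_op[OF open_UNIV pot_smooth(2)[OF \<psi>] Zs_smooth])
 have "heat (-1) (potA \<psi>) z + \<psi> z = 0"
 proof (rule weak_zero[where g="\<lambda>z. heat (-1) (potA \<psi>) z + \<psi> z"])
  show "continuous_on UNIV (\<lambda>z. heat (-1) (potA \<psi>) z + \<psi> z)"
   by (rule smooth_onD(4)[OF smooth_on_add[OF open_UNIV sH s\<psi>]])
  fix \<phi> :: "real \<times> 'g => real" assume \<phi>: "test_fun \<phi>"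
  have "(LINT z|lborel. heat (-1) (potA \<psi>) z * \<phi> z) = (LINT z|lborel. potA \<psi> z * heat 1 \<phi> z)"
   using integration_by_parts[OF pot_smooth(2)[OF \<psi>] \<phi>, of 1] by simp
  also have "\<dots> = (LINT z|lborel. potB (heat 1 \<phi>) z * \<psi> z)"
   using potB_weak[OF test_fun_heat_op[OF \<phi> Zs_smooth] \<psi>] by (simp add: mult.commute)
  also have "\<dots> = - (LINT z|lborel. \<psi> z * \<phi> z)" by (simp add: BH[OF \<phi>] mult.commute)
  finally show "(LINT z|lborel. (heat (-1) (potA \<psi>) z + \<psi> z) * \<phi> z) = 0"
   using integrable_times_test[OF sH \<phi>] integrable_times_test[OF s\<psi> \<phi>] by (simp add: distrib_right)
 qed
 then show ?thesis by simp
qed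

text \<open>Expresses self-adjointness of the spatial part. After time reflection
  \<open>potA \<psi>\<close> solves the equation whose solution is \<open>potB\<close> of the
  reflected test function, so the two agree at the identity; this says that \<open>\<gamma>\<close>
  and its spatially inverted copy have equal pairings with all test functions.\<close>

lemma gam_sym: "(t, x) \<noteq> 0 ==> \<gamma> (t, ginv x) = \<gamma> (t, x)"
proof -
 assume nz: "(t, x) \<noteq> 0"
 define r where "r z = (fst z, ginv (snd z))" for z :: "real \<times> 'g"
 have rr: "r (r z) = z" for z by (simp add: r_def)
 have sr: "smooth_map r" unfolding r_def by (intro smooth_map_Pair smooth_map_fst smooth_map_inv smooth_map_snd)
 have r0: "r z \<noteq> 0 \<longleftrightarrow> z \<noteq> 0" for z
  by (metis rr r_def fst_zero snd_zero inv_simps(1) zero_prod_def)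
 have pr: "distr lborel borel r = lborel"
 proof (rule homog_family_preserves[OF T.dil T.dil, where \<Phi>="\<lambda>_. r" and \<Psi>="\<lambda>_. r" and c=0])
  show "smooth_map (\<lambda>z::(real \<times> 'g) \<times> (real \<times> 'g). r (snd z))" by (rule smooth_map_compose[OF sr smooth_map_snd])
  show "r (tdil \<delta> l a) = tdil \<delta> l (r a)" if "l > 0" for l a using inv_dil[OF that] by (simp add: r_def dprod_def)
 qed (simp_all add: rr smooth_mapD(3)[OF sr])
 note ir = preserved_integral[OF pr smooth_mapD(3)[OF sr]]
 have gr: "(\<lambda>h. \<gamma> (r h)) \<in> borel_measurable borel"
  using measurable_compose[OF smooth_mapD(3)[OF sr] gam_meas] .
 have "\<gamma> (r (t, x)) = \<gamma> (t, x)"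
 proof (rule off_zero_eqI[OF _ gam_cont _ gam_locint _ nz])
  show "continuous_on (UNIV - {0}) (\<lambda>z. \<gamma> (r z))"
   by (rule continuous_on_compose2[OF gam_cont smooth_mapD(2)[OF sr]]) (use r0 in auto)
  show "loc_int (\<lambda>z. \<gamma> (r z))" unfolding loc_int_def set_integrable_def
  proof (intro allI impI)
   fix K :: "(real \<times> 'g) set" assume "compact K"
   then have "compact (r ` K)" by (intro compact_continuous_image smooth_mapD(2)[OF sr])
   then have i: "integrable lborel (\<lambda>y. indicator (r ` K) y *\<^sub>R \<gamma> y)"
    using gam_locint by (simp add: loc_int_def set_integrable_def)
   have "r x \<in> r ` K \<longleftrightarrow> x \<in> K" for x by (metis rr imageE imageI)
   then have "indicator (r ` K) (r x) = (indicator K x :: real)" for x by (simp add: indicator_def)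
   then show "integrable lborel (\<lambda>x. indicator K x *\<^sub>R \<gamma> (r x))"
    using ir(2)[of "\<lambda>y. indicator (r ` K) y *\<^sub>R \<gamma> y"] borel_measurable_integrable[OF i] i by simp
  qed
  fix \<psi> :: "real \<times> 'g => real" assume \<psi>: "test_fun \<psi>"
  have s: "smooth_on UNIV \<psi>" using test_funE[OF \<psi>] by metis
  have [measurable]: "\<psi> \<in> borel_measurable borel" by (rule test_fun_integrable(3)[OF \<psi>])
  define \<rho> where "\<rho> z = \<psi> (- fst z, snd z)" for z
  have \<rho>: "test_fun \<rho>"
  proof -
   obtain S where S: "compact S" "\<And>x. x \<notin> S ==> \<psi> x = 0" using test_funE[OF \<psi>] by metis
   show ?thesis
   proof (rule test_funI')
    show "smooth_on UNIV \<rho>" unfolding \<rho>_def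
     by (rule smooth_on_compose_map[OF open_UNIV smooth_map_reflect s]) simp
    show "compact ((\<lambda>z. (- fst z, snd z)) ` S)" by (intro compact_continuous_image S(1) smooth_mapD(2)[OF smooth_map_reflect])
    show "z \<in> (\<lambda>z. (- fst z, snd z)) ` S" if "\<rho> z \<noteq> 0" for z
     using that S(2)[of "(- fst z, snd z)"] unfolding \<rho>_def by (force simp: image_iff)
   qed
  qed
  note CA = smooth_onD(1)[OF pot_smooth(2)[OF \<psi>], of 2]
  define A' where "A' z = potA \<psi> (- fst z, snd z)" for z
  have sA': "smooth_on UNIV A'" unfolding A'_def
   by (rule smooth_on_compose_map[OF open_UNIV smooth_map_reflect pot_smooth(2)[OF \<psi>]]) simp
  have hA': "heat 1 A' z = - \<rho> z" for z
   using heat_reflect[OF open_UNIV UNIV_I CA, of 1 z] potA_heat'[OF \<psi>] by (simp add: A'_def[abs_def] \<rho>_def)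
  note C = smooth_onD(1)[OF sA', of 2] smooth_onD(1)[OF pot_smooth(1)[OF \<rho>], of 2]
  have "1 * A' 0 + (- 1) * potB \<rho> 0 = 0"
  proof (rule vanishing_solution_zero[OF Zs_smooth, where T=0])
   show "C_k_on 2 UNIV (\<lambda>z. 1 * A' z + (- 1) * potB \<rho> z)" by (intro C_k_on_add C_k_on_cmult C open_UNIV)
   have "filterlim (\<lambda>z::real \<times> 'g. (- fst z, snd z)) at_infinity at_infinity"
    unfolding filterlim_at_infinity[OF order_refl]
    by (auto simp: eventually_at_infinity norm_prod_def)
   from filterlim_compose[OF pot_lim(2)[OF \<psi>] this]
   have "((\<lambda>z. 1 * A' z + (- 1) * potB \<rho> z) \<longlongrightarrow> 1 * 0 + (- 1) * 0) at_infinity"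
    unfolding A'_def by (intro tendsto_intros pot_lim \<rho>)
   then show "((\<lambda>z. 1 * A' z + (- 1) * potB \<rho> z) \<longlongrightarrow> 0) at_infinity" by simp
   show "heat 1 (\<lambda>z. 1 * A' z + (- 1) * potB \<rho> z) y = 0" for y
    by (subst heat_op_cmult_add[OF open_UNIV UNIV_I C Zs_smooth]) (simp add: potB_heat[OF \<rho>] hA')
  qed simp
  then have "potA \<psi> 0 = potB \<rho> 0" by (simp add: A'_def zero_prod_def)
  then have "(LINT h|lborel. \<gamma> h * \<psi> h) = (LINT h|lborel. \<gamma> h * \<psi> (r h))"
   by (simp add: potA_def potB_def \<rho>_def r_def tinv_def mult.commute)
  also have "\<dots> = (LINT h|lborel. \<gamma> (r (r h)) * \<psi> (r h))" by (simp add: rr)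
  also have "\<dots> = (LINT h|lborel. \<gamma> (r h) * \<psi> h)"
   by (rule ir(1)) (use gr in measurable)
  finally show "(LINT h|lborel. \<gamma> (r h) * \<psi> h) = (LINT h|lborel. \<gamma> h * \<psi> h)" by simp
 qed
 then show ?thesis by (simp add: r_def)
qed

section \<open>Time derivatives of the kernel and their spatial decay\<close>

fun gdt :: "nat => real \<times> 'g => real" where
 "gdt 0 = \<gamma>"
| "gdt (Suc j) = ddir (1, 0) (gdt j)"

lemma gdt_smooth: "smooth_on (UNIV - {0}) (gdt j)"
 by (induction j) (auto intro: gam_smooth smooth_onD(3))

lemma gdt_homog: "homog (tdil \<delta>) (- Q - 2 * real j) (UNIV - {0}) (gdt j)"
proof (induction j)
 case (Suc j)
 have "homog (tdil \<delta>) (- Q - 2 * real j - twt w (1, 0)) (UNIV - {0}) (ddir (1, 0) (gdt j))"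
  by (rule homog_ddir[OF T.dil _ Suc]) (auto intro: smooth_onD(2)[OF gdt_smooth] simp: Basis_prod_def)
 then show ?case by (simp add: wprod_def algebra_simps)
qed (simp add: gam_homog)

lemma gdt_zero: "z \<noteq> 0 ==> fst z \<le> 0 ==> gdt j z = 0"
proof (induction j arbitrary: z)
 case (Suc j)
 have neg: "gdt (Suc j) z = 0" if "fst z < 0" for z
 proof -
  have o: "open {z :: real \<times> 'g. fst z < 0}" by (intro open_Collect_less continuous_intros)
  have "frechet_derivative (gdt j) (at z) = frechet_derivative (\<lambda>_. 0) (at z)"
  proof (rule frechet_derivative_cong_open[OF o])
   show "gdt j y = 0" if "y \<in> {z. fst z < 0}" for y using that by (intro Suc.IH) auto
  qed (use that in simp)
  then show ?thesis by (simp add: frechet_derivative_const)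
 qed
 show ?case
 proof (cases "fst z < 0")
  case False
  then have z0: "z = (0, snd z)" using Suc.prems(2) by (simp add: prod_eq_iff)
  have "isCont (gdt (Suc j)) z"
   using smooth_onD(4)[OF gdt_smooth[of "Suc j"]] Suc.prems(1) continuous_on_eq_continuous_at[OF open_off_zero] by blast
  moreover have "(\<lambda>n. (- inverse (real (Suc n)), snd z)) \<longlonglongrightarrow> (- 0, snd z)"
   by (intro tendsto_Pair tendsto_minus LIMSEQ_inverse_real_of_nat tendsto_const)
  ultimately have "(\<lambda>n. gdt (Suc j) (- inverse (real (Suc n)), snd z)) \<longlonglongrightarrow> gdt (Suc j) z"
   using z0 isCont_tendsto_compose[of z "gdt (Suc j)"] by (metis neg_equal_0_iff_equal)
  moreover have "gdt (Suc j) (- inverse (real (Suc n)), snd z) = 0" for n by (rule neg) simp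
  ultimately show ?thesis by (simp add: LIMSEQ_const_iff)
 qed (rule neg)
qed (simp add: gam_zero)

lemma gdt_deriv: "(t, x) \<noteq> 0 ==> ((\<lambda>t. gdt j (t, x)) has_real_derivative gdt (Suc j) (t, x)) (at t)"
proof -
 assume nz: "(t, x) \<noteq> 0"
 then have d: "gdt j differentiable (at ((0, x) + t *\<^sub>R (1, 0)))" using smooth_onD(2)[OF gdt_smooth] by simp
 show ?thesis using ddir_line[OF d] by simp
qed

text \<open>All time derivatives vanish at \<open>t = 0\<close> away from the pole, so one more derivative, which has
 degree lower by two, controls the decay in space.\<close>

lemma gdt_bound:
 assumes "0 < a"
 obtains C where "\<And>t x. a \<le> t ==> t \<le> T ==> \<bar>gdt j (t, x)\<bar> \<le> C * (1 + hn w x) powr (- Q - 2)"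
proof -
 have q: "Q \<ge> 1" by (rule hdim_ge_1[OF dil])
 define S where "S = {x. hn w x \<ge> 1}"
 have S: "closed S" unfolding S_def by (intro closed_Collect_le continuous_on_const continuous_on_hn[OF dil])
 have sub: "{0..T} \<times> S \<subseteq> UNIV - {0}" by (auto simp: S_def zero_prod_def hn_def)
 have ax: "(0, h) \<in> UNIV - {0 :: real \<times> 'g}" if "h \<noteq> 0" for h using that by (simp add: zero_prod_def)
 have d: "- Q - 2 * real (Suc j) \<le> 0" using q by simp
 obtain C where C: "\<And>t x. t \<in> {0..T} ==> x \<in> S ==> \<bar>gdt (Suc j) (t, x)\<bar> \<le> C * (1 + hn w x) powr (- Q - 2 * real (Suc j))"
  using homog_dominated[OF dilation_real dil open_off_zero gdt_homog smooth_onD(4)[OF gdt_smooth] ax compact_Icc S sub d] by blast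
 have "compact (gdt j ` ({a..T} \<times> {x. hn w x \<le> 1}))"
  by (intro compact_continuous_image compact_Times compact_Icc hn_compact(1)[OF dil] continuous_on_subset[OF smooth_onD(4)[OF gdt_smooth]])
   (use assms in \<open>auto simp: zero_prod_def\<close>)
 from bounded_iff[THEN iffD1, OF compact_imp_bounded[OF this]]
 obtain B where B: "\<forall>y\<in>gdt j ` ({a..T} \<times> {x. hn w x \<le> 1}). norm y \<le> B" ..
 \<comment> \<open>The first summand covers gauge at most 1, where the weight is at least
   \<open>2 powr (- Q - 2)\<close>; the second is the mean value estimate over a time interval of
   length at most \<open>T\<close>.\<close>
 define D where "D = \<bar>B\<bar> * 2 powr (Q + 2) + T * \<bar>C\<bar>"
 have "\<bar>gdt j (t, x)\<bar> \<le> D * (1 + hn w x) powr (- Q - 2)" if t: "a \<le> t" "t \<le> T" for t x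
 proof (cases "hn w x \<le> 1")
  case True
  have "2 powr (- Q - 2) \<le> (1 + hn w x) powr (- Q - 2)"
   using True q hn_nonneg[of w x] by (intro powr_mono2') auto
  then have "1 \<le> 2 powr (Q + 2) * (1 + hn w x) powr (- Q - 2)"
  proof -
   have "1 = 2 powr (Q + 2) * 2 powr (- Q - 2)" by (simp add: powr_add[symmetric])
   also have "\<dots> \<le> 2 powr (Q + 2) * (1 + hn w x) powr (- Q - 2)"
    using \<open>2 powr (- Q - 2) \<le> _\<close> by (intro mult_left_mono) auto
   finally show ?thesis .
  qed
  from mult_left_mono[OF this, of "\<bar>B\<bar>"]
  have "\<bar>B\<bar> \<le> \<bar>B\<bar> * 2 powr (Q + 2) * (1 + hn w x) powr (- Q - 2)" by (simp add: mult_ac)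
  moreover have "\<bar>gdt j (t, x)\<bar> \<le> \<bar>B\<bar>" using B t True by force
  moreover have "0 \<le> T * \<bar>C\<bar> * (1 + hn w x) powr (- Q - 2)" using t assms by simp
  ultimately show ?thesis unfolding D_def distrib_right by linarith
 next
  case False
  then have x: "x \<in> S" "x \<noteq> 0" by (auto simp: S_def hn_def)
  obtain s where s: "0 < s" "s < t" "gdt j (t, x) - gdt j (0, x) = (t - 0) * gdt (Suc j) (s, x)"
   using MVT2[of 0 t "\<lambda>t. gdt j (t, x)" "\<lambda>t. gdt (Suc j) (t, x)"] gdt_deriv x(2) t assms by (auto simp: zero_prod_def simp del: gdt.simps)
  have "\<bar>gdt (Suc j) (s, x)\<bar> \<le> \<bar>C\<bar> * (1 + hn w x) powr (- Q - 2)"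
  proof -
   have "\<bar>gdt (Suc j) (s, x)\<bar> \<le> C * (1 + hn w x) powr (- Q - 2 * real (Suc j))" by (rule C) (use s t x in auto)
   also have "\<dots> \<le> \<bar>C\<bar> * (1 + hn w x) powr (- Q - 2)"
    using hn_nonneg[of w x] by (intro mult_mono powr_mono) auto
   finally show ?thesis .
  qed
  then have "t * \<bar>gdt (Suc j) (s, x)\<bar> \<le> T * (\<bar>C\<bar> * (1 + hn w x) powr (- Q - 2))" using t assms by (intro mult_mono) auto
  moreover have "gdt j (t, x) = t * gdt (Suc j) (s, x)" using s(3) gdt_zero[of "(0, x)" j] x(2) by (simp add: zero_prod_def del: gdt.simps)
  moreover have "0 \<le> \<bar>B\<bar> * 2 powr (Q + 2) * (1 + hn w x) powr (- Q - 2)" by simp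
  moreover from calculation have "\<bar>gdt j (t, x)\<bar> = t * \<bar>gdt (Suc j) (s, x)\<bar>"
   using t assms by (simp add: abs_mult del: gdt.simps)
  ultimately show ?thesis unfolding D_def distrib_right mult.assoc by linarith
 qed
 then show thesis by (rule that)
qed

text \<open>Degree \<open>- Q\<close> would be exactly borderline on the group; the two extra powers
  gained in \<open>gdt_bound\<close> make each time slice integrable.\<close>

lemma integrable_decay: "integrable lborel (\<lambda>x. C * (1 + hn w x) powr (- Q - 2))"
 using integrable_hn[OF dil, of "Q + 2"] by simp

end

section \<open>Parameter integrals of homogeneous kernels\<close>

lemma pdc_homog:
 assumes "dilation v \<delta>" "dilation w \<epsilon>" "open W" "smooth_on W f" "homog (dprod \<delta> \<epsilon>) d W f" "g \<in> pdc f"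
 shows "\<exists>d'. homog (dprod \<delta> \<epsilon>) d' W g \<and> (g = f \<and> d' = d \<or> d' \<le> d - 1)"
 using assms(6)
proof (induction rule: pdc.induct)
 case base then show ?case using assms(5) by blast
next
 case (step g b)
 then obtain d' where d': "homog (dprod \<delta> \<epsilon>) d' W g" "g = f \<and> d' = d \<or> d' \<le> d - 1" by blast
 have B: "(b, 0) \<in> Basis" using step.hyps(2) by (simp add: Basis_prod_def)
 have "homog (dprod \<delta> \<epsilon>) (d' - wprod v w (b, 0)) W (ddir (b, 0) g)"
  by (rule homog_ddir[OF dilation_dprod[OF assms(1,2)] assms(3) d'(1) _ B])
   (rule smooth_onD(2)[OF pdc_smooth[OF step.hyps(1) assms(4)]])
 moreover have "wprod v w (b, 0) \<ge> 1"
  using dilationD(1)[OF assms(1) step.hyps(2)] by (simp add: wprod_def)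
 then have "d' - wprod v w (b, 0) \<le> d - 1" using d'(2) by linarith
 ultimately show ?case by blast
qed

text \<open>Weights are at least 1, so each proper derivative has degree at most
  \<open>d - 1\<close>, below the integrability threshold. Only \<open>f\<close> itself may be
  borderline, and \<open>base\<close> supplies its majorant separately.\<close>

lemma good_kernel_homog:
 fixes f :: "'a::euclidean_space \<times> 'b::euclidean_space => real"
 assumes v: "dilation v \<delta>" and w: "dilation w \<epsilon>" and W: "open W" "smooth_on W f" "homog (dprod \<delta> \<epsilon>) d W f"
  and axis: "\<And>h. h \<noteq> 0 ==> (0, h) \<in> W" and U: "open U" and S: "closed S" "U \<times> S \<subseteq> W"
  and c: "c \<in> borel_measurable borel" "\<And>h. \<bar>c h\<bar> \<le> M" "\<And>h. c h \<noteq> 0 ==> h \<in> S"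
  and d: "d \<le> 0" "d - 1 < - hdim w"
  and base: "\<And>p0. p0 \<in> U ==> \<exists>e>0. \<exists>B. integrable lborel B \<and> (\<forall>p\<in>ball p0 e. \<forall>h. \<bar>f (p, h) * c h\<bar> \<le> B h)"
 shows "good_kernel U c W f"
 unfolding good_kernel_def
proof (intro conjI ballI allI impI U W(1,2) c(1))
 show "(p, h) \<in> W" if "p \<in> U" "c h \<noteq> 0" for p h using that S(2) c(3) by blast
 fix g p0 assume g: "g \<in> pdc f" and p0: "p0 \<in> U"
 obtain d' where d': "homog (dprod \<delta> \<epsilon>) d' W g" "g = f \<and> d' = d \<or> d' \<le> d - 1"
  using pdc_homog[OF v w W g] by blast
 show "\<exists>e>0. \<exists>B. integrable lborel B \<and> (\<forall>p\<in>ball p0 e. \<forall>h. \<bar>g (p, h) * c h\<bar> \<le> B h)"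
 proof (cases "g = f")
  case True then show ?thesis using base[OF p0] by simp
 next
  case False
  then have d1: "d' \<le> d - 1" "d' \<le> 0" using d'(2) d(1) by auto
  obtain e where e: "e > 0" "cball p0 e \<subseteq> U" using U p0 open_contains_cball by blast
  then have sub: "cball p0 e \<times> S \<subseteq> W" using S(2) by blast
  obtain C where C: "\<And>p h. p \<in> cball p0 e ==> h \<in> S ==> \<bar>g (p, h)\<bar> \<le> C * (1 + hn w h) powr d'"
   using homog_dominated[OF v w W(1) d'(1) smooth_onD(4)[OF pdc_smooth[OF g W(2)]] axis compact_cball S(1) sub d1(2)] by blast
  have M: "M \<ge> 0" using c(2)[of 0] by simp
  define B where "B h = (\<bar>C\<bar> * M) * (1 + hn w h) powr (- (1 - d))" for h
  have "integrable lborel B" unfolding B_def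
   by (intro integrable_mult_right integrable_hn[OF w]) (use d(2) in simp)
  moreover have "\<bar>g (p, h) * c h\<bar> \<le> B h" if p: "p \<in> ball p0 e" for p h
  proof (cases "c h = 0")
   case True
   then show ?thesis using M by (simp add: B_def)
  next
   case False
   have "p \<in> cball p0 e" using p by auto
   then have "\<bar>g (p, h)\<bar> \<le> C * (1 + hn w h) powr d'" using C c(3)[OF False] by blast
   also have "\<dots> \<le> \<bar>C\<bar> * (1 + hn w h) powr (- (1 - d))"
    using hn_nonneg[of w h] d1 by (intro mult_mono powr_mono) auto
   finally have "\<bar>g (p, h)\<bar> * \<bar>c h\<bar> \<le> (\<bar>C\<bar> * (1 + hn w h) powr (- (1 - d))) * M"
    using c(2) by (intro mult_mono) auto
   then show ?thesis by (simp add: B_def abs_mult mult_ac)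
  qed
  ultimately show ?thesis using e(1) by blast
 qed
qed

text \<open>The case in which already the degree of \<open>f\<close> is below the threshold, so that
  homogeneity alone provides the missing majorant.\<close>

lemma good_kernel_homog':
 fixes f :: "'a::euclidean_space \<times> 'b::euclidean_space => real"
 assumes v: "dilation v \<delta>" and w: "dilation w \<epsilon>" and W: "open W" "smooth_on W f" "homog (dprod \<delta> \<epsilon>) d W f"
  and axis: "\<And>h. h \<noteq> 0 ==> (0, h) \<in> W" and U: "open U" and S: "closed S" "U \<times> S \<subseteq> W"
  and c: "c \<in> borel_measurable borel" "\<And>h. \<bar>c h\<bar> \<le> M" "\<And>h. c h \<noteq> 0 ==> h \<in> S"
  and d: "d < - hdim w"
 shows "good_kernel U c W f"
proof (rule good_kernel_homog[OF v w W axis U S c])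
 have d0: "d \<le> 0" using d hdim_ge_1[OF w] by simp
 then show "d \<le> 0" "d - 1 < - hdim w" using d by auto
 fix p0 assume p0: "p0 \<in> U"
 obtain e where e: "e > 0" "cball p0 e \<subseteq> U" using U p0 open_contains_cball by blast
 then have sub: "cball p0 e \<times> S \<subseteq> W" using S(2) by blast
 obtain C where C: "\<And>p h. p \<in> cball p0 e ==> h \<in> S ==> \<bar>f (p, h)\<bar> \<le> C * (1 + hn w h) powr d"
  using homog_dominated[OF v w W(1,3) smooth_onD(4)[OF W(2)] axis compact_cball S(1) sub d0] by blast
 have M: "M \<ge> 0" using c(2)[of 0] by simp
 define B where "B h = (\<bar>C\<bar> * M) * (1 + hn w h) powr (- (- d))" for h
 have "integrable lborel B" unfolding B_def
  by (intro integrable_mult_right integrable_hn[OF w]) (use d in simp)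
 moreover have "\<bar>f (p, h) * c h\<bar> \<le> B h" if p: "p \<in> ball p0 e" for p h
 proof (cases "c h = 0")
  case True
  then show ?thesis using M by (simp add: B_def)
 next
  case False
  have "p \<in> cball p0 e" using p by auto
  then have "\<bar>f (p, h)\<bar> \<le> C * (1 + hn w h) powr d" using C c(3)[OF False] by blast
  also have "\<dots> \<le> \<bar>C\<bar> * (1 + hn w h) powr d" by (intro mult_right_mono) auto
  finally have "\<bar>f (p, h)\<bar> * \<bar>c h\<bar> \<le> (\<bar>C\<bar> * (1 + hn w h) powr d) * M"
   using c(2) by (intro mult_mono) auto
  then show ?thesis by (simp add: B_def abs_mult mult_ac)
 qed
 ultimately show "\<exists>e>0. \<exists>B. integrable lborel B \<and> (\<forall>p\<in>ball p0 e. \<forall>h. \<bar>f (p, h) * c h\<bar> \<le> B h)"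
  using e(1) by blast
qed auto

section \<open>Comparison of the gauge with the group law\<close>

context hgroup
begin

text \<open>A quasi-triangle inequality: dilations are automorphisms, so it is enough to bound the
  product on the compact set of pairs of gauge at most 1.\<close>

lemma hn_mul_le: obtains c where "c \<ge> 0" "\<And>a b. hn w (mul a b) \<le> c * (hn w a + hn w b)"
proof -
 define S where "S = {z :: 'g \<times> 'g. hn w (fst z) \<le> 1 \<and> hn w (snd z) \<le> 1}"
 have "S = {a. hn w a \<le> 1} \<times> {b. hn w b \<le> 1}" by (auto simp: S_def)
 then have "compact S" by (simp add: compact_Times hn_compact(1)[OF dil])
 then have "compact ((\<lambda>z. hn w (mul (fst z) (snd z))) ` S)"
  by (intro compact_continuous_image continuous_on_compose2[OF continuous_on_hn[OF dil, of UNIV]]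
    continuous_on_mul continuous_on_fst continuous_on_snd continuous_on_id) auto
 from bounded_iff[THEN iffD1, OF compact_imp_bounded[OF this]]
 obtain c where c: "\<forall>y\<in>(\<lambda>z. hn w (mul (fst z) (snd z))) ` S. norm y \<le> c" ..
 have "hn w (mul a b) \<le> \<bar>c\<bar> * (hn w a + hn w b)" for a b
 proof (cases "hn w a + hn w b = 0")
  case True
  then have "hn w a = 0" "hn w b = 0" using hn_nonneg[of w a] hn_nonneg[of w b] by linarith+
  then have "a = 0" "b = 0" using hn_eq_0[OF dil] by blast+
  then show ?thesis by (simp add: hn_def)
 next
  case False
  define l where "l = hn w a + hn w b"
  have l: "l > 0" using False hn_nonneg[of w a] hn_nonneg[of w b] by (simp add: l_def)
  have "(\<delta> (1 / l) a, \<delta> (1 / l) b) \<in> S"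
   using l hn_dilation[OF dil, of "1 / l"] hn_nonneg[of w a] hn_nonneg[of w b] by (simp add: S_def l_def)
  then have "hn w (mul (\<delta> (1 / l) a) (\<delta> (1 / l) b)) \<le> \<bar>c\<bar>" using c by force
  then have "(1 / l) * hn w (mul a b) \<le> \<bar>c\<bar>" using l by (simp add: aut hn_dilation[OF dil])
  then show ?thesis using l by (simp add: l_def field_simps)
 qed
 then show thesis by (intro that[of "\<bar>c\<bar>"]) auto
qed

lemma hn_inv_le: obtains c where "c \<ge> 0" "\<And>a. hn w (ginv a) \<le> c * hn w a"
proof -
 have "compact ((\<lambda>z. hn w (ginv z)) ` {a. hn w a \<le> 1})"
  by (intro compact_continuous_image continuous_on_compose2[OF continuous_on_hn[OF dil, of UNIV]]
    continuous_on_inv continuous_on_id hn_compact(1)[OF dil]) auto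
 from bounded_iff[THEN iffD1, OF compact_imp_bounded[OF this]]
 obtain c where c: "\<forall>y\<in>(\<lambda>z. hn w (ginv z)) ` {a. hn w a \<le> 1}. norm y \<le> c" ..
 have "hn w (ginv a) \<le> \<bar>c\<bar> * hn w a" for a
 proof (cases "hn w a = 0")
  case True
  then have "a = 0" using hn_eq_0[OF dil] by blast
  then show ?thesis by (simp add: hn_def)
 next
  case False
  define l where "l = hn w a"
  have l: "l > 0" using False hn_nonneg[of w a] by (simp add: l_def)
  have "hn w (\<delta> (1 / l) a) \<le> 1" using l hn_dilation[OF dil, of "1 / l"] by (simp add: l_def)
  then have "hn w (ginv (\<delta> (1 / l) a)) \<le> \<bar>c\<bar>" using c by force
  then have "(1 / l) * hn w (ginv a) \<le> \<bar>c\<bar>" using l by (simp add: inv_dil hn_dilation[OF dil])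
  then show ?thesis using l by (simp add: l_def field_simps)
 qed
 then show thesis by (intro that[of "\<bar>c\<bar>"]) auto
qed

text \<open>Write \<open>h\<close> as \<open>x\<close> times the inverse of
  \<open>mul (ginv h) x\<close>. This converts decay in the translated variable into decay in
  \<open>h\<close>, uniformly for \<open>x\<close> in a compact set.\<close>

lemma hn_translate_le:
 assumes "compact K"
 obtains C where "C \<ge> 1" "\<And>x h. x \<in> K ==> 1 + hn w h \<le> C * (1 + hn w (mul (ginv h) x))"
proof -
 obtain c where c: "c \<ge> 0" "\<And>a b. hn w (mul a b) \<le> c * (hn w a + hn w b)" using hn_mul_le by blast
 obtain c' where c': "c' \<ge> 0" "\<And>a. hn w (ginv a) \<le> c' * hn w a" using hn_inv_le by blast
 have "compact (hn w ` K)" by (intro compact_continuous_image assms continuous_on_hn[OF dil])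
 from bounded_iff[THEN iffD1, OF compact_imp_bounded[OF this]]
 obtain B where B: "\<forall>y\<in>hn w ` K. norm y \<le> B" ..
 have "1 + hn w h \<le> (1 + c * \<bar>B\<bar> + c * c') * (1 + hn w (mul (ginv h) x))" if x: "x \<in> K" for x h
 proof -
  define y where "y = mul (ginv h) x"
  have "hn w h = hn w (mul x (ginv y))" by (simp add: y_def)
  also have "\<dots> \<le> c * (hn w x + hn w (ginv y))" by (rule c(2))
  also have "\<dots> \<le> c * (\<bar>B\<bar> + c' * hn w y)"
   using B x c'(2)[of y] by (intro mult_left_mono c(1) add_mono) force+
  finally have "1 + hn w h \<le> 1 + c * \<bar>B\<bar> + c * c' * hn w y" by (simp add: algebra_simps)
  also have "\<dots> \<le> (1 + c * \<bar>B\<bar> + c * c') * (1 + hn w y)"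
   using c(1) c'(1) hn_nonneg[of w y] by (simp add: algebra_simps)
  finally show ?thesis by (simp add: y_def)
 qed
 then show thesis using c(1) c'(1) by (intro that[of "1 + c * \<bar>B\<bar> + c * c'"]) auto
qed

end

section \<open>Total mass of the kernel\<close>

context heat_group
begin

lemma gdt_cont_space: "t > 0 ==> continuous_on UNIV F ==> continuous_on UNIV (\<lambda>x. gdt j (t, F x))"
 by (rule continuous_on_compose2[OF smooth_onD(4)[OF gdt_smooth]]) (auto intro!: continuous_intros simp: zero_prod_def)

lemma gdt_meas [measurable]: "gdt j \<in> borel_measurable borel"
 by (rule measurable_off_point[OF smooth_onD(4)[OF gdt_smooth]])

lemma gdt_integrable: "t > 0 ==> integrable lborel (\<lambda>x. gdt j (t, x))"
proof -
 assume t: "t > 0"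
 obtain C where C: "\<And>s x. t \<le> s ==> s \<le> t ==> \<bar>gdt j (s, x)\<bar> \<le> C * (1 + hn w x) powr (- Q - 2)"
  using gdt_bound[OF t, of t j] by blast
 have "norm (gdt j (t, x)) \<le> norm (C * (1 + hn w x) powr (- Q - 2))" for x using C[of t x] by simp
 then show ?thesis
  by (intro Bochner_Integration.integrable_bound[OF integrable_decay[of C]])
   (auto intro: borel_measurable_continuous_onI gdt_cont_space[OF t] continuous_on_id)
qed

lemma gam_scale: "l > 0 ==> (t, x) \<noteq> 0 ==> \<gamma> (l\<^sup>2 * t, \<delta> l x) = l powr (- Q) * \<gamma> (t, x)"
 using homogD(2)[OF gam_homog, of l "(t, x)"] by (simp add: dprod_def)

lemma gam_integrable: "t > 0 ==> integrable lborel (\<lambda>x. \<gamma> (t, x))"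
 using gdt_integrable[of t 0] by simp

definition mass where "mass = (LINT x|lborel. \<gamma> (1, x))"

text \<open>Almost everywhere only: the slice at time 0 contains the pole, where the value of
  \<open>\<gamma>\<close> is arbitrary.\<close>

lemma gam_time_null: "t \<le> 0 ==> AE x in lborel. \<gamma> (t, x) = 0"
 using AE_lborel_singleton[of "0::'g"] gam_zero[of "(t, _)"] by (auto elim!: eventually_mono simp: zero_prod_def)

lemma gam_sq: "t > 0 ==> \<gamma> (t, \<delta> (sqrt t) x) = sqrt t powr (- Q) * \<gamma> (1, x)"
 using gam_scale[of "sqrt t" 1 x] by (simp add: zero_prod_def)

text \<open>The dilation by \<open>sqrt t\<close> moves the slice to time 1, and its volume factor
  cancels the degree \<open>- Q\<close>.\<close>

lemma gam_mass: "(LINT x|lborel. \<gamma> (t, x)) = (if t > 0 then mass else 0)"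
proof (cases "t > 0")
 case True
 have m: "(\<lambda>x. \<gamma> (t, x)) \<in> borel_measurable borel" using borel_measurable_integrable[OF gam_integrable[OF True]] by simp
 have "(LINT x|lborel. \<gamma> (t, x)) = sqrt t powr Q * (LINT x|lborel. \<gamma> (t, \<delta> (sqrt t) x))"
  using integral_dilation(1)[OF dil _ m, of "sqrt t"] True by simp
 also have "\<dots> = (sqrt t powr Q * sqrt t powr (- Q)) * mass" by (simp add: gam_sq[OF True] mass_def)
 also have "sqrt t powr Q * sqrt t powr (- Q) = 1" using True by (simp add: powr_minus)
 finally show ?thesis using True by simp
next
 case False
 then have "(LINT x|lborel. \<gamma> (t, x)) = 0" by (intro integral_eq_zero_AE gam_time_null) simp
 then show ?thesis using False by simp
qed

text \<open>Since each positive slice has the same mass, integrability over space-time is decided by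
  the time factor. This gives global integrability that local integrability of
  \<open>\<gamma>\<close> cannot give.\<close>

lemma gam_strip:
 assumes c: "c \<in> borel_measurable borel" "integrable lborel (\<lambda>t::real. c t)"
 shows "integrable lborel (\<lambda>z. \<gamma> z * c (fst z))"
  and "(LINT z|lborel. \<gamma> z * c (fst z)) = mass * (LINT t|lborel. indicator {0<..} t * c t)"
proof -
 have AEnn: "AE x in lborel. norm (\<gamma> (t, x) * c t) = \<gamma> (t, x) * \<bar>c t\<bar>" for t
  using AE_lborel_singleton[of "0::'g"] by eventually_elim (use gam_nonneg[of "(t, _)"] in \<open>auto simp: zero_prod_def abs_mult\<close>)
 have n: "(LINT x|lborel. norm (\<gamma> (t, x) * c t)) = indicator {0<..} t * (mass * \<bar>c t\<bar>)" for t
 proof -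
  have "(LINT x|lborel. norm (\<gamma> (t, x) * c t)) = (LINT x|lborel. \<gamma> (t, x) * \<bar>c t\<bar>)"
   by (rule integral_cong_AE) (use AEnn in auto)
  then show ?thesis by (simp add: gam_mass)
 qed
 have m: "(\<lambda>z. \<gamma> z * c (fst z)) \<in> borel_measurable (lborel \<Otimes>\<^sub>M lborel)"
  unfolding lborel_prod using c(1) gam_meas by (simp add: borel_prod[symmetric])
 have ind: "integrable lborel (\<lambda>t. indicator {0<..} t * (mass * \<bar>c t\<bar>))" "integrable lborel (\<lambda>t. indicator {0<..} t * c t)"
  using c by (auto intro!: integrable_mult_indicator[where 'b=real, unfolded real_scaleR_def] integrable_mult_right)
 have ii: "integrable (lborel \<Otimes>\<^sub>M lborel) (\<lambda>z. \<gamma> z * c (fst z))"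
 proof (rule lborel_pair.Fubini_integrable[OF m])
  show "integrable lborel (\<lambda>t. LINT x|lborel. norm (\<gamma> (t, x) * c (fst (t, x))))" unfolding fst_conv n by (rule ind(1))
  have "integrable lborel (\<lambda>x. \<gamma> (t, x))" for t
  proof (cases "t > 0")
   case False
   then show ?thesis using integrable_cong_AE[of "\<lambda>x. \<gamma> (t, x)" lborel "\<lambda>_. 0"] gam_time_null[of t] by auto
  qed (rule gam_integrable)
  then show "AE t in lborel. integrable lborel (\<lambda>x. \<gamma> (t, x) * c (fst (t, x)))" by simp
 qed
 then show i: "integrable lborel (\<lambda>z. \<gamma> z * c (fst z))" by (simp add: lborel_prod)
 have "(LINT z|lborel. \<gamma> z * c (fst z)) = (LINT z|(lborel \<Otimes>\<^sub>M lborel). \<gamma> z * c (fst z))" by (simp add: lborel_prod)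
 also have "\<dots> = (LINT t|lborel. LINT x|lborel. \<gamma> (t, x) * c t)"
  using lborel_pair.integral_fst'[OF ii] by simp
 also have "\<dots> = (LINT t|lborel. mass * (indicator {0<..} t * c t))"
  by (intro Bochner_Integration.integral_cong) (auto simp: gam_mass)
 finally show "(LINT z|lborel. \<gamma> z * c (fst z)) = mass * (LINT t|lborel. indicator {0<..} t * c t)" by simp
qed

lemma heat_time_product:
 assumes \<rho>: "smooth_on UNIV \<rho>" and G: "smooth_on UNIV G"
 shows "heat (-1) (\<lambda>z. \<rho> (fst z) * G z) z = \<rho> (fst z) * heat (-1) G z + deriv \<rho> (fst z) * G z"
proof -
 have fs: "(fst has_derivative fst) (at z)" for z :: "real \<times> 'g" by (rule bounded_linear_imp_has_derivative[OF bounded_linear_fst])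
 have d\<rho>: "((\<lambda>z. \<rho> (fst z)) has_derivative (\<lambda>v. frechet_derivative \<rho> (at (fst z)) (fst v))) (at z)" for z :: "real \<times> 'g"
  by (rule has_derivative_compose[OF fs has_derivative_frechet[OF smooth_onD(2)[OF \<rho> UNIV_I]]])
 have pr: "((\<lambda>z. \<rho> (fst z) * F z) has_derivative (\<lambda>v. \<rho> (fst z) * frechet_derivative F (at z) v + frechet_derivative \<rho> (at (fst z)) (fst v) * F z)) (at z)"
  if "smooth_on UNIV F" for F :: "real \<times> 'g => real" and z
  by (rule has_derivative_mult[OF d\<rho> has_derivative_frechet[OF smooth_onD(2)[OF that UNIV_I]]])
 have d1: "frechet_derivative \<rho> (at t) 1 = deriv \<rho> t" for t
 proof -
  have "(\<rho> has_real_derivative frechet_derivative \<rho> (at t) 1) (at t)"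
   using ddir_line[of \<rho> 0 t 1] smooth_onD(2)[OF \<rho> UNIV_I, of t] by simp
  then show ?thesis by (rule DERIV_imp_deriv[symmetric])
 qed
 have z0: "frechet_derivative \<rho> (at t) 0 = 0" for t using frechet_derivative_linear(3)[OF smooth_onD(2)[OF \<rho> UNIV_I]] .
 have v: "vf (tvf (Zs j)) (\<lambda>z. \<rho> (fst z) * F z) = (\<lambda>z. \<rho> (fst z) * vf (tvf (Zs j)) F z)" if "smooth_on UNIV F" for F j
  using frechet_derivative_eqI[OF pr[OF that]] by (auto simp: vf_def tvf_def z0)
 have "vf (tvf (Zs j)) (vf (tvf (Zs j)) (\<lambda>z. \<rho> (fst z) * G z)) z = \<rho> (fst z) * vf (tvf (Zs j)) (vf (tvf (Zs j)) G) z"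
  if "j < m" for j
  unfolding v[OF G] v[OF smooth_on_vf_tvf[OF open_UNIV G Zs_smooth[rule_format, OF that]]] ..
 moreover have "frechet_derivative (\<lambda>z. \<rho> (fst z) * G z) (at z) (1, 0) = \<rho> (fst z) * frechet_derivative G (at z) (1, 0) + deriv \<rho> (fst z) * G z"
  by (simp add: frechet_derivative_eqI[OF pr[OF G]] d1)
 ultimately show ?thesis by (simp add: heat_op_def distrib_left sum_distrib_left)
qed

text \<open>Test the equation with \<open>\<rho>\<close> in time times a dilated spatial cutoff. The
  spatial operator on the cutoff contributes order \<open>1 / R\<^sup>2\<close> and disappears as
  the cutoff widens. What remains is the mass times the integral of the derivative of
  \<open>\<rho>\<close> over positive times, that is \<open>- mass * \<rho> 0\<close>, and it equals
  \<open>- \<rho> 0\<close>.\<close>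

lemma mass_one: "mass = 1"
proof -
 define \<rho> :: "real => real" where "\<rho> = bump 0 1"
 have \<rho>: "smooth_on UNIV \<rho>" "test_fun \<rho>" "\<rho> 0 > 0" unfolding \<rho>_def
  using bump_pos[of 1 0 "0::real"] by (auto intro: smooth_on_bump test_fun_bump)
 have \<rho>z: "\<rho> t = 0" if "\<bar>t\<bar> \<ge> 1" for t
  using that bump_pos[of 1 0 t] bump_nonneg[of 1 0 t] by (auto simp: \<rho>_def dist_real_def)
 have d\<rho>: "(\<rho> has_real_derivative deriv \<rho> t) (at t)" for t
  using smooth_onD(2)[OF \<rho>(1), of t] by (simp add: DERIV_deriv_iff_real_differentiable)
 have der: "deriv \<rho> t = frechet_derivative \<rho> (at t) 1" for t
  using frechet_derivative_eqI[of \<rho> "\<lambda>h. deriv \<rho> t * h" t] d\<rho>[of t] by (simp add: has_field_derivative_def)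
 have td: "test_fun (deriv \<rho>)"
 proof -
  have "frechet_derivative \<rho> (at t) 1 = 0" if "t \<notin> cball 0 1" for t
   by (subst frechet_derivative_cong_open[of "- cball 0 1" _ _ "\<lambda>_. 0"])
    (use that \<rho>z in \<open>auto simp: frechet_derivative_const\<close>)
  then show ?thesis unfolding der[abs_def]
   by (intro test_funI[OF smooth_onD(3)[OF \<rho>(1)] compact_cball, of 0 1]) auto
 qed
 define \<theta> :: "real \<times> 'g => real" where "\<theta> z = cutoff 1 (snd z)" for z
 have \<theta>: "smooth_on UNIV \<theta>" unfolding \<theta>_def
  by (rule smooth_on_compose_map[OF open_UNIV smooth_map_snd smooth_on_cutoff]) auto
 have \<theta>b: "0 \<le> \<theta> z" "\<theta> z \<le> 1" for z using cutoff_range[of 1 "snd z"] by (auto simp: \<theta>_def)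
 have lim\<theta>: "((\<lambda>R. \<theta> (tdil \<delta> (1 / R) z)) \<longlongrightarrow> 1) at_top" for z
 proof -
  have "((\<lambda>R. \<theta> (tdil \<delta> (1 / R) z)) \<longlongrightarrow> \<theta> 0) at_top"
  proof (rule isCont_tendsto_compose[where g=\<theta>])
   show "isCont \<theta> 0" using smooth_onD(4)[OF \<theta>] continuous_on_eq_continuous_at[OF open_UNIV] by blast
  qed (rule dilation_tendsto_0[OF T.dil])
  then show ?thesis using cutoff_one[of 1 "0::'g"] by (simp add: \<theta>_def)
 qed
 have hz: "heat (-1) \<theta> (t, x) = heat (-1) \<theta> (0, x)" for t x
 proof -
  have "heat (-1) (\<lambda>z. \<theta> ((t, 0) \<star> z)) (0, x) = heat (-1) \<theta> ((t, 0) \<star> (0, x))"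
   by (rule heat_left[OF open_UNIV UNIV_I smooth_onD(1)[OF \<theta>]])
  moreover have "(\<lambda>z. \<theta> ((t, 0) \<star> z)) = \<theta>" by (simp add: tmul_def \<theta>_def fun_eq_iff)
  moreover have "(t, 0) \<star> (0, x) = (t, x)" by (simp add: tmul_def)
  ultimately show ?thesis by simp
 qed
 have hz0: "heat (-1) \<theta> (0, x) = 0" if "norm x > 2" for x
 proof -
  have o: "open {y :: real \<times> 'g. norm (snd y) > 2}" by (intro open_Collect_less continuous_intros)
  have "heat (-1) \<theta> (0, x) = heat (-1) (\<lambda>z. 0 * \<theta> z + 0) (0, x)"
   by (rule heat_op_cong[OF o]) (use that cutoff_zero[where r=1 and 'a='g] in \<open>auto simp: \<theta>_def\<close>)
  then show ?thesis using heat_op_shift[OF Zs_smooth open_UNIV UNIV_I smooth_onD(1)[OF \<theta>], of "-1" 0 0] by simp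
 qed
 have "compact ((\<lambda>x. heat (-1) \<theta> (0, x)) ` cball 0 2)"
  by (intro compact_continuous_image compact_cball
    continuous_on_compose2[OF smooth_onD(4)[OF smooth_on_heat_op[OF open_UNIV \<theta> Zs_smooth]]] continuous_intros) auto
 from bounded_iff[THEN iffD1, OF compact_imp_bounded[OF this]]
 obtain B where B: "\<forall>y\<in>(\<lambda>x. heat (-1) \<theta> (0, x)) ` cball 0 2. norm y \<le> B" ..
 have hB: "\<bar>heat (-1) \<theta> z\<bar> \<le> \<bar>B\<bar>" for z
 proof (cases "norm (snd z) > 2")
  case True
  then show ?thesis using hz0[OF True] hz[of "fst z" "snd z"] by simp
 next
  case False
  then have "\<bar>heat (-1) \<theta> (0, snd z)\<bar> \<le> B" using B by force
  then show ?thesis using hz[of "fst z" "snd z"] by simp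
 qed
 have i\<rho>: "integrable lborel (\<lambda>z. \<gamma> z * \<rho> (fst z))" "integrable lborel (\<lambda>z. \<gamma> z * deriv \<rho> (fst z))"
  using gam_strip(1)[of \<rho>] gam_strip(1)[of "deriv \<rho>"] test_fun_integrable(1,3) \<rho>(2) td by auto
 define R where "R n = real (Suc n)" for n
 have R: "R n \<ge> 1" "R n > 0" for n by (auto simp: R_def)
 have Rinf: "filterlim R at_top sequentially" unfolding R_def
  by (rule filterlim_compose[OF filterlim_real_sequentially filterlim_Suc])
 define F where "F n z = \<gamma> z * (\<rho> (fst z) * ((1 / R n)\<^sup>2 * heat (-1) \<theta> (tdil \<delta> (1 / R n) z)) + deriv \<rho> (fst z) * \<theta> (tdil \<delta> (1 / R n) z))" for n z
 have mF: "F n \<in> borel_measurable borel" for n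
 proof -
  have md: "tdil \<delta> (1 / R n) \<in> borel_measurable borel"
   by (intro borel_measurable_continuous_onI linear_continuous_on dilation_bounded_linear[OF T.dil]) (use R(2)[of n] in simp)
  have m1: "(\<lambda>z::real \<times> 'g. f (fst z)) \<in> borel_measurable borel" if "test_fun f" for f :: "real => real"
   by (rule borel_measurable_continuous_onI, rule continuous_on_compose2[OF test_fun_integrable(4)[OF that]])
    (auto intro: continuous_intros)
  have m2: "(\<lambda>z. \<theta> (tdil \<delta> (1 / R n) z)) \<in> borel_measurable borel"
   by (rule measurable_compose[OF md borel_measurable_continuous_onI[OF smooth_onD(4)[OF \<theta>]]])
  have m3: "(\<lambda>z. heat (-1) \<theta> (tdil \<delta> (1 / R n) z)) \<in> borel_measurable borel"
   by (rule measurable_compose[OF md borel_measurable_continuous_onI[OF smooth_onD(4)[OF smooth_on_heat_op[OF open_UNIV \<theta> Zs_smooth]]]])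
  show ?thesis unfolding F_def[abs_def]
   by (intro borel_measurable_times borel_measurable_add borel_measurable_const gam_meas m1 m2 m3 \<rho>(2) td)
 qed
 have val: "(LINT z|lborel. F n z) = - \<rho> 0" for n
 proof -
  have l: "1 / R n > 0" using R(2)[of n] by simp
  define G where "G z = \<theta> (tdil \<delta> (1 / R n) z)" for z
  have sG: "smooth_on UNIV G" unfolding G_def
   by (rule smooth_on_compose_map[OF open_UNIV smooth_map_linear[OF dilation_bounded_linear[OF T.dil l]] \<theta>]) simp
  have hG: "heat (-1) G z = (1 / R n)\<^sup>2 * heat (-1) \<theta> (tdil \<delta> (1 / R n) z)" for z
   unfolding G_def by (rule heat_dil[OF open_UNIV UNIV_I smooth_onD(1)[OF \<theta>] l])
  have t: "test_fun (\<lambda>z. \<rho> (fst z) * G z)"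
  proof (rule test_funI'[where K="cball 0 1 \<times> (\<delta> (R n) ` cball 0 2)"])
   show "smooth_on UNIV (\<lambda>z. \<rho> (fst z) * G z)"
    by (intro smooth_on_mult open_UNIV sG smooth_on_compose_map[OF open_UNIV smooth_map_fst \<rho>(1)]) simp
   show "compact (cball (0::real) 1 \<times> (\<delta> (R n) ` cball 0 2))"
    by (intro compact_Times compact_cball compact_continuous_image linear_continuous_on dilation_bounded_linear[OF dil] R(2))
   fix z assume nz: "\<rho> (fst z) * G z \<noteq> 0"
   then have "\<rho> (fst z) \<noteq> 0" "cutoff 1 (\<delta> (1 / R n) (snd z)) \<noteq> 0" by (auto simp: G_def \<theta>_def dprod_def)
   then have "fst z \<in> cball 0 1" "\<delta> (1 / R n) (snd z) \<in> cball 0 2"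
    using \<rho>z[of "fst z"] cutoff_zero[of 1 "\<delta> (1 / R n) (snd z)"] by (force, force)
   then show "z \<in> cball 0 1 \<times> (\<delta> (R n) ` cball 0 2)"
    using dilation_inverse(1)[OF dil R(2)[of n], of "snd z"] by (metis imageI mem_Times_iff)
  qed
  have "(LINT z|lborel. F n z) = (LINT z|lborel. \<gamma> z * heat (-1) (\<lambda>z. \<rho> (fst z) * G z) z)"
   unfolding heat_time_product[OF \<rho>(1) sG] hG by (simp only: F_def G_def)
  also have "\<dots> = - (\<rho> 0 * G 0)" using gam_fund[OF t] by simp
  also have "G 0 = 1" using cutoff_one[of 1 "0::'g"] dilation_0[OF dil l] by (simp add: G_def \<theta>_def dprod_def)
  finally show ?thesis by simp
 qed
 have "(\<lambda>n. LINT z|lborel. F n z) \<longlonglongrightarrow> (LINT z|lborel. \<gamma> z * deriv \<rho> (fst z))"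
 proof (rule integral_dominated_convergence)
  show "integrable lborel (\<lambda>z. \<bar>B\<bar> * \<bar>\<gamma> z * \<rho> (fst z)\<bar> + \<bar>\<gamma> z * deriv \<rho> (fst z)\<bar>)" using i\<rho> by simp
  show "AE z in lborel. (\<lambda>n. F n z) \<longlonglongrightarrow> \<gamma> z * deriv \<rho> (fst z)"
  proof (rule AE_I2)
   fix z
   have l0: "(\<lambda>n. (1 / R n)\<^sup>2 * heat (-1) \<theta> (tdil \<delta> (1 / R n) z)) \<longlonglongrightarrow> 0"
   proof (rule Lim_null_comparison)
    show "\<forall>\<^sub>F n in sequentially. norm ((1 / R n)\<^sup>2 * heat (-1) \<theta> (tdil \<delta> (1 / R n) z)) \<le> (1 / R n)\<^sup>2 * \<bar>B\<bar>"
     by (intro always_eventually allI) (auto simp: abs_mult intro!: mult_left_mono hB)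
    have "(\<lambda>n. 1 / R n) \<longlonglongrightarrow> 0"
     by (rule tendsto_divide_0[OF tendsto_const filterlim_at_top_imp_at_infinity[OF Rinf]])
    from tendsto_mult[OF tendsto_power[OF this, of 2] tendsto_const[of "\<bar>B\<bar>"]]
    show "(\<lambda>n. (1 / R n)\<^sup>2 * \<bar>B\<bar>) \<longlonglongrightarrow> 0" by simp
   qed
   have l1: "(\<lambda>n. \<theta> (tdil \<delta> (1 / R n) z)) \<longlonglongrightarrow> 1" by (rule filterlim_compose[OF lim\<theta> Rinf])
   have "(\<lambda>n. F n z) \<longlonglongrightarrow> \<gamma> z * (\<rho> (fst z) * 0 + deriv \<rho> (fst z) * 1)"
    unfolding F_def by (intro tendsto_mult tendsto_add tendsto_const l0 l1)
   then show "(\<lambda>n. F n z) \<longlonglongrightarrow> \<gamma> z * deriv \<rho> (fst z)" by simp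
  qed
  show "AE z in lborel. norm (F n z) \<le> \<bar>B\<bar> * \<bar>\<gamma> z * \<rho> (fst z)\<bar> + \<bar>\<gamma> z * deriv \<rho> (fst z)\<bar>" for n
  proof (rule AE_I2)
   fix z
   have "(1 / R n)\<^sup>2 \<le> 1" using R[of n] by (simp add: power_le_one)
   then have a: "\<bar>(1 / R n)\<^sup>2 * heat (-1) \<theta> (tdil \<delta> (1 / R n) z)\<bar> \<le> 1 * \<bar>B\<bar>"
    unfolding abs_mult using hB[of "tdil \<delta> (1 / R n) z"] by (intro mult_mono) auto
   have b: "\<bar>\<theta> (tdil \<delta> (1 / R n) z)\<bar> \<le> 1" using \<theta>b[of "tdil \<delta> (1 / R n) z"] by simp
   have "norm (F n z) \<le> \<bar>\<gamma> z\<bar> * (\<bar>\<rho> (fst z)\<bar> * \<bar>(1 / R n)\<^sup>2 * heat (-1) \<theta> (tdil \<delta> (1 / R n) z)\<bar> + \<bar>deriv \<rho> (fst z)\<bar> * \<bar>\<theta> (tdil \<delta> (1 / R n) z)\<bar>)"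
    unfolding F_def real_norm_def abs_mult[of "\<gamma> z"] by (intro mult_left_mono order_trans[OF abs_triangle_ineq]) (auto simp: abs_mult)
   also have "\<dots> \<le> \<bar>\<gamma> z\<bar> * (\<bar>\<rho> (fst z)\<bar> * (1 * \<bar>B\<bar>) + \<bar>deriv \<rho> (fst z)\<bar> * 1)"
    using a b by (intro mult_left_mono add_mono) auto
   finally show "norm (F n z) \<le> \<bar>B\<bar> * \<bar>\<gamma> z * \<rho> (fst z)\<bar> + \<bar>\<gamma> z * deriv \<rho> (fst z)\<bar>" by (simp add: abs_mult algebra_simps)
  qed
 qed (use mF i\<rho>(2) in auto)
 then have "- \<rho> 0 = (LINT z|lborel. \<gamma> z * deriv \<rho> (fst z))" unfolding val by (simp add: LIMSEQ_const_iff)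
 also have "\<dots> = mass * (LINT t|lborel. indicator {0<..} t * deriv \<rho> t)"
  by (rule gam_strip(2)) (use test_fun_integrable(1,3)[OF td] in auto)
 \<comment> \<open>The function \<open>\<rho>\<close> vanishes from time 1 on, so ending at 2
   changes nothing and gives a compact interval for the fundamental theorem of calculus. The
   endpoint 0 is a null set.\<close>
 also have "(LINT t|lborel. indicator {0<..} t * deriv \<rho> t) = (LINT t|lborel. deriv \<rho> t * indicator {0..2} t)"
 proof (rule integral_cong_AE)
  have "deriv \<rho> t = 0" if "t > 2" for t
  proof -
   have "frechet_derivative \<rho> (at t) = frechet_derivative (\<lambda>_. 0) (at t)"
    by (rule frechet_derivative_cong_open[of "{1<..}"]) (use that \<rho>z in auto)
   then show ?thesis by (simp add: der frechet_derivative_const)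
  qed
  then show "AE t in lborel. indicator {0<..} t * deriv \<rho> t = deriv \<rho> t * indicator {0..2} t"
   using AE_lborel_singleton[of "0::real"] by (auto elim!: eventually_mono simp: indicator_def)
 qed (use test_fun_integrable(3)[OF td] in auto)
 also have "\<dots> = \<rho> 2 - \<rho> 0"
  by (rule integral_FTC_Icc_real) (use d\<rho> test_fun_integrable(4)[OF td] in \<open>auto simp: continuous_on_eq_continuous_at\<close>)
 also have "\<rho> 2 = 0" by (rule \<rho>z) simp
 finally show ?thesis using \<rho>(3) by simp
qed

end

section \<open>The Cauchy problem on the group and the semigroup identity\<close>

context heat_group
begin

text \<open>Multiplied by a cutoff around \<open>z\<close> the kernel becomes globally smooth, so
  integration by parts applies. Against test functions supported where the cutoff is 1, the weak
  equation then says that the operator gives 0 near \<open>z\<close>.\<close>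

lemma gam_heat:
 assumes z: "z \<noteq> 0"
 shows "heat 1 \<gamma> z = 0"
proof (rule ccontr)
 assume nz: "heat 1 \<gamma> z \<noteq> 0"
 \<comment> \<open>The cutoff then lives in the ball of radius two thirds of \<open>norm z\<close>
   around \<open>z\<close>, which misses the pole.\<close>
 define k where "k = 3 / norm z"
 have k: "k > 0" "2 / k < norm z" using z by (auto simp: k_def field_simps)
 define \<theta> where "\<theta> y = cutoff 1 (k *\<^sub>R (y - z))" for y
 have s\<theta>: "smooth_on UNIV \<theta>" unfolding \<theta>_def
  by (rule smooth_on_compose_map[OF open_UNIV _ smooth_on_cutoff])
   (auto intro!: smooth_map_scaleR smooth_map_diff smooth_map_const smooth_map_ident)
 have \<theta>1: "\<theta> y = 1" if "y \<in> ball z (1 / k)" for y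
 proof -
  have "k * norm (y - z) \<le> 1" using that k(1) by (simp add: dist_norm norm_minus_commute field_simps)
  then have "norm (k *\<^sub>R (y - z)) \<le> 1" using k(1) by simp
  then show ?thesis unfolding \<theta>_def by (intro cutoff_one) auto
 qed
 have \<theta>0: "\<theta> y = 0" if "y \<notin> cball z (2 / k)" for y
 proof -
  have "\<not> k * norm (y - z) \<le> 2" using that k(1) by (simp add: dist_norm norm_minus_commute field_simps)
  then have "\<not> norm (k *\<^sub>R (y - z)) \<le> 2" using k(1) by simp
  then show ?thesis unfolding \<theta>_def by (intro cutoff_zero) auto
 qed
 define u where "u y = \<gamma> y * \<theta> y" for y
 have su: "smooth_on UNIV u"
 proof (rule smooth_on_localI)
  fix y :: "real \<times> 'g"
  show "\<exists>V. open V \<and> y \<in> V \<and> smooth_on V u"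
  proof (cases "y = 0")
   case True
   have o: "open (- cball z (2 / k))" by (intro open_Compl closed_cball)
   have "smooth_on (- cball z (2 / k)) u"
    by (rule smooth_on_cong[OF o _ smooth_on_const[of _ 0]]) (simp add: u_def \<theta>0)
   then show ?thesis using o True k(2) by (intro exI[of _ "- cball z (2 / k)"]) auto
  next
   case False
   have "smooth_on (UNIV - {0}) u" unfolding u_def
    by (intro smooth_on_mult gam_smooth smooth_on_subset[OF s\<theta>] open_off_zero) auto
   then show ?thesis using False open_off_zero by (intro exI[of _ "UNIV - {0}"]) auto
  qed
 qed
 have eq: "heat 1 u y = heat 1 \<gamma> y" if "y \<in> ball z (1 / k)" for y
  by (rule heat_op_cong[OF open_ball that]) (simp add: u_def \<theta>1)
 have zb: "z \<in> ball z (1 / k)" using k(1) by simp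
 define f where "f y = sgn (heat 1 \<gamma> z) * heat 1 u y" for y
 have cf: "continuous_on UNIV f" unfolding f_def
  by (intro continuous_intros smooth_onD(4)[OF smooth_on_heat_op[OF open_UNIV su Zs_smooth]])
 have "f z > 0" using nz eq[OF zb] by (simp add: f_def sgn_if)
 from test_fun_detect[OF open_ball continuous_on_subset[OF cf subset_UNIV] borel_measurable_continuous_onI[OF cf] zb this]
 obtain \<psi> where p: "test_fun \<psi>" "\<And>x. \<psi> x \<noteq> 0 ==> x \<in> ball z (1 / k)" "(LINT x|lborel. f x * \<psi> x) > 0" by metis
 have h0: "heat (-1) \<psi> y = 0" if "y \<notin> cball z (1 / k)" for y
 proof -
  have o: "open (- cball z (1 / k))" by (intro open_Compl closed_cball)
  have "heat (-1) \<psi> y = heat (-1) (\<lambda>y. 0 * \<theta> y + 0) y"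
   by (rule heat_op_cong[OF o]) (use that p(2) in force)+
  then show ?thesis using heat_op_shift[OF Zs_smooth open_UNIV UNIV_I smooth_onD(1)[OF s\<theta>], of "-1" 0 0] by simp
 qed
 have h1: "u y * heat (-1) \<psi> y = \<gamma> y * heat (-1) \<psi> y" for y
 proof (cases "y \<in> ball z (1 / k)")
  case True then show ?thesis by (simp add: u_def \<theta>1)
 next
  case False
  show ?thesis
  \<comment> \<open>The bounding sphere is not covered by \<open>h0\<close>, but there the cutoff is
    still 1.\<close>
  proof (cases "y \<in> cball z (1 / k)")
   case True
   then have "k * norm (y - z) \<le> 1" using k(1) by (simp add: dist_norm norm_minus_commute field_simps)
   then have "norm (k *\<^sub>R (y - z)) \<le> 1" using k(1) by simp
   then show ?thesis using cutoff_one[of 1 "k *\<^sub>R (y - z)"] by (simp add: u_def \<theta>_def)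
  qed (simp add: h0)
 qed
 have "\<psi> 0 = 0"
 proof (rule ccontr)
  assume "\<psi> 0 \<noteq> 0"
  then have "norm z < 1 / k" using p(2)[of 0] by (simp add: dist_norm)
  then show False using k by (simp add: field_simps)
 qed
 have "(LINT x|lborel. heat 1 u x * \<psi> x) = (LINT x|lborel. u x * heat (-1) \<psi> x)"
  using integration_by_parts[OF su p(1), of "-1"] by simp
 also have "\<dots> = - \<psi> 0" unfolding h1 by (rule gam_fund[OF p(1)])
 finally have "(LINT x|lborel. heat 1 u x * \<psi> x) = 0" using \<open>\<psi> 0 = 0\<close> by simp
 then show False using p(3) by (simp add: f_def mult.assoc)
qed

text \<open>A majorant for an integral in \<open>h\<close> must decay in \<open>h\<close> itself,
  not in \<open>mul (ginv h) x\<close>; it must also be uniform near the point of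
  differentiation.\<close>

lemma kernel_bound:
 assumes "0 < a" "compact K"
 obtains C where "C \<ge> 0" "\<And>t x h. a \<le> t ==> t \<le> T ==> x \<in> K ==> \<bar>gdt j (t, mul (ginv h) x)\<bar> \<le> C * (1 + hn w h) powr (- Q - 2)"
proof -
 obtain C where C: "\<And>t x. a \<le> t ==> t \<le> T ==> \<bar>gdt j (t, x)\<bar> \<le> C * (1 + hn w x) powr (- Q - 2)"
  using gdt_bound[OF assms(1), of T j] by blast
 obtain D where D: "D \<ge> 1" "\<And>x h. x \<in> K ==> 1 + hn w h \<le> D * (1 + hn w (mul (ginv h) x))"
  using hn_translate_le[OF assms(2)] by blast
 have q: "Q \<ge> 1" by (rule hdim_ge_1[OF dil])
 have "\<bar>gdt j (t, mul (ginv h) x)\<bar> \<le> (\<bar>C\<bar> * D powr (Q + 2)) * (1 + hn w h) powr (- Q - 2)"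
  if t: "a \<le> t" "t \<le> T" and x: "x \<in> K" for t x h
 proof -
  have "(1 + hn w h) / D \<le> 1 + hn w (mul (ginv h) x)" using D(1) D(2)[OF x, of h] by (simp add: field_simps)
  then have "(1 + hn w (mul (ginv h) x)) powr (- Q - 2) \<le> ((1 + hn w h) / D) powr (- Q - 2)"
   using q D(1) hn_nonneg[of w h] by (intro powr_mono2') (auto intro!: divide_pos_pos)
  also have "\<dots> = D powr (Q + 2) * (1 + hn w h) powr (- Q - 2)"
  proof -
   have "D powr (- Q - 2) = 1 / D powr (Q + 2)" using powr_minus_divide[of D "Q + 2"] by simp
   then show ?thesis by (simp add: powr_divide)
  qed
  finally have "\<bar>C\<bar> * (1 + hn w (mul (ginv h) x)) powr (- Q - 2) \<le> \<bar>C\<bar> * (D powr (Q + 2) * (1 + hn w h) powr (- Q - 2))"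
   by (intro mult_left_mono) auto
  moreover have "\<bar>gdt j (t, mul (ginv h) x)\<bar> \<le> \<bar>C\<bar> * (1 + hn w (mul (ginv h) x)) powr (- Q - 2)"
   using C[OF t, of "mul (ginv h) x"] by (rule order_trans) (intro mult_right_mono, auto)
  ultimately show ?thesis by (simp add: mult.assoc)
 qed
 then show thesis by (intro that[of "\<bar>C\<bar> * D powr (Q + 2)"]) auto
qed

definition ker :: "(real \<times> 'g) \<times> 'g => real" where
 "ker q = \<gamma> (fst (fst q), mul (ginv (snd q)) (snd (fst q)))"

definition kerW :: "((real \<times> 'g) \<times> 'g) set" where
 "kerW = {q. (fst (fst q), mul (ginv (snd q)) (snd (fst q))) \<noteq> 0}"

lemma ker_map: "smooth_map (\<lambda>q::(real \<times> 'g) \<times> 'g. (fst (fst q), mul (ginv (snd q)) (snd (fst q))))"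
 by (intro smooth_map_Pair smooth_map_mul smooth_map_inv smooth_map_fst' smooth_map_snd' smooth_map_ident)

lemma open_kerW: "open kerW"
proof -
 have "kerW = (\<lambda>q. (fst (fst q), mul (ginv (snd q)) (snd (fst q)))) -` (UNIV - {0})" by (auto simp: kerW_def)
 then show ?thesis using open_vimage[OF open_off_zero smooth_mapD(2)[OF ker_map]] by simp
qed

lemma ker_smooth: "smooth_on kerW ker"
 unfolding ker_def by (rule smooth_on_compose_map[OF open_kerW ker_map gam_smooth]) (auto simp: kerW_def)

lemma ker_homog: "homog (dprod (tdil \<delta>) \<delta>) (- Q) kerW ker"
 unfolding homog_def
proof (intro allI impI ballI)
 fix l :: real and q assume l: "l > 0" and q: "q \<in> kerW"
 have "(fst (fst (dprod (tdil \<delta>) \<delta> l q)), mul (ginv (snd (dprod (tdil \<delta>) \<delta> l q))) (snd (fst (dprod (tdil \<delta>) \<delta> l q))))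
   = tdil \<delta> l (fst (fst q), mul (ginv (snd q)) (snd (fst q)))"
  by (simp add: dprod_def inv_dil[OF l] aut[OF l])
 then show "dprod (tdil \<delta>) \<delta> l q \<in> kerW \<and> ker (dprod (tdil \<delta>) \<delta> l q) = l powr - Q * ker q"
  using homogD[OF gam_homog l, of "(fst (fst q), mul (ginv (snd q)) (snd (fst q)))"] q by (simp add: ker_def kerW_def)
qed

lemma ker_axis: "h \<noteq> 0 ==> (0, h) \<in> kerW"
 by (simp add: kerW_def zero_prod_def) (metis inv_simps(1,2))

lemma open_pos: "open {p :: real \<times> 'g. 0 < fst p}"
 by (intro open_Collect_less continuous_intros)

text \<open>The degree \<open>- Q\<close> of the kernel is borderline, so the majorant for the
  undifferentiated kernel comes from \<open>kernel_bound\<close> at times bounded away from 0; the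
  derivatives are covered by homogeneity.\<close>

lemma ker_good:
 assumes c: "c \<in> borel_measurable borel" "\<And>h. \<bar>c h\<bar> \<le> M"
 shows "good_kernel {p. 0 < fst p} c kerW ker"
proof (rule good_kernel_homog[OF T.dil dil open_kerW ker_smooth ker_homog ker_axis open_pos closed_UNIV _ c])
 show "{p. 0 < fst p} \<times> UNIV \<subseteq> kerW" by (auto simp: kerW_def zero_prod_def)
 show "- Q \<le> 0" "- Q - 1 < - Q" using hdim_ge_1[OF dil] by auto
 fix p0 :: "real \<times> 'g" assume p0: "p0 \<in> {p. 0 < fst p}"
 define a where "a = fst p0 / 2"
 have a: "a > 0" using p0 by (simp add: a_def)
 have M: "M \<ge> 0" using c(2)[of 0] by simp
 have "compact (snd ` cball p0 a)" by (intro compact_continuous_image continuous_intros compact_cball)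
 then obtain C where C: "C \<ge> 0" "\<And>t x h. a \<le> t ==> t \<le> 4 * a ==> x \<in> snd ` cball p0 a ==> \<bar>gdt 0 (t, mul (ginv h) x)\<bar> \<le> C * (1 + hn w h) powr (- Q - 2)"
  using kernel_bound[OF a, of "snd ` cball p0 a" "4 * a" 0] by blast
 have "\<bar>ker (p, h) * c h\<bar> \<le> (C * M) * (1 + hn w h) powr (- Q - 2)" if p: "p \<in> ball p0 a" for p h
 proof -
  have "\<bar>fst p0 - fst p\<bar> \<le> a" using p dist_fst_le[of p0 p] by (simp add: dist_real_def)
  then have t: "a \<le> fst p" "fst p \<le> 4 * a" unfolding a_def by linarith+
  have "snd p \<in> snd ` cball p0 a" using p by auto
  from C(2)[OF t this, of h] have "\<bar>ker (p, h)\<bar> \<le> C * (1 + hn w h) powr (- Q - 2)" by (simp add: ker_def)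
  then have "\<bar>ker (p, h)\<bar> * \<bar>c h\<bar> \<le> (C * (1 + hn w h) powr (- Q - 2)) * M" using c(2)[of h] by (intro mult_mono) auto
  then show ?thesis by (simp add: abs_mult mult_ac)
 qed
 then show "\<exists>e>0. \<exists>B. integrable lborel B \<and> (\<forall>p\<in>ball p0 e. \<forall>h. \<bar>ker (p, h) * c h\<bar> \<le> B h)"
  using a integrable_decay[of "C * M"] by blast
qed auto

definition heatsol :: "('g => real) => real \<times> 'g => real" where
 "heatsol \<phi> z = (if fst z > 0 then LINT h|lborel. ker (z, h) * \<phi> h else \<phi> (snd z))"

lemma heatsol_alt:
 assumes "fst z > 0" "\<phi> \<in> borel_measurable borel"
 shows "heatsol \<phi> z = (LINT h|lborel. \<gamma> (fst z, h) * \<phi> (mul (snd z) h))"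
proof -
 have m: "(\<lambda>h. \<gamma> (fst z, h)) \<in> borel_measurable borel" using borel_measurable_integrable[OF gam_integrable[OF assms(1)]] by simp
 have [measurable]: "(\<lambda>h. \<phi> (mul (snd z) h)) \<in> borel_measurable borel"
  by (rule measurable_compose[OF smooth_mapD(3)[OF smooth_mul_left] assms(2)])
 have "(LINT h|lborel. \<gamma> (fst z, mul (ginv (snd z)) h) * \<phi> (mul (snd z) (mul (ginv (snd z)) h)))
   = (LINT h|lborel. \<gamma> (fst z, h) * \<phi> (mul (snd z) h))"
  by (rule integral_left(1)) (use m in measurable)
 moreover have "\<gamma> (fst z, mul (ginv (snd z)) h) = ker (z, h)" for h
  using gam_sym[of "fst z" "mul (ginv (snd z)) h"] assms(1) by (simp add: ker_def zero_prod_def)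
 ultimately show ?thesis using assms(1) by (simp add: heatsol_def)
qed

text \<open>A continuous extension of the dilation by \<open>sqrt t\<close> down to
  \<open>t = 0\<close>, where \<open>0 powr w b = 0\<close> makes it the zero map; the dilation
  itself is specified for positive factors only.\<close>

definition rootdil :: "real => 'g => 'g" where
 "rootdil t h = (\<Sum>b\<in>Basis. (sqrt t powr w b * (h \<bullet> b)) *\<^sub>R b)"

lemma rootdil: "t > 0 ==> rootdil t h = \<delta> (sqrt t) h" "rootdil 0 h = 0"
proof -
 show "t > 0 ==> rootdil t h = \<delta> (sqrt t) h"
  by (rule dilation_eqI[OF dil, symmetric]) (auto simp: rootdil_def)
qed (simp add: rootdil_def)

lemma rootdil_cont: "continuous_on {0..} (\<lambda>t. rootdil t h)"
 unfolding rootdil_def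
 by (intro continuous_on_sum continuous_on_scaleR continuous_on_mult continuous_on_powr' continuous_intros)
  (use dilationD(1)[OF dil] in fastforce)+

text \<open>All dependence on the point moves into the argument of \<open>\<phi>\<close>, against
  the fixed probability density \<open>\<gamma> (1, h)\<close>. The formula stays valid at time 0,
  so continuity up to the initial slice is a single dominated convergence and the bound by
  \<open>M\<close> is immediate.\<close>

lemma heatsol_scaled:
 assumes "fst z \<ge> 0" "\<phi> \<in> borel_measurable borel"
 shows "heatsol \<phi> z = (LINT h|lborel. \<gamma> (1, h) * \<phi> (mul (snd z) (rootdil (fst z) h)))"
proof (cases "fst z > 0")
 case True
 define t where "t = fst z"
 have t: "t > 0" using True by (simp add: t_def)
 have m: "(\<lambda>h. \<gamma> (t, h)) \<in> borel_measurable borel" using borel_measurable_integrable[OF gam_integrable[OF t]] by simp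
 have m2: "(\<lambda>h. \<phi> (mul (snd z) h)) \<in> borel_measurable borel"
  by (rule measurable_compose[OF smooth_mapD(3)[OF smooth_mul_left] assms(2)])
 have "heatsol \<phi> z = (LINT h|lborel. \<gamma> (t, h) * \<phi> (mul (snd z) h))" using heatsol_alt[OF True assms(2)] by (simp add: t_def)
 also have "\<dots> = sqrt t powr Q * (LINT h|lborel. \<gamma> (t, \<delta> (sqrt t) h) * \<phi> (mul (snd z) (\<delta> (sqrt t) h)))"
  by (rule integral_dilation(1)[OF dil]) (use t m m2 in auto)
 also have "\<dots> = sqrt t powr Q * (LINT h|lborel. sqrt t powr (- Q) * (\<gamma> (1, h) * \<phi> (mul (snd z) (rootdil t h))))"
  by (simp add: gam_sq[OF t] rootdil(1)[OF t] mult.assoc)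
 also have "\<dots> = (sqrt t powr Q * sqrt t powr (- Q)) * (LINT h|lborel. \<gamma> (1, h) * \<phi> (mul (snd z) (rootdil t h)))" by simp
 also have "sqrt t powr Q * sqrt t powr (- Q) = 1" using t by (simp add: powr_minus)
 finally show ?thesis by (simp add: t_def)
next
 case False
 then show ?thesis using assms(1) mass_one by (simp add: heatsol_def rootdil(2) mass_def)
qed

lemma heatsol_solution:
 assumes c: "continuous_on UNIV \<phi>" and b: "\<And>x. \<bar>\<phi> x\<bar> \<le> M"
 shows "smooth_on {z. 0 < fst z} (heatsol \<phi>)" and "0 < fst z ==> heat 1 (heatsol \<phi>) z = 0"
  and "continuous_on {z. 0 \<le> fst z} (heatsol \<phi>)" and "0 \<le> fst z ==> \<bar>heatsol \<phi> z\<bar> \<le> M"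
proof -
 have m: "\<phi> \<in> borel_measurable borel" by (rule borel_measurable_continuous_onI[OF c])
 note k = ker_good[OF m b]
 show "smooth_on {z. 0 < fst z} (heatsol \<phi>)"
  by (rule smooth_on_cong[OF open_pos _ good_kernel_smooth[OF k]]) (simp add: heatsol_def)
 show "heat 1 (heatsol \<phi>) z = 0" if z: "0 < fst z"
 proof -
  have "heat 1 (\<lambda>p. ker (p, h)) z = 0" for h
  proof -
   have eq: "ker (p, h) = \<gamma> ((0, ginv h) \<star> p)" for p by (simp add: ker_def tmul_def)
   have nz: "(0, ginv h) \<star> z \<noteq> 0" using z by (auto simp: tmul_def zero_prod_def)
   show ?thesis unfolding eq
    using heat_left[OF open_off_zero _ smooth_onD(1)[OF gam_smooth], of "(0, ginv h)" z 1] gam_heat[OF nz] nz by simp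
  qed
  moreover have "heat 1 (heatsol \<phi>) z = heat 1 (\<lambda>p. LINT h|lborel. ker (p, h) * \<phi> h) z"
   by (rule heat_op_cong[OF open_pos]) (use z in \<open>auto simp: heatsol_def\<close>)
  ultimately show ?thesis using good_kernel_heat_op[OF k _ Zs_smooth, of z 1] z by simp
 qed
 have i1: "integrable lborel (\<lambda>h. \<gamma> (1, h))" by (rule gam_integrable) simp
 have g1: "\<gamma> (1, h) \<ge> 0" for h by (rule gam_nonneg) (simp add: zero_prod_def)
 have m1: "(\<lambda>h. \<gamma> (1, h)) \<in> borel_measurable borel" using borel_measurable_integrable[OF i1] by simp
 have cr: "continuous_on UNIV (\<lambda>h. rootdil t h)" for t
  unfolding rootdil_def by (intro continuous_intros)
 have mm: "(\<lambda>h. \<gamma> (1, h) * \<phi> (mul x (rootdil t h))) \<in> borel_measurable borel" for x t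
  by (intro borel_measurable_times m1 borel_measurable_continuous_onI continuous_on_compose2[OF c] continuous_on_mul continuous_on_const cr) auto
 have gb: "\<bar>\<gamma> (1, h) * \<phi> x\<bar> \<le> M * \<gamma> (1, h)" for h x
  using mult_left_mono[OF b[of x] g1[of h]] g1[of h] by (simp add: abs_mult mult.commute)
 have M0: "0 \<le> M" using b[of 0] by simp
 show "\<bar>heatsol \<phi> z\<bar> \<le> M" if "0 \<le> fst z"
 proof -
  have "\<bar>heatsol \<phi> z\<bar> \<le> (LINT h|lborel. \<bar>\<gamma> (1, h) * \<phi> (mul (snd z) (rootdil (fst z) h))\<bar>)"
   using integral_norm_bound[of lborel "\<lambda>h. \<gamma> (1, h) * \<phi> (mul (snd z) (rootdil (fst z) h))"]
   by (simp only: heatsol_scaled[OF that m] real_norm_def)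
  also have "\<dots> \<le> (LINT h|lborel. M * \<gamma> (1, h))"
  proof (rule integral_mono')
   show "integrable lborel (\<lambda>h. M * \<gamma> (1, h))" by (rule integrable_mult_right[OF i1])
  qed (rule gb, rule mult_nonneg_nonneg[OF M0 g1])
  also have "\<dots> = M" using mass_one by (simp add: mass_def)
  finally show ?thesis .
 qed
 show "continuous_on {z. 0 \<le> fst z} (heatsol \<phi>)"
  unfolding continuous_on_def tendsto_at_iff_sequentially
 proof (intro ballI allI impI)
  fix z :: "real \<times> 'g" and X assume z: "z \<in> {z. 0 \<le> fst z}" and X: "\<forall>i. X i \<in> {z. 0 \<le> fst z} - {z}" "X \<longlonglongrightarrow> z"
  have z0: "0 \<le> fst z" and X0: "0 \<le> fst (X i)" for i using z X(1) by auto
  have "(\<lambda>i. LINT h|lborel. \<gamma> (1, h) * \<phi> (mul (snd (X i)) (rootdil (fst (X i)) h)))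
   \<longlonglongrightarrow> (LINT h|lborel. \<gamma> (1, h) * \<phi> (mul (snd z) (rootdil (fst z) h)))"
  proof (rule integral_dominated_convergence)
   show "integrable lborel (\<lambda>h. M * \<gamma> (1, h))" using i1 by simp
   show "AE h in lborel. (\<lambda>i. \<gamma> (1, h) * \<phi> (mul (snd (X i)) (rootdil (fst (X i)) h))) \<longlonglongrightarrow> \<gamma> (1, h) * \<phi> (mul (snd z) (rootdil (fst z) h))"
   proof (rule AE_I2)
    fix h
    have "(\<lambda>i. rootdil (fst (X i)) h) \<longlonglongrightarrow> rootdil (fst z) h"
     using continuous_on_tendsto_compose[OF rootdil_cont[of h] tendsto_fst[OF X(2)]] z0 X0 by simp
    then have "(\<lambda>i. (snd (X i), rootdil (fst (X i)) h)) \<longlonglongrightarrow> (snd z, rootdil (fst z) h)"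
     by (intro tendsto_Pair tendsto_snd X(2))
    from continuous_on_tendsto_compose[OF smooth_mapD(2)[OF smooth(1), of UNIV] this]
    have "(\<lambda>i. mul (snd (X i)) (rootdil (fst (X i)) h)) \<longlonglongrightarrow> mul (snd z) (rootdil (fst z) h)" by simp
    from continuous_on_tendsto_compose[OF c this]
    show "(\<lambda>i. \<gamma> (1, h) * \<phi> (mul (snd (X i)) (rootdil (fst (X i)) h))) \<longlonglongrightarrow> \<gamma> (1, h) * \<phi> (mul (snd z) (rootdil (fst z) h))"
     by (intro tendsto_mult tendsto_const) simp
   qed
   show "AE h in lborel. norm (\<gamma> (1, h) * \<phi> (mul (snd (X i)) (rootdil (fst (X i)) h))) \<le> M * \<gamma> (1, h)" for i
    unfolding real_norm_def by (intro AE_I2 gb)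
  qed (use mm in auto)
  then show "(heatsol \<phi> \<circ> X) \<longlonglongrightarrow> heatsol \<phi> z" by (simp add: heatsol_scaled[OF z0 m] heatsol_scaled[OF X0 m] comp_def)
 qed
qed

lemma gam_sup_bound:
 assumes "a > 0"
 obtains C where "\<And>t x. a \<le> t ==> \<bar>\<gamma> (t, x)\<bar> \<le> C"
proof -
 have q: "Q \<ge> 1" by (rule hdim_ge_1[OF dil])
 obtain C where C: "\<And>t x. 1 \<le> t ==> t \<le> 1 ==> \<bar>gdt 0 (t, x)\<bar> \<le> C * (1 + hn w x) powr (- Q - 2)"
  using gdt_bound[of 1 1 0] by auto
 have C1: "\<bar>\<gamma> (1, x)\<bar> \<le> \<bar>C\<bar>" for x
 proof -
  have "\<bar>\<gamma> (1, x)\<bar> \<le> \<bar>C\<bar> * (1 + hn w x) powr (- Q - 2)" using C[of 1 x, simplified] by (rule order_trans) (intro mult_right_mono, auto)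
  also have "\<dots> \<le> \<bar>C\<bar> * (1 + hn w x) powr 0" using q hn_nonneg[of w x] by (intro mult_left_mono powr_mono) auto
  finally show ?thesis using hn_nonneg[of w x] by (simp split: if_splits)
 qed
 have "\<bar>\<gamma> (t, x)\<bar> \<le> sqrt a powr (- Q) * \<bar>C\<bar>" if "a \<le> t" for t x
 proof -
  have t: "t > 0" "sqrt t > 0" using that assms by auto
  have "\<gamma> (t, x) = sqrt t powr (- Q) * \<gamma> (1, \<delta> (1 / sqrt t) x)"
   using gam_sq[OF t(1), of "\<delta> (1 / sqrt t) x"] dilation_inverse(1)[OF dil t(2)] by simp
  moreover have "sqrt t powr (- Q) \<le> sqrt a powr (- Q)" using q assms that by (intro powr_mono2') auto
  ultimately show ?thesis using C1 by (simp add: abs_mult mult_mono)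
 qed
 then show thesis by (rule that)
qed

text \<open>As functions of \<open>(t, g)\<close> both sides are bounded solutions of the Cauchy
  problem with initial value \<open>\<gamma> (s, g)\<close>; uniqueness identifies them.\<close>

lemma chapman_kolmogorov:
 assumes t: "t > 0" and s: "s > 0"
 shows "\<gamma> (t + s, g) = (LINT h|lborel. \<gamma> (t, h) * \<gamma> (s, mul g h))"
proof -
 define \<phi> where "\<phi> x = \<gamma> (s, x)" for x
 have c: "continuous_on UNIV \<phi>" unfolding \<phi>_def using gdt_cont_space[OF s continuous_on_id, of 0] by simp
 obtain C where C: "\<And>t x. s \<le> t ==> \<bar>\<gamma> (t, x)\<bar> \<le> C" using gam_sup_bound[OF s] by blast
 have b: "\<bar>\<phi> x\<bar> \<le> C" for x using C by (simp add: \<phi>_def)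
 note S = heatsol_solution[OF c b]
 define u where "u z = \<gamma> ((s, 0) \<star> z)" for z
 have nz: "(s, 0) \<star> z \<noteq> 0" if "0 \<le> fst z" for z using that s by (auto simp: tmul_def zero_prod_def)
 have cu: "continuous_on {z. 0 \<le> fst z} u" unfolding u_def
  by (rule continuous_on_compose2[OF gam_cont smooth_mapD(2)[OF T.smooth_mul_left]]) (use nz in auto)
 have su: "smooth_on {z. 0 < fst z} u" unfolding u_def
  by (rule smooth_on_compose_map[OF open_pos T.smooth_mul_left gam_smooth]) (use nz in auto)
 have hu: "heat 1 u z = 0" if "0 < fst z" for z
  unfolding u_def using heat_left[OF open_off_zero _ smooth_onD(1)[OF gam_smooth], of "(s, 0)" z 1] gam_heat nz[of z] that by simp
 have "1 * u (t, g) + (- 1) * heatsol \<phi> (t, g) = 0"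
 proof (rule bounded_cauchy_unique[OF Zs_smooth dil Zs_hom])
  show "continuous_on {z. 0 \<le> fst z} (\<lambda>z. 1 * u z + (- 1) * heatsol \<phi> z)"
   by (intro continuous_intros cu S(3))
  show "C_k_on 2 {z. 0 < fst z} (\<lambda>z. 1 * u z + (- 1) * heatsol \<phi> z)"
   by (intro C_k_on_add C_k_on_cmult open_pos smooth_onD(1)[OF su] smooth_onD(1)[OF S(1)])
  show "heat 1 (\<lambda>z. 1 * u z + (- 1) * heatsol \<phi> z) z = 0" if "0 < fst z" for z
   using heat_op_cmult_add[OF open_pos _ smooth_onD(1)[OF su] smooth_onD(1)[OF S(1)] Zs_smooth, of z 1 1 "-1"] that hu[OF that] S(2)[OF that]
   by simp
  show "1 * u (0, x) + (- 1) * heatsol \<phi> (0, x) = 0" for x by (simp add: u_def heatsol_def \<phi>_def tmul_def)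
  show "\<bar>1 * u z + (- 1) * heatsol \<phi> z\<bar> \<le> 2 * C" if "0 < fst z" for z
  proof -
   have "\<bar>u z\<bar> \<le> C" using C[of "s + fst z" "snd z"] that by (simp add: u_def tmul_def)
   then show ?thesis using S(4)[of z] that by simp
  qed
 qed (use t in simp)
 then have "\<gamma> (s + t, g) = heatsol \<phi> (t, g)" by (simp add: u_def tmul_def)
 also have "\<dots> = (LINT h|lborel. \<gamma> (t, h) * \<gamma> (s, mul g h))"
  by (subst heatsol_alt) (use t borel_measurable_continuous_onI[OF c] in \<open>auto simp: \<phi>_def\<close>)
 finally show ?thesis by (simp add: add.commute)
qed

section \<open>Bounds for time derivatives by their values at the pole, and strict
  positivity\<close>

lemma has_derivative_gdt_integral:
 assumes t: "t > 0" and \<psi>: "\<psi> \<in> borel_measurable borel" "\<And>h. \<bar>\<psi> h\<bar> \<le> M"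
 shows "((\<lambda>t. LINT h|lborel. gdt j (t, h) * \<psi> h) has_real_derivative (LINT h|lborel. gdt (Suc j) (t, h) * \<psi> h)) (at t)"
proof -
 define e where "e = t / 2"
 have e: "e > 0" using t by (simp add: e_def)
 have pos: "s > 0" if "s \<in> ball t e" for s using that t by (auto simp: e_def dist_real_def abs_if split: if_splits)
 have rng: "e \<le> s" "s \<le> 4 * e" if "s \<in> ball t e" for s using that by (auto simp: e_def dist_real_def abs_if split: if_splits)
 obtain C where C: "\<And>s x. e \<le> s ==> s \<le> 4 * e ==> \<bar>gdt (Suc j) (s, x)\<bar> \<le> C * (1 + hn w x) powr (- Q - 2)"
  using gdt_bound[OF e, of "4 * e" "Suc j"] by blast
 have M: "M \<ge> 0" using \<psi>(2)[of 0] by simp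
 have d: "((\<lambda>t. gdt j (t, h) * \<psi> h) has_real_derivative gdt (Suc j) (s, h) * \<psi> h) (at s)" if "s \<in> ball t e" for s h
  by (rule DERIV_cmult_right[OF gdt_deriv]) (use pos[OF that] in \<open>simp add: zero_prod_def\<close>)
 have dd: "ddir b (\<lambda>t. gdt j (t, h) * \<psi> h) s = b * (gdt (Suc j) (s, h) * \<psi> h)" if "s \<in> ball t e" for b s h
  using frechet_derivative_eqI[of "\<lambda>t. gdt j (t, h) * \<psi> h" "\<lambda>b. (gdt (Suc j) (s, h) * \<psi> h) * b" s] d[OF that]
  by (simp add: has_field_derivative_def del: gdt.simps)
 have m: "(\<lambda>h. gdt i (s, h) * \<psi> h) \<in> borel_measurable borel" if "s > 0" for s i
  by (intro borel_measurable_times \<psi>(1) borel_measurable_continuous_onI gdt_cont_space[OF that] continuous_on_id)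
 have i: "integrable lborel (\<lambda>h. gdt j (s, h) * \<psi> h)" if "s > 0" for s
 proof (rule Bochner_Integration.integrable_bound[OF integrable_mult_right[OF integrable_abs[OF gdt_integrable[OF that]], of M]])
  show "AE h in lborel. norm (gdt j (s, h) * \<psi> h) \<le> norm (M * \<bar>gdt j (s, h)\<bar>)"
   using M mult_left_mono[OF \<psi>(2), of "\<bar>gdt j (s, _)\<bar>"] by (intro AE_I2) (auto simp: abs_mult mult.commute)
 qed (use m[OF that] in simp)
 have "((\<lambda>t. LINT h|lborel. gdt j (t, h) * \<psi> h) has_derivative
   (\<lambda>v. \<Sum>b\<in>Basis. (v \<bullet> b) * (LINT h|lborel. ddir b (\<lambda>t. gdt j (t, h) * \<psi> h) t))) (at t)"
 proof (rule has_derivative_integral_dominated[OF e, where B="\<lambda>h. (\<bar>C\<bar> * M) * (1 + hn w h) powr (- Q - 2)"])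
  show "(\<lambda>t. gdt j (t, h) * \<psi> h) differentiable (at s)" if "s \<in> ball t e" for s h
   using d[OF that, of h] unfolding has_field_derivative_def differentiable_def by blast
  show "integrable lborel (\<lambda>h. gdt j (s, h) * \<psi> h)" if "s \<in> ball t e" for s by (rule i[OF pos[OF that]])
  show "(\<lambda>h. ddir b (\<lambda>t. gdt j (t, h) * \<psi> h) t) \<in> borel_measurable lborel" for b
   using m[OF t, of "Suc j"] e by (simp add: dd del: gdt.simps)
  show "\<bar>ddir b (\<lambda>t. gdt j (t, h) * \<psi> h) s\<bar> \<le> (\<bar>C\<bar> * M) * (1 + hn w h) powr (- Q - 2)" if "b \<in> Basis" "s \<in> ball t e" for b s h
  proof -
   have "\<bar>gdt (Suc j) (s, h)\<bar> \<le> \<bar>C\<bar> * (1 + hn w h) powr (- Q - 2)"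
    using C[OF rng[OF that(2)], of h] by (rule order_trans) (intro mult_right_mono, auto)
   then have "\<bar>gdt (Suc j) (s, h)\<bar> * \<bar>\<psi> h\<bar> \<le> (\<bar>C\<bar> * (1 + hn w h) powr (- Q - 2)) * M"
    using \<psi>(2)[of h] by (intro mult_mono) auto
   then show ?thesis using that by (simp add: dd abs_mult del: gdt.simps) (simp add: mult.left_commute mult.commute)
  qed
  show "integrable lborel (\<lambda>h. (\<bar>C\<bar> * M) * (1 + hn w h) powr (- Q - 2))" by (rule integrable_decay)
 qed
 moreover have "(\<Sum>b\<in>Basis. (v \<bullet> b) * (LINT h|lborel. ddir b (\<lambda>t. gdt j (t, h) * \<psi> h) t)) = (LINT h|lborel. gdt (Suc j) (t, h) * \<psi> h) * v" for v :: real
  using e by (simp add: dd del: gdt.simps)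
 ultimately show ?thesis by (simp only: has_field_derivative_def)
qed

lemma gdt_sup:
 assumes "t > 0"
 obtains C where "\<And>x. \<bar>gdt j (t, x)\<bar> \<le> C"
proof -
 obtain C where C: "\<And>s x. t \<le> s ==> s \<le> t ==> \<bar>gdt j (s, x)\<bar> \<le> C * (1 + hn w x) powr (- Q - 2)"
  using gdt_bound[OF assms, of t j] by blast
 have "\<bar>gdt j (t, x)\<bar> \<le> \<bar>C\<bar>" for x
 proof -
  have "\<bar>gdt j (t, x)\<bar> \<le> \<bar>C\<bar> * (1 + hn w x) powr (- Q - 2)"
   using C[OF order_refl order_refl, of x] by (rule order_trans) (intro mult_right_mono, auto)
  also have "\<dots> \<le> \<bar>C\<bar> * (1 + hn w x) powr 0"
   using hdim_ge_1[OF dil] hn_nonneg[of w x] by (intro mult_left_mono powr_mono) auto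
  finally show ?thesis using hn_nonneg[of w x] by (simp split: if_splits)
 qed
 then show thesis by (rule that)
qed

text \<open>The orders are raised one at a time, first in \<open>t\<close> and then in
  \<open>s\<close>, by differentiating the identity under the integral.\<close>

lemma chapman_kolmogorov_deriv:
 "t > 0 ==> s > 0 ==> gdt (j + k) (t + s, g) = (LINT h|lborel. gdt j (t, h) * gdt k (s, mul g h))"
proof (induction k arbitrary: s)
 case 0
 obtain C where C: "\<And>x. \<bar>gdt 0 (s, x)\<bar> \<le> C" using gdt_sup[OF 0(2)] by blast
 have m: "(\<lambda>h. gdt 0 (s, mul g h)) \<in> borel_measurable borel"
  by (intro borel_measurable_continuous_onI gdt_cont_space[OF 0(2)] smooth_mapD(2)[OF smooth_mul_left])
 show ?case using 0(1)
 proof (induction j arbitrary: t)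
  case 0 then show ?case using chapman_kolmogorov[OF _ \<open>s > 0\<close>] by simp
 next
  case (Suc j)
  have "((\<lambda>t. gdt j (t + s, g)) has_real_derivative gdt (Suc j) (t + s, g)) (at t)"
   using DERIV_shift[of "\<lambda>t. gdt j (t, g)" _ t s] gdt_deriv[of "t + s" g j] Suc.prems \<open>s > 0\<close> by (simp add: zero_prod_def del: gdt.simps)
  moreover have "((\<lambda>t. gdt j (t + s, g)) has_real_derivative (LINT h|lborel. gdt (Suc j) (t, h) * gdt 0 (s, mul g h))) (at t)"
   by (rule has_field_derivative_transform_within_open[OF has_derivative_gdt_integral[OF Suc.prems m C], of "{0<..}"])
    (use Suc in auto)
  ultimately show ?case using DERIV_unique by (simp del: gdt.simps) blast
 qed
next
 case (Suc k)
 obtain C where C: "\<And>x. \<bar>gdt j (t, x)\<bar> \<le> C" using gdt_sup[OF Suc.prems(1)] by blast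
 have m: "(\<lambda>h. gdt j (t, mul (ginv g) h)) \<in> borel_measurable borel"
  by (intro borel_measurable_continuous_onI gdt_cont_space[OF Suc.prems(1)] smooth_mapD(2)[OF smooth_mul_left])
 \<comment> \<open>A left translation frees the factor depending on \<open>s\<close> from
   \<open>g\<close>, so that the same differentiation result applies to it.\<close>
 have sub: "(LINT h|lborel. gdt j (t, h) * gdt i (s, mul g h)) = (LINT h|lborel. gdt i (s, h) * gdt j (t, mul (ginv g) h))" if "s > 0" for s i
 proof -
  have "(LINT h|lborel. gdt i (s, mul g h) * gdt j (t, mul (ginv g) (mul g h))) = (LINT h|lborel. gdt i (s, h) * gdt j (t, mul (ginv g) h))"
   by (rule integral_left(1)) (intro borel_measurable_times m borel_measurable_continuous_onI gdt_cont_space[OF that] continuous_on_id)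
  then show ?thesis by (simp add: mult.commute)
 qed
 have "((\<lambda>s. gdt (j + k) (t + s, g)) has_real_derivative gdt (Suc (j + k)) (t + s, g)) (at s)"
  using DERIV_shift[of "\<lambda>t. gdt (j + k) (t, g)" _ s t] gdt_deriv[of "t + s" g "j + k"] Suc.prems
  by (simp add: zero_prod_def add.commute del: gdt.simps)
 moreover have "((\<lambda>s. gdt (j + k) (t + s, g)) has_real_derivative (LINT h|lborel. gdt (Suc k) (s, h) * gdt j (t, mul (ginv g) h))) (at s)"
  by (rule has_field_derivative_transform_within_open[OF has_derivative_gdt_integral[OF Suc.prems(2) m C], of "{0<..}"])
   (use Suc.prems Suc.IH sub in \<open>auto simp del: gdt.simps\<close>)
 ultimately have "gdt (Suc (j + k)) (t + s, g) = (LINT h|lborel. gdt (Suc k) (s, h) * gdt j (t, mul (ginv g) h))"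
  by (rule DERIV_unique)
 then show ?case using sub[OF Suc.prems(2), of "Suc k"] by (simp del: gdt.simps)
qed

text \<open>With time and order halved, the derivative is the pairing of a function with its left
  translate. Both have the same square integral, and for \<open>g = 0\<close> the pairing is that
  square integral itself; the arithmetic-geometric inequality under the integral then suffices in
  place of the full Cauchy-Schwarz inequality.\<close>

lemma gdt_even_bound: "t > 0 ==> \<bar>gdt (2 * j) (t, g)\<bar> \<le> gdt (2 * j) (t, 0)"
proof -
 assume t: "t > 0"
 define s where "s = t / 2"
 have s: "s > 0" "t = s + s" using t by (auto simp: s_def)
 define A where "A h = gdt j (s, h)" for h
 define B where "B h = gdt j (s, mul g h)" for h
 obtain C where C: "\<And>x. \<bar>gdt j (s, x)\<bar> \<le> C" using gdt_sup[OF s(1)] by blast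
 have C0: "C \<ge> 0" using C[of 0] by simp
 have iA: "integrable lborel A" unfolding A_def by (rule gdt_integrable[OF s(1)])
 have mA: "A \<in> borel_measurable borel" using borel_measurable_integrable[OF iA] by simp
 have iA2: "integrable lborel (\<lambda>h. A h * A h)"
 proof (rule Bochner_Integration.integrable_bound[OF integrable_mult_right[OF iA, of C]])
  show "AE h in lborel. norm (A h * A h) \<le> norm (C * A h)"
   using C C0 by (intro AE_I2) (simp add: abs_mult A_def mult_right_mono del: abs_mult_self)
 qed (use mA in simp)
 have BA: "B h = A (mul g h)" for h by (simp add: A_def B_def)
 have mA2: "(\<lambda>h. A h * A h) \<in> borel_measurable borel" using mA by simp
 have iB2: "integrable lborel (\<lambda>h. B h * B h)" "(LINT h|lborel. B h * B h) = (LINT h|lborel. A h * A h)"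
  using iA2 by (simp_all only: BA integral_left(1)[OF mA2] integral_left(2)[OF mA2])
 have e1: "gdt (2 * j) (t, 0) = (LINT h|lborel. A h * A h)"
  using chapman_kolmogorov_deriv[OF s(1) s(1), of j j 0] by (simp only: s(2) A_def mult_2 unit)
 have e2: "gdt (2 * j) (t, g) = (LINT h|lborel. A h * B h)"
  using chapman_kolmogorov_deriv[OF s(1) s(1), of j j g] by (simp only: s(2) A_def B_def mult_2)
 have "\<bar>LINT h|lborel. A h * B h\<bar> \<le> (LINT h|lborel. \<bar>A h * B h\<bar>)"
  using integral_norm_bound[of lborel "\<lambda>h. A h * B h"] by simp
 also have "\<dots> \<le> (LINT h|lborel. (A h * A h + B h * B h) / 2)"
 proof (rule integral_mono')
  show "\<bar>A h * B h\<bar> \<le> (A h * A h + B h * B h) / 2" for h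
   using sum_squares_bound[of "\<bar>A h\<bar>" "\<bar>B h\<bar>"] by (simp add: abs_mult power2_eq_square)
 qed (use iA2 iB2 in auto)
 also have "\<dots> = (LINT h|lborel. A h * A h)" using iA2 iB2 by simp
 finally show ?thesis by (simp only: e1 e2)
qed

text \<open>The spatial origin is fixed by dilations, so along the pole axis the kernel is a pure
  power of time, of exponent \<open>- Q / 2\<close>; its repeated differentiation produces the
  Pochhammer symbol.\<close>

lemma gdt_pole: "t > 0 ==> gdt j (t, 0) = (- 1) ^ j * pochhammer (Q / 2) j * t powr (- (Q / 2) - j) * \<gamma> (1, 0)"
proof (induction j arbitrary: t)
 case 0
 have "\<gamma> (t, \<delta> (sqrt t) 0) = sqrt t powr (- Q) * \<gamma> (1, 0)" by (rule gam_sq[OF 0])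
 moreover have "sqrt t powr (- Q) = t powr (- (Q / 2))" using 0 by (simp add: powr_half_sqrt[symmetric] powr_powr)
 ultimately show ?case using 0 by (simp add: dilation_0[OF dil])
next
 case (Suc j)
 define c where "c = (- 1) ^ j * pochhammer (Q / 2) j * \<gamma> (1, 0)"
 have "((\<lambda>t. c * t powr (- (Q / 2) - j)) has_real_derivative c * ((- (Q / 2) - j) * t powr (- (Q / 2) - j - 1))) (at t)"
  using Suc.prems by (intro DERIV_cmult has_real_derivative_powr)
 then have "((\<lambda>t. gdt j (t, 0)) has_real_derivative c * ((- (Q / 2) - j) * t powr (- (Q / 2) - j - 1))) (at t)"
  by (rule has_field_derivative_transform_within_open[of _ _ _ "{0<..}"]) (use Suc in \<open>auto simp: c_def\<close>)
 moreover have "((\<lambda>t. gdt j (t, 0)) has_real_derivative gdt (Suc j) (t, 0)) (at t)"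
  by (rule gdt_deriv) (use Suc.prems in \<open>simp add: zero_prod_def\<close>)
 ultimately have "gdt (Suc j) (t, 0) = c * ((- (Q / 2) - j) * t powr (- (Q / 2) - j - 1))" by (metis DERIV_unique)
 then show ?case by (simp add: c_def pochhammer_Suc algebra_simps del: gdt.simps)
qed

text \<open>Halving the time at \<open>g = 0\<close> writes the value as an integral of a square,
  and unit mass prevents that square from vanishing identically.\<close>

lemma gam_pole_pos: "t > 0 ==> \<gamma> (t, 0) > 0"
proof -
 assume t: "t > 0"
 define s where "s = t / 2"
 have s: "s > 0" "t = s + s" using t by (auto simp: s_def)
 have c: "continuous_on UNIV (\<lambda>h. \<gamma> (s, h))" using gdt_cont_space[OF s(1) continuous_on_id, of 0] by simp
 obtain x where x: "\<gamma> (s, x) \<noteq> 0"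
 proof (rule ccontr)
  assume "\<not> thesis"
  then have "\<gamma> (s, h) = 0" for h using that by blast
  then show False using gam_mass[of s] s(1) mass_one by simp
 qed
 have g0: "0 \<le> \<gamma> (s, h)" for h by (rule gam_nonneg) (use s(1) in \<open>simp add: zero_prod_def\<close>)
 obtain C where C: "\<And>x. \<bar>gdt 0 (s, x)\<bar> \<le> C" using gdt_sup[OF s(1)] by blast
 have i: "integrable lborel (\<lambda>h. \<gamma> (s, h) * \<gamma> (s, h))"
 proof (rule Bochner_Integration.integrable_bound[OF integrable_mult_right[OF gam_integrable[OF s(1)], of C]])
  have C0: "C \<ge> 0" using C[of 0] by simp
  show "AE h in lborel. norm (\<gamma> (s, h) * \<gamma> (s, h)) \<le> norm (C * \<gamma> (s, h))"
   using C C0 by (intro AE_I2) (simp add: abs_mult mult_right_mono del: abs_mult_self)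
  show "(\<lambda>h. \<gamma> (s, h) * \<gamma> (s, h)) \<in> borel_measurable lborel"
   using borel_measurable_continuous_onI[OF c] by simp
 qed
 have "0 < (LINT h|lborel. \<gamma> (s, h) * \<gamma> (s, h))"
 proof (rule integral_pos_point[OF _ i open_UNIV UNIV_I, of x])
  show "continuous_on UNIV (\<lambda>h. \<gamma> (s, h) * \<gamma> (s, h))" by (intro continuous_on_mult c)
  show "0 < \<gamma> (s, x) * \<gamma> (s, x)" using x g0[of x] by (simp add: less_le)
 qed (simp add: g0)
 then show ?thesis using chapman_kolmogorov[OF s(1) s(1), of 0] by (simp add: s(2))
qed

text \<open>The integrand in Chapman-Kolmogorov is nonnegative. Near \<open>h = 0\<close> its first
  factor is positive, so a nonzero value at the earlier time would make the value at
  \<open>t0\<close> positive.\<close>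

lemma gam_zero_before:
 assumes z: "\<gamma> (t0, g) = 0" and t: "0 < t" "t < t0"
 shows "\<gamma> (t, g) = 0"
proof (rule ccontr)
 assume nz: "\<gamma> (t, g) \<noteq> 0"
 define s where "s = t0 - t"
 have s: "s > 0" "t0 = s + t" using t by (auto simp: s_def)
 have g0: "0 \<le> \<gamma> (r, h)" if "r > 0" for r h by (rule gam_nonneg) (use that in \<open>simp add: zero_prod_def\<close>)
 have c: "continuous_on UNIV (\<lambda>h. \<gamma> (s, h))" "continuous_on UNIV (\<lambda>h. \<gamma> (t, mul g h))"
  using gdt_cont_space[OF s(1) continuous_on_id, of 0] gdt_cont_space[OF t(1) smooth_mapD(2)[OF smooth_mul_left], of 0] by simp_all
 obtain C where C: "\<And>x. \<bar>gdt 0 (t, x)\<bar> \<le> C" using gdt_sup[OF t(1)] by blast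
 have C0: "C \<ge> 0" using C[of 0] by simp
 have i: "integrable lborel (\<lambda>h. \<gamma> (s, h) * \<gamma> (t, mul g h))"
 proof (rule Bochner_Integration.integrable_bound[OF integrable_mult_right[OF gam_integrable[OF s(1)], of C]])
  show "AE h in lborel. norm (\<gamma> (s, h) * \<gamma> (t, mul g h)) \<le> norm (C * \<gamma> (s, h))"
  proof (intro AE_I2)
   fix h
   show "norm (\<gamma> (s, h) * \<gamma> (t, mul g h)) \<le> norm (C * \<gamma> (s, h))"
    using C[of "mul g h"] C0 mult_right_mono[OF C[of "mul g h"], of "\<bar>\<gamma> (s, h)\<bar>"] by (simp add: abs_mult mult.commute)
  qed
  show "(\<lambda>h. \<gamma> (s, h) * \<gamma> (t, mul g h)) \<in> borel_measurable lborel"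
   using borel_measurable_continuous_onI[OF c(1)] borel_measurable_continuous_onI[OF c(2)] by simp
 qed
 have "0 < (LINT h|lborel. \<gamma> (s, h) * \<gamma> (t, mul g h))"
 proof (rule integral_pos_point[OF _ i open_UNIV UNIV_I, of 0])
  show "continuous_on UNIV (\<lambda>h. \<gamma> (s, h) * \<gamma> (t, mul g h))" by (intro continuous_on_mult c)
  show "0 < \<gamma> (s, 0) * \<gamma> (t, mul g 0)" using nz g0[OF t(1), of g] gam_pole_pos[OF s(1)] by (simp add: less_le)
 qed (simp add: g0 s t)
 then show False using chapman_kolmogorov[OF s(1) t(1), of g] z by (simp add: s(2))
qed

text \<open>These are the terms of the convergent binomial series of
  \<open>(1 - 1 / 2) powr (- a)\<close>.\<close>

lemma poch_fact_half_tendsto: "(\<lambda>n. pochhammer (a :: real) n / fact n * (1 / 2) ^ n) \<longlonglongrightarrow> 0"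
proof -
 have "summable (\<lambda>n. ((- a) gchoose n) * (- 1 / 2) ^ n)"
  using gen_binomial_real[of "- 1 / 2 :: real" "- a"] by (simp add: sums_iff)
 moreover have "((- a) gchoose n) * (- 1 / 2) ^ n = pochhammer a n / fact n * (1 / 2) ^ n" for n
 proof -
  have "((- 1) ^ n :: real) * (- 1 / 2) ^ n = (1 / 2) ^ n" by (simp add: power_mult_distrib[symmetric])
  then show ?thesis by (simp add: gbinomial_pochhammer)
 qed
 ultimately have "summable (\<lambda>n. pochhammer a n / fact n * (1 / 2) ^ n)" by simp
 then show ?thesis by (rule summable_LIMSEQ_zero)
qed

text \<open>All time derivatives vanish at \<open>t0\<close>, being 0 to its left, so Taylor's
  formula consists of its remainder alone. At even order the remainder is bounded by the derivative
  at the pole, and a step of at most \<open>t0 / 2\<close> makes this bound a multiple of a term of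
  the binomial series with ratio \<open>1 / 2\<close>. This explains the factor
  \<open>3 / 2\<close>.\<close>

lemma gam_zero_extend:
 assumes z: "\<gamma> (t0, g) = 0" and t0: "0 < t0" and t: "t0 < t" "t \<le> 3 / 2 * t0"
 shows "\<gamma> (t, g) = 0"
proof -
 have z1: "gdt j (s, g) = 0" if "0 < s" "s < t0" for j s using that
 proof (induction j arbitrary: s)
  case 0 then show ?case using gam_zero_before[OF z] by simp
 next
  case (Suc j)
  have "((\<lambda>s. gdt j (s, g)) has_real_derivative 0) (at s)"
   by (rule has_field_derivative_transform_within_open[of "\<lambda>_. 0" _ _ "{0<..<t0}"]) (use Suc in auto)
  moreover have "((\<lambda>s. gdt j (s, g)) has_real_derivative gdt (Suc j) (s, g)) (at s)"
   by (rule gdt_deriv) (use Suc.prems in \<open>simp add: zero_prod_def\<close>)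
  ultimately show ?case by (metis DERIV_unique)
 qed
 have z2: "gdt j (t0, g) = 0" for j
 proof -
  have "((\<lambda>s. gdt j (s, g)) has_real_derivative gdt (Suc j) (t0, g)) (at t0)"
   by (rule gdt_deriv) (use t0 in \<open>simp add: zero_prod_def\<close>)
  then have "isCont (\<lambda>s. gdt j (s, g)) t0" by (rule DERIV_isCont)
  then have "((\<lambda>s. gdt j (s, g)) \<longlongrightarrow> gdt j (t0, g)) (at_left t0)"
   unfolding isCont_def by (rule filterlim_mono[OF _ order_refl at_le]) simp
  moreover have "((\<lambda>s. gdt j (s, g)) \<longlongrightarrow> 0) (at_left t0)"
  proof (rule tendsto_eventually)
   show "\<forall>\<^sub>F s in at_left t0. gdt j (s, g) = 0"
    unfolding eventually_at_left[OF t0] using z1 t0 by (intro exI[of _ 0]) auto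
  qed
  ultimately show ?thesis using tendsto_unique trivial_limit_at_left_real by blast
 qed
 define B where "B n = pochhammer (Q / 2) n / fact n * (1 / 2) ^ n * (t0 powr (- (Q / 2)) * \<gamma> (1, 0))" for n
 have g1: "\<gamma> (1, 0) > 0" by (rule gam_pole_pos) simp
 have pp: "pochhammer (Q / 2) n \<ge> 0" for n using hdim_ge_1[OF dil] by (intro pochhammer_nonneg) simp
 have bd: "\<bar>\<gamma> (t, g)\<bar> \<le> B (2 * j)" if j: "j > 0" for j
 proof -
  let ?n = "2 * j"
  have "\<exists>s>t0. s < t \<and> gdt 0 (t, g) = (\<Sum>i<?n. gdt i (t0, g) / fact i * (t - t0) ^ i) + gdt ?n (s, g) / fact ?n * (t - t0) ^ ?n"
  proof (rule Taylor_up[where a=t0 and b=t and f="\<lambda>s. gdt 0 (s, g)" and diff="\<lambda>i s. gdt i (s, g)"])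
   show "\<forall>i s. i < ?n \<and> t0 \<le> s \<and> s \<le> t \<longrightarrow> ((\<lambda>s. gdt i (s, g)) has_real_derivative gdt (Suc i) (s, g)) (at s)"
    by (intro allI impI gdt_deriv) (use t0 in \<open>simp add: zero_prod_def\<close>)
  qed (use j t in auto)
  then obtain s where s: "t0 < s" "s < t" "\<gamma> (t, g) = gdt ?n (s, g) / fact ?n * (t - t0) ^ ?n"
   by (auto simp: z2 simp del: gdt.simps(2))
  have s0: "s > 0" using s t0 by simp
  have "\<bar>gdt ?n (s, g)\<bar> \<le> gdt ?n (s, 0)" by (rule gdt_even_bound[OF s0])
  also have "\<dots> = pochhammer (Q / 2) ?n * \<gamma> (1, 0) * s powr (- (Q / 2) - ?n)" by (subst gdt_pole[OF s0]) simp
  also have "\<dots> \<le> pochhammer (Q / 2) ?n * \<gamma> (1, 0) * t0 powr (- (Q / 2) - ?n)"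
   using s(1) t0 hdim_ge_1[OF dil] g1 pp by (intro mult_left_mono powr_mono2') auto
  also have "t0 powr (- (Q / 2) - ?n) = t0 powr (- (Q / 2)) / t0 ^ ?n"
   using t0 by (subst powr_diff) (simp add: powr_realpow[symmetric])
  finally have 1: "\<bar>gdt ?n (s, g)\<bar> \<le> pochhammer (Q / 2) ?n * \<gamma> (1, 0) * (t0 powr (- (Q / 2)) / t0 ^ ?n)" .
  have 2: "(t - t0) ^ ?n \<le> (t0 / 2) ^ ?n" using t by (intro power_mono) auto
  have "\<bar>\<gamma> (t, g)\<bar> = \<bar>gdt ?n (s, g)\<bar> / fact ?n * (t - t0) ^ ?n" using t by (simp add: s(3) abs_mult power_abs del: gdt.simps)
  also have "\<dots> \<le> (pochhammer (Q / 2) ?n * \<gamma> (1, 0) * (t0 powr (- (Q / 2)) / t0 ^ ?n)) / fact ?n * (t0 / 2) ^ ?n"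
   using 1 2 t pp g1 t0 by (intro mult_mono divide_right_mono) (auto simp del: gdt.simps)
  also have "\<dots> = B ?n" using t0 by (simp add: B_def power_divide)
  finally show ?thesis .
 qed
 have "B \<longlonglongrightarrow> 0 * (t0 powr (- (Q / 2)) * \<gamma> (1, 0))"
  unfolding B_def by (intro tendsto_mult poch_fact_half_tendsto tendsto_const)
 moreover have "strict_mono (\<lambda>j::nat. 2 * j)" by (auto intro: strict_monoI)
 ultimately have "(\<lambda>j. B (2 * j)) \<longlonglongrightarrow> 0" using LIMSEQ_subseq_LIMSEQ[of B 0 "\<lambda>j. 2 * j"] by (simp add: comp_def)
 then have "\<bar>\<gamma> (t, g)\<bar> \<le> 0"
 proof (rule tendsto_lowerbound)
  show "\<forall>\<^sub>F j in sequentially. \<bar>\<gamma> (t, g)\<bar> \<le> B (2 * j)"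
   using eventually_gt_at_top[of "0::nat"] by eventually_elim (rule bd)
 qed simp
 then show ?thesis by simp
qed

text \<open>A zero at one time propagates to all later times, but \<open>t powr (Q / 2) * \<gamma> (t, g)\<close> tends to
 \<open>\<gamma> (1, 0) > 0\<close> as \<open>t\<close> grows.\<close>

lemma gam_pos: "t > 0 ==> \<gamma> (t, g) > 0"
proof (rule ccontr)
 assume t: "t > 0" and n: "\<not> \<gamma> (t, g) > 0"
 have "0 \<le> \<gamma> (t, g)" by (rule gam_nonneg) (use t in \<open>simp add: zero_prod_def\<close>)
 then have z: "\<gamma> (t, g) = 0" using n by simp
 have all: "\<gamma> (t * (3 / 2) ^ n, g) = 0" for n
 proof (induction n)
  case (Suc n)
  show ?case by (rule gam_zero_extend[OF Suc]) (use t in auto)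
 qed (simp add: z)
 \<comment> \<open>Dilation by \<open>s n\<close> carries time 1 to the time of the
   \<open>n\<close>-th zero, so each zero yields one on the slice at time 1, at a point contracting
   to the origin.\<close>
 define s where "s n = sqrt (t * (3 / 2) ^ n)" for n :: nat
 have s: "s n > 0" "s n * s n = t * (3 / 2) ^ n" for n using t by (auto simp: s_def)
 have z1: "\<gamma> (1, \<delta> (1 / s n) g) = 0" for n
 proof -
  have "\<gamma> (s n * s n, \<delta> (s n) (\<delta> (1 / s n) g)) = s n powr (- Q) * \<gamma> (1, \<delta> (1 / s n) g)"
   using gam_sq[of "s n * s n" "\<delta> (1 / s n) g"] s(1)[of n] by (simp add: real_sqrt_mult)
  then show ?thesis using all[of n] s[of n] dilation_inverse(1)[OF dil s(1)[of n]] by simp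
 qed
 have "filterlim (\<lambda>n. t * (3 / 2) ^ n) at_top sequentially"
  by (rule filterlim_tendsto_pos_mult_at_top[OF tendsto_const t filterlim_at_infinity_imp_filterlim_at_top])
   (auto intro: filterlim_realpow_sequentially_gt1)
 then have "filterlim s at_top sequentially" unfolding s_def by (rule filterlim_compose[OF sqrt_at_top])
 then have "(\<lambda>n. \<delta> (1 / s n) g) \<longlonglongrightarrow> 0" by (rule filterlim_compose[OF dilation_tendsto_0[OF dil]])
 then have "(\<lambda>n. \<gamma> (1, \<delta> (1 / s n) g)) \<longlonglongrightarrow> \<gamma> (1, 0)"
  by (intro continuous_on_tendsto_compose[of UNIV "\<lambda>h. \<gamma> (1, h)"]) (use gdt_cont_space[OF zero_less_one continuous_on_id, of 0] in auto)
 then have "\<gamma> (1, 0) = 0" by (simp add: z1 LIMSEQ_const_iff)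
 then show False using gam_pole_pos[of 1] by simp
qed

end

section \<open>Lifted groups and their fibres\<close>

text \<open>Continuity keeps \<open>f\<close> bounded along the contraction to the origin, while
  homogeneity multiplies it by a factor tending to 0; the product is constantly
  \<open>f x\<close>.\<close>

lemma homog_neg_zero:
 fixes f :: "'a::euclidean_space => real"
 assumes \<delta>: "dilation w \<delta>" and f: "continuous_on UNIV f" "homog \<delta> d UNIV f" and d: "d < 0"
 shows "f x = 0"
proof -
 have "((\<lambda>l. f (\<delta> (1 / l) x)) \<longlongrightarrow> f 0) at_top"
  using continuous_on_tendsto_compose[OF f(1) dilation_tendsto_0[OF \<delta>]] by simp
 moreover have "((\<lambda>l::real. l powr d) \<longlongrightarrow> 0) at_top" by (rule tendsto_neg_powr[OF d filterlim_ident])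
 ultimately have "((\<lambda>l. l powr d * f (\<delta> (1 / l) x)) \<longlongrightarrow> 0 * f 0) at_top" by (intro tendsto_mult)
 moreover have "\<forall>\<^sub>F l in at_top. l powr d * f (\<delta> (1 / l) x) = f x"
  using eventually_gt_at_top[of 0]
 proof eventually_elim
  case (elim l)
  then show ?case using homogD(2)[OF f(2) elim, of "\<delta> (1 / l) x"] dilation_inverse(1)[OF \<delta> elim] by simp
 qed
 ultimately have "((\<lambda>l::real. f x) \<longlongrightarrow> 0) at_top" by (simp add: tendsto_cong)
 then show ?thesis by (simp add: tendsto_const_iff)
qed

locale lifted_group = heat_group mul ginv "dprod \<delta>x \<delta>y" "wprod v u" m Zs \<gamma>
 for mul :: "'x::euclidean_space \<times> 'y::euclidean_space => 'x \<times> 'y => 'x \<times> 'y" and ginv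
  and \<delta>x :: "real => 'x => 'x" and \<delta>y :: "real => 'y => 'y" and v u m Zs \<gamma> +
 fixes Xs :: "nat => 'x => 'x"
 assumes dil_x: "dilation v \<delta>x" and dil_y: "dilation u \<delta>y"
  and Xs_smooth: "\<forall>j<m. smooth_map (Xs j)"
  and lift: "\<forall>j<m. \<forall>g. fst (Zs j g) = Xs j (fst g)"
  and gen: "\<And>Y. smooth_map Y ==> (\<And>a x. frechet_derivative (mul a) (at x) (Y x) = Y (mul a x)) ==> Y \<in> lie_gen (Zs ` {..<m})"
begin

lemma Xs_hom: "\<forall>j<m. \<forall>l>0. \<forall>x. \<delta>x l (Xs j x) = l *\<^sub>R Xs j (\<delta>x l x)"
proof (intro allI impI)
 fix j l x assume j: "j < m" and l: "(l::real) > 0"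
 have "dprod \<delta>x \<delta>y l (Zs j (x, 0)) = l *\<^sub>R Zs j (dprod \<delta>x \<delta>y l (x, 0))" using Zs_hom j l by blast
 from arg_cong[OF this, of fst] show "\<delta>x l (Xs j x) = l *\<^sub>R Xs j (\<delta>x l x)"
  using lift j by (simp add: dprod_def)
qed

text \<open>Vector fields whose horizontal component factors through the projection form a Lie algebra.\<close>

lemma lie_gen_projectable:
 assumes "Y \<in> lie_gen (Zs ` {..<m})"
 shows "smooth_map Y \<and> (\<forall>g. fst (Y g) = fst (Y (fst g, 0)))"
 using assms
proof (induction rule: lie_gen.induct)
 case (base X)
 then obtain j where j: "j < m" "X = Zs j" by auto
 then show ?case using Zs_smooth lift by simp
next
 case zero then show ?case by (simp add: smooth_map_const)
next
 case (add X Y)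
 then have "fst (X g) + fst (Y g) = fst (X (fst g, 0)) + fst (Y (fst g, 0))" for g by metis
 then show ?case using add.IH by (simp only: fst_add smooth_map_add simp_thms)
next
 case (scale X c)
 then have "c *\<^sub>R fst (X g) = c *\<^sub>R fst (X (fst g, 0))" for g by metis
 then show ?case using scale.IH by (simp only: fst_scaleR smooth_map_scaleR smooth_on_const simp_thms)
next
 case (bracket X Y)
 have sm: "smooth_map (\<lambda>g. frechet_derivative B (at g) (A g))" if "smooth_map A" "smooth_map B" for A B :: "'x \<times> 'y => 'x \<times> 'y"
 proof -
  have "frechet_derivative B (at g) (A g) = (\<Sum>b\<in>Basis. (A g \<bullet> b) *\<^sub>R frechet_derivative B (at g) b)" for g
  proof -
   note L = linear_frechet_derivative[OF smooth_mapD(1)[OF that(2)]]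
   have "frechet_derivative B (at g) (A g) = frechet_derivative B (at g) (\<Sum>b\<in>Basis. (A g \<bullet> b) *\<^sub>R b)"
    by (simp add: euclidean_representation)
   also have "\<dots> = (\<Sum>b\<in>Basis. (A g \<bullet> b) *\<^sub>R frechet_derivative B (at g) b)"
    by (simp add: linear_sum[OF L] linear_cmul[OF L])
   finally show ?thesis .
  qed
  then show ?thesis
   by (simp only:) (intro smooth_map_sum smooth_map_scaleR smooth_map_component smooth_map_frechet that)
 qed
 \<comment> \<open>The horizontal part of \<open>B\<close> is a map \<open>F\<close> of the base
   point, so its derivative along \<open>A\<close> involves the horizontal part of \<open>A\<close>
   only.\<close>
 have pr: "fst (frechet_derivative B (at g) (A g)) = fst (frechet_derivative B (at (fst g, 0)) (A (fst g, 0)))"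
  if A: "smooth_map A" "\<forall>g. fst (A g) = fst (A (fst g, 0))" and B: "smooth_map B" "\<forall>g. fst (B g) = fst (B (fst g, 0))" for A B :: "'x \<times> 'y => 'x \<times> 'y" and g
 proof -
  define F where "F x = fst (B (x, 0))" for x
  have sF: "smooth_map F" unfolding F_def
   by (intro smooth_map_fst' smooth_map_compose[OF B(1)] smooth_map_Pair smooth_map_const smooth_map_ident)
  have "fst (frechet_derivative B (at g) w) = frechet_derivative F (at (fst g)) (fst w)" for g w
  proof -
   have 1: "((\<lambda>g. fst (B g)) has_derivative (\<lambda>w. fst (frechet_derivative B (at g) w))) (at g)"
    by (intro has_derivative_fst has_derivative_frechet smooth_mapD(1)[OF B(1)])
   have 2: "((\<lambda>g. F (fst g)) has_derivative (\<lambda>w. frechet_derivative F (at (fst g)) (fst w))) (at g)"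
    by (rule has_derivative_compose[OF has_derivative_fst[OF has_derivative_ident] has_derivative_frechet[OF smooth_mapD(1)[OF sF]]])
   have "(\<lambda>g. fst (B g)) = (\<lambda>g. F (fst g))" using B(2) unfolding F_def by blast
   then show ?thesis using has_derivative_unique[OF 1] 2 by metis
  qed
  then show ?thesis using A(2) by (metis fst_conv)
 qed
 have X: "smooth_map X" "\<forall>g. fst (X g) = fst (X (fst g, 0))" and Y: "smooth_map Y" "\<forall>g. fst (Y g) = fst (Y (fst g, 0))"
  using bracket.IH by auto
 have "smooth_map (lie_bracket X Y)" unfolding lie_bracket_def
  by (intro smooth_map_diff sm X(1) Y(1))
 moreover have "fst (lie_bracket X Y g) = fst (lie_bracket X Y (fst g, 0))" for g
  unfolding lie_bracket_def fst_diff by (rule arg_cong2[where f="(-)", OF pr[OF X Y] pr[OF Y X]])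
 ultimately show ?case by metis
qed

text \<open>The left-invariant field with value \<open>k\<close> at the identity.\<close>

definition frame :: "'x \<times> 'y => 'x \<times> 'y => 'x \<times> 'y" where
 "frame k g = frechet_derivative (mul g) (at 0) k"

lemma mul_deriv: "(mul g has_derivative frechet_derivative (mul g) (at h)) (at h)"
 by (rule has_derivative_frechet[OF smooth_mapD(1)[OF smooth_mul_left]])

lemma frame_smooth: "smooth_map (frame k)"
proof -
 have "frame k g = frechet_derivative (\<lambda>p. mul (fst p) (snd p)) (at (g, 0)) (0, k)" for g
 proof -
  have "((\<lambda>b. (g, b)) has_derivative (\<lambda>w. (0, w))) (at 0)"
   by (intro has_derivative_Pair has_derivative_const has_derivative_ident)
  from has_derivative_compose[OF this has_derivative_frechet[OF smooth_mapD(1)[OF smooth(1)]]]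
  have "(mul g has_derivative (\<lambda>w. frechet_derivative (\<lambda>p. mul (fst p) (snd p)) (at (g, 0)) (0, w))) (at 0)" by simp
  from fun_cong[OF frechet_derivative_at[OF this], of k] show ?thesis by (simp add: frame_def)
 qed
 then have "frame k = (\<lambda>g. frechet_derivative (\<lambda>p. mul (fst p) (snd p)) (at (g, 0)) (0, k))" by blast
 then show ?thesis
  by (simp only:) (rule smooth_map_compose[OF smooth_map_frechet[OF smooth(1)] smooth_map_Pair[OF smooth_map_ident smooth_map_const]])
qed

lemma frame_left: "frechet_derivative (mul a) (at g) (frame k g) = frame k (mul a g)"
proof -
 have "((\<lambda>b. mul a (mul g b)) has_derivative (\<lambda>w. frechet_derivative (mul a) (at (mul g 0)) (frechet_derivative (mul g) (at 0) w))) (at 0)"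
  by (rule has_derivative_compose[OF mul_deriv mul_deriv])
 then have "(mul (mul a g) has_derivative (\<lambda>w. frechet_derivative (mul a) (at g) (frechet_derivative (mul g) (at 0) w))) (at 0)"
  by (simp add: assoc[symmetric])
 from fun_cong[OF frechet_derivative_at[OF this], of k] show ?thesis by (simp add: frame_def)
qed

text \<open>Here generation enters: every left-invariant field, not only the given ones, belongs to
  the generated Lie algebra and therefore projects to the base.\<close>

lemma frame_fst: "fst (frame k g) = fst (frame k (fst g, 0))"
 using lie_gen_projectable[OF gen[OF frame_smooth frame_left]] by blast

text \<open>The induction runs over the degree of homogeneity of \<open>f\<close>: differentiating \<open>f \<circ> fst\<close> along the
 left-invariant frame lowers it by at least one, and functions of negative degree vanish.\<close>

lemma equivariant_homog:
 "smooth_on UNIV f ==> homog \<delta>x d UNIV f ==> d < real n ==> fst a = fst a' ==> f (fst (mul a g)) = f (fst (mul a' g))"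
proof (induction n arbitrary: d f a a' g)
 case 0
 then show ?case using homog_neg_zero[OF dil_x smooth_onD(4)[OF 0(1)] 0(2)] by simp
next
 case (Suc n)
 note f = Suc.prems(1,2)
 \<comment> \<open>The derivative of \<open>f\<close> along the projected frame field. By
   \<open>frame_fst\<close> it is again a function on the base, so the induction hypothesis can be
   applied to it.\<close>
 define fk where "fk k x = frechet_derivative f (at x) (fst (frame k (x, 0)))" for k x
 have df: "((\<lambda>b. f (fst (mul w b))) has_derivative (\<lambda>k. frechet_derivative f (at (fst w)) (fst (frame k w)))) (at 0)" for w
 proof -
  have "((\<lambda>b. f (fst (mul w b))) has_derivative (\<lambda>k. frechet_derivative f (at (fst (mul w 0))) (fst (frechet_derivative (mul w) (at 0) k)))) (at 0)"
   by (rule has_derivative_compose[OF has_derivative_fst[OF mul_deriv] has_derivative_frechet[OF smooth_onD(2)[OF f(1) UNIV_I]]])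
  then show ?thesis by (simp add: frame_def)
 qed
 have dfk: "frechet_derivative f (at (fst w)) (fst (frame k w)) = fk k (fst w)" for k w
  unfolding fk_def using frame_fst[of k w] by simp
 have sfk: "smooth_on UNIV (fk k)" for k
 proof -
  have "fk k = (\<lambda>x. \<Sum>b\<in>Basis. (fst (frame k (x, 0)) \<bullet> b) * ddir b f x)"
   unfolding fk_def using frechet_derivative_basis[OF smooth_onD(2)[OF f(1) UNIV_I]] by blast
  moreover have "smooth_map (\<lambda>x. fst (frame k (x, 0)))"
   by (intro smooth_map_fst' smooth_map_compose[OF frame_smooth] smooth_map_Pair smooth_map_const smooth_map_ident)
  ultimately show ?thesis
   by (simp only:) (intro smooth_on_sum open_UNIV smooth_on_mult smooth_map_component smooth_onD(3)[OF f(1)])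
 qed
 \<comment> \<open>Differentiating at the identity along \<open>k\<close> lowers the degree by the
   weight of \<open>k\<close>, which is at least 1.\<close>
 have hfk: "homog \<delta>x (d - wprod v u k) UNIV (fk k)" if k: "k \<in> Basis" for k
  unfolding homog_def
 proof (intro allI impI ballI conjI UNIV_I)
  fix l :: real and x assume l: "l > 0"
  let ?D = "dprod \<delta>x \<delta>y"
  have bl: "bounded_linear (?D (1 / l))" using dilation_bounded_linear[OF dil] l by simp
  have eq: "f (fst (mul (\<delta>x l x, 0) b)) = l powr d * f (fst (mul (x, 0) (?D (1 / l) b)))" for b
  proof -
   have "mul (?D l (x, 0)) (?D l (?D (1 / l) b)) = ?D l (mul (x, 0) (?D (1 / l) b))" by (rule aut[OF l])
   moreover have "?D l (x, 0) = (\<delta>x l x, 0)" by (simp add: dprod_def dilation_0[OF dil_y l])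
   moreover have "?D l (?D (1 / l) b) = b" by (rule dilation_inverse(1)[OF dil l])
   ultimately have "fst (mul (\<delta>x l x, 0) b) = \<delta>x l (fst (mul (x, 0) (?D (1 / l) b)))" by (simp add: dprod_def)
   then show ?thesis using homogD(2)[OF f(2) l UNIV_I] by simp
  qed
  have "((\<lambda>b. f (fst (mul (x, 0) (?D (1 / l) b)))) has_derivative (\<lambda>w. frechet_derivative f (at (fst (x, 0::'y))) (fst (frame (?D (1 / l) w) (x, 0))))) (at 0)"
   by (rule has_derivative_compose[OF bounded_linear_imp_has_derivative[OF bl]]) (use df[of "(x, 0)"] dilation_0[OF dil] l in simp)
  from has_derivative_mult_right[OF this, of "l powr d"]
  have "((\<lambda>b. f (fst (mul (\<delta>x l x, 0) b))) has_derivative (\<lambda>w. l powr d * frechet_derivative f (at (fst (x, 0::'y))) (fst (frame (?D (1 / l) w) (x, 0))))) (at 0)"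
   unfolding eq .
  from fun_cong[OF has_derivative_unique[OF df[of "(\<delta>x l x, 0)"] this], of k]
  have "fk k (\<delta>x l x) = l powr d * fk (?D (1 / l) k) x" by (simp add: fk_def)
  also have "?D (1 / l) k = ((1 / l) powr wprod v u k) *\<^sub>R k" using dilation_Basis[OF dil _ k, of "1 / l"] l by simp
  also have "fk (((1 / l) powr wprod v u k) *\<^sub>R k) x = (1 / l) powr wprod v u k * fk k x"
   using frechet_derivative_linear(1)[OF smooth_onD(2)[OF f(1) UNIV_I]]
   by (simp add: fk_def frame_def linear_cmul[OF linear_frechet_derivative[OF smooth_mapD(1)[OF smooth_mul_left]]])
  also have "(1 / l) powr wprod v u k = l powr (- wprod v u k)" using l by (simp add: powr_minus_divide powr_divide)
  finally show "fk k (\<delta>x l x) = l powr (d - wprod v u k) * fk k x" using l by (simp add: powr_add[symmetric])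
 qed
 have IH: "fk k (fst (mul a g)) = fk k (fst (mul a' g))" if k: "k \<in> Basis" for k g
  by (rule Suc.IH[OF sfk hfk[OF k]]) (use Suc.prems(3,4) dilationD(1)[OF dil k] in auto)
 \<comment> \<open>By the induction hypothesis all frame derivatives of this difference vanish, so
   it is constant; at the identity it is 0 because \<open>a\<close> and \<open>a'\<close> have the
   same base point.\<close>
 define h where "h g = f (fst (mul a g)) - f (fst (mul a' g))" for g
 have dh: "(h has_derivative (\<lambda>_. 0)) (at g)" for g
 proof -
  have "((\<lambda>b. f (fst (mul (mul a g) b)) - f (fst (mul (mul a' g) b))) has_derivative
   (\<lambda>k. frechet_derivative f (at (fst (mul a g))) (fst (frame k (mul a g))) - frechet_derivative f (at (fst (mul a' g))) (fst (frame k (mul a' g))))) (at 0)"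
   by (intro has_derivative_diff df)
  then have d0: "((\<lambda>b. h (mul g b)) has_derivative (\<lambda>k. fk k (fst (mul a g)) - fk k (fst (mul a' g)))) (at 0)"
   by (simp add: h_def assoc dfk)
  have lin: "linear (\<lambda>k. fk k (fst (mul a g)) - fk k (fst (mul a' g)))"
   using has_derivative_linear[OF d0] .
  have "fk k (fst (mul a g)) - fk k (fst (mul a' g)) = 0" for k
   using linear_eq_0_on_span[OF lin, of Basis k] IH by simp
  then have d1: "((\<lambda>b. h (mul g b)) has_derivative (\<lambda>k. 0)) (at (mul (ginv g) g))" using d0 by simp
  from has_derivative_compose[OF mul_deriv[of "ginv g" g] d1] show ?thesis by simp
 qed
 have "\<exists>c. \<forall>g\<in>UNIV. h g = c"
  by (rule has_derivative_zero_constant[OF convex_UNIV]) (use dh in simp)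
 then have "h g = h 0" by (metis UNIV_I)
 then show ?case using Suc.prems(4) by (simp add: h_def)
qed

text \<open>Coordinate functions are homogeneous, of degree equal to their weight.\<close>

lemma equivariant: "fst a = fst a' ==> fst (mul a g) = fst (mul a' g)"
proof (rule euclidean_eqI)
 fix b :: 'x assume eq: "fst a = fst a'" and b: "b \<in> Basis"
 have 1: "smooth_on UNIV (\<lambda>x. x \<bullet> b)" by (rule smooth_on_linear) (rule bounded_linear_inner_left)
 have 2: "homog \<delta>x (v b) UNIV (\<lambda>x. x \<bullet> b)" using dilationD(2)[OF dil_x _ b] by (simp add: homog_def)
 obtain n where n: "v b < real n" using reals_Archimedean2 by blast
 show "fst (mul a g) \<bullet> b = fst (mul a' g) \<bullet> b" by (rule equivariant_homog[OF 1 2 n eq])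
qed

text \<open>The origin of the vertical maps below: left multiplication by the quotient of two points
  of one fibre maps every fibre to itself.\<close>

lemma fst_divide: "fst a = fst a' ==> fst (mul (mul a (ginv a')) g) = fst g"
 using equivariant[of "mul a (ginv a')" "mul a' (ginv a')" g] equivariant[of a a' "ginv a'"] by simp

text \<open>The reparametrisation of the fibre over \<open>y\<close> that compensates for replacing
  \<open>a'\<close> by \<open>a\<close> in the kernel, as \<open>fibre_mul\<close> states.\<close>

definition fibre :: "'x \<times> 'y => 'x \<times> 'y => 'x => 'y => 'y" where
 "fibre a a' y \<eta> = snd (mul (mul a (ginv a')) (y, \<eta>))"

lemma fibre_mul: "fst a = fst a' ==> mul (ginv a) (y, fibre a a' y \<eta>) = mul (ginv a') (y, \<eta>)"
proof -
 assume eq: "fst a = fst a'"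
 have "(y, fibre a a' y \<eta>) = mul (mul a (ginv a')) (y, \<eta>)" using fst_divide[OF eq, of "(y, \<eta>)"] by (simp add: fibre_def prod_eq_iff)
 then show ?thesis by (simp add: assoc)
qed

lemma fibre_smooth:
 assumes "smooth_map A" "smooth_map A'" "smooth_map y" "smooth_map \<eta>"
 shows "smooth_map (\<lambda>p. fibre (A p) (A' p) (y p) (\<eta> p))"
 unfolding fibre_def by (intro smooth_map_snd' smooth_map_mul smooth_map_inv smooth_map_Pair assms)

text \<open>The maps form a homogeneous family in all four parameters. Exchanging the two vertical
  parameters inverts them, and at parameter 0 the two coincide.\<close>

lemma fibre_preserved: "distr lborel borel (fibre (x, \<xi>) (x, \<xi>') y) = lborel"
proof -
 define \<delta>\<delta> where "\<delta>\<delta> = dprod (dprod \<delta>x \<delta>x) (dprod \<delta>y \<delta>y)"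
 have inv: "fibre (x, \<xi>) (x, \<xi>') y (fibre (x, \<xi>') (x, \<xi>) y \<eta>) = \<eta>" for x \<xi> \<xi>' y \<eta>
 proof -
  have "mul (ginv (x, \<xi>)) (y, fibre (x, \<xi>) (x, \<xi>') y (fibre (x, \<xi>') (x, \<xi>) y \<eta>)) = mul (ginv (x, \<xi>)) (y, \<eta>)"
   by (simp add: fibre_mul)
  then have "(y, fibre (x, \<xi>) (x, \<xi>') y (fibre (x, \<xi>') (x, \<xi>) y \<eta>)) = (y, \<eta>)" by (metis cancel(2))
  then show ?thesis by simp
 qed
 have "distr lborel borel ((\<lambda>c. fibre (fst (fst c), fst (snd c)) (fst (fst c), snd (snd c)) (snd (fst c))) ((x, y), (\<xi>, \<xi>'))) = lborel"
 proof (rule homog_family_preserves[where \<delta>=\<delta>\<delta> and \<epsilon>=\<delta>y and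
   \<Phi>="\<lambda>c. fibre (fst (fst c), snd (snd c)) (fst (fst c), fst (snd c)) (snd (fst c))"])
  show "dilation (wprod (wprod v v) (wprod u u)) \<delta>\<delta>" unfolding \<delta>\<delta>_def by (intro dilation_dprod dil_x dil_y)
  show "dilation u \<delta>y" by (rule dil_y)
  show "smooth_map (\<lambda>z::(('x \<times> 'x) \<times> ('y \<times> 'y)) \<times> 'y. fibre (fst (fst (fst z)), snd (snd (fst z))) (fst (fst (fst z)), fst (snd (fst z))) (snd (fst (fst z))) (snd z))"
   by (intro fibre_smooth smooth_map_Pair smooth_map_fst' smooth_map_snd' smooth_map_ident)
  show "fibre (fst (fst (0::('x \<times> 'x) \<times> ('y \<times> 'y))), snd (snd (0::('x \<times> 'x) \<times> ('y \<times> 'y)))) (fst (fst (0::('x \<times> 'x) \<times> ('y \<times> 'y))), fst (snd (0::('x \<times> 'x) \<times> ('y \<times> 'y)))) (snd (fst (0::('x \<times> 'x) \<times> ('y \<times> 'y))))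
    (fibre (fst (fst (0::('x \<times> 'x) \<times> ('y \<times> 'y))), snd (snd (0::('x \<times> 'x) \<times> ('y \<times> 'y)))) (fst (fst (0::('x \<times> 'x) \<times> ('y \<times> 'y))), fst (snd (0::('x \<times> 'x) \<times> ('y \<times> 'y)))) (snd (fst (0::('x \<times> 'x) \<times> ('y \<times> 'y)))) a) = a" for a
   by (simp add: inv)
  show "fibre (fst (fst (\<delta>\<delta> l c)), snd (snd (\<delta>\<delta> l c))) (fst (fst (\<delta>\<delta> l c)), fst (snd (\<delta>\<delta> l c))) (snd (fst (\<delta>\<delta> l c))) (\<delta>y l a)
   = \<delta>y l (fibre (fst (fst c), snd (snd c)) (fst (fst c), fst (snd c)) (snd (fst c)) a)" if l: "l > 0" for l c a
  proof -
   have p: "(\<delta>x l x, \<delta>y l y) = dprod \<delta>x \<delta>y l (x, y)" for x y by (simp add: dprod_def)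
   have "snd (dprod \<delta>x \<delta>y l g) = \<delta>y l (snd g)" for g by (simp add: dprod_def)
   then show ?thesis unfolding \<delta>\<delta>_def fibre_def by (simp add: dprod_def[of "dprod \<delta>x \<delta>x"] dprod_def[of \<delta>x \<delta>x] dprod_def[of \<delta>y \<delta>y] p inv_dil[OF l] aut[OF l])
  qed
  show "fibre (fst (fst c), fst (snd c)) (fst (fst c), snd (snd c)) (snd (fst c)) \<in> borel_measurable borel" for c :: "('x \<times> 'x) \<times> ('y \<times> 'y)"
   by (rule smooth_mapD(3)) (intro fibre_smooth smooth_map_const smooth_map_ident)
 qed (simp_all add: inv)
 then show ?thesis by simp
qed

lemma fibre_measurable: "fibre a a' y \<in> borel_measurable borel"
 by (rule smooth_mapD(3)) (intro fibre_smooth smooth_map_const smooth_map_ident)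

text \<open>Exchanges which of two base points carries the free fibre variable: after this
  substitution an integral over the fibre of \<open>x\<close> runs over the fibre of
  \<open>y\<close>. It is what symmetry of the kernel in \<open>x\<close> and \<open>y\<close>
  requires.\<close>

definition swap :: "'x => 'x => 'y => 'y" where
 "swap x y \<eta> = snd (mul (mul (y, 0) (ginv (y, \<eta>))) (x, 0))"

lemma swap_mul: "mul (ginv (y, 0)) (x, swap x y \<eta>) = mul (ginv (y, \<eta>)) (x, 0)"
proof -
 have "(x, swap x y \<eta>) = mul (mul (y, 0) (ginv (y, \<eta>))) (x, 0)"
  using fst_divide[of "(y, 0)" "(y, \<eta>)" "(x, 0)"] by (simp add: swap_def prod_eq_iff)
 then show ?thesis by (simp add: assoc)
qed

lemma swap_measurable: "swap x y \<in> borel_measurable borel"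
 unfolding swap_def
 by (rule smooth_mapD(3)) (intro smooth_map_snd' smooth_map_mul smooth_map_inv smooth_map_Pair smooth_map_const smooth_map_ident)

lemma swap_preserved: "distr lborel borel (swap x y) = lborel"
proof -
 have inv: "swap x y (swap y x \<eta>) = \<eta>" for x y \<eta>
 proof -
  have "mul (ginv (x, swap x y (swap y x \<eta>))) (y, 0) = ginv (mul (ginv (y, 0)) (x, swap x y (swap y x \<eta>)))" by simp
  also have "\<dots> = mul (ginv (x, 0)) (y, swap y x \<eta>)" by (subst swap_mul) simp
  also have "\<dots> = mul (ginv (x, \<eta>)) (y, 0)" by (rule swap_mul)
  finally have "ginv (x, swap x y (swap y x \<eta>)) = ginv (x, \<eta>)" by (metis cancel'(1))
  then have "(x, swap x y (swap y x \<eta>)) = (x, \<eta>)" by (metis inv_simps(2))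
  then show ?thesis by simp
 qed
 have "distr lborel borel ((\<lambda>c. swap (fst c) (snd c)) (x, y)) = lborel"
 proof (rule homog_family_preserves[where \<delta>="dprod \<delta>x \<delta>x" and \<epsilon>=\<delta>y and \<Phi>="\<lambda>c. swap (snd c) (fst c)"])
  show "dilation (wprod v v) (dprod \<delta>x \<delta>x)" by (intro dilation_dprod dil_x)
  show "dilation u \<delta>y" by (rule dil_y)
  show "smooth_map (\<lambda>z::('x \<times> 'x) \<times> 'y. swap (snd (fst z)) (fst (fst z)) (snd z))"
   unfolding swap_def
   by (intro smooth_map_snd' smooth_map_mul smooth_map_inv smooth_map_Pair smooth_map_fst' smooth_map_const smooth_map_ident)
  show "swap (snd (0 :: 'x \<times> 'x)) (fst (0 :: 'x \<times> 'x)) (swap (snd (0 :: 'x \<times> 'x)) (fst (0 :: 'x \<times> 'x)) a) = a" for a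
   by (simp add: inv)
  show "swap (snd (dprod \<delta>x \<delta>x l c)) (fst (dprod \<delta>x \<delta>x l c)) (\<delta>y l a) = \<delta>y l (swap (snd c) (fst c) a)" if l: "l > 0" for l c a
  proof -
   have p: "(\<delta>x l x, \<delta>y l y) = dprod \<delta>x \<delta>y l (x, y)" "(\<delta>x l x, 0) = dprod \<delta>x \<delta>y l (x, 0)" for x y
    by (simp_all add: dprod_def dilation_0[OF dil_y l])
   have "snd (dprod \<delta>x \<delta>y l g) = \<delta>y l (snd g)" for g by (simp add: dprod_def)
   then show ?thesis unfolding swap_def by (simp add: dprod_def[of \<delta>x \<delta>x] p inv_dil[OF l] aut[OF l])
  qed
  show "swap (fst c) (snd c) \<in> borel_measurable borel" for c by (rule swap_measurable)
 qed (simp_all add: inv)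
 then show ?thesis by simp
qed

end

section \<open>The kernel obtained by integrating over the fibres\<close>

lemma nn_integral_prod:
 fixes f :: "'a::euclidean_space \<times> 'b::euclidean_space => ennreal"
 assumes "f \<in> borel_measurable borel"
 shows "(\<integral>\<^sup>+z. f z \<partial>lborel) = (\<integral>\<^sup>+x. \<integral>\<^sup>+y. f (x, y) \<partial>lborel \<partial>lborel)"
 using lborel.nn_integral_fst[of f lborel] assms by (simp add: lborel_prod)

lemma LINT_prod:
 fixes f :: "'a::euclidean_space \<times> 'b::euclidean_space => real"
 assumes "integrable lborel f"
 shows "(LINT z|lborel. f z) = (LINT x|lborel. LINT y|lborel. f (x, y))"
  and "AE x in lborel. integrable lborel (\<lambda>y. f (x, y))"
  and "integrable lborel (\<lambda>x. LINT y|lborel. f (x, y))"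
 using lborel_pair.integral_fst'[of f] lborel_pair.AE_integrable_fst'[of f] lborel_pair.integrable_fst'[of f] assms
 by (simp_all add: lborel_prod)

lemma integrable_prod:
 fixes a :: "'a::euclidean_space => real" and b :: "'b::euclidean_space => real"
 assumes "integrable lborel a" "integrable lborel b"
 shows "integrable lborel (\<lambda>z. a (fst z) * b (snd z))"
proof -
 have "integrable (lborel \<Otimes>\<^sub>M lborel) (\<lambda>z. a (fst z) * b (snd z))"
  by (rule lborel_pair.Fubini_integrable) (use assms in \<open>auto simp: abs_mult intro!: AE_I2\<close>)
 then show ?thesis by (simp add: lborel_prod)
qed

context lifted_group
begin

lemma hdim_split: "Q = hdim v + hdim u" by (rule hdim_wprod)

lemma hdim_pos: "hdim v \<ge> 1" "hdim u \<ge> 1" by (rule hdim_ge_1[OF dil_x], rule hdim_ge_1[OF dil_y])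

definition K :: "real => 'x => 'x => real" where
 "K t x y = (LINT \<eta>|lborel. \<gamma> (t, mul (ginv (x, 0)) (y, \<eta>)))"

definition farg :: "((real \<times> 'x) \<times> (real \<times> 'x)) \<times> 'y => real \<times> ('x \<times> 'y)" where
 "farg p = (fst (snd (fst p)) - fst (fst (fst p)), mul (ginv (snd (fst (fst p)), 0)) (snd (snd (fst p)), snd p))"

lemma farg_smooth: "smooth_map farg"
 unfolding farg_def
 by (intro smooth_map_Pair smooth_map_mul smooth_map_inv smooth_map_diff smooth_map_fst' smooth_map_snd' smooth_map_const smooth_map_ident)

lemma open_off_diagonal: "open {p :: (real \<times> 'x) \<times> (real \<times> 'x). fst p \<noteq> snd p}"
 by (intro open_Collect_neq continuous_intros)

text \<open>The degree \<open>- Q = - (hdim v + hdim u)\<close> lies below the fibre threshold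
  \<open>- hdim u\<close> by \<open>hdim v \<ge> 1\<close>, so the kernel and all its derivatives
  are integrable along fibres. Off the diagonal the fibre misses the pole, which includes distinct
  points at equal times.\<close>

lemma fibre_kernel_good: "good_kernel {p. fst p \<noteq> snd p} (\<lambda>_. 1) {p. farg p \<noteq> 0} (\<lambda>p. \<gamma> (farg p))"
proof (rule good_kernel_homog')
 let ?DD = "dprod (tdil \<delta>x) (tdil \<delta>x)"
 have ow: "{p. farg p \<noteq> 0} = farg -` (UNIV - {0})" by auto
 show "dilation (wprod (twt v) (twt v)) ?DD" by (intro dilation_dprod dilation_real dil_x)
 show "dilation u \<delta>y" by (rule dil_y)
 show "open {p. farg p \<noteq> 0}" unfolding ow by (rule open_vimage[OF open_off_zero smooth_mapD(2)[OF farg_smooth]])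
 then show "smooth_on {p. farg p \<noteq> 0} (\<lambda>p. \<gamma> (farg p))"
  by (rule smooth_on_compose_map[OF _ farg_smooth gam_smooth]) auto
 show "homog (dprod ?DD \<delta>y) (- Q) {p. farg p \<noteq> 0} (\<lambda>p. \<gamma> (farg p))"
  unfolding homog_def
 proof (intro allI impI ballI)
  fix l :: real and p assume l: "l > 0" and p: "p \<in> {p. farg p \<noteq> 0}"
  have e: "(\<delta>x l x, \<delta>y l y) = dprod \<delta>x \<delta>y l (x, y)" "(\<delta>x l x, 0) = dprod \<delta>x \<delta>y l (x, 0)" for x y
   by (simp_all add: dprod_def dilation_0[OF dil_y l])
  have "farg (dprod ?DD \<delta>y l p) = tdil (dprod \<delta>x \<delta>y) l (farg p)"
   unfolding farg_def by (simp add: dprod_def[of ?DD] dprod_def[of "tdil \<delta>x"] dprod_def[of _ \<delta>x] dprod_def[of _ "dprod \<delta>x \<delta>y"])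
    (simp add: e inv_dil[OF l] aut[OF l] right_diff_distrib)
  then show "dprod ?DD \<delta>y l p \<in> {p. farg p \<noteq> 0} \<and> \<gamma> (farg (dprod ?DD \<delta>y l p)) = l powr - Q * \<gamma> (farg p)"
   using homogD[OF gam_homog l, of "farg p"] p by simp
 qed
 show "(0, h) \<in> {p. farg p \<noteq> 0}" if "h \<noteq> 0" for h using that by (simp add: farg_def zero_prod_def[symmetric]) (simp add: zero_prod_def)
 show "{p. fst p \<noteq> snd p} \<times> UNIV \<subseteq> {p. farg p \<noteq> 0}"
 proof clarsimp
  fix t s :: real and x y :: 'x and \<eta> :: 'y
  assume z: "farg (((t, x), (s, y)), \<eta>) = 0" "t = s \<longrightarrow> x \<noteq> y"
  then have "s - t = 0" "mul (ginv (x, 0)) (y, \<eta>) = 0" by (auto simp: farg_def zero_prod_def)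
  then show False using z(2) inv_eq_iff by simp
 qed
 show "- Q < - hdim u" using hdim_pos(1) by (simp add: hdim_split)
 show "\<bar>1 :: real\<bar> \<le> 1" by simp
qed (auto intro: open_off_diagonal)

lemma fibre_integrable: "t \<noteq> 0 \<or> x \<noteq> y ==> integrable lborel (\<lambda>\<eta>. \<gamma> (t, mul (ginv (x, 0)) (y, \<eta>)))"
 using good_kernel_integrable[OF fibre_kernel_good, of "((0, x), (t, y))"] by (simp add: farg_def)

lemma K_smooth: "smooth_on {p. fst p \<noteq> snd p} (\<lambda>p. K (fst (snd p) - fst (fst p)) (snd (fst p)) (snd (snd p)))"
 using good_kernel_smooth[OF fibre_kernel_good] by (simp add: K_def farg_def)

lemma fibre_gam_meas: "(\<lambda>\<eta>. \<gamma> (t, mul (ginv a) (y, \<eta>))) \<in> borel_measurable borel"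
 and fibre_gam_meas': "(\<lambda>\<xi>. \<gamma> (t, mul (ginv (x, \<xi>)) b)) \<in> borel_measurable borel"
 by (rule measurable_compose[OF smooth_mapD(3) gam_meas],
   intro smooth_map_Pair smooth_map_mul smooth_map_inv smooth_map_const smooth_map_ident)+

text \<open>Moving the base point within its fibre is undone by a measure-preserving map of the
  fibre over \<open>y\<close>.\<close>

lemma K_fibre:
 "(LINT \<eta>|lborel. \<gamma> (t, mul (ginv (x, \<xi>)) (y, \<eta>))) = K t x y"
 "integrable lborel (\<lambda>\<eta>. \<gamma> (t, mul (ginv (x, \<xi>)) (y, \<eta>))) \<longleftrightarrow> integrable lborel (\<lambda>\<eta>. \<gamma> (t, mul (ginv (x, 0)) (y, \<eta>)))"
proof -
 have eq: "\<gamma> (t, mul (ginv (x, \<xi>)) (y, \<eta>)) = \<gamma> (t, mul (ginv (x, 0)) (y, fibre (x, 0) (x, \<xi>) y \<eta>))" for \<eta>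
  by (simp add: fibre_mul)
 show "(LINT \<eta>|lborel. \<gamma> (t, mul (ginv (x, \<xi>)) (y, \<eta>))) = K t x y"
  unfolding eq K_def by (rule preserved_integral(1)[OF fibre_preserved fibre_measurable fibre_gam_meas])
 show "integrable lborel (\<lambda>\<eta>. \<gamma> (t, mul (ginv (x, \<xi>)) (y, \<eta>))) \<longleftrightarrow> integrable lborel (\<lambda>\<eta>. \<gamma> (t, mul (ginv (x, 0)) (y, \<eta>)))"
  unfolding eq by (rule preserved_integral(2)[OF fibre_preserved fibre_measurable fibre_gam_meas])
qed

lemma gam_null: "t \<le> 0 ==> a \<noteq> b ==> \<gamma> (t, mul (ginv a) b) = 0"
 by (rule gam_zero) (auto simp: zero_prod_def[of] inv_eq_iff[unfolded zero_prod_def])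

lemma K_nonpos: "t \<le> 0 ==> K t x y = 0"
 unfolding K_def
proof (rule integral_eq_zero_AE)
 assume t: "t \<le> 0"
 show "AE \<eta> in lborel. \<gamma> (t, mul (ginv (x, 0)) (y, \<eta>)) = 0"
  using AE_lborel_singleton[of "0::'y"] by eventually_elim (use gam_null[OF t] in auto)
qed

lemma gam_inverse: "t > 0 ==> \<gamma> (t, mul (ginv a) b) = \<gamma> (t, mul (ginv b) a)"
 using gam_sym[of t "mul (ginv a) b"] by (simp add: zero_prod_def)

text \<open>The \<open>swap\<close> substitution reverses the group quotient, and invariance of
  \<open>\<gamma>\<close> under spatial inversion restores it.\<close>

lemma K_sym: "K t x y = K t y x"
proof (cases "t > 0")
 case True
 have "K t y x = (LINT \<eta>|lborel. \<gamma> (t, mul (ginv (y, 0)) (x, swap x y \<eta>)))"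
  unfolding K_def by (rule preserved_integral(1)[OF swap_preserved swap_measurable fibre_gam_meas, symmetric])
 also have "\<dots> = (LINT \<eta>|lborel. \<gamma> (t, mul (ginv (x, 0)) (y, \<eta>)))"
  unfolding swap_mul using gam_inverse[OF True] by metis
 finally show ?thesis by (simp add: K_def)
qed (simp add: K_nonpos)

lemma K_fibre': "(LINT \<xi>|lborel. \<gamma> (t, mul (ginv (x, \<xi>)) (y, \<eta>))) = K t x y"
proof (cases "t > 0")
 case True
 have "(LINT \<xi>|lborel. \<gamma> (t, mul (ginv (x, \<xi>)) (y, \<eta>))) = (LINT \<xi>|lborel. \<gamma> (t, mul (ginv (y, \<eta>)) (x, \<xi>)))"
  by (rule Bochner_Integration.integral_cong[OF refl]) (rule gam_inverse[OF True])
 then show ?thesis using K_fibre(1) K_sym by simp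
next
 case False
 have "(LINT \<xi>|lborel. \<gamma> (t, mul (ginv (x, \<xi>)) (y, \<eta>))) = 0"
 proof (rule integral_eq_zero_AE)
  show "AE \<xi> in lborel. \<gamma> (t, mul (ginv (x, \<xi>)) (y, \<eta>)) = 0"
   using AE_lborel_singleton[of \<eta>] by eventually_elim (use gam_null[of t] False in auto)
 qed
 then show ?thesis using False by (simp add: K_nonpos)
qed

lemma K_pos: "t > 0 ==> K t x y > 0"
 unfolding K_def
proof (rule integral_pos_point[OF _ _ open_UNIV UNIV_I, of _ 0])
 assume t: "t > 0"
 show "integrable lborel (\<lambda>\<eta>. \<gamma> (t, mul (ginv (x, 0)) (y, \<eta>)))" by (rule fibre_integrable) (use t in simp)
 show "continuous_on UNIV (\<lambda>\<eta>. \<gamma> (t, mul (ginv (x, 0)) (y, \<eta>)))"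
  using gdt_cont_space[OF t, of "\<lambda>\<eta>. mul (ginv (x, 0)) (y, \<eta>)" 0]
  by (simp add: continuous_on_mul continuous_on_Pair)
qed (auto simp: gam_pos less_imp_le)

lemma K_nonneg: "K t x y \<ge> 0"
 using K_pos[of t x y] K_nonpos[of t x y] by linarith

lemma K_zero_iff: "K t x y = 0 \<longleftrightarrow> t \<le> 0"
 using K_pos[of t x y] K_nonpos[of t x y] by linarith

lemma K_scale:
 assumes l: "l > 0"
 shows "K (l\<^sup>2 * t) (\<delta>x l x) (\<delta>x l y) = l powr (- hdim v) * K t x y"
proof (cases "t > 0")
 case True
 have e: "mul (ginv (\<delta>x l x, 0)) (\<delta>x l y, \<delta>y l \<eta>) = dprod \<delta>x \<delta>y l (mul (ginv (x, 0)) (y, \<eta>))" for \<eta>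
 proof -
  have "(\<delta>x l x, 0) = dprod \<delta>x \<delta>y l (x, 0)" "(\<delta>x l y, \<delta>y l \<eta>) = dprod \<delta>x \<delta>y l (y, \<eta>)"
   by (simp_all add: dprod_def dilation_0[OF dil_y l])
  then show ?thesis by (simp add: inv_dil[OF l] aut[OF l])
 qed
 have "K (l\<^sup>2 * t) (\<delta>x l x) (\<delta>x l y) = l powr hdim u * (LINT \<eta>|lborel. \<gamma> (l\<^sup>2 * t, mul (ginv (\<delta>x l x, 0)) (\<delta>x l y, \<delta>y l \<eta>)))"
  unfolding K_def by (rule integral_dilation(1)[OF dil_y l fibre_gam_meas])
 also have "\<dots> = l powr hdim u * (l powr (- Q) * K t x y)"
  unfolding e K_def using gam_scale[OF l, of t] True by (simp add: zero_prod_def)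
 also have "\<dots> = (l powr hdim u * l powr (- Q)) * K t x y" by simp
 also have "l powr hdim u * l powr (- Q) = l powr (- hdim v)" using l by (simp add: powr_add[symmetric] hdim_split)
 finally show ?thesis .
next
 case False
 then have "l\<^sup>2 * t \<le> 0" by (simp add: mult_nonneg_nonpos)
 then show ?thesis using False by (simp add: K_nonpos)
qed

text \<open>With nonnegative integrals the order of integration can be exchanged below without
  establishing joint integrability first.\<close>

lemma K_nn: "t > 0 ==> (\<integral>\<^sup>+\<eta>. ennreal (\<gamma> (t, mul (ginv (x, \<xi>)) (y, \<eta>))) \<partial>lborel) = ennreal (K t x y)"
proof -
 assume t: "t > 0"
 have "integrable lborel (\<lambda>\<eta>. \<gamma> (t, mul (ginv (x, \<xi>)) (y, \<eta>)))" using K_fibre(2) fibre_integrable[of t] t by blast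
 then show ?thesis unfolding K_fibre(1)[of t x \<xi> y, symmetric]
  by (rule nn_integral_eq_integral) (simp add: gam_pos[OF t] less_imp_le)
qed

lemma K_cont: "t > 0 ==> continuous_on UNIV (K t x)"
proof -
 assume t: "t > 0"
 have "continuous_on UNIV (\<lambda>y. ((0::real, x), (t, y)))" by (intro continuous_intros)
 from continuous_on_compose2[OF smooth_onD(4)[OF K_smooth] this] t show ?thesis by (simp add: image_subset_iff)
qed

lemma K_meas [measurable]: "K t x \<in> borel_measurable borel"
proof (cases "t > 0")
 case False
 then have "K t x = (\<lambda>_. 0)" by (auto simp: K_nonpos)
 then show ?thesis by simp
qed (rule borel_measurable_continuous_onI[OF K_cont])

lemma K_meas' [measurable]: "(\<lambda>x. K t x y) \<in> borel_measurable borel"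
 using K_meas[of t y] ext[of "K t y" "\<lambda>x. K t x y", OF K_sym] by simp

lemma mul_gam_meas: "(\<lambda>h. \<gamma> (t, mul (ginv a) h)) \<in> borel_measurable borel"
 and mul_gam_meas': "(\<lambda>p. \<gamma> (t, mul (ginv (fst p)) (y, snd p))) \<in> borel_measurable borel"
 by (rule measurable_compose[OF smooth_mapD(3) gam_meas],
   intro smooth_map_Pair smooth_map_mul smooth_map_inv smooth_map_fst smooth_map_snd smooth_map_const smooth_map_ident)+

lemma K_mass_nn: "t > 0 ==> (\<integral>\<^sup>+y. ennreal (K t x y) \<partial>lborel) = 1"
proof -
 assume t: "t > 0"
 have m: "(\<lambda>h. ennreal (\<gamma> (t, h))) \<in> borel_measurable borel" using borel_measurable_integrable[OF gam_integrable[OF t]] by simp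
 have m': "(\<lambda>h. ennreal (\<gamma> (t, mul (ginv (x, 0)) h))) \<in> borel_measurable borel" using mul_gam_meas by simp
 have "(\<integral>\<^sup>+y. ennreal (K t x y) \<partial>lborel) = (\<integral>\<^sup>+h. ennreal (\<gamma> (t, mul (ginv (x, 0)) h)) \<partial>lborel)"
  unfolding nn_integral_prod[OF m'] K_nn[OF t, of x 0, symmetric] ..
 also have "\<dots> = (\<integral>\<^sup>+h. ennreal (\<gamma> (t, h)) \<partial>lborel)" by (rule integral_left(3)[OF m])
 also have "\<dots> = ennreal (LINT h|lborel. \<gamma> (t, h))"
  by (rule nn_integral_eq_integral[OF gam_integrable[OF t]]) (simp add: gam_pos[OF t] less_imp_le)
 also have "\<dots> = 1" using gam_mass[of t] t mass_one by simp
 finally show ?thesis .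
qed

lemma K_mass: "t > 0 ==> (LINT y|lborel. K t x y) = 1"
 by (subst integral_eq_nn_integral) (auto simp: K_nonneg K_mass_nn)

lemma chapman_kolmogorov_nn:
 assumes t: "t > 0" "s > 0"
 shows "ennreal (\<gamma> (t + s, mul (ginv a) b)) = (\<integral>\<^sup>+h. ennreal (\<gamma> (t, mul (ginv a) h) * \<gamma> (s, mul (ginv h) b)) \<partial>lborel)"
proof -
 let ?f = "\<lambda>h. \<gamma> (t, h) * \<gamma> (s, mul (mul (ginv b) a) h)"
 have ts: "t + s > 0" using t by simp
 have e: "\<gamma> (t + s, mul (ginv b) a) = (LINT h|lborel. ?f h)" by (rule chapman_kolmogorov[OF t])
 \<comment> \<open>A non-integrable function has Bochner integral 0 by convention, whereas the value
   here is positive; hence integrability.\<close>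
 have i: "integrable lborel ?f" using gam_pos[OF ts, of "mul (ginv b) a"] not_integrable_integral_eq[of lborel ?f] e by force
 have m: "(\<lambda>h. ennreal (?f h)) \<in> borel_measurable borel" using borel_measurable_integrable[OF i] by simp
 have "ennreal (\<gamma> (t + s, mul (ginv a) b)) = ennreal (LINT h|lborel. ?f h)" using gam_inverse[OF ts] e by metis
 also have "\<dots> = (\<integral>\<^sup>+h. ennreal (?f h) \<partial>lborel)"
  by (rule nn_integral_eq_integral[OF i, symmetric]) (simp add: gam_pos t less_imp_le)
 also have "\<dots> = (\<integral>\<^sup>+h. ennreal (?f (mul (ginv a) h)) \<partial>lborel)" by (rule integral_left(3)[OF m, symmetric])
 also have "\<dots> = (\<integral>\<^sup>+h. ennreal (\<gamma> (t, mul (ginv a) h) * \<gamma> (s, mul (ginv h) b)) \<partial>lborel)"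
  using gam_inverse[OF t(2), of b] by (simp add: assoc)
 finally show ?thesis .
qed

text \<open>Integrate the group identity over the fibre of \<open>y\<close>. The inner integral
  depends on \<open>h\<close> through its base point only, so a second fibre integration applies to
  the other factor.\<close>

lemma K_chapman_kolmogorov:
 assumes t: "t > 0" "s > 0"
 shows "K (t + s) x y = (LINT w|lborel. K t x w * K s w y)"
proof -
 have ts: "t + s > 0" using t by simp
 have "(\<lambda>p. ennreal (\<gamma> (t, mul (ginv (x, 0)) (fst p)) * \<gamma> (s, mul (ginv (fst p)) (y, snd p)))) \<in> borel_measurable borel"
  by (intro measurable_compose[OF _ measurable_ennreal] borel_measurable_times mul_gam_meas'
   measurable_compose[OF smooth_mapD(3)[OF smooth_map_fst] mul_gam_meas])
 then have m: "(\<lambda>(h, \<eta>). ennreal (\<gamma> (t, mul (ginv (x, 0)) h) * \<gamma> (s, mul (ginv h) (y, \<eta>)))) \<in> borel_measurable (lborel \<Otimes>\<^sub>M lborel)"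
  by (simp only: case_prod_beta' lborel_prod measurable_lborel1 measurable_lborel2)
 have m2: "(\<lambda>h. ennreal (\<gamma> (t, mul (ginv (x, 0)) h) * K s (fst h) y)) \<in> borel_measurable borel"
  by (intro measurable_compose[OF _ measurable_ennreal] borel_measurable_times mul_gam_meas
   measurable_compose[OF smooth_mapD(3)[OF smooth_map_fst] K_meas'])
 have g0: "\<gamma> (t, h) \<ge> 0" "\<gamma> (s, h) \<ge> 0" for h using gam_pos[OF t(1)] gam_pos[OF t(2)] by (simp_all add: less_imp_le)
 have "ennreal (K (t + s) x y) = (\<integral>\<^sup>+\<eta>. \<integral>\<^sup>+h. ennreal (\<gamma> (t, mul (ginv (x, 0)) h) * \<gamma> (s, mul (ginv h) (y, \<eta>))) \<partial>lborel \<partial>lborel)"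
  unfolding K_nn[OF ts, of x 0, symmetric] chapman_kolmogorov_nn[OF t] ..
 also have "\<dots> = (\<integral>\<^sup>+h. \<integral>\<^sup>+\<eta>. ennreal (\<gamma> (t, mul (ginv (x, 0)) h) * \<gamma> (s, mul (ginv h) (y, \<eta>))) \<partial>lborel \<partial>lborel)"
  by (rule lborel_pair.Fubini'[OF m])
 also have "\<dots> = (\<integral>\<^sup>+h. ennreal (\<gamma> (t, mul (ginv (x, 0)) h) * K s (fst h) y) \<partial>lborel)"
 proof (rule nn_integral_cong)
  fix h
  have "(\<integral>\<^sup>+\<eta>. ennreal (\<gamma> (s, mul (ginv h) (y, \<eta>))) \<partial>lborel) = ennreal (K s (fst h) y)" using K_nn[OF t(2), of "fst h" "snd h" y] by simp
  then show "(\<integral>\<^sup>+\<eta>. ennreal (\<gamma> (t, mul (ginv (x, 0)) h) * \<gamma> (s, mul (ginv h) (y, \<eta>))) \<partial>lborel) = ennreal (\<gamma> (t, mul (ginv (x, 0)) h) * K s (fst h) y)"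
   unfolding ennreal_mult[OF g0(1) g0(2)] ennreal_mult[OF g0(1) K_nonneg]
   by (subst nn_integral_cmult) (simp_all only: measurable_lborel2 measurable_compose[OF fibre_gam_meas measurable_ennreal])
 qed
 also have "\<dots> = (\<integral>\<^sup>+w. \<integral>\<^sup>+\<omega>. ennreal (\<gamma> (t, mul (ginv (x, 0)) (w, \<omega>)) * K s w y) \<partial>lborel \<partial>lborel)"
  unfolding nn_integral_prod[OF m2] by simp
 also have "\<dots> = (\<integral>\<^sup>+w. ennreal (K t x w * K s w y) \<partial>lborel)"
 proof (rule nn_integral_cong)
  fix w
  show "(\<integral>\<^sup>+\<omega>. ennreal (\<gamma> (t, mul (ginv (x, 0)) (w, \<omega>)) * K s w y) \<partial>lborel) = ennreal (K t x w * K s w y)"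
   unfolding ennreal_mult[OF g0(1) K_nonneg] ennreal_mult[OF K_nonneg K_nonneg]
   by (subst nn_integral_multc) (simp_all only: measurable_lborel2 measurable_compose[OF fibre_gam_meas measurable_ennreal] K_nn[OF t(1)])
 qed
 finally have eq: "ennreal (K (t + s) x y) = (\<integral>\<^sup>+w. ennreal (K t x w * K s w y) \<partial>lborel)" .
 have "(LINT w|lborel. K t x w * K s w y) = enn2real (\<integral>\<^sup>+w. ennreal (K t x w * K s w y) \<partial>lborel)"
  by (rule integral_eq_nn_integral) (auto simp: K_nonneg)
 then show ?thesis by (simp add: eq[symmetric] K_nonneg)
qed

text \<open>For \<open>e = 1\<close> this is the kernel of the theorem; for \<open>e = - 1\<close>
  it is the adjoint kernel, the same function with its arguments exchanged.\<close>

definition GG :: "real => real \<times> 'x => real \<times> 'x => real" where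
 "GG e z \<zeta> = K (e * (fst \<zeta> - fst z)) (snd z) (snd \<zeta>)"

lemma GG_flip: "GG (- e) z \<zeta> = GG e \<zeta> z"
 unfolding GG_def using K_sym[of _ "snd z"] by (simp add: algebra_simps)

lemma GG_nonneg: "GG e z \<zeta> \<ge> 0" by (simp add: GG_def K_nonneg)

lemma GG_smooth:
 assumes e: "e \<noteq> 0"
 shows "smooth_on {p. fst p \<noteq> snd p} (\<lambda>p. GG e (fst p) (snd p))"
proof -
 let ?F = "\<lambda>p :: (real \<times> 'x) \<times> (real \<times> 'x). ((e * fst (fst p), snd (fst p)), (e * fst (snd p), snd (snd p)))"
 have "smooth_map (\<lambda>p :: (real \<times> 'x) \<times> (real \<times> 'x). e *\<^sub>R fst (fst p))" "smooth_map (\<lambda>p :: (real \<times> 'x) \<times> (real \<times> 'x). e *\<^sub>R fst (snd p))"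
  by (intro smooth_map_scaleR smooth_on_const smooth_map_fst' smooth_map_snd' smooth_map_ident)+
 then have "smooth_map ?F" by (intro smooth_map_Pair smooth_map_snd' smooth_map_fst' smooth_map_ident) simp_all
 moreover have "?F ` {p. fst p \<noteq> snd p} \<subseteq> {p. fst p \<noteq> snd p}" using e by (auto simp: prod_eq_iff)
 ultimately show ?thesis
  using smooth_on_compose_map[OF open_off_diagonal _ K_smooth, of ?F] by (simp add: GG_def right_diff_distrib)
qed

lemma GG_homog: "homog (dprod (tdil \<delta>x) (tdil \<delta>x)) (- hdim v) {p. fst p \<noteq> snd p} (\<lambda>p. GG e (fst p) (snd p))"
 unfolding homog_def
proof (intro allI impI ballI)
 fix l :: real and p :: "(real \<times> 'x) \<times> (real \<times> 'x)" assume l: "l > 0" and p: "p \<in> {p. fst p \<noteq> snd p}"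
 have d: "dilation (twt v) (tdil \<delta>x)" by (intro dilation_dprod dilation_real dil_x)
 have inj: "a = b" if "tdil \<delta>x l a = tdil \<delta>x l b" for a b
  using arg_cong[OF that, of "tdil \<delta>x (1 / l)"] unfolding dilation_inverse(2)[OF d l] .
 have e1: "e * (l\<^sup>2 * s - l\<^sup>2 * t) = l\<^sup>2 * (e * (s - t))" for s t by (simp add: algebra_simps)
 have g: "GG e (tdil \<delta>x l z) (tdil \<delta>x l \<zeta>) = l powr - hdim v * GG e z \<zeta>" for z \<zeta>
  unfolding GG_def dprod_def fst_conv snd_conv e1 by (rule K_scale[OF l])
 have f: "fst (dprod A A l p) = A l (fst p)" "snd (dprod A A l p) = A l (snd p)" for A :: "real => real \<times> 'x => real \<times> 'x"
  unfolding dprod_def by (rule fst_conv, rule snd_conv)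
 show "dprod (tdil \<delta>x) (tdil \<delta>x) l p \<in> {p. fst p \<noteq> snd p} \<and>
  GG e (fst (dprod (tdil \<delta>x) (tdil \<delta>x) l p)) (snd (dprod (tdil \<delta>x) (tdil \<delta>x) l p)) = l powr - hdim v * GG e (fst p) (snd p)"
  unfolding f g mem_Collect_eq using p inj[of "fst p" "snd p"] by blast
qed

lemma GG_decay:
 assumes "compact C" "e \<noteq> 0"
 obtains R B where "R \<ge> 1" "\<And>z \<zeta>. z \<in> C ==> hn (twt v) \<zeta> \<ge> R ==> GG e z \<zeta> \<le> B * hn (twt v) \<zeta> powr (- hdim v)"
proof -
 have d: "dilation (twt v) (tdil \<delta>x)" by (intro dilation_dprod dilation_real dil_x)
 have ax: "(0, h) \<in> {p. fst p \<noteq> snd p}" if "h \<noteq> (0 :: real \<times> 'x)" for h using that by simp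
 show thesis
 proof (rule homog_decay[OF d d open_off_diagonal GG_homog smooth_onD(4)[OF GG_smooth[OF assms(2)]] ax assms(1)])
  fix R B :: real assume R: "R \<ge> 1" and "B \<ge> 0" and B: "\<And>p h. p \<in> C ==> hn (twt v) h \<ge> R ==>
   (p, h) \<in> {p. fst p \<noteq> snd p} \<and> \<bar>GG e (fst (p, h)) (snd (p, h))\<bar> \<le> B * hn (twt v) h powr (- hdim v)"
  show thesis
  proof (rule that[OF R])
   fix z \<zeta> assume "z \<in> C" "hn (twt v) \<zeta> \<ge> R"
   from conjunct2[OF B[OF this]] show "GG e z \<zeta> \<le> B * hn (twt v) \<zeta> powr (- hdim v)"
    unfolding fst_conv snd_conv by (rule order_trans[OF abs_ge_self])
  qed
 qed
qed

lemma hn_decay: "((\<lambda>\<zeta>::real \<times> 'x. B * hn (twt v) \<zeta> powr (- hdim v)) \<longlongrightarrow> 0) at_infinity"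
proof -
 have d: "dilation (twt v) (tdil \<delta>x)" by (intro dilation_dprod dilation_real dil_x)
 have "((\<lambda>r::real. r powr (- hdim v)) \<longlongrightarrow> 0) at_top" by (rule tendsto_neg_powr[OF _ filterlim_ident]) (use hdim_pos in simp)
 from tendsto_mult_right_zero[OF filterlim_compose[OF this hn_at_infinity[OF d]]] show ?thesis .
qed

lemma hn_eventually: "\<forall>\<^sub>F \<zeta> in at_infinity. hn (twt v) (\<zeta>::real \<times> 'x) \<ge> R"
proof -
 have d: "dilation (twt v) (tdil \<delta>x)" by (intro dilation_dprod dilation_real dil_x)
 show ?thesis using hn_at_infinity[OF d] by (auto simp: filterlim_at_top)
qed

lemma GG_sup_lim:
 assumes C: "compact C" "C \<noteq> {}" and e: "e \<noteq> 0"
 shows "((\<lambda>\<zeta>. SUP z\<in>C. GG e z \<zeta>) \<longlongrightarrow> 0) at_infinity"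
proof -
 obtain R B where RB: "\<And>z \<zeta>. z \<in> C ==> hn (twt v) \<zeta> \<ge> R ==> GG e z \<zeta> \<le> B * hn (twt v) \<zeta> powr (- hdim v)"
  using GG_decay[OF C(1) e] by metis
 show ?thesis
 proof (rule tendsto_sandwich[OF _ _ tendsto_const hn_decay[of B]])
  show "\<forall>\<^sub>F \<zeta> in at_infinity. (SUP z\<in>C. GG e z \<zeta>) \<le> B * hn (twt v) \<zeta> powr (- hdim v)"
   using hn_eventually[of R] by eventually_elim (rule cSUP_least[OF C(2)], rule RB)
  show "\<forall>\<^sub>F \<zeta> in at_infinity. 0 \<le> (SUP z\<in>C. GG e z \<zeta>)"
   using hn_eventually[of R]
  proof eventually_elim
   case (elim \<zeta>)
   obtain z0 where z0: "z0 \<in> C" using C(2) by blast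
   \<comment> \<open>The supremum is known to dominate its members only for a set bounded above; the
     decay estimate provides the bound.\<close>
   have "bdd_above ((\<lambda>z. GG e z \<zeta>) ` C)" using RB[OF _ elim] unfolding bdd_above_def by blast
   from cSUP_upper[OF z0 this] show ?case using GG_nonneg[of e z0 \<zeta>] by linarith
  qed
 qed
qed

lemma GG_meas:
 assumes e: "e \<noteq> 0"
 shows "(\<lambda>p. GG e (fst p) (snd p)) \<in> borel_measurable borel" and "GG e z \<in> borel_measurable borel"
proof -
 let ?U = "{p :: (real \<times> 'x) \<times> (real \<times> 'x). fst p \<noteq> snd p}"
 have "(\<lambda>p. indicator ?U p *\<^sub>R GG e (fst p) (snd p)) \<in> borel_measurable borel"
  by (rule borel_measurable_continuous_on_indicator[OF _ smooth_onD(4)[OF GG_smooth[OF e]]]) (simp add: open_off_diagonal)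
 \<comment> \<open>On the diagonal the time difference is 0, where \<open>K\<close> is 0, so the
   indicator changes nothing.\<close>
 moreover have "indicator ?U p *\<^sub>R GG e (fst p) (snd p) = GG e (fst p) (snd p)" for p
  by (auto simp: indicator_def GG_def K_nonpos)
 ultimately show m: "(\<lambda>p. GG e (fst p) (snd p)) \<in> borel_measurable borel" by (simp only:)
 have "(\<lambda>\<zeta>. (z, \<zeta>)) \<in> borel_measurable borel" by (intro borel_measurable_continuous_onI continuous_intros)
 from measurable_compose[OF this m] show "GG e z \<in> borel_measurable borel" by (simp only: fst_conv snd_conv)
qed

text \<open>Each time slice has mass at most 1, so the integral over a strip is at most its length,
  independently of the pole.\<close>

lemma GG_strip:
 assumes e: "e \<noteq> 0"
 shows "(\<integral>\<^sup>+\<zeta>. ennreal (indicator {-r..r} (fst \<zeta>) * GG e z \<zeta>) \<partial>lborel) \<le> ennreal (2 * \<bar>r\<bar>)"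
proof -
 have "(\<integral>\<^sup>+\<zeta>. ennreal (indicator {-r..r} (fst \<zeta>) * GG e z \<zeta>) \<partial>lborel)
  = (\<integral>\<^sup>+s. \<integral>\<^sup>+y. ennreal (indicator {-r..r} s * GG e z (s, y)) \<partial>lborel \<partial>lborel)"
 proof (subst nn_integral_prod)
  show "(\<lambda>\<zeta>. ennreal (indicator {-r..r} (fst \<zeta>) * GG e z \<zeta>)) \<in> borel_measurable borel"
   by (intro measurable_compose[OF _ measurable_ennreal] borel_measurable_times GG_meas(2)[OF e]
    measurable_compose[OF smooth_mapD(3)[OF smooth_map_fst] borel_measurable_indicator]) simp
 qed (simp only: fst_conv)
 also have "\<dots> \<le> (\<integral>\<^sup>+s. indicator {-r..r} s \<partial>lborel)"
 proof (rule nn_integral_mono)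
  fix s
  have "(\<integral>\<^sup>+y. ennreal (K t x y) \<partial>lborel) \<le> 1" for t x
   using K_mass_nn[of t x] by (cases "t > 0") (simp_all add: K_nonpos)
  then show "(\<integral>\<^sup>+y. ennreal (indicator {-r..r} s * GG e z (s, y)) \<partial>lborel) \<le> indicator {-r..r} s"
   by (auto simp: GG_def split: split_indicator)
 qed
 also have "\<dots> \<le> ennreal (2 * \<bar>r\<bar>)" by (cases "r \<ge> 0") auto
 finally show ?thesis .
qed

lemma GG_loc_int:
 assumes e: "e \<noteq> 0"
 shows "loc_int (GG e z)" and "loc_int (\<lambda>p. GG e (fst p) (snd p))"
proof -
 show "loc_int (GG e z)"
  unfolding loc_int_def set_integrable_def
 proof (intro allI impI)
  fix C :: "(real \<times> 'x) set" assume C: "compact C"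
  from bounded_iff[THEN iffD1, OF compact_imp_bounded[OF C]] obtain r where r: "\<forall>\<zeta>\<in>C. norm \<zeta> \<le> r" ..
  have sub: "fst \<zeta> \<in> {-r..r}" if "\<zeta> \<in> C" for \<zeta> using r[rule_format, OF that] norm_fst_le[of "fst \<zeta>" "snd \<zeta>"] by (auto simp: abs_le_iff)
  have "C \<in> sets borel" using C by (simp add: compact_imp_closed borel_closed)
  show "integrable lborel (\<lambda>\<zeta>. indicator C \<zeta> *\<^sub>R GG e z \<zeta>)"
  proof (rule integrableI_nonneg)
   have "(\<integral>\<^sup>+\<zeta>. ennreal (indicator C \<zeta> *\<^sub>R GG e z \<zeta>) \<partial>lborel) \<le> (\<integral>\<^sup>+\<zeta>. ennreal (indicator {-r..r} (fst \<zeta>) * GG e z \<zeta>) \<partial>lborel)"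
    by (rule nn_integral_mono) (use sub in \<open>auto simp: indicator_def GG_nonneg\<close>)
   also have "\<dots> < \<infinity>" using GG_strip[OF e, of r z] by (simp add: le_less_trans)
   finally show "(\<integral>\<^sup>+\<zeta>. ennreal (indicator C \<zeta> *\<^sub>R GG e z \<zeta>) \<partial>lborel) < \<infinity>" .
   show "(\<lambda>\<zeta>. indicator C \<zeta> *\<^sub>R GG e z \<zeta>) \<in> borel_measurable lborel"
    unfolding measurable_lborel2 by (intro borel_measurable_scaleR borel_measurable_indicator GG_meas(2)[OF e]) fact
  qed (simp add: GG_nonneg)
 qed
 show "loc_int (\<lambda>p. GG e (fst p) (snd p))"
  unfolding loc_int_def set_integrable_def
 proof (intro allI impI)
  fix C :: "((real \<times> 'x) \<times> (real \<times> 'x)) set" assume C: "compact C"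
  from bounded_iff[THEN iffD1, OF compact_imp_bounded[OF C]] obtain r where r: "\<forall>\<zeta>\<in>C. norm \<zeta> \<le> r" ..
  have sub: "fst p \<in> cball 0 r" "fst (snd p) \<in> {-r..r}" if "p \<in> C" for p
   using r[rule_format, OF that] norm_fst_le[of "fst p" "snd p"] norm_snd_le[of "snd p" "fst p"] norm_fst_le[of "fst (snd p)" "snd (snd p)"]
   by (auto simp: abs_le_iff)
  have "C \<in> sets borel" using C by (simp add: compact_imp_closed borel_closed)
  show "integrable lborel (\<lambda>p. indicator C p *\<^sub>R GG e (fst p) (snd p))"
  proof (rule integrableI_nonneg)
   let ?f = "\<lambda>p. ennreal (indicator (cball 0 r) (fst p) * (indicator {-r..r} (fst (snd p)) * GG e (fst p) (snd p)))"
   have "(\<lambda>p :: (real \<times> 'x) \<times> (real \<times> 'x). indicator (cball 0 r) (fst p) :: real) \<in> borel_measurable borel"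
    by (rule measurable_compose[OF smooth_mapD(3)[OF smooth_map_fst] borel_measurable_indicator]) simp
   moreover have "(\<lambda>p :: (real \<times> 'x) \<times> (real \<times> 'x). indicator {-r..r} (fst (snd p)) :: real) \<in> borel_measurable borel"
    by (rule measurable_compose[OF smooth_mapD(3) borel_measurable_indicator]) (intro smooth_map_fst' smooth_map_snd, simp)
   ultimately have m: "?f \<in> borel_measurable borel"
    by (intro measurable_compose[OF _ measurable_ennreal] borel_measurable_times GG_meas(1)[OF e])
   have "(\<integral>\<^sup>+p. ennreal (indicator C p *\<^sub>R GG e (fst p) (snd p)) \<partial>lborel) \<le> (\<integral>\<^sup>+p. ?f p \<partial>lborel)"
    by (rule nn_integral_mono) (use sub in \<open>auto simp: indicator_def GG_nonneg\<close>)
   also have "\<dots> = (\<integral>\<^sup>+z. \<integral>\<^sup>+\<zeta>. ?f (z, \<zeta>) \<partial>lborel \<partial>lborel)" by (rule nn_integral_prod[OF m])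
   also have "\<dots> \<le> (\<integral>\<^sup>+z. ennreal (2 * \<bar>r\<bar>) * indicator (cball (0 :: real \<times> 'x) r) z \<partial>lborel)"
   proof (rule nn_integral_mono)
    fix z :: "real \<times> 'x"
    show "(\<integral>\<^sup>+\<zeta>. ?f (z, \<zeta>) \<partial>lborel) \<le> ennreal (2 * \<bar>r\<bar>) * indicator (cball 0 r) z"
     using GG_strip[OF e, of r z] by (simp split: split_indicator)
   qed
   also have "\<dots> = ennreal (2 * \<bar>r\<bar>) * emeasure lborel (cball (0 :: real \<times> 'x) r)" by (subst nn_integral_cmult_indicator) auto
   also have "\<dots> < \<infinity>" using emeasure_lborel_cball_finite[of "0 :: real \<times> 'x" r] by (simp add: ennreal_mult_less_top)
   finally show "(\<integral>\<^sup>+p. ennreal (indicator C p *\<^sub>R GG e (fst p) (snd p)) \<partial>lborel) < \<infinity>" .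
   show "(\<lambda>p. indicator C p *\<^sub>R GG e (fst p) (snd p)) \<in> borel_measurable lborel"
    unfolding measurable_lborel2 by (intro borel_measurable_scaleR borel_measurable_indicator GG_meas(1)[OF e]) fact
  qed (simp add: GG_nonneg)
 qed
qed

end

section \<open>Potentials and the Cauchy problem on the base\<close>

lemma hn_wprod: "hn (wprod v w) z = hn v (fst z) + hn w (snd z)"
proof -
 have "hn (wprod v w) z = (\<Sum>b\<in>(\<lambda>u. (u, 0)) ` Basis. \<bar>z \<bullet> b\<bar> powr (1 / wprod v w b)) + (\<Sum>b\<in>(\<lambda>u. (0, u)) ` Basis. \<bar>z \<bullet> b\<bar> powr (1 / wprod v w b))"
  unfolding hn_def Basis_prod_def by (rule sum.union_disjoint) (auto dest: nonzero_Basis)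
 then show ?thesis
  by (simp add: hn_def sum.reindex inj_on_def wprod_def inner_prod_def) (auto intro!: sum.cong dest: nonzero_Basis)
qed

text \<open>Multiplying time by a sign \<open>e\<close> reduces both operators to
  \<open>heat_op 1\<close>, for which the maximum principle is formulated.\<close>

lemma heat_op_time_sign:
 fixes u :: "real \<times> 'a::euclidean_space => real"
 assumes "e * e = 1" "open W" "(e * fst z, snd z) \<in> W" "C_k_on 2 W u" "\<forall>j<m. smooth_map (Xs j)"
 shows "heat_op e m Xs (\<lambda>z. u (e * fst z, snd z)) z = heat_op 1 m Xs u (e * fst z, snd z)"
proof -
 have "heat_op e m Xs (\<lambda>z. u (e * fst z + 0, snd z)) z = 1\<^sup>2 * heat_op 1 m Xs u (e * fst z + 0, snd z)"
  by (rule heat_op_related[OF assms(2) _ assms(4) smooth_map_ident assms(5)])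
   (use assms(1,3) in \<open>auto simp: frechet_derivative_eqI[OF has_derivative_ident]\<close>)
 then show ?thesis by simp
qed

lemma smooth_map_time_sign: "smooth_map (\<lambda>z::real \<times> 'a::euclidean_space. (e * fst z, snd z))"
proof -
 have "smooth_map (\<lambda>z::real \<times> 'a. e *\<^sub>R fst z)" by (intro smooth_map_scaleR smooth_on_const smooth_map_fst)
 then show ?thesis by (intro smooth_map_Pair smooth_map_snd) simp
qed

lemma time_sign_preserved:
 fixes w :: "'a::euclidean_space => real"
 assumes "dilation w \<delta>" "e * e = 1"
 shows "distr lborel borel (\<lambda>z::real \<times> 'a. (e * fst z, snd z)) = lborel"
proof -
 have d: "dilation (twt w) (tdil \<delta>)" by (intro dilation_dprod dilation_real assms(1))
 have e2: "e * (e * t) = t" for t using assms(2) by (metis mult.assoc mult_1)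
 show ?thesis
 proof (rule homog_family_preserves[OF d d, where \<Phi>="\<lambda>_ z. (e * fst z, snd z)" and \<Psi>="\<lambda>_ z. (e * fst z, snd z)" and c=0])
  show "smooth_map (\<lambda>z::(real \<times> 'a) \<times> (real \<times> 'a). (e * fst (snd z), snd (snd z)))"
   by (rule smooth_map_compose[OF smooth_map_time_sign smooth_map_snd])
  show "(\<lambda>z::real \<times> 'a. (e * fst z, snd z)) \<in> borel_measurable borel" by (rule smooth_mapD(3)[OF smooth_map_time_sign])
  show "(e * fst (tdil \<delta> l a), snd (tdil \<delta> l a)) = tdil \<delta> l (e * fst a, snd a)" for l a
   unfolding dprod_def fst_conv snd_conv by (simp add: mult.left_commute)
 qed (simp_all add: e2)
qed

context lifted_group
begin

text \<open>The same superposition as \<open>potB\<close>, in the variable of the source. Lifted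
  test functions are constant along fibres and hence not compactly supported, so the potential has
  to make sense for sources merely bounded in a time strip.\<close>

definition conv :: "(real \<times> ('x \<times> 'y) => real) => real \<times> ('x \<times> 'y) => real" where
 "conv c \<zeta> = (LINT z|lborel. \<gamma> (ti z \<star> \<zeta>) * c z)"

definition prj :: "real \<times> ('x \<times> 'y) => real \<times> 'x" where
 "prj z = (fst z, fst (snd z))"

lemma smooth_map_prj: "smooth_map prj"
 unfolding prj_def by (intro smooth_map_Pair smooth_map_fst' smooth_map_snd' smooth_map_ident)

lemma conv_meas: "(\<lambda>z. \<gamma> (ti z \<star> \<zeta>)) \<in> borel_measurable borel"
 by (rule measurable_compose[OF smooth_mapD(3) gam_meas])
  (intro T.smooth_map_mul T.smooth_map_inv smooth_map_const smooth_map_ident)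

text \<open>Slices of \<open>\<gamma>\<close> have finite mass, so boundedness of the source and a
  bounded range of times are enough; inversion and right translation reduce the claim to
  \<open>gam_strip\<close>.\<close>

lemma conv_integrable:
 assumes c: "c \<in> borel_measurable borel" "\<And>z. \<bar>c z\<bar> \<le> B * indicator {-r..r} (fst z)"
 shows "integrable lborel (\<lambda>z. \<gamma> (ti z \<star> \<zeta>) * c z)"
proof -
 define s where "s = fst \<zeta>"
 define k :: "real => real" where "k t = B * indicator {s - r..s + r} t" for t
 define g where "g z = \<gamma> z * k (fst z)" for z
 have "integrable lborel (indicator {s - r..s + r} :: real => real)"
  by (rule integrable_real_indicator) (simp_all add: emeasure_lborel_Icc_eq)
 then have ik: "integrable lborel k" unfolding k_def[abs_def] by (rule integrable_mult_right)
 have mk: "k \<in> borel_measurable borel" using borel_measurable_integrable[OF ik] by simp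
 have ig: "integrable lborel g" unfolding g_def[abs_def] by (rule gam_strip(1)[OF mk ik])
 have mg: "g \<in> borel_measurable borel" using borel_measurable_integrable[OF ig] by simp
 have mg': "(\<lambda>z. g (z \<star> \<zeta>)) \<in> borel_measurable borel"
  by (rule measurable_compose[OF smooth_mapD(3)[OF T.smooth_mul_right] mg])
 have i: "integrable lborel (\<lambda>z. g (ti z \<star> \<zeta>))"
  using T.integral_inv(2)[OF mg'] T.integral_right(2)[OF mg, of \<zeta>] ig by blast
 show ?thesis
 proof (rule Bochner_Integration.integrable_bound[OF i])
  show "(\<lambda>z. \<gamma> (ti z \<star> \<zeta>) * c z) \<in> borel_measurable lborel"
   unfolding measurable_lborel2 by (intro borel_measurable_times conv_meas c(1))
  show "AE z in lborel. norm (\<gamma> (ti z \<star> \<zeta>) * c z) \<le> norm (g (ti z \<star> \<zeta>))"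
  proof (rule AE_I2)
   fix z
   have "fst (ti z \<star> \<zeta>) = s - fst z" by (simp add: tmul_def tinv_def s_def)
   then have "k (fst (ti z \<star> \<zeta>)) = B * indicator {-r..r} (fst z)" by (auto simp: k_def split: split_indicator)
   then have "\<bar>c z\<bar> \<le> \<bar>k (fst (ti z \<star> \<zeta>))\<bar>" using c(2)[of z] by (metis abs_ge_self order_trans)
   then show "norm (\<gamma> (ti z \<star> \<zeta>) * c z) \<le> norm (g (ti z \<star> \<zeta>))"
    unfolding g_def real_norm_def abs_mult by (rule mult_left_mono) simp
  qed
 qed
qed

lemma conv_potB:
 assumes \<phi>: "test_fun \<phi>"
 shows "conv \<phi> \<zeta> = potB \<phi> \<zeta>"
proof -
 define g where "g h = \<phi> (\<zeta> \<star> ti h) * \<gamma> h" for h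
 have "(\<lambda>h. \<phi> (\<zeta> \<star> ti h)) \<in> borel_measurable borel"
  by (rule measurable_compose[OF smooth_mapD(3) test_fun_integrable(3)[OF \<phi>]])
   (intro T.smooth_map_mul T.smooth_map_inv smooth_map_const smooth_map_ident)
 then have mg: "g \<in> borel_measurable borel" unfolding g_def[abs_def] by (intro borel_measurable_times gam_meas)
 have mg': "(\<lambda>z. g (z \<star> \<zeta>)) \<in> borel_measurable borel"
  by (rule measurable_compose[OF smooth_mapD(3)[OF T.smooth_mul_right] mg])
 have "potB \<phi> \<zeta> = (LINT h|lborel. g h)" by (simp only: potB_def g_def)
 also have "\<dots> = (LINT z|lborel. g (z \<star> \<zeta>))" by (rule T.integral_right(1)[OF mg, symmetric])
 also have "\<dots> = (LINT z|lborel. g (ti z \<star> \<zeta>))" by (rule T.integral_inv(1)[OF mg', symmetric])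
 also have "\<dots> = conv \<phi> \<zeta>" unfolding conv_def g_def by (simp add: mult.commute)
 finally show ?thesis by simp
qed

lemma GG_times_test_integrable:
 assumes "test_fun \<phi>" "e \<noteq> 0"
 shows "integrable lborel (\<lambda>z. GG e z \<zeta> * \<phi> z)"
proof -
 have "loc_int (GG (- e) \<zeta>)" by (rule GG_loc_int(1)) (use assms(2) in simp)
 from integrable_loc_test[OF this assms(1)] show ?thesis by (simp only: GG_flip)
qed

text \<open>Carrying out the integration over the fibre coordinate of the source first replaces
  \<open>\<gamma>\<close> by \<open>K\<close>: the potential of a lifted source is the lift of the
  potential on the base.\<close>

lemma Lam_lift:
 assumes \<phi>: "test_fun \<phi>"
 shows "conv (\<lambda>z. \<phi> (prj z)) \<zeta> = Lam (GG 1) \<phi> (prj \<zeta>)"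
proof -
 obtain s y \<eta> where \<zeta>: "\<zeta> = (s, (y, \<eta>))" by (metis surj_pair)
 obtain C where C: "compact C" "\<And>x. x \<notin> C ==> \<phi> x = 0" using test_funE[OF \<phi>] by metis
 from bounded_iff[THEN iffD1, OF compact_imp_bounded[OF C(1)]] obtain r where r: "\<forall>z\<in>C. norm z \<le> r" ..
 obtain B where B: "B \<ge> 0" "\<forall>x. \<bar>\<phi> x\<bar> \<le> B" using test_fun_integrable(2)[OF \<phi>] by blast
 define F where "F z = \<gamma> (ti z \<star> \<zeta>) * \<phi> (prj z)" for z
 define L where "L z = GG 1 z (s, y) * \<phi> z" for z
 have "\<bar>\<phi> (prj z)\<bar> \<le> B * indicator {-r..r} (fst z)" for z
 proof (cases "prj z \<in> C")
  case True
  then have "\<bar>fst z\<bar> \<le> r" using r norm_fst_le[of "fst z" "fst (snd z)"] unfolding prj_def by fastforce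
  then show ?thesis using B(2)[rule_format, of "prj z"] by (simp add: indicator_def abs_le_iff)
 qed (simp add: C(2) B(1) zero_le_mult_iff)
 then have iF: "integrable lborel F" unfolding F_def
  by (intro conv_integrable measurable_compose[OF smooth_mapD(3)[OF smooth_map_prj] test_fun_integrable(3)[OF \<phi>]])
 have iL: "integrable lborel L" unfolding L_def by (rule GG_times_test_integrable[OF \<phi>]) simp
 have eq: "(LINT g|lborel. F (t, g)) = (LINT x|lborel. L (t, x))" if "integrable lborel (\<lambda>g. F (t, g))" for t
 proof -
  have "(LINT \<xi>|lborel. F (t, (x, \<xi>))) = L (t, x)" for x
  proof -
   have "F (t, (x, \<xi>)) = \<gamma> (s - t, mul (ginv (x, \<xi>)) (y, \<eta>)) * \<phi> (t, x)" for \<xi>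
    by (simp add: F_def prj_def tmul_def tinv_def \<zeta>)
   then show ?thesis by (simp add: K_fibre' L_def GG_def)
  qed
  then show ?thesis using LINT_prod(1)[OF that] by simp
 qed
 have "conv (\<lambda>z. \<phi> (prj z)) \<zeta> = (LINT t|lborel. LINT g|lborel. F (t, g))"
  unfolding conv_def F_def[symmetric] by (rule LINT_prod(1)[OF iF])
 also have "\<dots> = (LINT t|lborel. LINT x|lborel. L (t, x))"
 proof (rule integral_cong_AE)
  show "AE t in lborel. (LINT g|lborel. F (t, g)) = (LINT x|lborel. L (t, x))"
   using LINT_prod(2)[OF iF] by eventually_elim (rule eq)
 qed (rule borel_measurable_integrable[OF LINT_prod(3)[OF iF]], rule borel_measurable_integrable[OF LINT_prod(3)[OF iL]])
 also have "\<dots> = (LINT z|lborel. L z)" by (rule LINT_prod(1)[OF iL, symmetric])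
 also have "\<dots> = Lam (GG 1) \<phi> (prj \<zeta>)" by (simp add: Lam_def L_def prj_def \<zeta>)
 finally show ?thesis .
qed

text \<open>The source lives at fibre distance at least \<open>R\<close> and is observed below
  \<open>R\<close>, so the pole is avoided. Time and base coordinates of the source stay bounded, so
  only decay along the fibre matters, and degree \<open>- Q\<close> is below
  \<open>- hdim u\<close>.\<close>

lemma far_kernel_good:
 assumes c: "c \<in> borel_measurable borel" "\<And>z. \<bar>c z\<bar> \<le> B * indicator C (prj z)" "\<And>z. norm (snd (snd z)) < R ==> c z = 0"
  and C: "compact C"
 shows "good_kernel {\<zeta>. norm (snd (snd \<zeta>)) < R} c {q. ti (snd q) \<star> fst q \<noteq> 0} (\<lambda>q. \<gamma> (ti (snd q) \<star> fst q))"
proof -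
 let ?W = "{q. ti (snd q) \<star> fst q \<noteq> 0}" and ?f = "\<lambda>q. \<gamma> (ti (snd q) \<star> fst q)"
 let ?D = "tdil (dprod \<delta>x \<delta>y)"
 have sm: "smooth_map (\<lambda>q. ti (snd q) \<star> fst q)"
  by (intro T.smooth_map_mul T.smooth_map_inv smooth_map_fst smooth_map_snd)
 have "?W = (\<lambda>q. ti (snd q) \<star> fst q) -` (UNIV - {0})" by auto
 then have oW: "open ?W" using open_vimage[OF open_off_zero smooth_mapD(2)[OF sm]] by (simp only:)
 have sf: "smooth_on ?W ?f" by (rule smooth_on_compose_map[OF oW sm gam_smooth]) (simp add: image_subset_iff)
 have hf: "homog (dprod ?D ?D) (- Q) ?W ?f"
  unfolding homog_def
 proof (intro allI impI ballI)
  fix l :: real and q assume l: "l > 0" and q: "q \<in> ?W"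
  have e: "ti (snd (dprod ?D ?D l q)) \<star> fst (dprod ?D ?D l q) = ?D l (ti (snd q) \<star> fst q)"
   unfolding dprod_def[of ?D ?D] fst_conv snd_conv T.inv_dil[OF l] T.aut[OF l] ..
  show "dprod ?D ?D l q \<in> ?W \<and> ?f (dprod ?D ?D l q) = l powr - Q * ?f q"
   unfolding mem_Collect_eq e using homogD[OF gam_homog l, of "ti (snd q) \<star> fst q"] q by simp
 qed
 have ax: "(0, h) \<in> ?W" if "h \<noteq> 0" for h
  using that T.inv_simps(1,2) unfolding mem_Collect_eq fst_conv snd_conv T.unit by metis
 have B0: "B * indicator C z \<ge> 0" for z
  using order_trans[OF abs_ge_zero c(2)[of "(fst z, (snd z, 0))"]] by (simp add: prj_def)
 have oU: "open {\<zeta> :: real \<times> ('x \<times> 'y). norm (snd (snd \<zeta>)) < R}" by (intro open_Collect_less continuous_intros)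
 have "\<exists>e>0. \<exists>D. integrable lborel D \<and> (\<forall>p\<in>ball p0 e. \<forall>h. \<bar>g (p, h) * c h\<bar> \<le> D h)"
  if g: "g \<in> pdc ?f" and p0: "norm (snd (snd p0)) < R" for g and p0 :: "real \<times> ('x \<times> 'y)"
 proof -
  obtain d' where d': "homog (dprod ?D ?D) d' ?W g" "d' \<le> - Q"
   using pdc_homog[OF T.dil T.dil oW sf hf g] by force
  have q: "Q \<ge> 1" by (rule hdim_ge_1[OF dil])
  define e where "e = (R - norm (snd (snd p0))) / 2"
  have e: "e > 0" using p0 by (simp add: e_def)
  define S where "S = {h :: real \<times> ('x \<times> 'y). R \<le> norm (snd (snd h))}"
  have S: "closed S" unfolding S_def by (intro closed_Collect_le continuous_intros)
  have sub: "cball p0 e \<times> S \<subseteq> ?W"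
  proof
   fix q assume q: "q \<in> cball p0 e \<times> S"
   have "dist p0 (fst q) \<le> e" using q by (simp add: mem_Times_iff)
   then have "dist (snd (snd p0)) (snd (snd (fst q))) \<le> e"
    using dist_snd_le[of p0 "fst q"] dist_snd_le[of "snd p0" "snd (fst q)"] by linarith
   then have "norm (snd (snd (fst q)) - snd (snd p0)) \<le> e" by (simp add: dist_norm norm_minus_commute)
   then have "norm (snd (snd (fst q))) \<le> norm (snd (snd p0)) + e"
    using norm_triangle_ineq2[of "snd (snd (fst q))" "snd (snd p0)"] by linarith
   moreover have "R \<le> norm (snd (snd (snd q)))" using q by (simp add: S_def mem_Times_iff)
   ultimately have "snd q \<noteq> fst q" using e unfolding e_def by (auto simp: field_simps)
   then show "q \<in> ?W" unfolding mem_Collect_eq using T.inv_eq_iff[of "snd q" "fst q"] by blast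
  qed
  have cg: "continuous_on ?W g" by (rule smooth_onD(4)[OF pdc_smooth[OF g sf]])
  have d0: "d' \<le> 0" using d'(2) q by simp
  have "\<exists>D. \<forall>p h. p \<in> cball p0 e \<longrightarrow> h \<in> S \<longrightarrow> \<bar>g (p, h)\<bar> \<le> D * (1 + hn (twt (wprod v u)) h) powr d'"
  proof (rule homog_dominated[OF T.dil T.dil oW d'(1) cg _ compact_cball S sub d0])
   show "(0, h) \<in> ?W" if "h \<noteq> 0" for h using ax[OF that] .
  qed blast
  then obtain D where D: "\<And>p h. p \<in> cball p0 e ==> h \<in> S ==> \<bar>g (p, h)\<bar> \<le> D * (1 + hn (twt (wprod v u)) h) powr d'"
   by blast
  obtain r where r: "\<forall>z\<in>C. norm z \<le> r" using bounded_iff[THEN iffD1, OF compact_imp_bounded[OF C]] ..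
  define M :: "real \<times> ('x \<times> 'y) => real" where
   "M h = indicator {-r..r} (fst h) * (indicator (cball 0 r) (fst (snd h)) * ((\<bar>D\<bar> * \<bar>B\<bar>) * (1 + hn u (snd (snd h))) powr (- Q)))" for h
  have iM: "integrable lborel M" unfolding M_def
  proof (rule integrable_prod, goal_cases)
   case 1 show ?case by (rule integrable_real_indicator) (simp_all add: emeasure_lborel_Icc_eq)
  next
   case 2
   show ?case
   proof (rule integrable_prod, goal_cases)
    case 1 show ?case by (rule integrable_real_indicator) (simp, rule emeasure_lborel_cball_finite)
   next
    case 2
    show ?case by (rule integrable_mult_right, rule integrable_hn[OF dil_y]) (use hdim_pos(1) in \<open>simp add: hdim_split\<close>)
   qed
  qed
  have bd: "\<bar>g (p, h) * c h\<bar> \<le> M h" if p: "p \<in> ball p0 e" for p h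
  proof (cases "c h = 0")
   case True
   have "M h \<ge> 0" unfolding M_def by (intro mult_nonneg_nonneg) (auto simp: indicator_def)
   then show ?thesis using True by simp
  next
   case False
   then have hS: "h \<in> S" using c(3)[of h] unfolding S_def by force
   have hC: "prj h \<in> C" using c(2)[of h] False by (cases "prj h \<in> C") simp_all
   then have "norm (prj h) \<le> r" using r by blast
   then have rr: "\<bar>fst h\<bar> \<le> r" "norm (fst (snd h)) \<le> r"
    using norm_fst_le[of "fst h" "fst (snd h)"] norm_snd_le[of "fst (snd h)" "fst h"] unfolding prj_def by auto
   have cB: "\<bar>c h\<bar> \<le> \<bar>B\<bar>" using c(2)[of h] hC by simp
   have n0: "hn u (snd (snd h)) \<ge> 0" "hn (twt (wprod v u)) h \<ge> hn u (snd (snd h))"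
    unfolding hn_wprod by (simp_all add: hn_nonneg)
   have "(1 + hn (twt (wprod v u)) h) powr d' \<le> (1 + hn (twt (wprod v u)) h) powr (- Q)"
    using n0 d'(2) by (intro powr_mono) auto
   also have "\<dots> \<le> (1 + hn u (snd (snd h))) powr (- Q)" using n0 q by (intro powr_mono2') auto
   finally have pw: "(1 + hn (twt (wprod v u)) h) powr d' \<le> (1 + hn u (snd (snd h))) powr (- Q)" .
   have "\<bar>g (p, h)\<bar> \<le> D * (1 + hn (twt (wprod v u)) h) powr d'" by (rule D[OF _ hS]) (use p in simp)
   also have "\<dots> \<le> \<bar>D\<bar> * (1 + hn (twt (wprod v u)) h) powr d'" by (rule mult_right_mono) auto
   also have "\<dots> \<le> \<bar>D\<bar> * (1 + hn u (snd (snd h))) powr (- Q)" by (rule mult_left_mono[OF pw]) simp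
   finally have "\<bar>g (p, h)\<bar> * \<bar>c h\<bar> \<le> (\<bar>D\<bar> * (1 + hn u (snd (snd h))) powr (- Q)) * \<bar>B\<bar>"
    using cB by (intro mult_mono) auto
   then show ?thesis using rr by (simp add: M_def abs_mult indicator_def abs_le_iff mult_ac)
  qed
  show ?thesis using e iM bd by blast
 qed
 moreover have "(p, h) \<in> ?W" if "norm (snd (snd p)) < R" "c h \<noteq> 0" for p h
 proof -
  have "h \<noteq> p" using c(3) that by blast
  then show ?thesis unfolding mem_Collect_eq fst_conv snd_conv using T.inv_eq_iff[of h p] by blast
 qed
 ultimately show ?thesis
  unfolding good_kernel_def mem_Collect_eq by (intro conjI oU oW sf c(1) ballI allI impI) simp_all
qed

text \<open>Split the lifted source by a cutoff in the fibre coordinate. The near part is a test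
  function, for which \<open>potB_heat\<close> holds; the far part is never met by the pole while
  the observation point stays in \<open>U\<close>, so it contributes a smooth solution of the
  homogeneous equation.\<close>

lemma conv_local:
 assumes \<phi>: "test_fun \<phi>" and R: "R > 0"
 defines "P \<equiv> \<lambda>z. \<phi> (prj z)" and "U \<equiv> {\<zeta> :: real \<times> ('x \<times> 'y). norm (snd (snd \<zeta>)) < R}"
 shows "smooth_on U (conv P)" and "\<zeta> \<in> U ==> heat 1 (conv P) \<zeta> = - P \<zeta>"
proof -
 obtain C where C: "compact C" "\<And>x. x \<notin> C ==> \<phi> x = 0" using test_funE[OF \<phi>] by metis
 from bounded_iff[THEN iffD1, OF compact_imp_bounded[OF C(1)]] obtain r where r: "\<forall>z\<in>C. norm z \<le> r" ..
 obtain B where B: "B \<ge> 0" "\<forall>x. \<bar>\<phi> x\<bar> \<le> B" using test_fun_integrable(2)[OF \<phi>] by blast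
 define \<theta> where "\<theta> z = cutoff R (snd (snd z))" for z :: "real \<times> ('x \<times> 'y)"
 define P1 where "P1 z = P z * \<theta> z" for z
 define P2 where "P2 z = P z * (1 - \<theta> z)" for z
 have s\<phi>: "smooth_on UNIV \<phi>" using \<phi> by (simp add: test_fun_def)
 have sP: "smooth_on UNIV P" unfolding P_def by (rule smooth_on_compose_map[OF open_UNIV smooth_map_prj s\<phi>]) simp
 have s\<theta>: "smooth_on UNIV \<theta>" unfolding \<theta>_def
  by (rule smooth_on_compose_map[OF open_UNIV _ smooth_on_cutoff[OF R]]) (auto intro: smooth_map_snd' smooth_map_snd)
 have \<theta>b: "0 \<le> \<theta> z" "\<theta> z \<le> 1" for z unfolding \<theta>_def using cutoff_range[OF R] by blast+
 have P0: "P z = 0" if "prj z \<notin> C" for z using C(2)[OF that] by (simp add: P_def)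
 have t1: "test_fun P1"
 proof (rule test_funI')
  show "smooth_on UNIV P1" unfolding P1_def by (intro smooth_on_mult open_UNIV sP s\<theta>)
  let ?K = "(\<lambda>q. (fst (fst q), (snd (fst q), snd q))) ` (C \<times> cball (0 :: 'y) (R + 1))"
  show "compact ?K"
   by (intro compact_continuous_image continuous_intros compact_Times C(1) compact_cball)
  show "z \<in> ?K" if "P1 z \<noteq> 0" for z
  proof -
   have "prj z \<in> C" using that P0[of z] unfolding P1_def by fastforce
   moreover have "snd (snd z) \<in> cball 0 (R + 1)" using that cutoff_zero[OF R, of "snd (snd z)"] by (auto simp: P1_def \<theta>_def)
   ultimately show ?thesis by (intro image_eqI[of _ _ "(prj z, snd (snd z))"]) (auto simp: prj_def)
  qed
 qed
 have m2: "P2 \<in> borel_measurable borel" unfolding P2_def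
  by (intro borel_measurable_continuous_onI smooth_onD(4)[of UNIV] smooth_on_mult smooth_on_diff smooth_on_const open_UNIV sP s\<theta>)
 have m1: "P1 \<in> borel_measurable borel" by (rule test_fun_integrable(3)[OF t1])
 have PB: "\<bar>P z\<bar> \<le> B * indicator C (prj z)" for z
  using B(1) B(2)[rule_format, of "prj z"] P0[of z] by (cases "prj z \<in> C") (simp_all add: P_def)
 have bnd: "\<bar>P1 z\<bar> \<le> B * indicator C (prj z)" "\<bar>P2 z\<bar> \<le> B * indicator C (prj z)" for z
 proof -
  have "\<bar>P z\<bar> * \<bar>\<theta> z\<bar> \<le> \<bar>P z\<bar> * 1" "\<bar>P z\<bar> * \<bar>1 - \<theta> z\<bar> \<le> \<bar>P z\<bar> * 1"
   using \<theta>b[of z] by (intro mult_left_mono; simp)+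
  then show "\<bar>P1 z\<bar> \<le> B * indicator C (prj z)" "\<bar>P2 z\<bar> \<le> B * indicator C (prj z)"
   using PB[of z] unfolding P1_def P2_def abs_mult by linarith+
 qed
 have strip: "B * indicator C (prj z) \<le> B * indicator {-r..r} (fst z)" for z
 proof (rule mult_left_mono[OF _ B(1)])
  have "\<bar>fst z\<bar> \<le> r" if "prj z \<in> C" using r that norm_fst_le[of "fst z" "fst (snd z)"] unfolding prj_def by fastforce
  then show "indicator C (prj z) \<le> (indicator {-r..r} (fst z) :: real)" by (auto simp: indicator_def abs_le_iff)
 qed
 have i: "integrable lborel (\<lambda>z. \<gamma> (ti z \<star> \<zeta>) * P1 z)" "integrable lborel (\<lambda>z. \<gamma> (ti z \<star> \<zeta>) * P2 z)" for \<zeta>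
  by (rule conv_integrable[OF m1 order_trans[OF bnd(1) strip]], rule conv_integrable[OF m2 order_trans[OF bnd(2) strip]])
 have split: "conv P \<zeta> = 1 * potB P1 \<zeta> + 1 * conv P2 \<zeta>" for \<zeta>
 proof -
  have "conv P \<zeta> = (LINT z|lborel. \<gamma> (ti z \<star> \<zeta>) * P1 z + \<gamma> (ti z \<star> \<zeta>) * P2 z)"
   unfolding conv_def P1_def P2_def by (rule Bochner_Integration.integral_cong[OF refl]) (simp add: algebra_simps)
  also have "\<dots> = conv P1 \<zeta> + conv P2 \<zeta>" unfolding conv_def by (rule Bochner_Integration.integral_add[OF i])
  finally show ?thesis by (simp add: conv_potB[OF t1])
 qed
 have z2: "P2 z = 0" if "norm (snd (snd z)) < R" for z
  using cutoff_one[OF R, of "snd (snd z)"] that by (simp add: P2_def \<theta>_def)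
 have k: "good_kernel {\<zeta>. norm (snd (snd \<zeta>)) < R} P2 {q. ti (snd q) \<star> fst q \<noteq> 0} (\<lambda>q. \<gamma> (ti (snd q) \<star> fst q))"
  by (rule far_kernel_good[OF m2 bnd(2) _ C(1)]) (rule z2)
 have c2: "conv P2 = (\<lambda>p. LINT h|lborel. \<gamma> (ti (snd (p, h)) \<star> fst (p, h)) * P2 h)" by (simp add: conv_def[abs_def])
 have oU: "open U" unfolding U_def by (rule good_kernelD(1)[OF k])
 have s2: "smooth_on U (conv P2)" unfolding c2 U_def by (rule good_kernel_smooth[OF k])
 have s1: "smooth_on U (potB P1)" by (rule smooth_on_subset[OF pot_smooth(1)[OF t1]]) simp
 have eqP: "conv P = (\<lambda>\<zeta>. 1 * potB P1 \<zeta> + 1 * conv P2 \<zeta>)" using split by blast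
 show "smooth_on U (conv P)" unfolding eqP by (intro smooth_on_add smooth_on_mult smooth_on_const oU s1 s2)
 show "heat 1 (conv P) \<zeta> = - P \<zeta>" if \<zeta>: "\<zeta> \<in> U"
 proof -
  have z0: "heat 1 (\<lambda>p. \<gamma> (ti (snd (p, h)) \<star> fst (p, h))) \<zeta> * P2 h = 0" for h
  proof (cases "P2 h = 0")
   case False
   then have nz: "ti h \<star> \<zeta> \<noteq> 0" using T.inv_eq_iff[of h \<zeta>] z2[of h] \<zeta> unfolding U_def by blast
   have "heat 1 (\<lambda>p. \<gamma> (ti h \<star> p)) \<zeta> = heat 1 \<gamma> (ti h \<star> \<zeta>)"
    by (rule heat_left[OF open_off_zero _ smooth_onD(1)[OF gam_smooth]]) (use nz in simp)
   then show ?thesis using gam_heat[OF nz] by simp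
  qed simp
  have "heat 1 (conv P2) \<zeta> = (LINT h|lborel. heat 1 (\<lambda>p. \<gamma> (ti (snd (p, h)) \<star> fst (p, h))) \<zeta> * P2 h)"
   unfolding c2 by (rule good_kernel_heat_op[OF k _ Zs_smooth]) (use \<zeta> in \<open>simp add: U_def\<close>)
  then have h2: "heat 1 (conv P2) \<zeta> = 0" unfolding z0 by simp
  have "heat 1 (conv P) \<zeta> = 1 * heat 1 (potB P1) \<zeta> + 1 * heat 1 (conv P2) \<zeta>"
   unfolding eqP by (rule heat_op_cmult_add[OF oU \<zeta> smooth_onD(1)[OF s1] smooth_onD(1)[OF s2] Zs_smooth])
  also have "\<dots> = - P1 \<zeta>" using potB_heat[OF t1, of \<zeta>] h2 by simp
  also have "P1 \<zeta> = P \<zeta>" using cutoff_one[OF R, of "snd (snd \<zeta>)"] \<zeta> by (simp add: P1_def \<theta>_def U_def)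
  finally show ?thesis .
 qed
qed

lemma heat_op_prj:
 assumes "open W" "prj \<zeta> \<in> W" "C_k_on 2 W f"
 shows "heat 1 (\<lambda>z. f (prj z)) \<zeta> = heat_op 1 m Xs f (prj \<zeta>)"
proof -
 have "frechet_derivative fst (at g) = fst" for g :: "'x \<times> 'y"
  using frechet_derivative_at[OF bounded_linear_imp_has_derivative[OF bounded_linear_fst], of g] by simp
 then have rel: "\<forall>j<m. \<forall>x. frechet_derivative fst (at x) (Zs j x) = 1 *\<^sub>R Xs j (fst x)" using lift by simp
 have "heat 1 (\<lambda>z. f (1 * fst z + 0, fst (snd z))) \<zeta> = 1\<^sup>2 * heat_op 1 m Xs f (1 * fst \<zeta> + 0, fst (snd \<zeta>))"
  by (rule heat_op_related[OF assms(1) _ assms(3) smooth_map_fst Xs_smooth rel]) (use assms(2) in \<open>simp_all add: prj_def\<close>)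
 then show ?thesis by (simp add: prj_def)
qed

lemma section_smooth: "smooth_map (\<lambda>w :: real \<times> 'x. (fst w, (snd w, 0 :: 'y)))"
 by (intro smooth_map_Pair smooth_map_fst smooth_map_snd smooth_map_const)

text \<open>Read the lifted potential along the section with fibre coordinate 0, where the local
  result applies with fibre radius 1.\<close>

lemma Lam_one:
 assumes \<phi>: "test_fun \<phi>"
 shows "smooth_on UNIV (Lam (GG 1) \<phi>)" and "heat_op 1 m Xs (Lam (GG 1) \<phi>) \<zeta> = - \<phi> \<zeta>"
proof -
 let ?V = "conv (\<lambda>z. \<phi> (prj z))"
 let ?U = "{\<zeta> :: real \<times> ('x \<times> 'y). norm (snd (snd \<zeta>)) < 1}"
 have sV: "smooth_on ?U ?V" by (rule conv_local(1)[OF \<phi> zero_less_one])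
 have "Lam (GG 1) \<phi> w = ?V (fst w, (snd w, 0))" for w using Lam_lift[OF \<phi>, of "(fst w, (snd w, 0))"] by (simp add: prj_def)
 then have eq: "Lam (GG 1) \<phi> = (\<lambda>w. ?V (fst w, (snd w, 0)))" by blast
 show s: "smooth_on UNIV (Lam (GG 1) \<phi>)"
  unfolding eq by (rule smooth_on_compose_map[OF open_UNIV section_smooth sV]) (simp add: image_subset_iff)
 define z where "z = (fst \<zeta>, (snd \<zeta>, 0 :: 'y))"
 have z: "prj z = \<zeta>" "z \<in> ?U" by (simp_all add: z_def prj_def)
 have "heat_op 1 m Xs (Lam (GG 1) \<phi>) \<zeta> = heat 1 (\<lambda>z. Lam (GG 1) \<phi> (prj z)) z"
  using heat_op_prj[OF open_UNIV UNIV_I smooth_onD(1)[OF s], of z] z(1) by simp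
 also have "(\<lambda>z. Lam (GG 1) \<phi> (prj z)) = ?V" using Lam_lift[OF \<phi>] by fastforce
 also have "heat 1 ?V z = - \<phi> (prj z)" by (rule conv_local(2)[OF \<phi> zero_less_one z(2)])
 finally show "heat_op 1 m Xs (Lam (GG 1) \<phi>) \<zeta> = - \<phi> \<zeta>" by (simp add: z(1))
qed

lemma test_fun_time_sign:
 fixes \<phi> :: "real \<times> 'x => real"
 assumes \<phi>: "test_fun \<phi>" and e: "e * e = 1"
 shows "test_fun (\<lambda>z. \<phi> (e * fst z, snd z))"
proof -
 obtain C where C: "compact C" "\<And>x. x \<notin> C ==> \<phi> x = 0" using test_funE[OF \<phi>] by metis
 have e2: "e * (e * t) = t" for t using e by (metis mult.assoc mult_1)
 show ?thesis
 proof (rule test_funI')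
  show "smooth_on UNIV (\<lambda>z. \<phi> (e * fst z, snd z))"
   by (rule smooth_on_compose_map[OF open_UNIV smooth_map_time_sign]) (use \<phi> in \<open>auto simp: test_fun_def\<close>)
  show "compact ((\<lambda>z. (e * fst z, snd z)) ` C)" by (intro compact_continuous_image continuous_intros C(1))
  show "z \<in> (\<lambda>z. (e * fst z, snd z)) ` C" if "\<phi> (e * fst z, snd z) \<noteq> 0" for z
   using C(2)[of "(e * fst z, snd z)"] that by (intro image_eqI[of _ _ "(e * fst z, snd z)"]) (auto simp: e2)
 qed
qed

lemma Lam_time_sign:
 assumes \<phi>: "test_fun \<phi>" and e: "e * e = 1"
 shows "Lam (GG e) \<phi> \<zeta> = Lam (GG 1) (\<lambda>z. \<phi> (e * fst z, snd z)) (e * fst \<zeta>, snd \<zeta>)"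
proof -
 let ?r = "\<lambda>z :: real \<times> 'x. (e * fst z, snd z)"
 have e2: "e * (e * t) = t" for t using e by (metis mult.assoc mult_1)
 have m: "(\<lambda>z. GG 1 z (?r \<zeta>) * \<phi> (?r z)) \<in> borel_measurable borel"
  using borel_measurable_integrable[OF GG_times_test_integrable[OF test_fun_time_sign[OF \<phi> e], of 1]] by simp
 have "Lam (GG e) \<phi> \<zeta> = (LINT z|lborel. GG 1 (?r z) (?r \<zeta>) * \<phi> (?r (?r z)))"
  unfolding Lam_def by (simp add: GG_def e2 right_diff_distrib)
 also have "\<dots> = (LINT z|lborel. GG 1 z (?r \<zeta>) * \<phi> (?r z))"
  by (rule preserved_integral(1)[OF time_sign_preserved[OF dil_x e] smooth_mapD(3)[OF smooth_map_time_sign] m])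
 finally show ?thesis by (simp only: Lam_def)
qed

lemma Lam_lim:
 assumes \<phi>: "test_fun \<phi>" and e: "e \<noteq> 0"
 shows "(Lam (GG e) \<phi> \<longlongrightarrow> 0) at_infinity"
proof -
 obtain C where C: "compact C" "\<And>x. x \<notin> C ==> \<phi> x = 0" using test_funE[OF \<phi>] by metis
 obtain R B where RB: "\<And>z \<zeta>. z \<in> C ==> hn (twt v) \<zeta> \<ge> R ==> GG e z \<zeta> \<le> B * hn (twt v) \<zeta> powr (- hdim v)"
  by (rule GG_decay[OF C(1) e]) (rule that)
 have i\<phi>: "integrable lborel (\<lambda>z. \<bar>\<phi> z\<bar>)" by (rule integrable_abs[OF test_fun_integrable(1)[OF \<phi>]])
 define J where "J = (LINT z|lborel. \<bar>\<phi> z\<bar>)"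
 have "norm (Lam (GG e) \<phi> \<zeta>) \<le> (\<bar>B\<bar> * J) * hn (twt v) \<zeta> powr (- hdim v)" if R: "hn (twt v) \<zeta> \<ge> R" for \<zeta>
 proof -
  let ?b = "\<bar>B\<bar> * hn (twt v) \<zeta> powr (- hdim v)"
  have "norm (Lam (GG e) \<phi> \<zeta>) \<le> (LINT z|lborel. norm (GG e z \<zeta> * \<phi> z))"
   unfolding Lam_def by (rule integral_norm_bound)
  also have "\<dots> \<le> (LINT z|lborel. ?b * \<bar>\<phi> z\<bar>)"
  proof (rule integral_mono')
   show "integrable lborel (\<lambda>z. ?b * \<bar>\<phi> z\<bar>)" by (rule integrable_mult_right[OF i\<phi>])
   show "norm (GG e z \<zeta> * \<phi> z) \<le> ?b * \<bar>\<phi> z\<bar>" for z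
   proof (cases "z \<in> C")
    case True
    have "B * hn (twt v) \<zeta> powr (- hdim v) \<le> ?b" by (rule mult_right_mono) auto
    then have "GG e z \<zeta> \<le> ?b" using RB[OF True R] by linarith
    then have "GG e z \<zeta> * \<bar>\<phi> z\<bar> \<le> ?b * \<bar>\<phi> z\<bar>" by (rule mult_right_mono) simp
    then show ?thesis by (simp add: abs_mult GG_nonneg)
   qed (simp add: C(2))
  qed simp
  also have "\<dots> = (\<bar>B\<bar> * J) * hn (twt v) \<zeta> powr (- hdim v)" by (simp add: J_def)
  finally show ?thesis .
 qed
 then have "\<forall>\<^sub>F \<zeta> in at_infinity. norm (Lam (GG e) \<phi> \<zeta>) \<le> (\<bar>B\<bar> * J) * hn (twt v) \<zeta> powr (- hdim v)"
  using hn_eventually[of R] by (rule_tac eventually_mono)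
 then show ?thesis by (rule Lim_null_comparison[OF _ hn_decay])
qed

lemma Lam_props:
 assumes \<phi>: "test_fun \<phi>" and e: "e * e = 1"
 shows "smooth_on UNIV (Lam (GG e) \<phi>)" and "heat_op e m Xs (Lam (GG e) \<phi>) \<zeta> = - \<phi> \<zeta>"
proof -
 let ?\<psi> = "\<lambda>z. \<phi> (e * fst z, snd z)"
 have e2: "e * (e * t) = t" for t using e by (metis mult.assoc mult_1)
 note t = test_fun_time_sign[OF \<phi> e]
 have eq: "Lam (GG e) \<phi> = (\<lambda>\<zeta>. Lam (GG 1) ?\<psi> (e * fst \<zeta>, snd \<zeta>))" using Lam_time_sign[OF \<phi> e] by blast
 show "smooth_on UNIV (Lam (GG e) \<phi>)" unfolding eq
  by (rule smooth_on_compose_map[OF open_UNIV smooth_map_time_sign Lam_one(1)[OF t]]) simp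
 have "heat_op e m Xs (Lam (GG e) \<phi>) \<zeta> = heat_op 1 m Xs (Lam (GG 1) ?\<psi>) (e * fst \<zeta>, snd \<zeta>)"
  unfolding eq by (rule heat_op_time_sign[OF e open_UNIV UNIV_I smooth_onD(1)[OF Lam_one(1)[OF t]] Xs_smooth])
 then show "heat_op e m Xs (Lam (GG e) \<phi>) \<zeta> = - \<phi> \<zeta>" using Lam_one(2)[OF t] by (simp add: e2)
qed

text \<open>Add \<open>\<phi>\<close> to the potential, for the opposite sign, of the image of
  \<open>\<phi>\<close> under \<open>heat_op (- e)\<close>. The sum solves the homogeneous equation
  and vanishes at infinity, so it is 0; exchanging arguments by \<open>GG_flip\<close> turns this
  into the integral identity.\<close>

lemma fundamental:
 assumes \<phi>: "test_fun \<phi>" and e: "e * e = 1"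
 shows "(LINT \<zeta>|lborel. GG e z \<zeta> * heat_op (- e) m Xs \<phi> \<zeta>) = - \<phi> z"
proof -
 let ?r = "\<lambda>z :: real \<times> 'x. (- e * fst z, snd z)"
 define \<psi> where "\<psi> = heat_op (- e) m Xs \<phi>"
 have me: "- e * - e = 1" "- e \<noteq> 0" using e by auto
 have e2: "- e * (- e * t) = t" for t using me(1) by (metis mult.assoc mult_1)
 have t\<psi>: "test_fun \<psi>" unfolding \<psi>_def by (rule test_fun_heat_op[OF \<phi> Xs_smooth])
 have s\<phi>: "smooth_on UNIV \<phi>" using \<phi> by (simp add: test_fun_def)
 define w where "w z = 1 * Lam (GG (- e)) \<psi> z + 1 * \<phi> z" for z
 have sL: "smooth_on UNIV (Lam (GG (- e)) \<psi>)" by (rule Lam_props(1)[OF t\<psi> me(1)])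
 have sw: "smooth_on UNIV w" unfolding w_def[abs_def] by (intro smooth_on_add smooth_on_mult smooth_on_const open_UNIV sL s\<phi>)
 have hw: "heat_op (- e) m Xs w z = 0" for z
 proof -
  have "heat_op (- e) m Xs w z = 1 * heat_op (- e) m Xs (Lam (GG (- e)) \<psi>) z + 1 * heat_op (- e) m Xs \<phi> z"
   unfolding w_def[abs_def] by (rule heat_op_cmult_add[OF open_UNIV UNIV_I smooth_onD(1)[OF sL] smooth_onD(1)[OF s\<phi>] Xs_smooth])
  then show ?thesis using Lam_props(2)[OF t\<psi> me(1), of z] by (simp add: \<psi>_def)
 qed
 have "((\<lambda>z. 1 * Lam (GG (- e)) \<psi> z + 1 * \<phi> z) \<longlongrightarrow> 1 * 0 + 1 * 0) at_infinity"
  by (intro tendsto_add tendsto_mult tendsto_const Lam_lim[OF t\<psi> me(2)] test_fun_lim[OF \<phi>])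
 then have lw: "(w \<longlongrightarrow> 0) at_infinity" by (simp add: w_def[abs_def])
 \<comment> \<open>Time is multiplied by \<open>- e\<close> because the uniqueness result concerns
   \<open>heat_op 1\<close>.\<close>
 define w' where "w' z = w (?r z)" for z
 have sw': "smooth_on UNIV w'" unfolding w'_def[abs_def] by (rule smooth_on_compose_map[OF open_UNIV smooth_map_time_sign sw]) simp
 have ww: "w = (\<lambda>z. w' (?r z))" unfolding w'_def fst_conv snd_conv e2 by simp
 have hw': "heat_op 1 m Xs w' z = 0" for z
 proof -
  have "heat_op (- e) m Xs w (?r z) = heat_op 1 m Xs w' (?r (?r z))"
   by (subst ww, rule heat_op_time_sign[OF me(1) open_UNIV UNIV_I smooth_onD(1)[OF sw'] Xs_smooth])
  moreover have "?r (?r z) = z" unfolding fst_conv snd_conv e2 by simp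
  ultimately show ?thesis using hw by simp
 qed
 have nr: "norm (?r z) = norm z" for z
 proof -
  have "(- e * fst z)\<^sup>2 = (fst z)\<^sup>2" using e by (simp add: power_mult_distrib power2_eq_square)
  then show ?thesis by (simp add: norm_prod_def)
 qed
 have lw': "(w' \<longlongrightarrow> 0) at_infinity"
  unfolding Lim_at_infinity
 proof (intro allI impI)
  fix \<epsilon> :: real assume "\<epsilon> > 0"
  then obtain b where "\<forall>x. norm x \<ge> b \<longrightarrow> dist (w x) 0 < \<epsilon>" using lw unfolding Lim_at_infinity by blast
  then have "\<forall>x. norm x \<ge> b \<longrightarrow> dist (w' x) 0 < \<epsilon>" unfolding w'_def using nr by metis
  then show "\<exists>b. \<forall>x. norm x \<ge> b \<longrightarrow> dist (w' x) 0 < \<epsilon>" ..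
 qed
 have "w' y = 0" for y
  by (rule vanishing_solution_zero[OF Xs_smooth smooth_onD(1)[OF sw'] lw' _ order_refl]) (rule hw')
 then have "w z = 0" using ww by metis
 then have "Lam (GG (- e)) \<psi> z = - \<phi> z" by (simp add: w_def)
 then show ?thesis by (simp only: Lam_def GG_flip \<psi>_def)
qed

text \<open>Initial data pulled back from the base have a group solution depending on the base point
  only, because the fibre integral of the kernel does; restricting it to the section with fibre
  coordinate 0 gives the solution on the base.\<close>

lemma cauchy_solution:
 assumes c: "continuous_on UNIV \<phi>" and b: "\<And>x. \<bar>\<phi> x\<bar> \<le> M"
 defines "f \<equiv> \<lambda>z. if 0 < fst z then LINT y|lborel. GG 1 (0, y) z * \<phi> y else \<phi> (snd z)"
 shows "smooth_on {z. 0 < fst z} f" and "0 < fst z ==> heat_op 1 m Xs f z = 0"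
  and "continuous_on {z. 0 \<le> fst z} f" and "0 \<le> fst z ==> \<bar>f z\<bar> \<le> M"
proof -
 have c': "continuous_on UNIV (\<lambda>g :: 'x \<times> 'y. \<phi> (fst g))"
  by (rule continuous_on_compose2[OF c]) (auto intro: continuous_intros)
 note S = heatsol_solution[OF c', of M, OF b]
 let ?h = "heatsol (\<lambda>g :: 'x \<times> 'y. \<phi> (fst g))"
 have m: "(\<lambda>g :: 'x \<times> 'y. \<phi> (fst g)) \<in> borel_measurable borel" by (rule borel_measurable_continuous_onI[OF c'])
 have hf: "?h z = f (prj z)" for z
 proof (cases "0 < fst z")
  case True
  let ?F = "\<lambda>h. ker (z, h) * \<phi> (fst h)"
  obtain t g where z: "z = (t, g)" by (metis surj_pair)
  obtain y \<eta> where g: "g = (y, \<eta>)" by (metis surj_pair)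
  have i: "integrable lborel ?F"
   using good_kernel_integrable[OF ker_good[OF m b], of z] True by simp
  have "(LINT \<xi>|lborel. ?F (x, \<xi>)) = GG 1 (0, x) (prj z) * \<phi> x" for x
  proof -
   have "?F (x, \<xi>) = \<gamma> (t, mul (ginv (x, \<xi>)) (y, \<eta>)) * \<phi> x" for \<xi> by (simp add: ker_def z g)
   then have "(\<lambda>\<xi>. ?F (x, \<xi>)) = (\<lambda>\<xi>. \<gamma> (t, mul (ginv (x, \<xi>)) (y, \<eta>)) * \<phi> x)" by blast
   then have "(LINT \<xi>|lborel. ?F (x, \<xi>)) = (LINT \<xi>|lborel. \<gamma> (t, mul (ginv (x, \<xi>)) (y, \<eta>)) * \<phi> x)" by (rule arg_cong)
   then show ?thesis by (simp add: K_fibre' GG_def prj_def z g)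
  qed
  then have "(LINT h|lborel. ?F h) = (LINT x|lborel. GG 1 (0, x) (prj z) * \<phi> x)"
   unfolding LINT_prod(1)[OF i] by (rule arg_cong[OF ext])
  then show ?thesis using True unfolding heatsol_def f_def by (simp add: prj_def)
 qed (simp add: heatsol_def f_def prj_def)
 have f: "f = (\<lambda>w. ?h (fst w, (snd w, 0)))" unfolding hf by (simp add: prj_def)
 have o: "open {z :: real \<times> 'x. 0 < fst z}" by (intro open_Collect_less continuous_intros)
 show s: "smooth_on {z. 0 < fst z} f" unfolding f
  by (rule smooth_on_compose_map[OF o section_smooth S(1)]) auto
 show "continuous_on {z. 0 \<le> fst z} f" unfolding f
  by (rule continuous_on_compose2[OF S(3) smooth_mapD(2)[OF section_smooth]]) auto
 show "\<bar>f z\<bar> \<le> M" if "0 \<le> fst z" unfolding f using S(4)[of "(fst z, (snd z, 0))"] that by simp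
 show "heat_op 1 m Xs f z = 0" if z: "0 < fst z"
 proof -
  let ?z = "(fst z, (snd z, 0 :: 'y))"
  have p: "prj ?z = z" by (simp add: prj_def)
  have "heat 1 (\<lambda>z. f (prj z)) ?z = heat_op 1 m Xs f z"
   using heat_op_prj[OF o _ smooth_onD(1)[OF s], of ?z] z unfolding p by simp
  moreover have "(\<lambda>z. f (prj z)) = ?h" using hf by fastforce
  ultimately show ?thesis using S(2)[of ?z] z by simp
 qed
qed

end

section \<open>The fundamental solution\<close>

text \<open>Cartesian coordinates on the base are fixed only here, since \<open>FS_props\<close> and
  \<open>Omega\<close> speak of \<open>real^'n\<close> and \<open>dil\<close>.\<close>

locale lifted_coordinates = lifted_group mul ginv "dil \<sigma>" \<delta>y "wvec \<sigma>" u m Zs \<gamma> Xs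
 for mul :: "(real^'n) \<times> 'y::euclidean_space => (real^'n) \<times> 'y => (real^'n) \<times> 'y" and ginv
  and \<sigma> :: "'n::finite => real" and \<delta>y and u and m Zs \<gamma> Xs
begin

lemma closure_Omega:
 assumes e: "e * e = 1"
 shows "closure (Omega e) = {z :: real \<times> (real^'n). 0 \<le> e * fst z}"
proof
 have "closed {z :: real \<times> (real^'n). 0 \<le> e * fst z}" by (intro closed_Collect_le continuous_intros)
 then show "closure (Omega e) \<subseteq> {z :: real \<times> (real^'n). 0 \<le> e * fst z}"
  by (rule closure_minimal[rotated]) (auto simp: Omega_def)
 show "{z :: real \<times> (real^'n). 0 \<le> e * fst z} \<subseteq> closure (Omega e)"
 proof
  fix z :: "real \<times> (real^'n)" assume z: "z \<in> {z. 0 \<le> e * fst z}"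
  have e1: "\<bar>e\<bar> = 1" using e by (metis abs_mult_self_eq abs_ge_zero abs_mult real_sqrt_abs2 real_sqrt_one)
  show "z \<in> closure (Omega e)" unfolding closure_approachable
  proof (intro allI impI)
   fix \<epsilon> :: real assume \<epsilon>: "\<epsilon> > 0"
   have "e * (fst z + e * (\<epsilon> / 2)) = e * fst z + (e * e) * (\<epsilon> / 2)" by (simp add: algebra_simps)
   then have "(fst z + e * (\<epsilon> / 2), snd z) \<in> Omega e" using z \<epsilon> e by (simp add: Omega_def)
   moreover have "dist (fst z + e * (\<epsilon> / 2), snd z) z < \<epsilon>"
    using e1 \<epsilon> by (simp add: dist_prod_def dist_real_def abs_mult)
   ultimately show "\<exists>y\<in>Omega e. dist y z < \<epsilon>" by blast
  qed
 qed
qed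

text \<open>The time sign transports the case \<open>e = 1\<close>. For uniqueness the difference of
  the two solutions has zero initial value and is bounded, so the barrier argument applies on the
  base.\<close>

lemma cauchy_problem:
 assumes e: "e * e = 1" and c: "continuous_on UNIV \<phi>" "bounded (range \<phi>)"
 defines "f \<equiv> \<lambda>z. if e * fst z > 0 then LINT y|lborel. GG e (0, y) z * \<phi> y else \<phi> (snd z)"
 shows "classical_sol e m Xs \<phi> f" "bounded (f ` Omega e)"
  and "classical_sol e m Xs \<phi> g ==> bounded (g ` Omega e) ==> z \<in> closure (Omega e) ==> g z = f z"
proof -
 obtain M where "\<forall>y\<in>range \<phi>. norm y \<le> M" using c(2) unfolding bounded_iff ..
 then have M: "\<bar>\<phi> x\<bar> \<le> M" for x by simp
 define k where "k z = (if 0 < fst z then LINT y|lborel. GG 1 (0, y) z * \<phi> y else \<phi> (snd z))" for z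
 note S = cauchy_solution[OF c(1) M, folded k_def]
 let ?r = "\<lambda>z :: real \<times> (real^'n). (e * fst z, snd z)"
 have e2: "e * (e * t) = t" for t using e by (metis mult.assoc mult_1)
 have rr: "?r (?r z) = z" for z unfolding fst_conv snd_conv e2 by simp
 have f: "f = (\<lambda>z. k (?r z))"
 proof (rule ext)
  have d: "1 * (e * s - 0) = e * (s - 0)" for s :: real by simp
  show "f z = k (?r z)" for z unfolding f_def k_def GG_def fst_conv snd_conv d ..
 qed
 have oO: "open (Omega e :: (real \<times> (real^'n)) set)" unfolding Omega_def by (intro open_Collect_less continuous_intros)
 have oP: "open {z :: real \<times> (real^'n). 0 < fst z}" by (intro open_Collect_less continuous_intros)
 have sf: "smooth_on (Omega e) f" unfolding f
  by (rule smooth_on_compose_map[OF oO smooth_map_time_sign S(1)]) (auto simp: Omega_def)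
 have hf: "heat_op e m Xs f z = 0" if "z \<in> Omega e" for z
  unfolding f using heat_op_time_sign[OF e oP _ smooth_onD(1)[OF S(1)] Xs_smooth, of z] S(2)[of "?r z"] that by (simp add: Omega_def)
 have cf: "continuous_on (closure (Omega e)) f" unfolding f
  by (rule continuous_on_compose2[OF S(3) smooth_mapD(2)[OF smooth_map_time_sign]]) (auto simp: closure_Omega[OF e])
 have f0: "f (0, x) = \<phi> x" for x by (simp add: f_def)
 show "classical_sol e m Xs \<phi> f" unfolding classical_sol_def using smooth_onD(1)[OF sf] hf cf f0 by simp
 have fM: "\<bar>f z\<bar> \<le> M" if "z \<in> Omega e" for z unfolding f using S(4)[of "?r z"] that by (simp add: Omega_def)
 then show "bounded (f ` Omega e)" unfolding bounded_iff by (intro exI[of _ M]) auto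
 show "g z = f z" if g: "classical_sol e m Xs \<phi> g" and bg: "bounded (g ` Omega e)" and z: "z \<in> closure (Omega e)"
 proof -
  have G: "C_k_on 2 (Omega e) g" "\<And>z. z \<in> Omega e ==> heat_op e m Xs g z = 0" "continuous_on (closure (Omega e)) g" "\<And>x. g (0, x) = \<phi> x"
   using g unfolding classical_sol_def by blast+
  obtain B where "\<forall>y\<in>g ` Omega e. norm y \<le> B" using bg unfolding bounded_iff ..
  then have B: "\<bar>g z\<bar> \<le> B" if "z \<in> Omega e" for z using that by simp
  have rO: "?r z \<in> Omega e" if "0 < fst z" for z using that unfolding Omega_def mem_Collect_eq fst_conv e2 .
  have Cg: "C_k_on 2 {z. 0 < fst z} (\<lambda>z. g (?r z))"
  proof (rule C_k_on_compose[OF oP _ G(1)])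
   show "C_k_on 2 {z. 0 < fst z} (\<lambda>x. (e * fst x, snd x) \<bullet> b)" for b :: "real \<times> (real^'n)"
    by (rule smooth_onD(1)[OF smooth_on_subset[OF smooth_map_component[OF smooth_map_time_sign]]]) simp
  qed (use rO in blast)
  have hg: "heat_op 1 m Xs (\<lambda>z. g (?r z)) z = 0" if z: "0 < fst z" for z
  proof -
   have rrz: "(e * fst (?r z), snd (?r z)) = z" using rr[of z] by simp
   have "heat_op e m Xs (\<lambda>y. g (?r (?r y))) (?r z) = heat_op 1 m Xs (\<lambda>z. g (?r z)) (e * fst (?r z), snd (?r z))"
    by (rule heat_op_time_sign[OF e oP _ Cg Xs_smooth]) (unfold rrz, use z in simp)
   then have "heat_op e m Xs g (?r z) = heat_op 1 m Xs (\<lambda>z. g (?r z)) z" unfolding rr rrz .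
   then show ?thesis using G(2)[OF rO[OF z]] by simp
  qed
  have "1 * g (?r (?r z)) + (- 1) * k (?r z) = 0"
  proof (rule bounded_cauchy_unique[OF Xs_smooth dil_x Xs_hom, where M="B + M"])
   show "continuous_on {z. 0 \<le> fst z} (\<lambda>z. 1 * g (?r z) + (- 1) * k z)"
   proof (intro continuous_on_add continuous_on_mult continuous_on_const S(3))
    show "continuous_on {z. 0 \<le> fst z} (\<lambda>z. g (?r z))"
     by (rule continuous_on_compose2[OF G(3) smooth_mapD(2)[OF smooth_map_time_sign]]) (auto simp: closure_Omega[OF e] e2)
   qed
   show "C_k_on 2 {z. 0 < fst z} (\<lambda>z. 1 * g (?r z) + (- 1) * k z)"
    by (intro C_k_on_add C_k_on_cmult oP Cg smooth_onD(1)[OF S(1)])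
   show "heat_op 1 m Xs (\<lambda>z. 1 * g (?r z) + (- 1) * k z) z = 0" if "0 < fst z" for z
    using heat_op_cmult_add[OF oP _ Cg smooth_onD(1)[OF S(1)] Xs_smooth, of z 1 1 "- 1"] hg[OF that] S(2)[OF that] that by simp
   show "1 * g (?r (0, x)) + (- 1) * k (0, x) = 0" for x by (simp add: k_def G(4))
   show "\<bar>1 * g (?r z) + (- 1) * k z\<bar> \<le> B + M" if "0 < fst z" for z
    using B[OF rO[OF that]] S(4)[of z] that by linarith
   show "0 \<le> fst (?r z)" using z by (simp add: closure_Omega[OF e])
  qed
  then show ?thesis unfolding rr f by simp
 qed
qed

lemma fundamental_solution_props:
 assumes e: "e * e = 1"
 shows "FS_props e m Xs \<sigma> (GG e)"
proof -
 have e0: "e \<noteq> 0" "- e \<noteq> 0" using e by auto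
 have fund: "\<forall>z. loc_int (GG e z) \<and> (\<forall>\<phi>. test_fun \<phi> \<longrightarrow> (LINT \<zeta>|lborel. GG e z \<zeta> * heat_op (- e) m Xs \<phi> \<zeta>) = - \<phi> z)"
  using GG_loc_int(1)[OF e0(1)] fundamental[OF _ e] by blast
 have nonneg: "\<forall>z \<zeta>. 0 \<le> GG e z \<zeta>" using GG_nonneg by blast
 have zero: "\<forall>t x s y. GG e (t, x) (s, y) = 0 \<longleftrightarrow> e * (s - t) \<le> 0" by (simp add: GG_def K_zero_iff)
 have sym: "\<forall>t x s y. GG e (t, x) (s, y) = GG e (- s, x) (- t, y) \<and> GG e (t, x) (s, y) = GG e (0, x) (s - t, y) \<and>
   GG e (t, x) (s, y) = GG e (t - s, x) (0, y) \<and> GG e (t, x) (s, y) = GG e (t, y) (s, x)"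
 proof (intro allI conjI)
  fix t s x y
  have d: "- t - - s = s - t" "s - t - 0 = s - t" "0 - (t - s) = s - t" for t s :: real by simp_all
  show "GG e (t, x) (s, y) = GG e (- s, x) (- t, y)" "GG e (t, x) (s, y) = GG e (0, x) (s - t, y)" "GG e (t, x) (s, y) = GG e (t - s, x) (0, y)"
   unfolding GG_def fst_conv snd_conv d by (rule refl)+
  show "GG e (t, x) (s, y) = GG e (t, y) (s, x)" unfolding GG_def fst_conv snd_conv by (rule K_sym)
 qed
 have hom: "\<forall>l>0. \<forall>t x s y. GG e (l\<^sup>2 * t, dil \<sigma> l x) (l\<^sup>2 * s, dil \<sigma> l y) = l powr (- (\<Sum>j\<in>UNIV. \<sigma> j)) * GG e (t, x) (s, y)"
 proof (intro allI impI)
  fix l t s :: real and x y :: "real^'n" assume l: "l > 0"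
  have d: "e * (l\<^sup>2 * s - l\<^sup>2 * t) = l\<^sup>2 * (e * (s - t))" by (simp add: algebra_simps)
  show "GG e (l\<^sup>2 * t, dil \<sigma> l x) (l\<^sup>2 * s, dil \<sigma> l y) = l powr (- (\<Sum>j\<in>UNIV. \<sigma> j)) * GG e (t, x) (s, y)"
   unfolding GG_def fst_conv snd_conv d using K_scale[OF l, unfolded hdim_wvec] .
 qed
 have lims: "\<forall>C. compact C \<and> C \<noteq> {} \<longrightarrow> ((\<lambda>\<zeta>. SUP z\<in>C. GG e z \<zeta>) \<longlongrightarrow> 0) at_infinity \<and> ((\<lambda>\<zeta>. SUP z\<in>C. GG e \<zeta> z) \<longlongrightarrow> 0) at_infinity"
  using GG_sup_lim[OF _ _ e0(1)] GG_sup_lim[OF _ _ e0(2)] by (simp add: GG_flip)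
 have li: "\<forall>z. loc_int (GG e z) \<and> loc_int (\<lambda>\<zeta>. GG e \<zeta> z)"
 proof (intro allI conjI)
  fix z
  show "loc_int (GG e z)" by (rule GG_loc_int(1)[OF e0(1)])
  have "loc_int (\<lambda>\<zeta>. GG (- e) z \<zeta>)" by (rule GG_loc_int(1)[OF e0(2)])
  then show "loc_int (\<lambda>\<zeta>. GG e \<zeta> z)" unfolding GG_flip .
 qed
 have mass: "\<forall>t x s. e * (s - t) > 0 \<longrightarrow> (LINT y|lborel. GG e (t, x) (s, y)) = 1" by (simp add: GG_def K_mass)
 have pot: "\<forall>\<phi>. test_fun \<phi> \<longrightarrow> smooth_on UNIV (Lam (GG e) \<phi>) \<and> (Lam (GG e) \<phi> \<longlongrightarrow> 0) at_infinity \<and> (\<forall>\<zeta>. heat_op e m Xs (Lam (GG e) \<phi>) \<zeta> = - \<phi> \<zeta>)"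
  using Lam_props[OF _ e] Lam_lim[OF _ e0(1)] by blast
 have cauchy: "\<forall>\<phi>. continuous_on UNIV \<phi> \<and> bounded (range \<phi>) \<longrightarrow>
   (let u = (\<lambda>z. if e * fst z > 0 then (LINT y|lborel. GG e (0, y) z * \<phi> y) else \<phi> (snd z))
    in classical_sol e m Xs \<phi> u \<and> bounded (u ` Omega e) \<and>
     (\<forall>v. classical_sol e m Xs \<phi> v \<and> bounded (v ` Omega e) \<longrightarrow> (\<forall>z\<in>closure (Omega e). v z = u z)))"
  unfolding Let_def by (intro allI impI conjI ballI; elim conjE; rule cauchy_problem[OF e]; assumption)
 have ck: "\<forall>x y s t. e * s > 0 \<and> e * t > 0 \<longrightarrow> GG e (0, y) (t + s, x) = (LINT w|lborel. GG e (0, w) (t, x) * GG e (0, y) (s, w))"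
 proof (intro allI impI)
  fix x y :: "real^'n" and s t :: real assume st: "e * s > 0 \<and> e * t > 0"
  have d: "e * (t + s - 0) = e * s + e * t" "e * (t - 0) = e * t" "e * (s - 0) = e * s" by (simp_all add: algebra_simps)
  show "GG e (0, y) (t + s, x) = (LINT w|lborel. GG e (0, w) (t, x) * GG e (0, y) (s, w))"
   unfolding GG_def fst_conv snd_conv d mult.commute[of "K (e * t) _ x"]
   by (rule K_chapman_kolmogorov) (use st in simp_all)
 qed
 show ?thesis
  unfolding FS_props_def
  by (intro conjI fund nonneg zero sym hom GG_smooth[OF e0(1)] lims GG_loc_int(2)[OF e0(1)] li mass pot cauchy ck)
qed

end

section \<open>From derivations of functions to coefficient vectors\<close>

lemma vf_inner:
 fixes F :: "'a::euclidean_space => 'b::euclidean_space"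
 shows "F differentiable (at x) ==> vf Z (\<lambda>x. F x \<bullet> b) x = frechet_derivative F (at x) (Z x) \<bullet> b"
 unfolding vf_def by (rule frechet_derivative_component)

lemma smooth_on_inner: "smooth_on UNIV (\<lambda>x. x \<bullet> b)"
 by (rule smooth_on_linear) (rule bounded_linear_inner_left)

lemma vf_coordinate: "vf Z (\<lambda>x. x \<bullet> b) x = Z x \<bullet> b"
 using vf_inner[of "\<lambda>x. x" x Z b] by (simp add: frechet_derivative_eqI[OF has_derivative_ident])

text \<open>Applying a field to the coordinate functions recovers its coefficients, so the identity
  of derivations need only be tested on them. Homogeneity and lifting are translated below in the
  same way.\<close>

lemma left_inv_iff:
 fixes gmul :: "'a::euclidean_space => 'a => 'a"
 assumes "\<And>a. smooth_map (gmul a)"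
 shows "left_inv gmul Z \<longleftrightarrow> (\<forall>a x. frechet_derivative (gmul a) (at x) (Z x) = Z (gmul a x))"
proof
 assume L: "left_inv gmul Z"
 show "\<forall>a x. frechet_derivative (gmul a) (at x) (Z x) = Z (gmul a x)"
 proof (intro allI, rule euclidean_eqI)
  fix a x b
  have "vf Z (\<lambda>y. gmul a y \<bullet> b) x = vf Z (\<lambda>y. y \<bullet> b) (gmul a x)"
   using L[unfolded left_inv_def, rule_format, OF smooth_on_inner] by (rule fun_cong)
  then show "frechet_derivative (gmul a) (at x) (Z x) \<bullet> b = Z (gmul a x) \<bullet> b"
   unfolding vf_inner[OF smooth_mapD(1)[OF assms]] vf_coordinate .
 qed
next
 assume R: "\<forall>a x. frechet_derivative (gmul a) (at x) (Z x) = Z (gmul a x)"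
 show "left_inv gmul Z"
  unfolding left_inv_def
 proof (intro allI impI ext)
  fix a f y assume f: "smooth_on UNIV (f :: 'a => real)"
  show "vf Z (\<lambda>y. f (gmul a y)) y = vf Z f (gmul a y)"
   unfolding vf_def frechet_derivative_compose_real[OF smooth_mapD(1)[OF assms] smooth_onD(2)[OF f UNIV_I]] R[rule_format] ..
 qed
qed

lemma hom_deg1_pointwise:
 assumes "hom_deg1 D Z" "l > 0" "bounded_linear (D l)"
 shows "D l (Z x) = l *\<^sub>R Z (D l x)"
proof (rule euclidean_eqI)
 fix b
 have "vf Z (\<lambda>y. D l y \<bullet> b) x = l * vf Z (\<lambda>y. y \<bullet> b) (D l x)"
  using assms(1)[unfolded hom_deg1_def, rule_format, OF assms(2) smooth_on_inner] by (rule fun_cong)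
 then show "D l (Z x) \<bullet> b = (l *\<^sub>R Z (D l x)) \<bullet> b"
  unfolding vf_inner[OF bounded_linear_imp_differentiable[OF assms(3)]] vf_coordinate
  by (simp add: frechet_derivative_eqI[OF bounded_linear_imp_has_derivative[OF assms(3)]])
qed

lemma lifts_pointwise:
 assumes "lifts Z X"
 shows "fst (Z w) = X (fst w)"
proof (rule euclidean_eqI)
 fix b
 have "vf Z (\<lambda>y. fst y \<bullet> b) w = vf X (\<lambda>y. y \<bullet> b) (fst w)"
  using assms[unfolded lifts_def, rule_format, OF smooth_on_inner] by (rule fun_cong)
 then show "fst (Z w) \<bullet> b = X (fst w) \<bullet> b"
  unfolding vf_inner[OF bounded_linear_imp_differentiable[OF bounded_linear_fst]] vf_coordinate
  by (simp add: frechet_derivative_eqI[OF bounded_linear_imp_has_derivative[OF bounded_linear_fst]])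
qed

theorem theorem1p3:
  fixes m :: nat
    and Xs :: "nat \<Rightarrow> real^'n \<Rightarrow> real^'n"
    and \<sigma> :: "'n::finite \<Rightarrow> real"
    and \<sigma>s :: "'p::finite \<Rightarrow> real"
    and gmul :: "(real^'n) \<times> (real^'p) \<Rightarrow> (real^'n) \<times> (real^'p) \<Rightarrow> (real^'n) \<times> (real^'p)"
    and ginv :: "(real^'n) \<times> (real^'p) \<Rightarrow> (real^'n) \<times> (real^'p)"
    and Zs :: "nat \<Rightarrow> (real^'n) \<times> (real^'p) \<Rightarrow> (real^'n) \<times> (real^'p)"
    and \<gamma> :: "real \<times> ((real^'n) \<times> (real^'p)) \<Rightarrow> real"
  defines "D \<equiv> (\<lambda>l w. (dil \<sigma> l (fst w), dil \<sigma>s l (snd w)))"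
  assumes Xs_smooth: "\<forall>j<m. smooth_map (Xs j)"
    and Xs_indep: "\<forall>c. (\<forall>x. (\<Sum>j<m. c j *\<^sub>R Xs j x) = 0) \<longrightarrow> (\<forall>j<m. c j = 0)"
    and sigma: "\<forall>j. 1 \<le> \<sigma> j" "\<exists>j. \<sigma> j = 1"
    and H1: "\<forall>j<m. hom_deg1 (dil \<sigma>) (Xs j)"
    and H2: "span {Y 0 | Y. Y \<in> lie_gen (Xs ` {..<m})} = UNIV"
    and dimN: "fields_dim (lie_gen (Xs ` {..<m})) (CARD('n) + CARD('p))"
    \<comment> \<open>homogeneous Carnot group on R^n x R^p\<close>
    and grp_assoc: "\<forall>a b c. gmul (gmul a b) c = gmul a (gmul b c)"
    and grp_unit: "\<forall>a. gmul 0 a = a \<and> gmul a 0 = a"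
    and grp_inv: "\<forall>a. gmul (ginv a) a = 0 \<and> gmul a (ginv a) = 0"
    and grp_smooth: "smooth_map (\<lambda>p. gmul (fst p) (snd p))" "smooth_map ginv"
    and sigmas: "\<forall>k. 1 \<le> \<sigma>s k"
    and D_aut: "\<forall>l>0. \<forall>a b. gmul (D l a) (D l b) = D l (gmul a b)"
    and Zs_smooth: "\<forall>i<m. smooth_map (Zs i)"
    and Zs_leftinv: "\<forall>i<m. left_inv gmul (Zs i)"
    and Zs_hom: "\<forall>i<m. hom_deg1 D (Zs i)"
    and Zs_gen: "lie_gen (Zs ` {..<m}) = {Y. smooth_map Y \<and> left_inv gmul Y}"
    and Zs_lift: "\<forall>i<m. lifts (Zs i) (Xs i)"
    \<comment> \<open>gamma_G: the fundamental solution of H_G with pole at the origin vanishing at infinity\<close>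
    and gam_smooth: "smooth_on (UNIV - {0}) \<gamma>"
    and gam_locint: "loc_int \<gamma>"
    and gam_fund: "\<forall>\<phi>. test_fun \<phi> \<longrightarrow> (LINT \<zeta>|lborel. \<gamma> \<zeta> * heat_op (-1) m Zs \<phi> \<zeta>) = - \<phi> 0"
    and gam_infty: "(\<gamma> \<longlongrightarrow> 0) at_infinity"
  shows "FS_props 1 m Xs \<sigma> (Gam gmul ginv \<gamma>) \<and>
         FS_props (-1) m Xs \<sigma> (\<lambda>z \<zeta>. Gam gmul ginv \<gamma> \<zeta> z)"
proof -
 have D: "D = dprod (dil \<sigma>) (dil \<sigma>s)" unfolding D_def dprod_def ..
 have dx: "dilation (wvec \<sigma>) (dil \<sigma>)" and dy: "dilation (wvec \<sigma>s) (dil \<sigma>s)"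
  using sigma(1) sigmas by (simp_all add: dilation_dil)
 have dD: "dilation (wprod (wvec \<sigma>) (wvec \<sigma>s)) D" unfolding D by (rule dilation_dprod[OF dx dy])
 have sl: "smooth_map (gmul a)" for a
  using smooth_map_compose[OF grp_smooth(1) smooth_map_Pair[OF smooth_map_const smooth_map_ident], of a] by simp
 interpret lifted_coordinates gmul ginv \<sigma> "dil \<sigma>s" "wvec \<sigma>s" m Zs \<gamma> Xs
 proof (unfold_locales, unfold D[symmetric])
  show "\<forall>j<m. \<forall>a x. frechet_derivative (gmul a) (at x) (Zs j x) = Zs j (gmul a x)"
   using Zs_leftinv unfolding left_inv_iff[OF sl] .
  show "\<forall>j<m. \<forall>l>0. \<forall>x. D l (Zs j x) = l *\<^sub>R Zs j (D l x)"
   using hom_deg1_pointwise Zs_hom dilation_bounded_linear[OF dD] by blast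
  show "\<forall>j<m. \<forall>g. fst (Zs j g) = Xs j (fst g)" using lifts_pointwise Zs_lift by blast
  show "Y \<in> lie_gen (Zs ` {..<m})" if "smooth_map Y" "\<And>a x. frechet_derivative (gmul a) (at x) (Y x) = Y (gmul a x)" for Y
   unfolding Zs_gen mem_Collect_eq left_inv_iff[OF sl] using that by blast
  show "gmul (D l a) (D l b) = D l (gmul a b)" if "l > 0" for l a b using D_aut that by blast
  show "gmul (gmul a b) c = gmul a (gmul b c)" for a b c using grp_assoc by blast
  show "gmul 0 a = a" "gmul a 0 = a" for a using grp_unit by blast+
  show "gmul (ginv a) a = 0" "gmul a (ginv a) = 0" for a using grp_inv by blast+
  show "(LINT \<zeta>|lborel. \<gamma> \<zeta> * heat_op (-1) m Zs \<phi> \<zeta>) = - \<phi> 0" if "test_fun \<phi>" for \<phi> using gam_fund that by blast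
 qed (fact grp_smooth dD Zs_smooth gam_smooth gam_locint gam_infty dx dy Xs_smooth)+
 have Gam: "Gam gmul ginv \<gamma> = GG 1" by (intro ext) (simp only: Gam_def GG_def K_def mult_1)
 \<comment> \<open>Symmetry of \<open>K\<close> makes the exchange of arguments equal to a reversal
   of time, so the dual statements are the same properties for the sign \<open>- 1\<close>.\<close>
 have Gam': "(\<lambda>z \<zeta>. Gam gmul ginv \<gamma> \<zeta> z) = GG (- 1)" by (intro ext) (simp only: Gam GG_flip)
 show ?thesis
 proof (rule conjI)
  show "FS_props 1 m Xs \<sigma> (Gam gmul ginv \<gamma>)" unfolding Gam by (rule fundamental_solution_props) simp
  show "FS_props (-1) m Xs \<sigma> (\<lambda>z \<zeta>. Gam gmul ginv \<gamma> \<zeta> z)" unfolding Gam' by (rule fundamental_solution_props) simp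
 qed
qed

end
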